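(* Let $T>0$ and let $(V,d,\pi,\kappa)$ and $(\phi,\psi^*,\alpha)$ satisfy the standing assumptions listed in the context. Suppose that the Fisher information functional $\mathscr D:\{\mathscr E<\infty\}\to[0,\infty]$ is convex. Then: (a) The set $\mathcal{RCE}([0,T])$ is convex: for all $(\rho^0,j^0),(\rho^1,j^1)\in\mathcal{RCE}([0,T])$ and $\theta\in(0,1)$, $((1-\theta)\rho^0+\theta\rho^1,(1-\theta)j^0+\theta j^1)\in\mathcal{RCE}([0,T])$. (b) If $(\rho,j)\in\mathcal{RCE}([0,T])$, then the chain rule holds along $(\rho,j)$. (c) In particular, if $(\rho,j)\in\mathcal{RCE}([0,T])$ is a Dissipative solution, then it is a Reflecting solution, fulfilling additionally, with $\rho_t=u_t\pi$, the pointwise energy-dissipation balance $$\mathscr R(\rho_t,j_t)+\mathscr D(\rho_t)=-\frac{\mathrm d}{\mathrm dt}\mathscr E(\rho_t)=\iint_E\big(-\overline\nabla(\phi'\circ u_t)\big)(x,y)\,j_t(\mathrm dx\,\mathrm dy)\qquad\text{for a.e. }t\in(0,T).$$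
   Context: **Setting.** $(V,d)$ is a separable metric space, $\pi$ a finite positive Borel measure on $V$, $E:=V\times V$, $E':=E\setminus\{(x,x):x\in V\}$, $\mathcal M^+(V)$ is the set of finite positive Borel measures on $V$. The jump kernel $\kappa=(\kappa(x,\cdot))_{x\in V}$ is a family of positive $\sigma$-finite Borel measures on $V$ with $\kappa(x,\{x\})=0$, such that $x\mapsto\int_V f(y)(1\wedge d^2(x,y))\,\kappa(x,\mathrm dy)$ is Borel for every bounded Borel $f:V\to\mathbb R$, and $\sup_{x\in V}\int_V(1\wedge d^2(x,y))\,\kappa(x,\mathrm dy)<\infty$. The $\sigma$-finite measure $\vartheta_\kappa(\mathrm dx\,\mathrm dy):=\pi(\mathrm dx)\,\kappa(x,\mathrm dy)$ on $E$ is invariant under $(x,y)\mapsto(y,x)$ (detailed balance). Write $\overline\nabla\varphi(x,y):=\varphi(y)-\varphi(x)$. **Fluxes.** For a separable metric space $Y$, $\mathcal M_\sigma(Y)$ is the set of pairs $\mu=(\mu^+,\mu^-)$ of mutually singular $\sigma$-finite positive Borel measures on $Y$; $|\mu|:=\mu^++\mu^-$ and $\int f\,\mathrm d\mu:=\int f\,\mathrm d\mu^+-\int f\,\mathrm d\mu^-$ for $f\in L^1(|\mu|)$. $\mathcal M_\sigma(Y)$ is a vector space: $\mu+\nu$ is the unique element whose value $(\mu+\nu)^+(B)-(\mu+\nu)^-(B)$ equals $\mu^+(B)-\mu^-(B)+\nu^+(B)-\nu^-(B)$ on all Borel $B$ where the terms are finite. A family $(j_t)_{t\in[0,T]}\subset\mathcal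 M_\sigma(E)$ is measurable if $t\mapsto j_t^\pm(B)$ is Borel for every Borel $B$. If $|\mu|\ll\gamma$ with $\gamma$ positive $\sigma$-finite, $\frac{\mathrm d\mu}{\mathrm d\gamma}:=\frac{\mathrm d\mu^+}{\mathrm d\gamma}-\frac{\mathrm d\mu^-}{\mathrm d\gamma}$. **Densities.** $\phi\in C([0,\infty))\cap C^1((0,\infty))$ is convex, $\min\phi=0$, $\lim_{r\to\infty}\phi(r)/r=\infty$. $\psi^*:\mathbb R\to[0,\infty)$ is convex, differentiable, even, $\psi^*(0)=0$, $\lim_{|\xi|\to\infty}\psi^*(\xi)/|\xi|=\infty$, $\lim_{\xi\to0}\psi^*(\xi)/|\xi|^2\in(0,\infty)$; $\psi$ is its convex conjugate. $\alpha:[0,\infty)^2\to[0,\infty)$ is not identically zero, continuous, concave, symmetric. **Functionals.** $\mathscr E(\rho):=\int_V\phi(\frac{\mathrm d\rho}{\mathrm d\pi})\,\mathrm d\pi$ if $\rho\ll\pi$, $+\infty$ otherwise. For $\rho=u\pi$ and $j\in\mathcal M_\sigma(E)$ let $\nu_\rho(\mathrm dx\,\mathrm dy):=\alpha(u(x),u(y))\,\vartheta_\kappa(\mathrm dx\,\mathrm dy)$ and $\mathscr R(\rho,j):=\frac12\iint\psi\big(\frac{\mathrm d(2j)}{\mathrm d\nu_\rho}\big)\,\mathrm d\nu_\rho$ if $|j|\ll\nu_\rho$, $+\infty$ otherwise. Set $\phi'(0):=\lim_{r\downarrow0}\phi'(r)\in[-\infty,\infty)$, $\Lambda_\phi(u,v):=\phi'(v)-\phi'(u)$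 for $(u,v)\ne(0,0)$, $\Lambda_\phi(0,0):=0$; $\overline\nabla(\phi'\circ u)(x,y)$ is understood as $\Lambda_\phi(u(x),u(y))$. $D_\phi^+(u,v):=\psi^*(\Lambda_\phi(u,v))\alpha(u,v)$ if $\alpha(u,v)>0$ (with $\psi^*(\pm\infty)=+\infty$), $:=0$ if $u=v=0$, $:=+\infty$ if $\alpha(u,v)=0$ and $u\neq v$; $D_\phi:[0,\infty)^2\to[0,\infty]$ is the lower semicontinuous envelope of $D_\phi^+$. The Fisher information is $\mathscr D(\rho):=\frac12\iint_E D_\phi(u(x),u(y))\,\vartheta_\kappa(\mathrm dx\,\mathrm dy)$ for $\rho=u\pi$. Standing assumption: $\mathscr D$ is lower semicontinuous under setwise convergence, i.e. if $\rho_n,\rho$ have finite entropy and $\rho_n(B)\to\rho(B)$ for all Borel $B$, then $\liminf_n\mathscr D(\rho_n)\ge\mathscr D(\rho)$. **Continuity equations.** $\mathrm{Lip}_b(V)$ is the space of bounded $d$-Lipschitz functions. $(\rho,j)\in\mathcal{CE}([0,T])$ means: $\rho=(\rho_t)_{t\in[0,T]}\subset\mathcal M^+(V)$; $j=(j_t)_{t\in[0,T]}\subset\mathcal M_\sigma(E)$ is a measurable family with $|j_t|(E\setminus E')=0$ and $\int_0^T\iint_E(1\wedge d(x,y))\,|j_t|(\mathrm dx\,\mathrm dy)\,\mathrm dt<\infty$; and for all $\varphi\in\mathrm{Lip}_b(V)$ and $[s,t]\subset[0,T]$: ( * ) $\int_V\varphi\,\mathrm d\rho_t-\int_V\varphi\,\mathrm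 d\rho_s=\int_s^t\iint_{E'}\overline\nabla\varphi(x,y)\,j_r(\mathrm dx\,\mathrm dy)\,\mathrm dr$. $\mathcal{ACE}([0,T])$: pairs in $\mathcal{CE}([0,T])$ with $\sup_{t\in[0,T]}\mathscr E(\rho_t)<\infty$ and $\int_0^T(\mathscr R(\rho_t,j_t)+\mathscr D(\rho_t))\,\mathrm dt<\infty$. $\mathcal{RCE}([0,T])$: pairs $(\rho,j)\in\mathcal{ACE}([0,T])$, $\rho_t=u_t\pi$, with $\operatorname{ess\,sup}_{t\in(0,T)}\|u_t\|_{L^\infty(V;\pi)}<\infty$, such that ( * ) holds for all $[s,t]\subset[0,T]$ and all $\varphi\in\mathcal X_2:=\{\varphi\in L^\infty(V;\pi):\iint_{E'}|\overline\nabla\varphi|^2\,\mathrm d\vartheta_\kappa<\infty\}$. **Chain rule along $(\rho,j)$.** $t\mapsto\mathscr E(\rho_t)$ is absolutely continuous on $[0,T]$ and $-\frac{\mathrm d}{\mathrm dt}\mathscr E(\rho_t)=\iint_{E'}(-\overline\nabla(\phi'\circ u_t))(x,y)\,j_t(\mathrm dx\,\mathrm dy)$ for a.e. $t\in(0,T)$. **Solutions.** $(\rho,j)\in\mathcal{CE}([0,T])$ with $\mathscr E(\rho_0)<\infty$ is a Dissipative solution if $\int_0^t(\mathscr R(\rho_r,j_r)+\mathscr D(\rho_r))\,\mathrm dr+\mathscr E(\rho_t)\le\mathscr E(\rho_0)$ for all $t\in[0,T]$. $(\rho,j)\in\mathcal{RCE}([0,T])$ with $\mathscr E(\rho_0)<\infty$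 is a Reflecting solution if $\int_s^t(\mathscr R(\rho_r,j_r)+\mathscr D(\rho_r))\,\mathrm dr+\mathscr E(\rho_t)=\mathscr E(\rho_s)$ for all $[s,t]\subset[0,T]$.
   Formalization: A flux family is called measurable if t ↦ j_t^±(B) is Lebesgue (not Borel) measurable on [0,T]; with Borel measurability, part (a) fails under the continuum hypothesis because of exceptional times in a null set. *)

theory Defs
  imports "HOL-Analysis.Analysis"
begin

section \<open>Measures and \<open>\<sigma>\<close>-finite signed measures\<close>

definition finite_borel_measures :: "'a::topological_space measure set" where
  "finite_borel_measures = {M. sets M = sets borel \<and> finite_measure M}"

definition add_measure :: "'a measure \<Rightarrow> 'a measure \<Rightarrow> 'a measure" where
  "add_measure M N = measure_of (space M) (sets M) (\<lambda>A. emeasure M A + emeasure N A)"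

definition mix_measure :: "real \<Rightarrow> 'a measure \<Rightarrow> 'a measure \<Rightarrow> 'a measure" where
  "mix_measure \<theta> M N =
     add_measure (scale_measure (ennreal (1 - \<theta>)) M) (scale_measure (ennreal \<theta>) N)"

type_synonym 'a signed = "'a measure \<times> 'a measure"

text \<open>An element of \<open>M\<^sub>\<sigma>(Y)\<close> is the pair \<open>(\<mu>\<^sup>+, \<mu>\<^sup>-)\<close>.\<close>

definition sigma_signed :: "'a::topological_space signed set" where
  "sigma_signed = {(P, N). sets P = sets borel \<and> sets N = sets borel \<and>
     sigma_finite_measure P \<and> sigma_finite_measure N \<and>
     (\<exists>A\<in>sets borel. emeasure P A = 0 \<and> emeasure N (- A) = 0)}"

definition total_var :: "'a signed \<Rightarrow> 'a measure" where
  "total_var \<mu> = add_measure (fst \<mu>) (snd \<mu>)"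

definition signed_integral :: "'a signed \<Rightarrow> 'a set \<Rightarrow> ('a \<Rightarrow> real) \<Rightarrow> real" where
  "signed_integral \<mu> S f = (LINT x:S|fst \<mu>. f x) - (LINT x:S|snd \<mu>. f x)"

text \<open>Integrals of extended-real functions that lie in \<open>L\<^sup>1(|\<mu>|)\<close>, hence are \<open>|\<mu>|\<close>-a.e. finite.\<close>

definition ext_integrable :: "'a signed \<Rightarrow> 'a set \<Rightarrow> ('a \<Rightarrow> ereal) \<Rightarrow> bool" where
  "ext_integrable \<mu> S f \<longleftrightarrow> (AE x\<in>S in total_var \<mu>. \<bar>f x\<bar> \<noteq> \<infinity>) \<and>
     set_integrable (total_var \<mu>) S (\<lambda>x. real_of_ereal (f x))"

definition ext_integral :: "'a signed \<Rightarrow> 'a set \<Rightarrow> ('a \<Rightarrow> ereal) \<Rightarrow> real" where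
  "ext_integral \<mu> S f = signed_integral \<mu> S (\<lambda>x. real_of_ereal (f x))"

definition signed_add :: "'a::topological_space signed \<Rightarrow> 'a signed \<Rightarrow> 'a signed" where
  "signed_add \<mu> \<nu> = (THE \<sigma>. \<sigma> \<in> sigma_signed \<and>
     (\<forall>B\<in>sets borel.
        (\<forall>M\<in>{fst \<sigma>, snd \<sigma>, fst \<mu>, snd \<mu>, fst \<nu>, snd \<nu>}. emeasure M B < \<infinity>) \<longrightarrow>
        measure (fst \<sigma>) B - measure (snd \<sigma>) B =
          measure (fst \<mu>) B - measure (snd \<mu>) B + measure (fst \<nu>) B - measure (snd \<nu>) B))"

definition signed_scale :: "real \<Rightarrow> 'a signed \<Rightarrow> 'a signed" where
  "signed_scale c \<mu> =
     (if 0 \<le> c then (scale_measure (ennreal c) (fst \<mu>), scale_measure (ennreal c) (snd \<mu>))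
      else (scale_measure (ennreal (- c)) (snd \<mu>), scale_measure (ennreal (- c)) (fst \<mu>)))"

definition mix_signed :: "real \<Rightarrow> 'a::topological_space signed \<Rightarrow> 'a signed \<Rightarrow> 'a signed" where
  "mix_signed \<theta> \<mu> \<nu> = signed_add (signed_scale (1 - \<theta>) \<mu>) (signed_scale \<theta> \<nu>)"

definition pos_deriv :: "'a measure \<Rightarrow> 'a measure \<Rightarrow> 'a \<Rightarrow> real" where
  "pos_deriv \<gamma> M x = enn2real (RN_deriv \<gamma> M x)"

definition signed_deriv :: "'a measure \<Rightarrow> 'a signed \<Rightarrow> 'a \<Rightarrow> real" where
  "signed_deriv \<gamma> \<mu> x = pos_deriv \<gamma> (fst \<mu>) x - pos_deriv \<gamma> (snd \<mu>) x"


section \<open>Jump kernel and densities\<close>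

abbreviation offdiag :: "('v \<times> 'v) set" where
  "offdiag \<equiv> {(x, y). x \<noteq> y}"

definition ograd :: "('v \<Rightarrow> real) \<Rightarrow> 'v \<times> 'v \<Rightarrow> real" where
  "ograd \<phi> = (\<lambda>(x, y). \<phi> y - \<phi> x)"

definition jump_kernel :: "('v::metric_space \<Rightarrow> 'v measure) \<Rightarrow> bool" where
  "jump_kernel \<kappa> \<longleftrightarrow>
     (\<forall>x. sets (\<kappa> x) = sets borel \<and> sigma_finite_measure (\<kappa> x) \<and> emeasure (\<kappa> x) {x} = 0) \<and>
     (\<forall>f::'v \<Rightarrow> real. f \<in> borel_measurable borel \<and> bounded (range f) \<longrightarrow>
        (\<lambda>x. LINT y|\<kappa> x. f y * min 1 ((dist x y)\<^sup>2)) \<in> borel_measurable borel) \<and>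
     (SUP x. \<integral>\<^sup>+ y. ennreal (min 1 ((dist x y)\<^sup>2)) \<partial>\<kappa> x) < \<infinity>"

text \<open>The measure \<open>\<pi>(dx) \<kappa>(x, dy)\<close> on \<open>V \<times> V\<close>\<close>

definition edge_measure ::
    "'v::metric_space measure \<Rightarrow> ('v \<Rightarrow> 'v measure) \<Rightarrow> ('v \<times> 'v) measure" where
  "edge_measure \<pi> \<kappa> =
     measure_of UNIV (sets borel) (\<lambda>A. \<integral>\<^sup>+ x. emeasure (\<kappa> x) (Pair x -` A) \<partial>\<pi>)"

definition detailed_balance ::
    "'v::metric_space measure \<Rightarrow> ('v \<Rightarrow> 'v measure) \<Rightarrow> bool" where
  "detailed_balance \<pi> \<kappa> \<longleftrightarrow>
     distr (edge_measure \<pi> \<kappa>) borel (\<lambda>(x, y). (y, x)) = edge_measure \<pi> \<kappa>"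

definition entropy_density :: "(real \<Rightarrow> real) \<Rightarrow> bool" where
  "entropy_density \<phi> \<longleftrightarrow>
     continuous_on {0..} \<phi> \<and>
     (\<forall>r>0. \<phi> differentiable (at r)) \<and> continuous_on {0<..} (deriv \<phi>) \<and>
     convex_on {0..} \<phi> \<and>
     (\<forall>r\<ge>0. 0 \<le> \<phi> r) \<and> (\<exists>r\<ge>0. \<phi> r = 0) \<and>
     filterlim (\<lambda>r. \<phi> r / r) at_top at_top"

definition dual_dissipation_density :: "(real \<Rightarrow> real) \<Rightarrow> bool" where
  "dual_dissipation_density \<psi>s \<longleftrightarrow>
     (\<forall>\<xi>. 0 \<le> \<psi>s \<xi>) \<and>
     convex_on UNIV \<psi>s \<and> (\<forall>\<xi>. \<psi>s differentiable (at \<xi>)) \<and>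
     (\<forall>\<xi>. \<psi>s (- \<xi>) = \<psi>s \<xi>) \<and> \<psi>s 0 = 0 \<and>
     filterlim (\<lambda>\<xi>. \<psi>s \<xi> / \<bar>\<xi>\<bar>) at_top at_infinity \<and>
     (\<exists>c>0. ((\<lambda>\<xi>. \<psi>s \<xi> / \<bar>\<xi>\<bar>\<^sup>2) \<longlongrightarrow> c) (at 0))"

abbreviation quadrant :: "(real \<times> real) set" where
  "quadrant \<equiv> {0..} \<times> {0..}"

definition mobility_density :: "(real \<times> real \<Rightarrow> real) \<Rightarrow> bool" where
  "mobility_density \<alpha> \<longleftrightarrow>
     (\<forall>p\<in>quadrant. 0 \<le> \<alpha> p) \<and> (\<exists>p\<in>quadrant. \<alpha> p \<noteq> 0) \<and>
     continuous_on quadrant \<alpha> \<and> concave_on quadrant \<alpha> \<and>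
     (\<forall>u\<ge>0. \<forall>v\<ge>0. \<alpha> (u, v) = \<alpha> (v, u))"

text \<open>For a superlinear \<open>\<psi>s\<close> the set is bounded above, so the real supremum is the conjugate.\<close>

definition convex_conjugate :: "(real \<Rightarrow> real) \<Rightarrow> real \<Rightarrow> real" where
  "convex_conjugate \<psi>s s = (SUP \<xi>. s * \<xi> - \<psi>s \<xi>)"


section \<open>Entropy, dissipation potential and Fisher information\<close>

definition entropy :: "'v measure \<Rightarrow> (real \<Rightarrow> real) \<Rightarrow> 'v measure \<Rightarrow> ennreal" where
  "entropy \<pi> \<phi> \<rho> =
     (if absolutely_continuous \<pi> \<rho> then \<integral>\<^sup>+ x. ennreal (\<phi> (pos_deriv \<pi> \<rho> x)) \<partial>\<pi> else \<infinity>)"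

definition flux_ref :: "'v::metric_space measure \<Rightarrow> ('v \<Rightarrow> 'v measure) \<Rightarrow>
    (real \<times> real \<Rightarrow> real) \<Rightarrow> 'v measure \<Rightarrow> ('v \<times> 'v) measure" where
  "flux_ref \<pi> \<kappa> \<alpha> \<rho> =
     density (edge_measure \<pi> \<kappa>)
       (\<lambda>(x, y). ennreal (\<alpha> (pos_deriv \<pi> \<rho> x, pos_deriv \<pi> \<rho> y)))"

definition dissipation :: "'v::metric_space measure \<Rightarrow> ('v \<Rightarrow> 'v measure) \<Rightarrow> (real \<Rightarrow> real) \<Rightarrow>
    (real \<times> real \<Rightarrow> real) \<Rightarrow> 'v measure \<Rightarrow> ('v \<times> 'v) signed \<Rightarrow> ennreal" where
  "dissipation \<pi> \<kappa> \<psi>s \<alpha> \<rho> j =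
     (let \<nu> = flux_ref \<pi> \<kappa> \<alpha> \<rho> in
      if absolutely_continuous \<nu> (total_var j)
      then (\<integral>\<^sup>+ p. ennreal (convex_conjugate \<psi>s (signed_deriv \<nu> (signed_scale 2 j) p)) \<partial>\<nu>) / 2
      else \<infinity>)"

definition entropy_slope :: "(real \<Rightarrow> real) \<Rightarrow> real \<Rightarrow> ereal" where
  "entropy_slope \<phi> r =
     (if 0 < r then ereal (deriv \<phi> r) else Lim (at_right 0) (\<lambda>s. ereal (deriv \<phi> s)))"

definition slope_diff :: "(real \<Rightarrow> real) \<Rightarrow> real \<times> real \<Rightarrow> ereal" where
  "slope_diff \<phi> = (\<lambda>(u, v).
     if u = 0 \<and> v = 0 then 0 else entropy_slope \<phi> v - entropy_slope \<phi> u)"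

definition ext_fun :: "(real \<Rightarrow> real) \<Rightarrow> ereal \<Rightarrow> ennreal" where
  "ext_fun \<psi>s z = (if \<bar>z\<bar> = \<infinity> then \<infinity> else ennreal (\<psi>s (real_of_ereal z)))"

text \<open>A mobility density never vanishes at \<open>(u, u)\<close> with \<open>u > 0\<close> (it is concave, nonnegative and
  not identically zero), so the last branch only concerns \<open>u \<noteq> v\<close>.\<close>

definition fisher_density_plus ::
    "(real \<Rightarrow> real) \<Rightarrow> (real \<Rightarrow> real) \<Rightarrow> (real \<times> real \<Rightarrow> real) \<Rightarrow> real \<times> real \<Rightarrow> ennreal" where
  "fisher_density_plus \<phi> \<psi>s \<alpha> p =
     (if 0 < \<alpha> p then ext_fun \<psi>s (slope_diff \<phi> p) * ennreal (\<alpha> p)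
      else if p = (0, 0) then 0 else \<infinity>)"

definition lsc_on :: "'b::topological_space set \<Rightarrow> ('b \<Rightarrow> ennreal) \<Rightarrow> bool" where
  "lsc_on S g \<longleftrightarrow> (\<forall>p\<in>S. g p \<le> Liminf (at p within S) g)"

definition lsc_envelope :: "'b::topological_space set \<Rightarrow> ('b \<Rightarrow> ennreal) \<Rightarrow> 'b \<Rightarrow> ennreal" where
  "lsc_envelope S f p = (SUP g\<in>{g. lsc_on S g \<and> (\<forall>q\<in>S. g q \<le> f q)}. g p)"

definition fisher_density ::
    "(real \<Rightarrow> real) \<Rightarrow> (real \<Rightarrow> real) \<Rightarrow> (real \<times> real \<Rightarrow> real) \<Rightarrow> real \<times> real \<Rightarrow> ennreal" where
  "fisher_density \<phi> \<psi>s \<alpha> = lsc_envelope quadrant (fisher_density_plus \<phi> \<psi>s \<alpha>)"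

text \<open>Only meaningful if \<open>\<rho>\<close> is absolutely continuous with respect to \<open>\<pi>\<close>; the same holds for
  \<^const>\<open>dissipation\<close>.\<close>

definition fisher :: "'v::metric_space measure \<Rightarrow> ('v \<Rightarrow> 'v measure) \<Rightarrow> (real \<Rightarrow> real) \<Rightarrow>
    (real \<Rightarrow> real) \<Rightarrow> (real \<times> real \<Rightarrow> real) \<Rightarrow> 'v measure \<Rightarrow> ennreal" where
  "fisher \<pi> \<kappa> \<phi> \<psi>s \<alpha> \<rho> =
     (\<integral>\<^sup>+ (x, y). fisher_density \<phi> \<psi>s \<alpha> (pos_deriv \<pi> \<rho> x, pos_deriv \<pi> \<rho> y)
        \<partial>edge_measure \<pi> \<kappa>) / 2"

definition fisher_lsc :: "'v::metric_space measure \<Rightarrow> ('v \<Rightarrow> 'v measure) \<Rightarrow> (real \<Rightarrow> real) \<Rightarrow>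
    (real \<Rightarrow> real) \<Rightarrow> (real \<times> real \<Rightarrow> real) \<Rightarrow> bool" where
  "fisher_lsc \<pi> \<kappa> \<phi> \<psi>s \<alpha> \<longleftrightarrow>
     (\<forall>\<rho>n \<rho>. (\<forall>n::nat. \<rho>n n \<in> finite_borel_measures \<and> entropy \<pi> \<phi> (\<rho>n n) < \<infinity>) \<and>
        \<rho> \<in> finite_borel_measures \<and> entropy \<pi> \<phi> \<rho> < \<infinity> \<and>
        (\<forall>B\<in>sets borel. (\<lambda>n. emeasure (\<rho>n n) B) \<longlonglongrightarrow> emeasure \<rho> B)
        \<longrightarrow> fisher \<pi> \<kappa> \<phi> \<psi>s \<alpha> \<rho> \<le> liminf (\<lambda>n. fisher \<pi> \<kappa> \<phi> \<psi>s \<alpha> (\<rho>n n)))"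

definition fisher_convex :: "'v::metric_space measure \<Rightarrow> ('v \<Rightarrow> 'v measure) \<Rightarrow> (real \<Rightarrow> real) \<Rightarrow>
    (real \<Rightarrow> real) \<Rightarrow> (real \<times> real \<Rightarrow> real) \<Rightarrow> bool" where
  "fisher_convex \<pi> \<kappa> \<phi> \<psi>s \<alpha> \<longleftrightarrow>
     (\<forall>\<rho>0\<in>finite_borel_measures. \<forall>\<rho>1\<in>finite_borel_measures. \<forall>\<theta>::real.
        entropy \<pi> \<phi> \<rho>0 < \<infinity> \<and> entropy \<pi> \<phi> \<rho>1 < \<infinity> \<and> 0 < \<theta> \<and> \<theta> < 1 \<longrightarrow>
        fisher \<pi> \<kappa> \<phi> \<psi>s \<alpha> (mix_measure \<theta> \<rho>0 \<rho>1) \<le>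
          ennreal (1 - \<theta>) * fisher \<pi> \<kappa> \<phi> \<psi>s \<alpha> \<rho>0 + ennreal \<theta> * fisher \<pi> \<kappa> \<phi> \<psi>s \<alpha> \<rho>1)"


section \<open>Continuity equations\<close>

text \<open>Curves are total functions of time; only their values on \<open>[0,T]\<close> matter.

  Measurability of a flux is meant with respect to the Lebesgue \<open>\<sigma>\<close>-algebra of \<open>[0,T]\<close>: fluxes
  matter only for a.e. time. With the Borel \<open>\<sigma>\<close>-algebra the sum of two measurable families need not
  be measurable: at the exceptional null set of times where \<open>1 \<and> d\<close> is not \<open>|j\<^sub>t|\<close>-integrable,
  the \<open>\<sigma>\<close>-finite measures \<open>j\<^sub>t\<close> need not be exhausted by sets that depend measurably on time.\<close>

definition measurable_flux :: "real \<Rightarrow> (real \<Rightarrow> 'a::topological_space signed) \<Rightarrow> bool" where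
  "measurable_flux T j \<longleftrightarrow> (\<forall>B\<in>sets borel.
     (\<lambda>t. emeasure (fst (j t)) B) \<in> borel_measurable (lebesgue_on {0..T}) \<and>
     (\<lambda>t. emeasure (snd (j t)) B) \<in> borel_measurable (lebesgue_on {0..T}))"

definition Lip_b :: "('v::metric_space \<Rightarrow> real) set" where
  "Lip_b = {\<phi>. bounded (range \<phi>) \<and> (\<exists>L. L-lipschitz_on UNIV \<phi>)}"

definition X2 :: "'v::metric_space measure \<Rightarrow> ('v \<Rightarrow> 'v measure) \<Rightarrow> ('v \<Rightarrow> real) set" where
  "X2 \<pi> \<kappa> = {\<phi>. \<phi> \<in> borel_measurable borel \<and> (\<exists>C. AE x in \<pi>. \<bar>\<phi> x\<bar> \<le> C) \<and>
     (\<integral>\<^sup>+p\<in>offdiag. ennreal (\<bar>ograd \<phi> p\<bar>\<^sup>2) \<partial>edge_measure \<pi> \<kappa>) < \<infinity>}"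

definition satisfies_ce :: "real \<Rightarrow> ('v::metric_space \<Rightarrow> real) set \<Rightarrow>
    (real \<Rightarrow> 'v measure) \<Rightarrow> (real \<Rightarrow> ('v \<times> 'v) signed) \<Rightarrow> bool" where
  "satisfies_ce T X \<rho> j \<longleftrightarrow>
     (\<forall>\<phi>\<in>X. \<forall>s t. 0 \<le> s \<and> s \<le> t \<and> t \<le> T \<longrightarrow>
        (LINT x|\<rho> t. \<phi> x) - (LINT x|\<rho> s. \<phi> x) =
        (LINT r:{s..t}|lebesgue. signed_integral (j r) offdiag (ograd \<phi>)))"

definition CE :: "real \<Rightarrow>
    ((real \<Rightarrow> 'v::{metric_space, second_countable_topology} measure) \<times>
     (real \<Rightarrow> ('v \<times> 'v) signed)) set" where
  "CE T = {(\<rho>, j).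
     (\<forall>t\<in>{0..T}. \<rho> t \<in> finite_borel_measures) \<and>
     (\<forall>t\<in>{0..T}. j t \<in> sigma_signed \<and> emeasure (total_var (j t)) (- offdiag) = 0) \<and>
     measurable_flux T j \<and>
     (\<integral>\<^sup>+t\<in>{0..T}. (\<integral>\<^sup>+ (x, y). ennreal (min 1 (dist x y)) \<partial>total_var (j t)) \<partial>lebesgue) < \<infinity> \<and>
     satisfies_ce T Lip_b \<rho> j}"

definition ACE :: "'v::{metric_space, second_countable_topology} measure \<Rightarrow> ('v \<Rightarrow> 'v measure) \<Rightarrow>
    (real \<Rightarrow> real) \<Rightarrow> (real \<Rightarrow> real) \<Rightarrow> (real \<times> real \<Rightarrow> real) \<Rightarrow> real \<Rightarrow>
    ((real \<Rightarrow> 'v measure) \<times> (real \<Rightarrow> ('v \<times> 'v) signed)) set" where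
  "ACE \<pi> \<kappa> \<phi> \<psi>s \<alpha> T = {(\<rho>, j). (\<rho>, j) \<in> CE T \<and>
     (SUP t\<in>{0..T}. entropy \<pi> \<phi> (\<rho> t)) < \<infinity> \<and>
     (\<integral>\<^sup>+t\<in>{0..T}. (dissipation \<pi> \<kappa> \<psi>s \<alpha> (\<rho> t) (j t) + fisher \<pi> \<kappa> \<phi> \<psi>s \<alpha> (\<rho> t)) \<partial>lebesgue) < \<infinity>}"

definition RCE :: "'v::{metric_space, second_countable_topology} measure \<Rightarrow> ('v \<Rightarrow> 'v measure) \<Rightarrow>
    (real \<Rightarrow> real) \<Rightarrow> (real \<Rightarrow> real) \<Rightarrow> (real \<times> real \<Rightarrow> real) \<Rightarrow> real \<Rightarrow>
    ((real \<Rightarrow> 'v measure) \<times> (real \<Rightarrow> ('v \<times> 'v) signed)) set" where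
  "RCE \<pi> \<kappa> \<phi> \<psi>s \<alpha> T = {(\<rho>, j). (\<rho>, j) \<in> ACE \<pi> \<kappa> \<phi> \<psi>s \<alpha> T \<and>
     (\<exists>C. AE t\<in>{0<..<T} in lebesgue. AE x in \<pi>. pos_deriv \<pi> (\<rho> t) x \<le> C) \<and>
     satisfies_ce T (X2 \<pi> \<kappa>) \<rho> j}"


section \<open>Chain rule and solutions\<close>

definition abs_cont_on :: "real \<Rightarrow> real \<Rightarrow> (real \<Rightarrow> real) \<Rightarrow> bool" where
  "abs_cont_on a b f \<longleftrightarrow>
     (\<forall>\<epsilon>>0. \<exists>\<delta>>0. \<forall>(n::nat) l r.
        (\<forall>i<n. a \<le> l i \<and> l i \<le> r i \<and> r i \<le> b) \<and>
        disjoint_family_on (\<lambda>i. {l i<..<r i}) {..<n} \<and>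
        (\<Sum>i<n. r i - l i) < \<delta>
        \<longrightarrow> (\<Sum>i<n. \<bar>f (r i) - f (l i)\<bar>) < \<epsilon>)"

text \<open>\<open>- \<nabla>(\<phi>' \<circ> u)\<close> for \<open>\<rho> = u \<pi>\<close>, an extended-real function on edges\<close>

definition neg_entropy_grad ::
    "'v measure \<Rightarrow> (real \<Rightarrow> real) \<Rightarrow> 'v measure \<Rightarrow> 'v \<times> 'v \<Rightarrow> ereal" where
  "neg_entropy_grad \<pi> \<phi> \<rho> = (\<lambda>(x, y). - slope_diff \<phi> (pos_deriv \<pi> \<rho> x, pos_deriv \<pi> \<rho> y))"

definition chain_rule :: "'v measure \<Rightarrow> (real \<Rightarrow> real) \<Rightarrow> real \<Rightarrow>
    (real \<Rightarrow> 'v measure) \<Rightarrow> (real \<Rightarrow> ('v \<times> 'v) signed) \<Rightarrow> bool" where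
  "chain_rule \<pi> \<phi> T \<rho> j \<longleftrightarrow>
     (\<forall>t\<in>{0..T}. entropy \<pi> \<phi> (\<rho> t) < \<infinity>) \<and>
     abs_cont_on 0 T (\<lambda>t. enn2real (entropy \<pi> \<phi> (\<rho> t))) \<and>
     (AE t\<in>{0<..<T} in lebesgue.
        ext_integrable (j t) offdiag (neg_entropy_grad \<pi> \<phi> (\<rho> t)) \<and>
        ((\<lambda>r. enn2real (entropy \<pi> \<phi> (\<rho> r))) has_real_derivative
           - ext_integral (j t) offdiag (neg_entropy_grad \<pi> \<phi> (\<rho> t))) (at t))"

definition dissipative_solution :: "'v::{metric_space, second_countable_topology} measure \<Rightarrow>
    ('v \<Rightarrow> 'v measure) \<Rightarrow> (real \<Rightarrow> real) \<Rightarrow> (real \<Rightarrow> real) \<Rightarrow> (real \<times> real \<Rightarrow> real) \<Rightarrow> real \<Rightarrow>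
    (real \<Rightarrow> 'v measure) \<Rightarrow> (real \<Rightarrow> ('v \<times> 'v) signed) \<Rightarrow> bool" where
  "dissipative_solution \<pi> \<kappa> \<phi> \<psi>s \<alpha> T \<rho> j \<longleftrightarrow>
     (\<rho>, j) \<in> CE T \<and> entropy \<pi> \<phi> (\<rho> 0) < \<infinity> \<and>
     (\<forall>t\<in>{0..T}.
        (\<integral>\<^sup>+r\<in>{0..t}. (dissipation \<pi> \<kappa> \<psi>s \<alpha> (\<rho> r) (j r) + fisher \<pi> \<kappa> \<phi> \<psi>s \<alpha> (\<rho> r)) \<partial>lebesgue)
          + entropy \<pi> \<phi> (\<rho> t) \<le> entropy \<pi> \<phi> (\<rho> 0))"

definition reflecting_solution :: "'v::{metric_space, second_countable_topology} measure \<Rightarrow>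
    ('v \<Rightarrow> 'v measure) \<Rightarrow> (real \<Rightarrow> real) \<Rightarrow> (real \<Rightarrow> real) \<Rightarrow> (real \<times> real \<Rightarrow> real) \<Rightarrow> real \<Rightarrow>
    (real \<Rightarrow> 'v measure) \<Rightarrow> (real \<Rightarrow> ('v \<times> 'v) signed) \<Rightarrow> bool" where
  "reflecting_solution \<pi> \<kappa> \<phi> \<psi>s \<alpha> T \<rho> j \<longleftrightarrow>
     (\<rho>, j) \<in> RCE \<pi> \<kappa> \<phi> \<psi>s \<alpha> T \<and> entropy \<pi> \<phi> (\<rho> 0) < \<infinity> \<and>
     (\<forall>s t. 0 \<le> s \<and> s \<le> t \<and> t \<le> T \<longrightarrow>
        (\<integral>\<^sup>+r\<in>{s..t}. (dissipation \<pi> \<kappa> \<psi>s \<alpha> (\<rho> r) (j r) + fisher \<pi> \<kappa> \<phi> \<psi>s \<alpha> (\<rho> r)) \<partial>lebesgue)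
          + entropy \<pi> \<phi> (\<rho> t) = entropy \<pi> \<phi> (\<rho> s))"

definition pointwise_energy_balance :: "'v::{metric_space, second_countable_topology} measure \<Rightarrow>
    ('v \<Rightarrow> 'v measure) \<Rightarrow> (real \<Rightarrow> real) \<Rightarrow> (real \<Rightarrow> real) \<Rightarrow> (real \<times> real \<Rightarrow> real) \<Rightarrow> real \<Rightarrow>
    (real \<Rightarrow> 'v measure) \<Rightarrow> (real \<Rightarrow> ('v \<times> 'v) signed) \<Rightarrow> bool" where
  "pointwise_energy_balance \<pi> \<kappa> \<phi> \<psi>s \<alpha> T \<rho> j \<longleftrightarrow>
     (AE t\<in>{0<..<T} in lebesgue. \<exists>e\<ge>0.
        dissipation \<pi> \<kappa> \<psi>s \<alpha> (\<rho> t) (j t) + fisher \<pi> \<kappa> \<phi> \<psi>s \<alpha> (\<rho> t) = ennreal e \<and>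
        ((\<lambda>r. enn2real (entropy \<pi> \<phi> (\<rho> r))) has_real_derivative - e) (at t) \<and>
        ext_integrable (j t) UNIV (neg_entropy_grad \<pi> \<phi> (\<rho> t)) \<and>
        e = ext_integral (j t) UNIV (neg_entropy_grad \<pi> \<phi> (\<rho> t)))"

end

theory Submission imports Defs begin

abbreviation Bor :: "'a measure => ('a => 'b::topological_space) set" where "Bor M \<equiv> borel_measurable M"

abbreviation recip :: "nat => real" where "recip n \<equiv> inverse (real (Suc n))"

abbreviation ind :: "'a set => 'a => 'b::zero_neq_one" where "ind A \<equiv> indicator A"

abbreviation em :: "'a measure => 'a set => ennreal" where "em M A \<equiv> emeasure M A"

text \<open>Densities with respect to \<open>\<theta> = \<pi> \<kappa>\<close> turn the flux into a measurable function of time and edge. In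
  these terms the dissipation is the integral of the perspective of \<open>\<psi>\<close>, which is jointly convex;
  with the convexity of the Fisher information this gives (a).

  For (b), \<open>\<phi>'\<close> is truncated near \<open>0\<close>. Then \<open>\<phi>'\<^sub>e \<circ> u\<^sub>t\<close> is bounded and, since truncated gradients are
  controlled by the Fisher information, an admissible test function in \<open>X2\<close> for a.e. \<open>t\<close>. Testing with it
  and convexity bound each increment of the entropy from both sides by time integrals of the flux
  tested at an end point. The error of replacing the end point by the integration time is small in
  mean, as translations are continuous in \<open>L\<^sup>2\<close>; so the entropy minus the primitive of its expected
  derivative is constant at Lebesgue points, and at all times by lower semicontinuity and
  convexity. Fenchel's inequality dominates the limit \<open>e \<rightarrow> 0\<close>.

  For (c), \<open>- d/dt E \<le> R + D\<close> by Fenchel, and a dissipative solution forces equality of the integrals.\<close>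

section \<open>Measurable families of finite measures\<close>

text \<open>Convexity of the Fisher information does more than give (a). The truncated slope is
  admissible only if its squared edge gradient is at most a multiple of the Fisher density
  \<open>D\<close> for bounded densities. By compactness this can fail only where the mobility
  vanishes, on the axes away from the origin. If \<open>D\<close> vanished at such a point, two
  functions with complementary supports and all their mixtures would have zero Fisher information,
  which forces \<phi>' to be constant and contradicts superlinear growth. The flux is controlled
  only through Fenchel's inequality, not in an L2 norm. Testing it with a bounded function
  \<open>h\<close> costs \<open>R / N\<close> plus a constant depending on \<open>N\<close> times
  the squared L2 norm of \<open>h\<close>. The first term is not small for fixed \<open>N\<close>,
  so its primitive is kept inside a monotone quantity; the time step tends to 0 first and
  \<open>N\<close> to infinity last. A flux is merely sigma-finite. The weight 1 \<and> d^2 makes it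
  finite, but at a.e. time only, so versions in time are exchanged up to null sets and time carries
  the complete Lebesgue sigma-algebra.\<close>

definition finite_kernel :: "'a measure => 'b measure => ('a => 'b measure) => bool" where
 "finite_kernel L N m \<longleftrightarrow> (\<forall>t\<in>space L. sets (m t) = sets N & finite_measure (m t)) &
  (\<forall>B\<in>sets N. (%t. em (m t) B) \<in> Bor L)"

lemma finite_kernelD:
 assumes "finite_kernel L N m"
 shows "t \<in> space L ==> sets (m t) = sets N" "t \<in> space L ==> finite_measure (m t)"
  "t \<in> space L ==> space (m t) = space N"
  "B \<in> sets N ==> (%t. em (m t) B) \<in> Bor L"
 using assms sets_eq_imp_space_eq[of "m t" N] by (auto simp: finite_kernel_def)

lemma finite_kernel_const:
 "finite_measure M ==> sets M = sets N ==> finite_kernel L N (%_. M)"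
 by (simp add: finite_kernel_def)

text \<open>Dynkin's argument, starting from the rectangles. Finiteness of the members enters in the
  complement case, where the measure of a section is subtracted.\<close>

lemma finite_kernel_section_measurable:
 assumes m: "finite_kernel L N m" and "Q \<in> sets (L \<Otimes>\<^sub>M N)"
 shows "(%t. em (m t) (Pair t -` Q)) \<in> Bor L" (is "?s Q \<in> _")
 using Int_stable_pair_measure_generator pair_measure_closed assms(2)
 unfolding sets_pair_measure
proof (induct rule: sigma_sets_induct_disjoint)
 case (compl A)
 then have A: "A \<in> sets (L \<Otimes>\<^sub>M N)" by (simp add: sets_pair_measure)
 have "em (m t) (Pair t -` ((space L \<times> space N) - A)) =
   em (m t) (space N) - ?s A t" if t: "t \<in> space L" for t
 proof -
  interpret finite_measure "m t" by (rule finite_kernelD(2)[OF m t])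
  note [simp] = finite_kernelD(1,3)[OF m t]
  have "Pair t -` ((space L \<times> space N) - A) = space (m t) - Pair t -` A"
   using t by auto
  moreover have "Pair t -` A \<in> sets (m t)" using sets_Pair1[OF A] by simp
  moreover have "em (m t) (Pair t -` A) ~= \<infinity>" by simp
  ultimately show ?thesis using emeasure_compl[of "Pair t -` A" "m t"] by simp
 qed
 moreover have "(%t. em (m t) (space N) - ?s A t) \<in> Bor L"
  using compl by (intro borel_measurable_minus_ennreal finite_kernelD(4)[OF m]) auto
 ultimately show ?case by (simp cong: measurable_cong)
next
 case (union F)
 then have F: "F i \<in> sets (L \<Otimes>\<^sub>M N)" for i by (auto simp: sets_pair_measure)
 have "em (m t) (Pair t -` (\<Union>i. F i)) = (\<Sum>i. ?s (F i) t)" if t: "t \<in> space L" for t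
 proof -
  have "(\<Sum>i. em (m t) (Pair t -` F i)) = em (m t) (\<Union>i. Pair t -` F i)"
   using union F sets_Pair1[OF F] finite_kernelD(1)[OF m t]
   by (intro suminf_emeasure) (auto intro!: disjoint_family_on_vimageI)
  then show ?thesis by (simp add: vimage_UN)
 qed
 moreover have "(%t. \<Sum>i. ?s (F i) t) \<in> Bor L"
  using union by simp
 ultimately show ?case by (simp cong: measurable_cong)
next
 case (basic a)
 then obtain A B where AB: "a = A \<times> B" "A \<in> sets L" "B \<in> sets N" by auto
 then have "?s a t = (if t \<in> A then em (m t) B else 0)" for t
  by (auto simp: vimage_def)
 then show ?case using AB finite_kernelD(4)[OF m] by simp
qed simp

text \<open>The semidirect product L(dt) m_t(dy). With \<pi> and \<kappa> in place of
  \<open>L\<close> and \<open>m\<close> it is the edge measure.\<close>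

definition kernel_joint :: "'a measure => 'b measure => ('a => 'b measure) => ('a \<times> 'b) measure" where
 "kernel_joint L N m = measure_of (space L \<times> space N) (sets (L \<Otimes>\<^sub>M N))
  (%A. \<integral>\<^sup>+ t. em (m t) (Pair t -` A) \<partial>L)"

lemma sets_kernel_joint[measurable_cong]: "sets (kernel_joint L N m) = sets (L \<Otimes>\<^sub>M N)"
proof -
 have "sets (L \<Otimes>\<^sub>M N) \<subseteq> Pow (space L \<times> space N)"
  using sets.space_closed[of "L \<Otimes>\<^sub>M N"] by (simp add: space_pair_measure)
 then show ?thesis
  using sets.sigma_sets_eq[of "L \<Otimes>\<^sub>M N"]
  by (simp add: kernel_joint_def space_pair_measure)
qed

lemma space_kernel_joint: "space (kernel_joint L N m) = space L \<times> space N"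
 using sets_eq_imp_space_eq[OF sets_kernel_joint] by (simp add: space_pair_measure)

text \<open>Stated with measurability of sections as hypothesis, so that it also covers the jump kernel,
  whose measures need not be finite.\<close>

lemma emeasure_kernel_joint':
 assumes m: "!!t. t \<in> space L ==> sets (m t) = sets N"
  and meas: "!!Q. Q \<in> sets (L \<Otimes>\<^sub>M N) ==> (%t. em (m t) (Pair t -` Q)) \<in> Bor L"
  and A: "A \<in> sets (L \<Otimes>\<^sub>M N)"
 shows "em (kernel_joint L N m) A = (\<integral>\<^sup>+ t. em (m t) (Pair t -` A) \<partial>L)"
proof (rule emeasure_measure_of[OF kernel_joint_def])
 show "sets (L \<Otimes>\<^sub>M N) \<subseteq> Pow (space L \<times> space N)"
  using sets.space_closed[of "L \<Otimes>\<^sub>M N"] by (simp add: space_pair_measure)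
 show "A \<in> sets (kernel_joint L N m)" using A by (simp add: sets_kernel_joint)
 show "positive (sets (kernel_joint L N m)) (%A. \<integral>\<^sup>+ t. em (m t) (Pair t -` A) \<partial>L)"
  by (simp add: positive_def)
 show "countably_additive (sets (kernel_joint L N m)) (%A. \<integral>\<^sup>+ t. em (m t) (Pair t -` A) \<partial>L)"
  unfolding sets_kernel_joint
 proof (rule countably_additiveI)
  fix F :: "nat => _"
  assume F: "range F \<subseteq> sets (L \<Otimes>\<^sub>M N)" "disjoint_family F"
  then have F': "F i \<in> sets (L \<Otimes>\<^sub>M N)" for i by auto
  have "(\<Sum>i. \<integral>\<^sup>+ t. em (m t) (Pair t -` F i) \<partial>L) =
    (\<integral>\<^sup>+ t. (\<Sum>i. em (m t) (Pair t -` F i)) \<partial>L)"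
   by (intro nn_integral_suminf[symmetric] meas F')
  also have "... = (\<integral>\<^sup>+ t. em (m t) (Pair t -` (\<Union>i. F i)) \<partial>L)"
  proof (intro nn_integral_cong)
   fix t assume t: "t \<in> space L"
   have "(\<Sum>i. em (m t) (Pair t -` F i)) = em (m t) (\<Union>i. Pair t -` F i)"
    using F sets_Pair1[OF F'] m[OF t]
    by (intro suminf_emeasure) (auto intro!: disjoint_family_on_vimageI)
   then show "(\<Sum>i. em (m t) (Pair t -` F i)) = em (m t) (Pair t -` (\<Union>i. F i))"
    by (simp add: vimage_UN)
  qed
  finally show "(\<Sum>i. \<integral>\<^sup>+ t. em (m t) (Pair t -` F i) \<partial>L) =
   (\<integral>\<^sup>+ t. em (m t) (Pair t -` (\<Union>i. F i)) \<partial>L)" .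
 qed
qed

text \<open>Fubini for a semidirect product. Both claims are proved in one induction, because
  interchanging sums and suprema with the outer integral needs the inner integrals to be measurable
  in the parameter.\<close>

lemma nn_integral_kernel_joint':
 assumes m: "!!t. t \<in> space L ==> sets (m t) = sets N"
  and meas: "!!Q. Q \<in> sets (L \<Otimes>\<^sub>M N) ==> (%t. em (m t) (Pair t -` Q)) \<in> Bor L"
  and h: "h \<in> Bor (L \<Otimes>\<^sub>M N)"
 shows "(%t. \<integral>\<^sup>+ y. h (t, y) \<partial>m t) \<in> Bor L &
  (\<integral>\<^sup>+ p. h p \<partial>kernel_joint L N m) = (\<integral>\<^sup>+ t. (\<integral>\<^sup>+ y. h (t, y) \<partial>m t) \<partial>L)"
 using h
proof (induct rule: borel_measurable_induct)
 case (cong f g)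
 have eq: "(\<integral>\<^sup>+ y. f (t, y) \<partial>m t) = (\<integral>\<^sup>+ y. g (t, y) \<partial>m t)" if "t \<in> space L" for t
  using that sets_eq_imp_space_eq[OF m[OF that]]
  by (intro nn_integral_cong cong(3)) (simp add: space_pair_measure)
 have "(\<integral>\<^sup>+ p. f p \<partial>kernel_joint L N m) = (\<integral>\<^sup>+ p. g p \<partial>kernel_joint L N m)"
  using cong(3) by (intro nn_integral_cong) (simp add: space_kernel_joint space_pair_measure)
 moreover have "(\<integral>\<^sup>+ t. (\<integral>\<^sup>+ y. f (t, y) \<partial>m t) \<partial>L) = (\<integral>\<^sup>+ t. (\<integral>\<^sup>+ y. g (t, y) \<partial>m t) \<partial>L)"
  by (rule nn_integral_cong) (rule eq)
 ultimately show ?case using cong(4) by (simp add: eq cong: measurable_cong)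
next
 case (set A)
 have eq: "(\<integral>\<^sup>+ y. ind A (t, y) \<partial>m t) = em (m t) (Pair t -` A)" if "t \<in> space L" for t
 proof -
  have "(\<integral>\<^sup>+ y. ind A (t, y) \<partial>m t) = (\<integral>\<^sup>+ y. ind (Pair t -` A) y \<partial>m t)"
   by (simp add: indicator_def)
  then show ?thesis
   using sets_Pair1[OF set, of t] m[OF that] by simp
 qed
 have "(\<integral>\<^sup>+ t. (\<integral>\<^sup>+ y. ind A (t, y) \<partial>m t) \<partial>L) = (\<integral>\<^sup>+ t. em (m t) (Pair t -` A) \<partial>L)"
  by (rule nn_integral_cong) (rule eq)
 with meas[OF set] set emeasure_kernel_joint'[OF m meas set] show ?case
  by (simp add: eq sets_kernel_joint cong: measurable_cong)
next
 case (mult u c)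
 have eq: "(\<integral>\<^sup>+ y. c * u (t, y) \<partial>m t) = c * (\<integral>\<^sup>+ y. u (t, y) \<partial>m t)" if "t \<in> space L" for t
  using mult(2) that m[OF that]
  by (intro nn_integral_cmult) (simp cong: measurable_cong_sets)
 have "(\<integral>\<^sup>+ t. (\<integral>\<^sup>+ y. c * u (t, y) \<partial>m t) \<partial>L) = (\<integral>\<^sup>+ t. c * (\<integral>\<^sup>+ y. u (t, y) \<partial>m t) \<partial>L)"
  by (rule nn_integral_cong) (rule eq)
 moreover have "(%t. c * (\<integral>\<^sup>+ y. u (t, y) \<partial>m t)) \<in> Bor L"
  using mult(4) by (intro borel_measurable_times_ennreal) simp_all
 ultimately show ?case using mult
  by (simp add: eq nn_integral_cmult cong: measurable_cong measurable_cong_sets[OF sets_kernel_joint refl])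
next
 case (add u v)
 have eq: "(\<integral>\<^sup>+ y. v (t, y) + u (t, y) \<partial>m t) = (\<integral>\<^sup>+ y. v (t, y) \<partial>m t) + (\<integral>\<^sup>+ y. u (t, y) \<partial>m t)"
  if "t \<in> space L" for t
  using add(1,4) that m[OF that]
  by (intro nn_integral_add) (simp_all cong: measurable_cong_sets)
 have "(\<integral>\<^sup>+ t. (\<integral>\<^sup>+ y. v (t, y) + u (t, y) \<partial>m t) \<partial>L) =
  (\<integral>\<^sup>+ t. (\<integral>\<^sup>+ y. v (t, y) \<partial>m t) + (\<integral>\<^sup>+ y. u (t, y) \<partial>m t) \<partial>L)"
  by (rule nn_integral_cong) (rule eq)
 moreover have "(%t. (\<integral>\<^sup>+ y. v (t, y) \<partial>m t) + (\<integral>\<^sup>+ y. u (t, y) \<partial>m t)) \<in> Bor L"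
  using add(3,7) by (intro borel_measurable_add) simp_all
 ultimately show ?case using add
  by (simp add: eq nn_integral_add cong: measurable_cong measurable_cong_sets[OF sets_kernel_joint refl])
next
 case (seq U)
 have eq: "(\<integral>\<^sup>+ y. (SUP i. U i) (t, y) \<partial>m t) = (SUP i. \<integral>\<^sup>+ y. U i (t, y) \<partial>m t)"
  if "t \<in> space L" for t
 proof -
  have "(\<integral>\<^sup>+ y. (SUP i. U i (t, y)) \<partial>m t) = (SUP i. \<integral>\<^sup>+ y. U i (t, y) \<partial>m t)"
   using seq(1,4) that m[OF that]
   by (intro nn_integral_monotone_convergence_SUP)
    (auto simp: mono_def le_fun_def cong: measurable_cong_sets)
  then show ?thesis by (simp add: image_comp)
 qed
 have "(\<integral>\<^sup>+ p. (SUP i. U i) p \<partial>kernel_joint L N m) = (SUP i. \<integral>\<^sup>+ p. U i p \<partial>kernel_joint L N m)"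
  using seq(1,4) nn_integral_monotone_convergence_SUP[of U "kernel_joint L N m"]
  by (simp add: image_comp cong: measurable_cong_sets[OF sets_kernel_joint refl])
 also have "... = (SUP i. \<integral>\<^sup>+ t. (\<integral>\<^sup>+ y. U i (t, y) \<partial>m t) \<partial>L)"
  using seq(3) by simp
 also have "... = (\<integral>\<^sup>+ t. (SUP i. \<integral>\<^sup>+ y. U i (t, y) \<partial>m t) \<partial>L)"
  using seq(3,4) by (intro nn_integral_monotone_convergence_SUP[symmetric])
   (auto simp: mono_def le_fun_def intro!: nn_integral_mono)
 also have "... = (\<integral>\<^sup>+ t. (\<integral>\<^sup>+ y. (SUP i. U i) (t, y) \<partial>m t) \<partial>L)"
  using eq by (intro nn_integral_cong) simp
 finally show ?case
 proof (rule conjI[rotated])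
  show "(%t. \<integral>\<^sup>+ y. (SUP i. U i) (t, y) \<partial>m t) \<in> Bor L"
   by (subst measurable_cong[OF eq], assumption, rule borel_measurable_SUP) (use seq(3) in blast)+
 qed
qed

lemma finite_kernel_nn_integral_measurable:
 assumes m: "finite_kernel L N m" and h: "h \<in> Bor (L \<Otimes>\<^sub>M N)"
 shows "(%t. \<integral>\<^sup>+ y. h (t, y) \<partial>m t) \<in> Bor L"
 using nn_integral_kernel_joint'[of L m N h] finite_kernelD[OF m]
  finite_kernel_section_measurable[OF m] h by blast

lemma emeasure_kernel_joint:
 "finite_kernel L N m ==> A \<in> sets (L \<Otimes>\<^sub>M N) ==>
  em (kernel_joint L N m) A = (\<integral>\<^sup>+ t. em (m t) (Pair t -` A) \<partial>L)"
 by (intro emeasure_kernel_joint' finite_kernel_section_measurable) (simp_all add: finite_kernelD)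

lemma nn_integral_kernel_joint:
 "finite_kernel L N m ==> h \<in> Bor (L \<Otimes>\<^sub>M N) ==>
  (\<integral>\<^sup>+ p. h p \<partial>kernel_joint L N m) = (\<integral>\<^sup>+ t. (\<integral>\<^sup>+ y. h (t, y) \<partial>m t) \<partial>L)"
 using nn_integral_kernel_joint'[of L m N h] finite_kernel_section_measurable[of L N m]
 by (simp add: finite_kernelD)

text \<open>The finite intersections of a countable base; the empty intersection contributes
  \<open>UNIV\<close>. Countability lets identities that hold for a.e. parameter, one set at a time,
  be combined into equality of measures for a.e. parameter.\<close>

lemma borel_Int_stable_generator:
 obtains G :: "'b::second_countable_topology set set"
 where "countable G" "Int_stable G" "UNIV \<in> G" "sets borel = sigma_sets UNIV G"
proof -
 obtain B :: "'b set set" where B: "countable B" "topological_basis B"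
  using ex_countable_basis by auto
 define G where "G = Inter ` {F. finite F & F \<subseteq> B}"
 have sb: "sets borel = sigma_sets UNIV B"
  by (subst borel_eq_countable_basis[OF B]) simp
 have "countable G" unfolding G_def
  using B(1) by (intro countable_image countable_Collect_finite_subset)
 moreover have "Int_stable G"
  unfolding Int_stable_def G_def
 proof (safe)
  fix F H assume "finite F" "F \<subseteq> B" "finite H" "H \<subseteq> B"
  then show "\<Inter>F \<inter> \<Inter>H \<in> Inter ` {F. finite F & F \<subseteq> B}"
   by (intro image_eqI[of _ _ "F \<union> H"]) auto
 qed
 moreover have "UNIV \<in> G" unfolding G_def by (intro image_eqI[of _ _ "{}"]) auto
 moreover have "sets borel = sigma_sets UNIV G"
 proof
  have "B \<subseteq> G" unfolding G_def
  proof
   fix b assume "b \<in> B" then show "b \<in> Inter ` {F. finite F & F \<subseteq> B}"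
    by (intro image_eqI[of _ _ "{b}"]) auto
  qed
  then show "sets borel \<subseteq> sigma_sets UNIV G"
   unfolding sb by (rule sigma_sets_subseteq)
  have "G \<subseteq> sets borel"
   unfolding G_def
  proof safe
   fix F assume "finite F" "F \<subseteq> B"
   moreover have "B \<subseteq> sets borel" unfolding sb by (auto intro: sigma_sets.Basic)
   ultimately show "\<Inter>F \<in> sets (borel::'b measure)"
    using sets.finite_INT[of F "%x. x" borel] by (cases "F = {}") auto
  qed
  then show "sigma_sets UNIV G \<subseteq> sets borel"
   using sets.sigma_sets_subset[of G borel] by simp
 qed
 ultimately show ?thesis by (rule that)
qed

text \<open>The disintegration: the density of the joint measures is, at almost every parameter, the
  density of the members of the families, by testing on a countable generator.\<close>

lemma kernel_density:
 fixes m M :: "'a => 'b::second_countable_topology measure"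
 assumes L: "finite_measure L" and m: "finite_kernel L borel m" and M: "finite_kernel L borel M"
  and ac: "AE t in L. absolutely_continuous (M t) (m t)"
 obtains f :: "'a \<times> 'b => ennreal" where "f \<in> Bor (L \<Otimes>\<^sub>M borel)"
  "AE t in L. m t = density (M t) (%y. f (t, y))"
proof -
 interpret L: finite_measure L by fact
 let ?JM = "kernel_joint L borel M" and ?Jm = "kernel_joint L borel m"
 note [measurable] = finite_kernelD(4)[OF m] finite_kernelD(4)[OF M]
 \<comment> \<open>The members are finite without a uniform bound, so the parameters are exhausted
   by bounds \<open>k\<close> on the total mass; over each such piece the joint measure is finite
   because \<open>L\<close> is.\<close>
 have "sigma_finite_measure ?JM"
 proof
  define S where "S k = {t\<in>space L. em (M t) UNIV <= of_nat k} \<times> (UNIV::'b set)" for k :: nat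
  have S: "S k \<in> sets (L \<Otimes>\<^sub>M borel)" for k
  proof -
   have [measurable]: "(%t. em (M t) UNIV) \<in> Bor L"
    using finite_kernelD(4)[OF M, of UNIV] by simp
   show ?thesis unfolding S_def by (intro pair_measureI) measurable
  qed
  have fin: "em ?JM (S k) ~= \<infinity>" for k
  proof -
   have "em ?JM (S k) = (\<integral>\<^sup>+ t. em (M t) (Pair t -` S k) \<partial>L)"
    by (rule emeasure_kernel_joint[OF M S])
   also have "... <= (\<integral>\<^sup>+ t. of_nat k \<partial>L)"
    unfolding S_def by (intro nn_integral_mono) (auto simp: vimage_def)
   also have "... < \<infinity>"
   proof -
    have "em L (space L) < top" by (metis L.emeasure_finite less_top)
    then show ?thesis by (simp add: ennreal_mult_less_top of_nat_less_top)
   qed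
   finally show ?thesis by simp
  qed
  have cov: "(\<Union>k. S k) = space L \<times> UNIV"
  proof -
   have "\<exists>k. t \<in> {t\<in>space L. em (M t) UNIV <= of_nat k}" if t: "t \<in> space L" for t
   proof -
    interpret finite_measure "M t" by (rule finite_kernelD(2)[OF M t])
    have "em (M t) UNIV < \<infinity>" by (metis emeasure_finite less_top infinity_ennreal_def)
    then obtain k where "em (M t) UNIV < of_nat k"
     using ennreal_Ex_less_of_nat[of "em (M t) UNIV"] by auto
    with t show ?thesis by (auto intro: less_imp_le)
   qed
   then show ?thesis unfolding S_def by blast
  qed
  show "\<exists>A. countable A & A \<subseteq> sets ?JM & \<Union> A = space ?JM & (\<forall>a\<in>A. em ?JM a ~= \<infinity>)"
   using S fin cov by (intro exI[of _ "range S"]) (auto simp: sets_kernel_joint space_kernel_joint)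
 qed
 then interpret JM: sigma_finite_measure ?JM .
 have "absolutely_continuous ?JM ?Jm"
  unfolding absolutely_continuous_def
 proof
  fix A assume A: "A \<in> null_sets ?JM"
  then have A': "A \<in> sets (L \<Otimes>\<^sub>M borel)" by (auto simp: null_sets_def sets_kernel_joint)
  from A have "(\<integral>\<^sup>+ t. em (M t) (Pair t -` A) \<partial>L) = 0"
   using emeasure_kernel_joint[OF M A'] by auto
  then have "AE t in L. em (M t) (Pair t -` A) = 0"
   using finite_kernel_section_measurable[OF M A'] by (simp add: nn_integral_0_iff_AE)
  with ac AE_space have "AE t in L. em (m t) (Pair t -` A) = 0"
  proof eventually_elim
   case (elim t)
   then have "Pair t -` A \<in> null_sets (M t)"
    using sets_Pair1[OF A'] finite_kernelD(1)[OF M] by (auto simp: null_sets_def)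
   with elim show ?case unfolding absolutely_continuous_def by auto
  qed
  then have "(\<integral>\<^sup>+ t. em (m t) (Pair t -` A) \<partial>L) = 0"
   using finite_kernel_section_measurable[OF m A'] by (simp add: nn_integral_0_iff_AE)
  then show "A \<in> null_sets ?Jm"
   using emeasure_kernel_joint[OF m A'] A' by (auto simp: null_sets_def sets_kernel_joint)
 qed
 from JM.Radon_Nikodym[OF this] obtain f
  where f': "f \<in> Bor ?JM" and dens: "density ?JM f = ?Jm"
  by (auto simp: sets_kernel_joint)
 have f[measurable]: "f \<in> Bor (L \<Otimes>\<^sub>M borel)"
  using f' by (simp cong: measurable_cong_sets[OF sets_kernel_joint refl])
 obtain G :: "'b set set" where G: "countable G" "Int_stable G" "UNIV \<in> G" "sets borel = sigma_sets UNIV G"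
  by (rule borel_Int_stable_generator)
 have GB: "B \<in> sets borel" if "B \<in> G" for B using G(4) that by auto
 have "AE t in L. em (m t) B = (\<integral>\<^sup>+ y. f (t, y) * ind B y \<partial>M t)" if "B \<in> G" for B
 proof -
  note [measurable] = GB[OF that]
  have meas: "(%t. \<integral>\<^sup>+ y. f (t, y) * ind B y \<partial>M t) \<in> Bor L"
   using finite_kernel_nn_integral_measurable[OF M, of "%p. f p * ind B (snd p)"] by simp
  \<comment> \<open>Integrating either side over a set \<open>A\<close> of parameters is evaluating
    the joint measures on the rectangle with sides \<open>A\<close> and \<open>B\<close>.\<close>
  have "density L (%t. em (m t) B) = density L (%t. \<integral>\<^sup>+ y. f (t, y) * ind B y \<partial>M t)"
  proof (rule measure_eqI)
   fix A assume "A \<in> sets (density L (%t. em (m t) B))"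
   then have [measurable]: "A \<in> sets L" by simp
   have AB: "A \<times> B \<in> sets (L \<Otimes>\<^sub>M borel)" by simp
   have "em (density L (%t. em (m t) B)) A = (\<integral>\<^sup>+ t. em (m t) B * ind A t \<partial>L)"
    by (simp add: emeasure_density)
   also have "... = (\<integral>\<^sup>+ t. em (m t) (Pair t -` (A \<times> B)) \<partial>L)"
    by (intro nn_integral_cong) (auto simp: indicator_def vimage_def)
   also have "... = em (density ?JM f) (A \<times> B)"
    unfolding dens by (rule emeasure_kernel_joint[OF m AB, symmetric])
   also have "... = (\<integral>\<^sup>+ p. f p * ind (A \<times> B) p \<partial>?JM)"
    using f' AB by (simp add: emeasure_density sets_kernel_joint)
   also have "... = (\<integral>\<^sup>+ t. (\<integral>\<^sup>+ y. f (t, y) * ind (A \<times> B) (t, y) \<partial>M t) \<partial>L)"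
    by (rule nn_integral_kernel_joint[OF M]) measurable
   also have "... = (\<integral>\<^sup>+ t. (\<integral>\<^sup>+ y. f (t, y) * ind B y \<partial>M t) * ind A t \<partial>L)"
    by (intro nn_integral_cong) (auto simp: indicator_def)
   also have "... = em (density L (%t. \<integral>\<^sup>+ y. f (t, y) * ind B y \<partial>M t)) A"
    using meas by (simp add: emeasure_density)
   finally show "em (density L (%t. em (m t) B)) A =
    em (density L (%t. \<integral>\<^sup>+ y. f (t, y) * ind B y \<partial>M t)) A" .
  qed simp
  then show ?thesis
   using L.density_unique_iff[of "%t. em (m t) B", OF _ meas] by simp
 qed
 then have "AE t in L. \<forall>B\<in>G. em (m t) B = (\<integral>\<^sup>+ y. f (t, y) * ind B y \<partial>M t)"
  using G(1) by (simp add: AE_ball_countable)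
 with AE_space have "AE t in L. m t = density (M t) (%y. f (t, y))"
 proof eventually_elim
  case (elim t)
  then interpret finite_measure "m t" by (intro finite_kernelD(2)[OF m])
  have sM: "sets (M t) = sets borel" and sm: "sets (m t) = sets borel"
   using finite_kernelD(1)[OF m] finite_kernelD(1)[OF M] elim by auto
  have ft: "(%y. f (t, y)) \<in> Bor (M t)"
   using elim sM by (simp cong: measurable_cong_sets)
  show ?case
  proof (rule measure_eqI_generator_eq[OF G(2), of UNIV _ _ "%_. UNIV"])
   fix B assume "B \<in> G"
   then show "em (m t) B = em (density (M t) (%y. f (t, y))) B"
    using elim ft GB[of B] sM by (simp add: emeasure_density)
  qed (use G sM sm in auto)
 qed
 with f that show ?thesis by blast
qed


text \<open>Completeness lets the measurability of a function of time be checked on a version that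
  agrees with it only almost everywhere.\<close>

lemma complete_measure_lebesgue_on: "S \<in> sets lebesgue ==> complete_measure (lebesgue_on S)"
proof
 fix A B :: "'a set" assume S: "S \<in> sets lebesgue" and A: "A \<subseteq> B" "B \<in> null_sets (lebesgue_on S)"
 then have "B \<in> null_sets lebesgue" "B \<subseteq> S"
  by (auto simp: null_sets_restrict_space)
 then have "A \<in> null_sets lebesgue" "A \<subseteq> S"
  using A(1) completion.complete2 by blast+
 then have "A \<in> null_sets (lebesgue_on S)"
  using S by (simp add: null_sets_restrict_space)
 then show "A \<in> sets (lebesgue_on S)" by auto
qed

lemma (in complete_measure) measurable_AE_cong:
 assumes f: "f \<in> measurable M N" and ae: "AE x in M. f x = g x"
  and g: "!!x. x \<in> space M ==> g x \<in> space N"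
 shows "g \<in> measurable M N"
proof (rule measurableI[OF g])
 fix A assume A: "A \<in> sets N"
 show "g -` A \<inter> space M \<in> sets M"
 proof (rule in_sets_AE)
  show "AE x in M. (x \<in> f -` A \<inter> space M) = (x \<in> g -` A \<inter> space M)"
   using ae by eventually_elim auto
 qed (use measurable_sets[OF f A] in auto)
qed

text \<open>For an integrand independent of the parameter, measurability of the masses of sets
  carries over directly and no complements of sections occur. This makes the statement available for
  the sigma-finite parts of a flux.\<close>

lemma nn_integral_measurable_of_emeasure:
 assumes m: "!!t. t \<in> space L ==> sets (m t) = sets N"
  and meas: "!!B. B \<in> sets N ==> (%t. em (m t) B) \<in> Bor L"
  and h: "h \<in> Bor N"
 shows "(%t. \<integral>\<^sup>+ y. h y \<partial>m t) \<in> Bor L"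
 using h
proof (induct rule: borel_measurable_induct)
 case (cong f g)
 have "(\<integral>\<^sup>+ y. f y \<partial>m t) = (\<integral>\<^sup>+ y. g y \<partial>m t)" if "t \<in> space L" for t
  using cong(3) sets_eq_imp_space_eq[OF m[OF that]] by (intro nn_integral_cong) simp
 with cong(4) show ?case by (simp cong: measurable_cong)
next
 case (set A)
 with m meas show ?case by (simp cong: measurable_cong)
next
 case (mult u c)
 have "(\<integral>\<^sup>+ y. c * u y \<partial>m t) = c * (\<integral>\<^sup>+ y. u y \<partial>m t)" if "t \<in> space L" for t
  using mult(2) m[OF that] by (intro nn_integral_cmult) (simp cong: measurable_cong_sets)
 with mult(4) show ?case by (simp cong: measurable_cong)
next
 case (add u v)
 have "(\<integral>\<^sup>+ y. v y + u y \<partial>m t) = (\<integral>\<^sup>+ y. v y \<partial>m t) + (\<integral>\<^sup>+ y. u y \<partial>m t)" if "t \<in> space L" for t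
  using add(1,4) m[OF that] by (intro nn_integral_add) (simp_all cong: measurable_cong_sets)
 with add(3,7) show ?case by (simp cong: measurable_cong)
next
 case (seq U)
 have "(\<integral>\<^sup>+ y. (SUP i. U i) y \<partial>m t) = (SUP i. \<integral>\<^sup>+ y. U i y \<partial>m t)" if "t \<in> space L" for t
  using seq(1,4) m[OF that] nn_integral_monotone_convergence_SUP[of U "m t"]
  by (simp add: image_comp cong: measurable_cong_sets)
 note eq = this
 show ?case
  by (subst measurable_cong[OF eq], assumption, rule borel_measurable_SUP) (use seq(3) in blast)+
qed


section \<open>Weighted kernels\<close>

text \<open>The parts of a flux are only sigma-finite; multiplied by a strictly positive weight they
  become finite, and dividing by the weight recovers them. Finiteness is asked at a.e. parameter
  because the bound on a flux holds only after integration in time.\<close>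

definition weighted_kernel ::
  "'a measure => 'b measure => ('b => real) => ('a => 'b measure) => bool" where
 "weighted_kernel L N \<omega> m \<longleftrightarrow> (\<forall>t\<in>space L. sets (m t) = sets N) &
  (\<forall>B\<in>sets N. (%t. em (m t) B) \<in> Bor L) &
  (AE t in L. (\<integral>\<^sup>+ y. ennreal (\<omega> y) \<partial>m t) < \<infinity>)"

lemma density_weight_cancel:
 fixes \<omega> :: "'b => real"
 assumes [measurable]: "\<omega> \<in> Bor M" and pos: "!!y. 0 < \<omega> y"
 shows "density (density M (%y. ennreal (\<omega> y))) (%y. ennreal (1 / \<omega> y)) = M"
proof -
 have "ennreal (\<omega> y) * ennreal (1 / \<omega> y) = 1" for y
  using pos[of y] by (simp flip: ennreal_mult)
 then show ?thesis by (simp add: density_density_eq density_1)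
qed

text \<open>A strictly positive weight does not change the null sets.\<close>

lemma absolutely_continuous_weight:
 fixes \<omega> :: "'b => real"
 assumes [measurable]: "\<omega> \<in> Bor N" and pos: "!!y. 0 < \<omega> y"
  and s: "sets M = sets N" "sets m = sets N" and ac: "absolutely_continuous M m"
 shows "absolutely_continuous (density M (%y. ennreal (\<omega> y))) (density m (%y. ennreal (\<omega> y)))"
proof -
 have [measurable]: "\<omega> \<in> Bor M" "\<omega> \<in> Bor m"
  using s by (simp_all cong: measurable_cong_sets)
 have nM: "null_sets (density M (%y. ennreal (\<omega> y))) = null_sets M"
  using pos by (auto simp: null_sets_density_iff not_le[symmetric] ennreal_eq_0_iff intro: AE_not_in
    simp flip: AE_iff_null_sets)
 have nm: "null_sets (density m (%y. ennreal (\<omega> y))) = null_sets m"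
  using pos by (auto simp: null_sets_density_iff not_le[symmetric] ennreal_eq_0_iff intro: AE_not_in
    simp flip: AE_iff_null_sets)
 show ?thesis using ac unfolding absolutely_continuous_def nM nm .
qed

locale weighted_space =
 fixes L :: "'a measure" and N :: "'b measure" and \<omega> :: "'b => real"
 assumes finL: "finite_measure L" and compL: "complete_measure L"
  and \<omega>_meas[measurable]: "\<omega> \<in> Bor N" and \<omega>_pos: "!!y. 0 < \<omega> y"
begin

lemma weighted_kernelD:
 assumes "weighted_kernel L N \<omega> m"
 shows "t \<in> space L ==> sets (m t) = sets N"
  "B \<in> sets N ==> (%t. em (m t) B) \<in> Bor L"
  "AE t in L. (\<integral>\<^sup>+ y. ennreal (\<omega> y) \<partial>m t) < \<infinity>"
 using assms by (auto simp: weighted_kernel_def)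

lemma weighted_kernel_finite_version:
 assumes m: "weighted_kernel L N \<omega> m"
 obtains m' where "finite_kernel L N m'"
  "AE t in L. m' t = density (m t) (%y. ennreal (\<omega> y))"
proof -
 note D = weighted_kernelD[OF m]
 define G where "G = {t\<in>space L. (\<integral>\<^sup>+ y. ennreal (\<omega> y) \<partial>m t) < \<infinity>}"
 have mI: "(%t. \<integral>\<^sup>+ y. h y \<partial>m t) \<in> Bor L" if "h \<in> Bor N" for h
  by (rule nn_integral_measurable_of_emeasure[OF D(1,2) that])
 have G[measurable]: "G \<in> sets L"
  unfolding G_def using mI[of "%y. ennreal (\<omega> y)"] by measurable
 \<comment> \<open>At parameters with infinite weighted mass the null measure is substituted. Since
   \<open>G\<close> is measurable, the result is a finite kernel at every parameter.\<close>
 define m' where "m' t = (if t \<in> G then density (m t) (%y. ennreal (\<omega> y)) else null_measure N)" for t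
 have GL: "t \<in> space L" if "t \<in> G" for t using that by (simp add: G_def)
 have om: "\<omega> \<in> Bor (m t)" if "t \<in> space L" for t
  using D(1)[OF that] by (simp cong: measurable_cong_sets)
 have em: "em (m' t) B = (if t \<in> G then (\<integral>\<^sup>+ y. ennreal (\<omega> y) * ind B y \<partial>m t) else 0)"
  if "B \<in> sets N" for t B
  using that om[OF GL] D(1)[OF GL] by (auto simp: m'_def emeasure_density)
 have "finite_kernel L N m'"
  unfolding finite_kernel_def
 proof (intro conjI ballI)
  fix t assume t: "t \<in> space L"
  show "sets (m' t) = sets N" using D(1)[OF t] by (simp add: m'_def)
  then have "space (m' t) = space N" by (rule sets_eq_imp_space_eq)
  show "finite_measure (m' t)"
  proof
   have "(\<integral>\<^sup>+ y. ennreal (\<omega> y) * ind (space N) y \<partial>m t) <= (\<integral>\<^sup>+ y. ennreal (\<omega> y) \<partial>m t)"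
    by (intro nn_integral_mono) (auto simp: indicator_def)
   also have "... < \<infinity>" if "t \<in> G" using that by (simp add: G_def)
   finally show "em (m' t) (space (m' t)) ~= \<infinity>"
    using em[of "space N" t] \<open>space (m' t) = space N\<close> by auto
  qed
 next
  fix B assume [measurable]: "B \<in> sets N"
  have [measurable]: "(%t. \<integral>\<^sup>+ y. ennreal (\<omega> y) * ind B y \<partial>m t) \<in> Bor L"
   by (intro mI) measurable
  show "(%t. em (m' t) B) \<in> Bor L"
   unfolding em[OF \<open>B \<in> sets N\<close>] by measurable
 qed
 moreover have "AE t in L. m' t = density (m t) (%y. ennreal (\<omega> y))"
  using D(3) AE_space by eventually_elim (simp add: m'_def G_def)
 ultimately show ?thesis by (rule that)
qed

text \<open>The integral is computed with the finite version and the reciprocal weight. The two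
  agree only at a.e. parameter, and completeness of \<open>L\<close> absorbs the exceptions.\<close>

lemma weighted_kernel_nn_integral_measurable:
 assumes m: "weighted_kernel L N \<omega> m" and h[measurable]: "h \<in> Bor (L \<Otimes>\<^sub>M N)"
 shows "(%t. \<integral>\<^sup>+ y. h (t, y) \<partial>m t) \<in> Bor L"
proof -
 interpret complete_measure L by (rule compL)
 note D = weighted_kernelD[OF m]
 obtain m' where m': "finite_kernel L N m'" "AE t in L. m' t = density (m t) (%y. ennreal (\<omega> y))"
  by (rule weighted_kernel_finite_version[OF m])
 have "(%t. \<integral>\<^sup>+ y. ennreal (1 / \<omega> y) * h (t, y) \<partial>m' t) \<in> Bor L"
  using finite_kernel_nn_integral_measurable[OF m'(1), of "%p. ennreal (1 / \<omega> (snd p)) * h p"] by simp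
 moreover have "AE t in L. (\<integral>\<^sup>+ y. ennreal (1 / \<omega> y) * h (t, y) \<partial>m' t) = (\<integral>\<^sup>+ y. h (t, y) \<partial>m t)"
  using m'(2) AE_space
 proof eventually_elim
  case (elim t)
  have [measurable]: "\<omega> \<in> Bor (m t)" "(%y. h (t, y)) \<in> Bor (m t)"
   using D(1)[OF elim(2)] elim(2) by (simp_all cong: measurable_cong_sets)
  have "(\<integral>\<^sup>+ y. h (t, y) \<partial>m t) =
    (\<integral>\<^sup>+ y. h (t, y) \<partial>density (density (m t) (%y. ennreal (\<omega> y))) (%y. ennreal (1 / \<omega> y)))"
   by (simp add: density_weight_cancel \<omega>_pos)
  also have "... = (\<integral>\<^sup>+ y. ennreal (1 / \<omega> y) * h (t, y) \<partial>m' t)"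
   unfolding elim(1) by (subst nn_integral_density) simp_all
  finally show ?case by simp
 qed
 ultimately show ?thesis by (rule measurable_AE_cong) simp
qed

end

text \<open>The density is found for the finite versions, and the weight cancels. It can be taken
  real: its weighted integral is finite at a.e. parameter, so it is finite a.e. with respect to the
  reference measure.\<close>

lemma weighted_kernel_density:
 fixes m M :: "'a => 'b::second_countable_topology measure"
 assumes "weighted_space L borel \<omega>"
  and m: "weighted_kernel L borel \<omega> m" and M: "weighted_kernel L borel \<omega> M"
  and ac: "AE t in L. absolutely_continuous (M t) (m t)"
 obtains f :: "'a \<times> 'b => real" where "f \<in> Bor (L \<Otimes>\<^sub>M borel)" "\<forall>p. 0 <= f p"
  "AE t in L. m t = density (M t) (%y. ennreal (f (t, y)))"
proof -
 interpret weighted_space L borel \<omega> by fact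
 note Dm = weighted_kernelD[OF m] and DM = weighted_kernelD[OF M]
 obtain m' where m': "finite_kernel L borel m'" "AE t in L. m' t = density (m t) (%y. ennreal (\<omega> y))"
  by (rule weighted_kernel_finite_version[OF m])
 obtain M' where M': "finite_kernel L borel M'" "AE t in L. M' t = density (M t) (%y. ennreal (\<omega> y))"
  by (rule weighted_kernel_finite_version[OF M])
 have "AE t in L. absolutely_continuous (M' t) (m' t)"
  using ac m'(2) M'(2) AE_space
  by eventually_elim (simp add: absolutely_continuous_weight[OF \<omega>_meas \<omega>_pos Dm(1) DM(1)]
   absolutely_continuous_weight[OF \<omega>_meas \<omega>_pos DM(1) Dm(1)])
 then obtain f where f[measurable]: "f \<in> Bor (L \<Otimes>\<^sub>M borel)"
  and fd: "AE t in L. m' t = density (M' t) (%y. f (t, y))"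
  using kernel_density[OF finL m'(1) M'(1)] by blast
 have "AE t in L. m t = density (M t) (%y. ennreal (enn2real (f (t, y))))"
  using fd m'(2) M'(2) Dm(3) AE_space
 proof eventually_elim
  case (elim t)
  have [measurable]: "\<omega> \<in> Bor (m t)" "\<omega> \<in> Bor (M t)"
   "(%y. f (t, y)) \<in> Bor (M t)"
   using Dm(1) DM(1) elim(5) by (simp_all cong: measurable_cong_sets)
  have e: "density (m t) (%y. ennreal (\<omega> y)) = density (density (M t) (%y. f (t, y))) (%y. ennreal (\<omega> y))"
   using elim by (simp add: density_density_eq mult.commute)
  then have "density (density (m t) (%y. ennreal (\<omega> y))) (%y. ennreal (1 / \<omega> y)) =
   density (density (density (M t) (%y. f (t, y))) (%y. ennreal (\<omega> y))) (%y. ennreal (1 / \<omega> y))"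
   by simp
  then have md: "m t = density (M t) (%y. f (t, y))"
   by (simp add: density_weight_cancel \<omega>_pos)
  have "(\<integral>\<^sup>+ y. ennreal (\<omega> y) \<partial>m t) = (\<integral>\<^sup>+ y. f (t, y) * ennreal (\<omega> y) \<partial>M t)"
   unfolding md by (simp add: nn_integral_density)
  with elim(4) have "AE y in M t. f (t, y) * ennreal (\<omega> y) ~= \<infinity>"
   by (intro nn_integral_PInf_AE) auto
  then have "AE y in M t. f (t, y) = ennreal (enn2real (f (t, y)))"
  proof eventually_elim
   case (elim y)
   have "ennreal (\<omega> y) ~= 0" using \<omega>_pos[of y] by simp
   with elim have "f (t, y) ~= top" by (auto simp: ennreal_top_mult)
   then show ?case by (simp add: less_top)
  qed
  then have "density (M t) (%y. f (t, y)) = density (M t) (%y. ennreal (enn2real (f (t, y))))"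
   by (intro density_cong) simp_all
  with md show ?case by simp
 qed
 moreover have "(%p. enn2real (f p)) \<in> Bor (L \<Otimes>\<^sub>M borel)" by simp
 ultimately show ?thesis using that[of "%p. enn2real (f p)"] by simp
qed

section \<open>Signed measures with a density\<close>

lemma sets_add_measure[simp, measurable_cong]: "sets (add_measure M N) = sets M"
 by (simp add: add_measure_def sets.sigma_sets_eq)

lemma space_add_measure[simp]: "space (add_measure M N) = space M"
 by (simp add: add_measure_def)

lemma emeasure_add_measure:
 assumes s: "sets N = sets M" and A: "A \<in> sets M"
 shows "em (add_measure M N) A = em M A + em N A"
proof (rule emeasure_measure_of[OF add_measure_def])
 show "sets M \<subseteq> Pow (space M)" by (rule sets.space_closed)
 show "countably_additive (sets (add_measure M N)) (%A. em M A + em N A)"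
 proof (rule countably_additiveI)
  fix F :: "nat => _" assume F: "range F \<subseteq> sets (add_measure M N)" "disjoint_family F"
  have "(\<Sum>i. em M (F i) + em N (F i)) = (\<Sum>i. em M (F i)) + (\<Sum>i. em N (F i))"
   by (rule suminf_add[symmetric]) auto
  with F s show "(\<Sum>i. em M (F i) + em N (F i)) =
   em M (\<Union>i. F i) + em N (\<Union>i. F i)"
   by (simp add: suminf_emeasure)
 qed
qed (use A in \<open>auto simp: positive_def\<close>)

lemma add_measure_density:
 assumes [measurable]: "f \<in> Bor M" "g \<in> Bor M"
 shows "add_measure (density M f) (density M g) = density M (%x. f x + g x)"
proof (rule measure_eqI)
 fix A assume "A \<in> sets (add_measure (density M f) (density M g))"
 then show "em (add_measure (density M f) (density M g)) A = em (density M (%x. f x + g x)) A"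
  by (simp add: emeasure_add_measure emeasure_density nn_integral_add distrib_right)
qed simp

lemma nn_integral_add_measure:
 assumes s: "sets N = sets M" and h: "h \<in> Bor M"
 shows "(\<integral>\<^sup>+ x. h x \<partial>add_measure M N) = (\<integral>\<^sup>+ x. h x \<partial>M) + (\<integral>\<^sup>+ x. h x \<partial>N)"
 using h
proof (induct rule: borel_measurable_induct)
 case (cong f g)
 have "(\<integral>\<^sup>+ x. f x \<partial>add_measure M N) = (\<integral>\<^sup>+ x. g x \<partial>add_measure M N)"
  "(\<integral>\<^sup>+ x. f x \<partial>M) = (\<integral>\<^sup>+ x. g x \<partial>M)" "(\<integral>\<^sup>+ x. f x \<partial>N) = (\<integral>\<^sup>+ x. g x \<partial>N)"
  using cong(3) sets_eq_imp_space_eq[OF s] by (auto intro!: nn_integral_cong)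
 with cong(4) show ?case by simp
next
 case (set A)
 with s show ?case by (simp add: emeasure_add_measure)
next
 case (mult u c)
 with s show ?case by (simp add: nn_integral_cmult distrib_left cong: measurable_cong_sets)
next
 case (add u v)
 with s show ?case by (simp add: nn_integral_add ac_simps cong: measurable_cong_sets)
next
 case (seq U)
 have mc: "(\<integral>\<^sup>+ x. (SUP i. U i) x \<partial>K) = (SUP i. \<integral>\<^sup>+ x. U i x \<partial>K)" if "sets K = sets M" for K
  using seq(1,4) that nn_integral_monotone_convergence_SUP[of U K]
  by (simp add: image_comp cong: measurable_cong_sets)
 have inc: "incseq (%i. \<integral>\<^sup>+ x. U i x \<partial>K)" for K
  using seq(4) by (auto simp: mono_def le_fun_def intro!: nn_integral_mono)
 have "(SUP i. (\<integral>\<^sup>+ x. U i x \<partial>M) + (\<integral>\<^sup>+ x. U i x \<partial>N)) =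
   (SUP i. \<integral>\<^sup>+ x. U i x \<partial>M) + (SUP i. \<integral>\<^sup>+ x. U i x \<partial>N)"
  by (rule ennreal_SUP_add[OF inc inc])
 then show ?case using mc[of "add_measure M N"] mc[of M] mc[OF s] seq(3) by simp
qed

lemma sigma_finite_add_measure:
 assumes s: "sets N = sets M" and M: "sigma_finite_measure M" and N: "sigma_finite_measure N"
 shows "sigma_finite_measure (add_measure M N)"
proof
 obtain A where A: "countable A" "A \<subseteq> sets M" "\<Union>A = space M" "\<forall>a\<in>A. em M a ~= \<infinity>"
  using sigma_finite_measure.sigma_finite_countable[OF M] by auto
 obtain B where B: "countable B" "B \<subseteq> sets N" "\<Union>B = space N" "\<forall>a\<in>B. em N a ~= \<infinity>"
  using sigma_finite_measure.sigma_finite_countable[OF N] by auto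
 have sp: "space N = space M" using s by (rule sets_eq_imp_space_eq)
 let ?C = "(%(a, b). a \<inter> b) ` (A \<times> B)"
 have "em (add_measure M N) (a \<inter> b) ~= \<infinity>" if "a \<in> A" "b \<in> B" for a b
 proof -
  have m: "a \<in> sets M" "b \<in> sets M" using A(2) B(2) s that by auto
  have "em M (a \<inter> b) <= em M a" "em N (a \<inter> b) <= em N b"
   using m s by (auto intro!: emeasure_mono)
  moreover have "em M a ~= \<infinity>" "em N b ~= \<infinity>" using A(4) B(4) that by auto
  ultimately show ?thesis using m s by (auto simp: emeasure_add_measure top_unique)
 qed
 moreover have "\<Union>?C = \<Union>A \<inter> \<Union>B" by blast
 then have "\<Union>?C = space M" using A(3) B(3) sp by simp
 moreover have "?C \<subseteq> sets M" using A(2) B(2) s by auto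
 moreover have "countable ?C" using A(1) B(1) by auto
 ultimately show "\<exists>A. countable A & A \<subseteq> sets (add_measure M N) & \<Union> A = space (add_measure M N) &
   (\<forall>a\<in>A. em (add_measure M N) a ~= \<infinity>)"
  by (intro exI[of _ ?C]) auto
qed

lemma absolutely_continuous_add_measure:
 assumes s: "sets N = sets M"
 shows "absolutely_continuous (add_measure M N) M" "absolutely_continuous (add_measure M N) N"
 using s by (auto simp: absolutely_continuous_def null_sets_def emeasure_add_measure)

lemma absolutely_continuous_trans:
 "absolutely_continuous A B ==> absolutely_continuous B C ==> absolutely_continuous A C"
 by (auto simp: absolutely_continuous_def)

lemma scale_measure_density:
 assumes [measurable]: "f \<in> Bor M"
 shows "scale_measure c (density M f) = density M (%x. c * f x)"
 by (rule measure_eqI) (simp_all add: emeasure_density nn_integral_cmult mult.assoc)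

text \<open>\<open>ennreal\<close> truncates at \<open>0\<close>, so the two densities are the positive and negative parts of \<open>f\<close>.\<close>

definition signed_density :: "'a measure => ('a => real) => 'a signed" where
 "signed_density Y f = (density Y (%x. ennreal (f x)), density Y (%x. ennreal (- f x)))"

lemma ennreal_real_parts_add: "ennreal x + ennreal (- x) = ennreal \<bar>x\<bar>"
 by (cases "0 <= x") (simp_all add: ennreal_neg)

lemma ennreal_real_parts_eq: "ennreal x = ennreal y ==> ennreal (- x) = ennreal (- y) ==> x = y"
 by (cases "0 <= x"; cases "0 <= y") (auto simp: ennreal_neg ennreal_eq_0_iff)

lemma signed_density_cong:
 assumes "f \<in> Bor Y" "g \<in> Bor Y" "AE x in Y. f x = g x"
 shows "signed_density Y f = signed_density Y g"
 unfolding signed_density_def using assms by (auto intro!: density_cong)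

lemma total_var_signed_density:
 assumes [measurable]: "f \<in> Bor Y"
 shows "total_var (signed_density Y f) = density Y (%x. ennreal \<bar>f x\<bar>)"
 by (simp add: total_var_def signed_density_def add_measure_density ennreal_real_parts_add)

lemma sigma_finite_density_real:
 assumes "sigma_finite_measure Y" and [measurable]: "f \<in> Bor Y"
 shows "sigma_finite_measure (density Y (%x. ennreal (f x)))"
 using sigma_finite_measure.sigma_finite_iff_density_finite[OF assms(1), of "%x. ennreal (f x)"] by simp

lemma signed_density_in_sigma_signed:
 assumes Y: "sigma_finite_measure Y" "sets Y = sets borel" and f: "f \<in> Bor borel"
 shows "signed_density Y f \<in> sigma_signed"
proof -
 have [measurable]: "f \<in> Bor Y" using f Y(2) by (simp cong: measurable_cong_sets)
 let ?A = "{x. f x <= 0}"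
 have A: "?A \<in> sets borel" using f by measurable
 have "em (density Y (%x. ennreal (f x))) ?A = (\<integral>\<^sup>+ x. ennreal (f x) * ind ?A x \<partial>Y)"
  using A Y(2) by (simp add: emeasure_density)
 also have "... = (\<integral>\<^sup>+ x. 0 \<partial>Y)"
  by (intro nn_integral_cong) (auto simp: indicator_def ennreal_neg)
 finally have 1: "em (density Y (%x. ennreal (f x))) ?A = 0" by simp
 have "em (density Y (%x. ennreal (- f x))) (- ?A) = (\<integral>\<^sup>+ x. ennreal (- f x) * ind (- ?A) x \<partial>Y)"
  using A Y(2) by (subst emeasure_density) auto
 also have "... = (\<integral>\<^sup>+ x. 0 \<partial>Y)"
  by (intro nn_integral_cong) (auto simp: indicator_def ennreal_neg)
 finally have 2: "em (density Y (%x. ennreal (- f x))) (- ?A) = 0" by simp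
 show ?thesis
  unfolding sigma_signed_def signed_density_def
  using 1 2 A Y sigma_finite_density_real[OF Y(1), of f] sigma_finite_density_real[OF Y(1), of "%x. - f x"]
  by auto
qed

lemma sigma_signedD:
 assumes "\<mu> \<in> sigma_signed"
 shows "sets (fst \<mu>) = sets borel" "sets (snd \<mu>) = sets borel" "sets (total_var \<mu>) = sets borel"
  "sigma_finite_measure (fst \<mu>)" "sigma_finite_measure (snd \<mu>)" "sigma_finite_measure (total_var \<mu>)"
proof -
 obtain P N where "\<mu> = (P, N)" by (cases \<mu>)
 with assms show "sets (fst \<mu>) = sets borel" "sets (snd \<mu>) = sets borel" "sets (total_var \<mu>) = sets borel"
  "sigma_finite_measure (fst \<mu>)" "sigma_finite_measure (snd \<mu>)" "sigma_finite_measure (total_var \<mu>)"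
  by (simp_all add: sigma_signed_def total_var_def sigma_finite_add_measure)
qed

lemma pos_deriv_density:
 assumes Y: "sigma_finite_measure Y" and M: "sigma_finite_measure M" "sets M = sets Y"
  "absolutely_continuous Y M"
 shows "density Y (%x. ennreal (pos_deriv Y M x)) = M"
proof -
 interpret sigma_finite_measure Y by fact
 have "AE x in Y. ennreal (pos_deriv Y M x) = RN_deriv Y M x"
  using RN_deriv_finite[OF M(1,3,2)] by eventually_elim (simp add: pos_deriv_def ennreal_enn2real_if)
 then have "density Y (%x. ennreal (pos_deriv Y M x)) = density Y (RN_deriv Y M)"
  by (intro density_cong) (auto simp: pos_deriv_def)
 also have "... = M" using M by (intro density_RN_deriv)
 finally show ?thesis .
qed

lemma pos_deriv_measurable[measurable]: "pos_deriv Y M \<in> Bor Y"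
 unfolding pos_deriv_def[abs_def] by measurable

lemma pos_deriv_nonneg[simp]: "0 <= pos_deriv Y M x"
 by (simp add: pos_deriv_def)

lemma pos_deriv_of_density:
 assumes Y: "sigma_finite_measure Y" and [measurable]: "f \<in> Bor Y" and "!!x. 0 <= f x"
 shows "AE x in Y. pos_deriv Y (density Y (%x. ennreal (f x))) x = f x"
proof -
 interpret sigma_finite_measure Y by fact
 have "AE x in Y. ennreal (f x) = RN_deriv Y (density Y (%x. ennreal (f x))) x"
  by (rule RN_deriv_unique) simp_all
 then show ?thesis
 proof eventually_elim
  case (elim x)
  then show ?case unfolding pos_deriv_def elim[symmetric] using assms(3) by simp
 qed
qed

lemma signed_deriv_measurable[measurable]: "signed_deriv Y \<mu> \<in> Bor Y"
 unfolding signed_deriv_def[abs_def] by measurable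

text \<open>Mutual singularity makes one of the two derivatives vanish at a.e. point. Hence their
  difference determines both parts of the signed measure.\<close>

lemma signed_density_signed_deriv:
 assumes Y: "sigma_finite_measure Y" "sets Y = sets borel" and \<mu>: "\<mu> \<in> sigma_signed"
  and ac: "absolutely_continuous Y (total_var \<mu>)"
 shows "\<mu> = signed_density Y (signed_deriv Y \<mu>)"
proof -
 obtain P N where PN: "\<mu> = (P, N)" by (cases \<mu>)
 note D = sigma_signedD[OF \<mu>, unfolded PN total_var_def, simplified]
 have acP: "absolutely_continuous Y P" and acN: "absolutely_continuous Y N"
  using ac D absolutely_continuous_add_measure[of N P] absolutely_continuous_trans
  unfolding PN total_var_def by auto
 let ?p = "pos_deriv Y P" and ?n = "pos_deriv Y N"
 have P: "density Y (%x. ennreal (?p x)) = P" using D Y acP by (intro pos_deriv_density) auto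
 have N: "density Y (%x. ennreal (?n x)) = N" using D Y acN by (intro pos_deriv_density) auto
 obtain A where A: "A \<in> sets borel" "em P A = 0" "em N (- A) = 0"
  using \<mu> unfolding PN sigma_signed_def by auto
 have A': "A \<in> sets Y" "- A \<in> sets Y" using A(1) Y(2) by auto
 have "em (density Y (%x. ennreal (?p x))) A = 0" unfolding P by (rule A)
 then have 1: "AE x in Y. x \<in> A --> ?p x <= 0"
  using A' by (simp add: emeasure_density nn_integral_0_iff_AE)
   (auto elim!: eventually_mono simp: ennreal_eq_0_iff indicator_def split: if_splits)
 have "em (density Y (%x. ennreal (?n x))) (- A) = 0" unfolding N by (rule A)
 then have 2: "AE x in Y. x \<in> - A --> ?n x <= 0"
  using A' by (simp add: emeasure_density nn_integral_0_iff_AE)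
   (auto elim!: eventually_mono simp: ennreal_eq_0_iff indicator_def split: if_splits)
 have ae: "AE x in Y. ?p x = 0 \<or> ?n x = 0"
  using 1 2 by eventually_elim (auto intro: antisym)
 have "P = density Y (%x. ennreal (signed_deriv Y \<mu> x))"
  by (subst P[symmetric], rule density_cong)
   (use ae in \<open>auto elim!: eventually_mono simp: signed_deriv_def PN ennreal_neg\<close>)
 moreover have "N = density Y (%x. ennreal (- signed_deriv Y \<mu> x))"
  by (subst N[symmetric], rule density_cong)
   (use ae in \<open>auto elim!: eventually_mono simp: signed_deriv_def PN ennreal_neg\<close>)
 ultimately show ?thesis unfolding signed_density_def PN by simp
qed

lemma signed_density_unique:
 assumes Y: "sigma_finite_measure Y" and [measurable]: "f \<in> Bor Y" "g \<in> Bor Y"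
  and eq: "signed_density Y f = signed_density Y g"
 shows "AE x in Y. f x = g x"
proof -
 interpret sigma_finite_measure Y by fact
 have "AE x in Y. ennreal (f x) = ennreal (g x)" "AE x in Y. ennreal (- f x) = ennreal (- g x)"
  using eq by (auto simp: signed_density_def density_unique_iff)
 then show ?thesis by eventually_elim (rule ennreal_real_parts_eq)
qed

lemma signed_deriv_signed_density:
 assumes Y: "sigma_finite_measure Y" "sets Y = sets borel" and f: "f \<in> Bor borel"
 shows "AE x in Y. signed_deriv Y (signed_density Y f) x = f x"
proof -
 have [measurable]: "f \<in> Bor Y" using f Y(2) by (simp cong: measurable_cong_sets)
 have "absolutely_continuous Y (total_var (signed_density Y f))"
  by (simp add: total_var_signed_density absolutely_continuousI_density)
 from signed_density_signed_deriv[OF Y signed_density_in_sigma_signed[OF Y f] this]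
 show ?thesis
  by (intro signed_density_unique[OF Y(1)]) simp_all
qed

text \<open>\<open>signed_add\<close> is a definite description, and this is its uniqueness half.
  The defining identity speaks only of sets on which all measures involved are finite, so the
  measures are first given densities with respect to one sigma-finite measure, and the identity is
  exploited on sets where these densities are bounded.\<close>

lemma signed_sum_unique:
 fixes \<sigma> \<sigma>' \<mu> \<nu> :: "'a::topological_space signed"
 defines "Q \<equiv> %\<sigma>. \<forall>B\<in>sets borel.
    (\<forall>M\<in>{fst \<sigma>, snd \<sigma>, fst \<mu>, snd \<mu>, fst \<nu>, snd \<nu>}. em M B < \<infinity>) -->
    measure (fst \<sigma>) B - measure (snd \<sigma>) B =
     measure (fst \<mu>) B - measure (snd \<mu>) B + measure (fst \<nu>) B - measure (snd \<nu>) B"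
 assumes in4: "\<sigma> \<in> sigma_signed" "\<sigma>' \<in> sigma_signed" "\<mu> \<in> sigma_signed" "\<nu> \<in> sigma_signed"
  and Q: "Q \<sigma>" "Q \<sigma>'"
 shows "\<sigma> = \<sigma>'"
proof -
 let ?g1 = "add_measure (total_var \<sigma>) (total_var \<sigma>')" and ?g2 = "add_measure (total_var \<mu>) (total_var \<nu>)"
 define Y where "Y = add_measure ?g1 ?g2"
 note D = sigma_signedD[OF in4(1)] sigma_signedD[OF in4(2)] sigma_signedD[OF in4(3)] sigma_signedD[OF in4(4)]
 have sb: "sets Y = sets borel" using D by (simp add: Y_def)
 have sf: "sigma_finite_measure Y"
  unfolding Y_def using D by (intro sigma_finite_add_measure) simp_all
 interpret sigma_finite_measure Y by (rule sf)
 have ac: "absolutely_continuous Y (total_var \<sigma>)" "absolutely_continuous Y (total_var \<sigma>')"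
  "absolutely_continuous Y (total_var \<mu>)" "absolutely_continuous Y (total_var \<nu>)"
  unfolding Y_def
  using D absolutely_continuous_add_measure[of "total_var \<sigma>'" "total_var \<sigma>"]
   absolutely_continuous_add_measure[of "total_var \<nu>" "total_var \<mu>"]
   absolutely_continuous_add_measure[of ?g2 ?g1] absolutely_continuous_trans
  by auto
 obtain s s' m n where smn[measurable]: "s \<in> Bor Y" "s' \<in> Bor Y"
  "m \<in> Bor Y" "n \<in> Bor Y"
  and rep: "\<sigma> = signed_density Y s" "\<sigma>' = signed_density Y s'" "\<mu> = signed_density Y m" "\<nu> = signed_density Y n"
  using signed_density_signed_deriv[OF sf sb in4(1) ac(1)] signed_density_signed_deriv[OF sf sb in4(2) ac(2)]
   signed_density_signed_deriv[OF sf sb in4(3) ac(3)] signed_density_signed_deriv[OF sf sb in4(4) ac(4)]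
   signed_deriv_measurable by metis
 obtain E where E: "range E \<subseteq> sets Y" "(\<Union>i. E i) = space Y" "!!i::nat. em Y (E i) ~= \<infinity>"
  using sigma_finite by auto
 have Em[measurable]: "E i \<in> sets Y" for i using E(1) by auto
 \<comment> \<open>On subsets of these sets all densities are bounded and the dominating measure is
   finite, so the defining identity applies. They exhaust the space.\<close>
 define C where "C i k = {x\<in>E i. \<bar>s x\<bar> <= real k & \<bar>s' x\<bar> <= real k & \<bar>m x\<bar> <= real k & \<bar>n x\<bar> <= real k}" for i k
 have C[measurable]: "C i k \<in> sets Y" for i k
 proof -
  have "C i k = {x\<in>space Y. x \<in> E i & \<bar>s x\<bar> <= real k & \<bar>s' x\<bar> <= real k & \<bar>m x\<bar> <= real k & \<bar>n x\<bar> <= real k}"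
   unfolding C_def using sets.sets_into_space[OF Em] by auto
  then show ?thesis by simp
 qed
 have fin: "em (density Y (%x. ennreal (f x))) B < \<infinity>"
  if [measurable]: "f \<in> Bor Y" "B \<in> sets Y" and "B \<subseteq> C i k" "!!x. x \<in> C i k ==> f x <= real k"
  for f B i k
 proof -
  have "em (density Y (%x. ennreal (f x))) B = (\<integral>\<^sup>+ x. ennreal (f x) * ind B x \<partial>Y)"
   by (simp add: emeasure_density)
  also have "... <= (\<integral>\<^sup>+ x. ennreal (real k) * ind (E i) x \<partial>Y)"
   using that by (intro nn_integral_mono) (auto simp: indicator_def C_def intro!: ennreal_leI)
  also have "... = ennreal (real k) * em Y (E i)" by (simp add: nn_integral_cmult_indicator)
  also have "... < \<infinity>" using E(3)[of i] by (auto simp: ennreal_mult_less_top top.not_eq_extremum)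
  finally show ?thesis .
 qed
 have ae: "AE x in Y. x \<in> C i k --> s x = s' x" for i k
 proof -
  let ?u = "%x. (ennreal (s x) + ennreal (- s' x)) * ind (C i k) x"
  let ?v = "%x. (ennreal (- s x) + ennreal (s' x)) * ind (C i k) x"
  have "density Y ?u = density Y ?v"
  proof (rule measure_eqI)
   fix A assume "A \<in> sets (density Y ?u)"
   then have [measurable]: "A \<in> sets Y" by simp
   define B where "B = A \<inter> C i k"
   have B[measurable]: "B \<in> sets Y" and BC: "B \<subseteq> C i k" by (auto simp: B_def)
   have fin': "em M B < \<infinity>"
    if "M \<in> {fst \<sigma>, snd \<sigma>, fst \<sigma>', snd \<sigma>', fst \<mu>, snd \<mu>, fst \<nu>, snd \<nu>}" for M
   proof -
    from that obtain f where f: "M = density Y (%x. ennreal (f x))"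
     "f \<in> {s, %x. - s x, s', %x. - s' x, m, %x. - m x, n, %x. - n x}"
     unfolding rep signed_density_def by auto
    show ?thesis unfolding f(1)
    proof (rule fin[OF _ B BC])
     show "f \<in> Bor Y" using f(2) by auto
     show "f x <= real k" if "x \<in> C i k" for x using f(2) that unfolding C_def by auto
    qed
   qed
   have "measure (fst \<sigma>) B - measure (snd \<sigma>) B = measure (fst \<sigma>') B - measure (snd \<sigma>') B"
    using Q fin' B sb unfolding Q_def by auto
   \<comment> \<open>Written without subtraction, so that it transfers to
     \<open>ennreal\<close>.\<close>
   then have e: "measure (fst \<sigma>) B + measure (snd \<sigma>') B = measure (snd \<sigma>) B + measure (fst \<sigma>') B"
    by simp
   have mm: "ennreal (measure M B) = em M B" if "em M B < \<infinity>" for M :: "'a measure"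
    using that by (simp add: measure_def)
   have "em (fst \<sigma>) B + em (snd \<sigma>') B = em (snd \<sigma>) B + em (fst \<sigma>') B"
    using arg_cong[OF e, of ennreal] fin' by (simp add: mm)
   then show "em (density Y ?u) A = em (density Y ?v) A"
    unfolding rep signed_density_def
    by (simp add: emeasure_density B_def indicator_inter_arith distrib_left distrib_right
     nn_integral_add ac_simps)
  qed simp
  then have "AE x in Y. ?u x = ?v x" by (simp add: density_unique_iff)
  then show ?thesis
  proof eventually_elim
   case (elim x)
   show ?case
   proof
    assume "x \<in> C i k"
    with elim have "ennreal (s x) + ennreal (- s' x) = ennreal (- s x) + ennreal (s' x)" by simp
    then show "s x = s' x"
     by (cases "0 <= s x"; cases "0 <= s' x")
      (auto simp: ennreal_neg ennreal_eq_0_iff simp flip: ennreal_plus)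
   qed
  qed
 qed
 have "AE x in Y. \<forall>i k. x \<in> C i k --> s x = s' x"
  using ae unfolding AE_all_countable by blast
 with AE_space have "AE x in Y. s x = s' x"
 proof eventually_elim
  case (elim x)
  from elim(1) have "x \<in> (\<Union>i. E i)" by (simp only: E(2))
  then obtain i where i: "x \<in> E i" by blast
  obtain k where "max (max \<bar>s x\<bar> \<bar>s' x\<bar>) (max \<bar>m x\<bar> \<bar>n x\<bar>) <= real k"
   using real_arch_simple by blast
  then have "x \<in> C i k" using i by (auto simp: C_def)
  with elim show ?case by auto
 qed
 then show ?thesis unfolding rep by (intro signed_density_cong) simp_all
qed

lemma signed_add_signed_density:
 assumes Y: "sigma_finite_measure Y" "sets Y = sets borel"
  and f: "f \<in> Bor borel" and g: "g \<in> Bor borel"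
 shows "signed_add (signed_density Y f) (signed_density Y g) = signed_density Y (%x. f x + g x)"
proof -
 have [measurable]: "f \<in> Bor Y" "g \<in> Bor Y"
  using f g Y(2) by (simp_all cong: measurable_cong_sets)
 let ?\<sigma> = "signed_density Y (%x. f x + g x)" and ?\<mu> = "signed_density Y f" and ?\<nu> = "signed_density Y g"
 have in3: "?\<sigma> \<in> sigma_signed" "?\<mu> \<in> sigma_signed" "?\<nu> \<in> sigma_signed"
  using f g by (auto intro!: signed_density_in_sigma_signed[OF Y])
 have Q: "measure (fst ?\<sigma>) B - measure (snd ?\<sigma>) B =
     measure (fst ?\<mu>) B - measure (snd ?\<mu>) B + measure (fst ?\<nu>) B - measure (snd ?\<nu>) B"
  if "B \<in> sets borel" and fin: "\<forall>M\<in>{fst ?\<sigma>, snd ?\<sigma>, fst ?\<mu>, snd ?\<mu>, fst ?\<nu>, snd ?\<nu>}. em M B < \<infinity>" for B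
 proof -
  have [measurable]: "B \<in> sets Y" using that Y(2) by simp
  have mm: "ennreal (measure M B) = em M B" if "em M B < \<infinity>" for M :: "'a measure"
   using that by (simp add: measure_def)
  \<comment> \<open>The decomposition of \<open>a + b\<close> into positive and negative parts,
    rearranged so that no subtraction of possibly infinite values occurs.\<close>
  have pt: "ennreal (a + b) + ennreal (- a) + ennreal (- b) = ennreal (- a - b) + ennreal a + ennreal b"
   for a b :: real
   by (cases "0 <= a"; cases "0 <= b"; cases "0 <= a + b")
    (auto simp: ennreal_neg simp flip: ennreal_plus)
  have "em (fst ?\<sigma>) B + em (snd ?\<mu>) B + em (snd ?\<nu>) B =
   (\<integral>\<^sup>+ x. (ennreal (f x + g x) + ennreal (- f x) + ennreal (- g x)) * ind B x \<partial>Y)"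
   by (simp add: signed_density_def emeasure_density distrib_right nn_integral_add)
  also have "... = em (snd ?\<sigma>) B + em (fst ?\<mu>) B + em (fst ?\<nu>) B"
   unfolding pt
   by (simp add: signed_density_def emeasure_density distrib_right nn_integral_add)
  finally have "ennreal (measure (fst ?\<sigma>) B + measure (snd ?\<mu>) B + measure (snd ?\<nu>) B) =
   ennreal (measure (snd ?\<sigma>) B + measure (fst ?\<mu>) B + measure (fst ?\<nu>) B)"
   using fin by (simp add: mm)
  then have "measure (fst ?\<sigma>) B + measure (snd ?\<mu>) B + measure (snd ?\<nu>) B =
   measure (snd ?\<sigma>) B + measure (fst ?\<mu>) B + measure (fst ?\<nu>) B"
   by (subst (asm) ennreal_inj) auto
  then show ?thesis by simp
 qed
 show ?thesis
  unfolding signed_add_def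
 proof (rule the_equality)
  show "?\<sigma> \<in> sigma_signed & (\<forall>B\<in>sets borel.
    (\<forall>M\<in>{fst ?\<sigma>, snd ?\<sigma>, fst ?\<mu>, snd ?\<mu>, fst ?\<nu>, snd ?\<nu>}. em M B < \<infinity>) -->
    measure (fst ?\<sigma>) B - measure (snd ?\<sigma>) B =
     measure (fst ?\<mu>) B - measure (snd ?\<mu>) B + measure (fst ?\<nu>) B - measure (snd ?\<nu>) B)"
   using in3(1) Q by blast
 next
  fix \<sigma> assume "\<sigma> \<in> sigma_signed & (\<forall>B\<in>sets borel.
    (\<forall>M\<in>{fst \<sigma>, snd \<sigma>, fst ?\<mu>, snd ?\<mu>, fst ?\<nu>, snd ?\<nu>}. em M B < \<infinity>) -->
    measure (fst \<sigma>) B - measure (snd \<sigma>) B =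
     measure (fst ?\<mu>) B - measure (snd ?\<mu>) B + measure (fst ?\<nu>) B - measure (snd ?\<nu>) B)"
  then show "\<sigma> = ?\<sigma>"
   using in3 Q by (intro signed_sum_unique[of \<sigma> ?\<sigma> ?\<mu> ?\<nu>]) blast+
 qed
qed

lemma signed_scale_signed_density:
 assumes [measurable]: "f \<in> Bor Y" and c: "0 <= c"
 shows "signed_scale c (signed_density Y f) = signed_density Y (%x. c * f x)"
proof -
 have "ennreal c * ennreal (f x) = ennreal (c * f x)" "ennreal c * ennreal (- f x) = ennreal (- (c * f x))" for x
  using c ennreal_mult'[of c "f x"] ennreal_mult'[of c "- f x"] by simp_all
 then show ?thesis
  using c by (simp add: signed_scale_def signed_density_def scale_measure_density)
qed

lemma mix_signed_signed_density:
 assumes Y: "sigma_finite_measure Y" "sets Y = sets borel"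
  and f: "f \<in> Bor borel" and g: "g \<in> Bor borel" and "0 <= \<theta>" "\<theta> <= 1"
 shows "mix_signed \<theta> (signed_density Y f) (signed_density Y g) =
  signed_density Y (%x. (1 - \<theta>) * f x + \<theta> * g x)"
proof -
 have [measurable]: "f \<in> Bor Y" "g \<in> Bor Y"
  using f g Y(2) by (simp_all cong: measurable_cong_sets)
 have "signed_scale (1 - \<theta>) (signed_density Y f) = signed_density Y (%x. (1 - \<theta>) * f x)"
  "signed_scale \<theta> (signed_density Y g) = signed_density Y (%x. \<theta> * g x)"
  using assms(5,6) by (intro signed_scale_signed_density; simp)+
 then show ?thesis
  unfolding mix_signed_def using f g by (simp add: signed_add_signed_density[OF Y])
qed

lemma mix_measure_density:
 assumes [measurable]: "f \<in> Bor Y" "g \<in> Bor Y"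
  and nn: "!!x. 0 <= f x" "!!x. 0 <= g x" and "0 <= \<theta>" "\<theta> <= 1"
 shows "mix_measure \<theta> (density Y (%x. ennreal (f x))) (density Y (%x. ennreal (g x))) =
  density Y (%x. ennreal ((1 - \<theta>) * f x + \<theta> * g x))"
 using assms by (simp add: mix_measure_def scale_measure_density add_measure_density ennreal_mult)

lemma integrable_total_var_signed_density:
 fixes h :: "'a => real"
 assumes [measurable]: "f \<in> Bor Y" "h \<in> Bor Y"
 shows "integrable (total_var (signed_density Y f)) h \<longleftrightarrow> integrable Y (%x. f x * h x)"
proof -
 have "integrable (total_var (signed_density Y f)) h \<longleftrightarrow> integrable Y (%x. \<bar>f x\<bar> * h x)"
  by (simp add: total_var_signed_density integrable_real_density)
 also have "... \<longleftrightarrow> integrable Y (%x. f x * h x)"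
  by (subst (1 2) integrable_iff_bounded) (simp add: abs_mult)
 finally show ?thesis .
qed

lemma signed_integral_signed_density:
 assumes [measurable]: "f \<in> Bor Y" "h \<in> Bor Y" "S \<in> sets Y"
  and int: "integrable Y (%x. f x * (ind S x * h x))"
 shows "signed_integral (signed_density Y f) S h = (\<integral>x. f x * (ind S x * h x) \<partial>Y)"
proof -
 \<comment> \<open>The formula for Bochner integrals against a density wants a nonnegative real
   density, so the truncation hidden in \<open>ennreal\<close> is made explicit.\<close>
 have part: "density Y (%x. ennreal (g x)) = density Y (%x. ennreal (max 0 (g x)))" for g :: "'a => real"
 proof -
  have "ennreal (g x) = ennreal (max 0 (g x))" for x by (cases "0 <= g x") (simp_all add: ennreal_neg max_def)
  then show ?thesis by simp
 qed
 have i1: "integrable Y (%x. max 0 (f x) * (ind S x * h x))"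
  by (rule Bochner_Integration.integrable_bound[OF int]) (auto simp: abs_mult max_def mult_right_mono)
 have i2: "integrable Y (%x. max 0 (- f x) * (ind S x * h x))"
  by (rule Bochner_Integration.integrable_bound[OF int]) (auto simp: abs_mult max_def mult_right_mono)
 have "signed_integral (signed_density Y f) S h =
   (\<integral>x. max 0 (f x) * (ind S x * h x) \<partial>Y) - (\<integral>x. max 0 (- f x) * (ind S x * h x) \<partial>Y)"
  unfolding signed_integral_def signed_density_def fst_conv snd_conv set_lebesgue_integral_def
  by (subst (1 2) part) (simp add: integral_real_density)
 also have "... = (\<integral>x. max 0 (f x) * (ind S x * h x) - max 0 (- f x) * (ind S x * h x) \<partial>Y)"
  using i1 i2 by simp
 also have "... = (\<integral>x. f x * (ind S x * h x) \<partial>Y)"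
  by (intro Bochner_Integration.integral_cong) (auto simp: max_def)
 finally show ?thesis .
qed

section \<open>The edge measure\<close>

text \<open>The value on the diagonal is irrelevant for diagonal-free measures and makes the weight
  strictly positive everywhere.\<close>

definition jump_weight :: "'v::metric_space \<times> 'v => real" where
 "jump_weight p = (if fst p = snd p then 1 else min 1 ((dist (fst p) (snd p))\<^sup>2))"

lemma closed_diag: "closed {p :: 'v::metric_space \<times> 'v. fst p = snd p}"
 by (intro closed_Collect_eq continuous_intros)

lemma diag_borel[measurable]: "{p :: 'v::metric_space \<times> 'v. fst p = snd p} \<in> sets borel"
 using closed_diag by (rule borel_closed)

lemma offdiag_borel[measurable]: "(offdiag :: ('v::metric_space \<times> 'v) set) \<in> sets borel"
proof -
 have "offdiag = - {p :: 'v \<times> 'v. fst p = snd p}" by auto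
 then show ?thesis using diag_borel by simp
qed

lemma jump_weight_measurable[measurable]:
 "(jump_weight :: 'v::metric_space \<times> 'v => real) \<in> Bor borel"
proof -
 have "(%p :: 'v \<times> 'v. min 1 ((dist (fst p) (snd p))\<^sup>2)) \<in> Bor borel"
  by (intro borel_measurable_continuous_onI continuous_intros)
 then have "(%p :: 'v \<times> 'v. if p \<in> {p. fst p = snd p} then 1 else min 1 ((dist (fst p) (snd p))\<^sup>2))
   \<in> Bor borel"
  by (intro measurable_If_set) auto
 then show ?thesis unfolding jump_weight_def[abs_def] by simp
qed

lemma jump_weight_pos: "0 < jump_weight p"
 by (auto simp: jump_weight_def)

lemma borel_measurable_fst_snd[measurable]:
 "fst \<in> Bor (borel :: ('a::topological_space \<times> 'b::topological_space) measure)"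
 "snd \<in> Bor (borel :: ('a::topological_space \<times> 'b::topological_space) measure)"
 by (auto intro!: borel_measurable_continuous_onI continuous_intros)

text \<open>The weighted measure is finite, and undoing the weight is passing to a real density,
  which preserves sigma-finiteness.\<close>

lemma sigma_finite_of_weight:
 fixes \<omega> :: "'a => real"
 assumes [measurable]: "\<omega> \<in> Bor M" and pos: "!!x. 0 < \<omega> x"
  and fin: "(\<integral>\<^sup>+ x. ennreal (\<omega> x) \<partial>M) < \<infinity>"
 shows "sigma_finite_measure M"
proof -
 have "finite_measure (density M (%x. ennreal (\<omega> x)))"
  using fin nn_integral_density[of "%x. ennreal (\<omega> x)" M "%_. 1"] by (intro finite_measureI) simp
 then have "sigma_finite_measure (density M (%x. ennreal (\<omega> x)))"
  by (rule finite_measure.axioms)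
 then have "sigma_finite_measure (density (density M (%x. ennreal (\<omega> x))) (%x. ennreal (1 / \<omega> x)))"
  by (rule sigma_finite_density_real) simp
 then show ?thesis by (simp add: density_weight_cancel pos)
qed

locale jump_space =
 fixes \<pi> :: "'v::{metric_space, second_countable_topology} measure" and \<kappa> :: "'v => 'v measure"
 assumes pi: "\<pi> \<in> finite_borel_measures" and ker: "jump_kernel \<kappa>" and db: "detailed_balance \<pi> \<kappa>"
begin

abbreviation "\<theta> \<equiv> edge_measure \<pi> \<kappa>"

lemma sets_pi[measurable_cong, simp]: "sets \<pi> = sets borel" and fin_pi: "finite_measure \<pi>"
 using pi by (auto simp: finite_borel_measures_def)

lemma space_pi[simp]: "space \<pi> = UNIV"
 using sets_eq_imp_space_eq[OF sets_pi] by simp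

sublocale pi: finite_measure \<pi> by (rule fin_pi)

lemma kappa: "sets (\<kappa> x) = sets borel" "sigma_finite_measure (\<kappa> x)" "em (\<kappa> x) {x} = 0"
 using ker by (auto simp: jump_kernel_def)

lemma kappa_bound:
 obtains K where "K < \<infinity>" "!!x. (\<integral>\<^sup>+ y. ennreal (min 1 ((dist x y)\<^sup>2)) \<partial>\<kappa> x) <= K"
proof (rule that)
 show "(SUP x. \<integral>\<^sup>+ y. ennreal (min 1 ((dist x y)\<^sup>2)) \<partial>\<kappa> x) < \<infinity>"
  using ker by (simp add: jump_kernel_def)
qed (rule SUP_upper, simp)

lemma min_dist_measurable[measurable]:
 "(%p :: 'v \<times> 'v. min 1 ((dist (fst p) (snd p))\<^sup>2)) \<in> Bor borel"
 by (intro borel_measurable_continuous_onI continuous_intros)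

lemma min_dist_measurable1[measurable]:
 "(%y :: 'v. min 1 ((dist x y)\<^sup>2)) \<in> Bor borel"
 by (intro borel_measurable_continuous_onI continuous_intros)

text \<open>The hypothesis on \<kappa> gives measurability only of integrals against 1 \<and> d^2.
  The kernel weighted in this way is finite and measurable, and the reciprocal weight recovers
  \<kappa>: the weight of \<open>y\<close> vanishes only at \<open>y = x\<close>, a point that
  \<open>\<kappa> x\<close> does not charge.\<close>

lemma sections_measurable:
 assumes Q: "Q \<in> sets (\<pi> \<Otimes>\<^sub>M borel)"
 shows "(%x. em (\<kappa> x) (Pair x -` Q)) \<in> Bor \<pi>"
proof -
 obtain K where K: "K < \<infinity>" "!!x. (\<integral>\<^sup>+ y. ennreal (min 1 ((dist x y)\<^sup>2)) \<partial>\<kappa> x) <= K"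
  by (rule kappa_bound) blast
 note [simp] = kappa(1) and [measurable_cong] = kappa(1)
 define k' where "k' x = density (\<kappa> x) (%y. ennreal (min 1 ((dist x y)\<^sup>2)))" for x
 have fk: "finite_kernel \<pi> borel k'"
  unfolding finite_kernel_def
 proof (intro conjI ballI)
  fix x
  show "sets (k' x) = sets borel" by (simp add: k'_def)
  have "em (k' x) (space (k' x)) = (\<integral>\<^sup>+ y. ennreal (min 1 ((dist x y)\<^sup>2)) \<partial>\<kappa> x)"
   using nn_integral_density[of "%y. ennreal (min 1 ((dist x y)\<^sup>2))" "\<kappa> x" "%_. 1"]
   unfolding k'_def by simp
  then show "finite_measure (k' x)"
   using K(2)[of x] K(1) by (intro finite_measureI) (auto simp: top_unique)
 next
  fix B :: "'v set" assume B[measurable]: "B \<in> sets borel"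
  have em: "em (k' x) B = ennreal (LINT y|\<kappa> x. ind B y * min 1 ((dist x y)\<^sup>2))" for x
  proof -
   have "em (k' x) B = (\<integral>\<^sup>+ y. ennreal (min 1 ((dist x y)\<^sup>2)) * ind B y \<partial>\<kappa> x)"
    unfolding k'_def by (simp add: emeasure_density)
   also have "... = (\<integral>\<^sup>+ y. ennreal (ind B y * min 1 ((dist x y)\<^sup>2)) \<partial>\<kappa> x)"
    by (intro nn_integral_cong) (auto simp: indicator_def)
   also have "... = ennreal (LINT y|\<kappa> x. ind B y * min 1 ((dist x y)\<^sup>2))"
   proof (rule nn_integral_eq_integral)
    have "(\<integral>\<^sup>+ y. ennreal (norm (ind B y * min 1 ((dist x y)\<^sup>2))) \<partial>\<kappa> x)
      <= (\<integral>\<^sup>+ y. ennreal (min 1 ((dist x y)\<^sup>2)) \<partial>\<kappa> x)"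
     by (intro nn_integral_mono) (auto simp: indicator_def)
    also have "... < \<infinity>" using K(2)[of x] K(1) by (rule le_less_trans)
    finally show "integrable (\<kappa> x) (%y. ind B y * min 1 ((dist x y)\<^sup>2))"
     by (subst integrable_iff_bounded) auto
   qed auto
   finally show ?thesis .
  qed
  have "(%x. LINT y|\<kappa> x. ind B y * min 1 ((dist x y)\<^sup>2)) \<in> Bor borel"
  proof -
   have "\<forall>f::'v => real. f \<in> Bor borel & bounded (range f) -->
     (%x. LINT y|\<kappa> x. f y * min 1 ((dist x y)\<^sup>2)) \<in> Bor borel"
    using ker unfolding jump_kernel_def by blast
   moreover have "bounded (range (ind B :: 'v => real))"
    by (auto simp: bounded_iff indicator_def intro!: exI[of _ 1])
   ultimately show ?thesis by simp
  qed
  then show "(%x. em (k' x) B) \<in> Bor \<pi>"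
   unfolding em by (simp cong: measurable_cong_sets)
 qed
 let ?h = "%p. ind Q p * ennreal (1 / min 1 ((dist (fst p) (snd p))\<^sup>2))"
 have bp: "sets (\<pi> \<Otimes>\<^sub>M borel) = sets (borel :: ('v \<times> 'v) measure)"
  unfolding borel_prod[symmetric] by (intro sets_pair_measure_cong) simp_all
 have Qb[measurable]: "Q \<in> sets borel" using Q bp by simp
 have "?h \<in> Bor (\<pi> \<Otimes>\<^sub>M borel)"
  unfolding measurable_cong_sets[OF bp refl] by measurable
 from finite_kernel_nn_integral_measurable[OF fk this]
 have "(%x. \<integral>\<^sup>+ y. ?h (x, y) \<partial>k' x) \<in> Bor \<pi>" .
 moreover have "(\<integral>\<^sup>+ y. ?h (x, y) \<partial>k' x) = em (\<kappa> x) (Pair x -` Q)" for x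
 proof -
  have Qx[measurable]: "Pair x -` Q \<in> sets borel" using sets_Pair1[OF Q, of x] by simp
  have "(%y. ?h (x, y)) = (%y. ind (Pair x -` Q) y * ennreal (1 / min 1 ((dist x y)\<^sup>2)))"
   by (auto simp: indicator_def)
  then have "(\<integral>\<^sup>+ y. ?h (x, y) \<partial>k' x) =
    (\<integral>\<^sup>+ y. ennreal (min 1 ((dist x y)\<^sup>2)) * (ind (Pair x -` Q) y * ennreal (1 / min 1 ((dist x y)\<^sup>2))) \<partial>\<kappa> x)"
   unfolding k'_def by (subst nn_integral_density[symmetric]) simp_all
  also have "... = (\<integral>\<^sup>+ y. ind (Pair x -` Q) y \<partial>\<kappa> x)"
  proof (rule nn_integral_cong_AE)
   have "AE y in \<kappa> x. y \<notin> {x}"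
    using kappa(3)[of x] by (intro AE_not_in) (auto simp: null_sets_def)
   then show "AE y in \<kappa> x. ennreal (min 1 ((dist x y)\<^sup>2)) *
     (ind (Pair x -` Q) y * ennreal (1 / min 1 ((dist x y)\<^sup>2))) = ind (Pair x -` Q) y"
   proof eventually_elim
    case (elim y)
    then have "0 < min 1 ((dist x y)\<^sup>2)" by auto
    then have "ennreal (min 1 ((dist x y)\<^sup>2)) * ennreal (1 / min 1 ((dist x y)\<^sup>2)) = 1"
     by (subst ennreal_mult[symmetric]) (simp_all del: min_less_iff_conj)
    then show ?case by (simp add: indicator_def)
   qed
  qed
  also have "... = em (\<kappa> x) (Pair x -` Q)" by simp
  finally show ?thesis .
 qed
 ultimately show ?thesis by simp
qed

lemma sets_pi_pair: "sets (\<pi> \<Otimes>\<^sub>M borel) = sets (borel :: ('v \<times> 'v) measure)"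
 unfolding borel_prod[symmetric] by (intro sets_pair_measure_cong) simp_all

lemma edge_measure_joint: "\<theta> = kernel_joint \<pi> borel \<kappa>"
 unfolding edge_measure_def kernel_joint_def by (simp only: sets_pi_pair space_pi space_borel UNIV_Times_UNIV)

lemma sets_edge[simp, measurable_cong]: "sets \<theta> = sets borel"
 unfolding edge_measure_joint sets_kernel_joint sets_pi_pair ..

lemma space_edge[simp]: "space \<theta> = UNIV"
 using sets_eq_imp_space_eq[OF sets_edge] by simp

lemma emeasure_edge:
 "A \<in> sets borel ==> em \<theta> A = (\<integral>\<^sup>+ x. em (\<kappa> x) (Pair x -` A) \<partial>\<pi>)"
 unfolding edge_measure_joint
 by (rule emeasure_kernel_joint'[OF _ sections_measurable]) (simp_all only: kappa sets_pi_pair)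

lemma nn_integral_edge:
 assumes h: "h \<in> Bor borel"
 shows "(\<integral>\<^sup>+ p. h p \<partial>\<theta>) = (\<integral>\<^sup>+ x. (\<integral>\<^sup>+ y. h (x, y) \<partial>\<kappa> x) \<partial>\<pi>)"
proof -
 have "h \<in> Bor (\<pi> \<Otimes>\<^sub>M borel)"
  unfolding measurable_cong_sets[OF sets_pi_pair refl] by (rule h)
 from nn_integral_kernel_joint'[OF _ sections_measurable this] show ?thesis
  unfolding edge_measure_joint by (simp add: kappa)
qed

lemma edge_diag: "em \<theta> {p. fst p = snd p} = 0"
proof -
 have "Pair x -` {p. fst p = snd p} = {x}" for x :: 'v by auto
 then show ?thesis by (simp add: emeasure_edge kappa)
qed

lemma AE_edge_offdiag: "AE p in \<theta>. fst p ~= snd p"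
proof -
 have "AE p in \<theta>. p \<notin> {p. fst p = snd p}"
  using edge_diag by (intro AE_not_in) (auto simp: null_sets_def)
 then show ?thesis by simp
qed

lemma edge_weight_finite: "(\<integral>\<^sup>+ p. ennreal (jump_weight p) \<partial>\<theta>) < \<infinity>"
proof -
 obtain K where K: "K < \<infinity>" "!!x. (\<integral>\<^sup>+ y. ennreal (min 1 ((dist x y)\<^sup>2)) \<partial>\<kappa> x) <= K"
  by (rule kappa_bound) blast
 have "(\<integral>\<^sup>+ p. ennreal (jump_weight p) \<partial>\<theta>) = (\<integral>\<^sup>+ p. ennreal (min 1 ((dist (fst p) (snd p))\<^sup>2)) \<partial>\<theta>)"
  using AE_edge_offdiag by (intro nn_integral_cong_AE) (auto elim!: eventually_mono simp: jump_weight_def)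
 also have "... = (\<integral>\<^sup>+ x. (\<integral>\<^sup>+ y. ennreal (min 1 ((dist x y)\<^sup>2)) \<partial>\<kappa> x) \<partial>\<pi>)"
  by (subst nn_integral_edge) simp_all
 also have "... <= (\<integral>\<^sup>+ x. K \<partial>\<pi>)"
  by (intro nn_integral_mono K)
 also have "... = K * em \<pi> UNIV" by simp
 also have "... < \<infinity>"
 proof -
  have "em \<pi> UNIV < top" by (metis pi.emeasure_finite less_top)
  then show ?thesis using K(1) by (simp add: ennreal_mult_less_top)
 qed
 finally show ?thesis .
qed

sublocale edge: sigma_finite_measure \<theta>
 using edge_weight_finite jump_weight_pos by (intro sigma_finite_of_weight[of jump_weight]) auto

lemma nn_integral_edge_swap:
 assumes [measurable]: "h \<in> Bor borel"
 shows "(\<integral>\<^sup>+ p. h (snd p, fst p) \<partial>\<theta>) = (\<integral>\<^sup>+ p. h p \<partial>\<theta>)"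
proof -
 have sw: "(%(x, y). (y, x)) \<in> \<theta> \<rightarrow>\<^sub>M (borel :: ('v \<times> 'v) measure)"
  unfolding measurable_cong_sets[OF sets_edge refl]
  by (intro borel_measurable_continuous_onI) (auto simp: split_def intro!: continuous_intros)
 have "(\<integral>\<^sup>+ p. h p \<partial>\<theta>) = (\<integral>\<^sup>+ p. h p \<partial>distr \<theta> borel (%(x, y). (y, x)))"
  using db by (simp add: detailed_balance_def)
 also have "... = (\<integral>\<^sup>+ p. h (snd p, fst p) \<partial>\<theta>)"
  by (subst nn_integral_distr[OF sw]) (simp_all add: split_def)
 finally show ?thesis by simp
qed

text \<open>A null set in the first variable gives a null strip because \<theta> disintegrates over
  \<pi>; detailed balance carries this to the second variable. It allows versions of a density to be
  exchanged inside edge integrals.\<close>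

lemma AE_edge:
 assumes "AE x in \<pi>. P x"
 shows "AE p in \<theta>. P (fst p) & P (snd p)"
proof -
 obtain N where N: "{x \<in> space \<pi>. ~ P x} \<subseteq> N" "N \<in> null_sets \<pi>"
  using assms unfolding eventually_ae_filter by blast
 then have [measurable]: "N \<in> sets borel" by auto
 have "(\<integral>\<^sup>+ p. ind N (fst p) \<partial>\<theta>) = (\<integral>\<^sup>+ x. (\<integral>\<^sup>+ y. ind N x \<partial>\<kappa> x) \<partial>\<pi>)"
  by (subst nn_integral_edge) simp_all
 also have "... = 0"
 proof -
  have "AE x in \<pi>. x \<notin> N" using N(2) by (rule AE_not_in)
  then have "AE x in \<pi>. (\<integral>\<^sup>+ y. ind N x \<partial>\<kappa> x) = 0"
   by eventually_elim simp
  then have "(\<integral>\<^sup>+ x. (\<integral>\<^sup>+ y. ind N x \<partial>\<kappa> x) \<partial>\<pi>) = (\<integral>\<^sup>+ x. 0 \<partial>\<pi>)"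
   by (intro nn_integral_cong_AE) auto
  then show ?thesis by simp
 qed
 finally have 1: "(\<integral>\<^sup>+ p. ind N (fst p) \<partial>\<theta>) = 0" .
 then have 2: "(\<integral>\<^sup>+ p. ind N (snd p) \<partial>\<theta>) = 0"
  using nn_integral_edge_swap[of "%p. ind N (fst p)"] by simp
 have "AE p in \<theta>. ind N (fst p) = (0::ennreal)" "AE p in \<theta>. ind N (snd p) = (0::ennreal)"
  using 1 2 by (simp_all add: nn_integral_0_iff_AE)
 then show ?thesis
  by eventually_elim (use N(1) in \<open>auto simp: indicator_def split: if_splits\<close>)
qed

end

section \<open>Lower semicontinuity\<close>

text \<open>The lower limit is taken over punctured neighbourhoods. At \<open>p\<close> itself the
  strict inequality is the assumption, so \<open>p\<close> may be included.\<close>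

lemma lsc_on_iff:
 "lsc_on S g \<longleftrightarrow> (\<forall>p\<in>S. \<forall>c<g p. \<exists>U. open U & p \<in> U & (\<forall>q\<in>U \<inter> S. c < g q))"
proof -
 have "(g p <= Liminf (at p within S) g) \<longleftrightarrow>
   (\<forall>c<g p. \<exists>U. open U & p \<in> U & (\<forall>q\<in>U \<inter> S. c < g q))" for p
  unfolding le_Liminf_iff eventually_at_topological by (metis IntD1 IntD2 IntI)
 then show ?thesis by (simp add: lsc_on_def)
qed

lemma lsc_on_continuous:
 assumes "continuous_on S h"
 shows "lsc_on S (%p. ennreal (h p))"
 unfolding lsc_on_iff
proof (intro ballI allI impI)
 fix p c assume p: "p \<in> S" and c: "c < ennreal (h p)"
 have "continuous_on S (%p. ennreal (h p))" using assms by (rule continuous_on_ennreal)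
 then obtain A where "open A" "A \<inter> S = (%p. ennreal (h p)) -` {c<..} \<inter> S"
  unfolding continuous_on_open_invariant by (meson open_greaterThan)
 with p c show "\<exists>U. open U & p \<in> U & (\<forall>q\<in>U \<inter> S. c < ennreal (h q))"
  by (intro exI[of _ A]) blast
qed

lemma lsc_envelope_le: "p \<in> S ==> lsc_envelope S f p <= f p"
 unfolding lsc_envelope_def by (rule SUP_least) auto

lemma lsc_envelope_ge: "lsc_on S g ==> (!!q. q \<in> S ==> g q <= f q) ==> g p <= lsc_envelope S f p"
 unfolding lsc_envelope_def by (rule SUP_upper) auto

lemma lsc_on_lsc_envelope: "lsc_on S (lsc_envelope S f)"
 unfolding lsc_on_iff
proof (intro ballI allI impI)
 fix p c assume p: "p \<in> S" "c < lsc_envelope S f p"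
 then obtain g where g: "lsc_on S g" "\<forall>q\<in>S. g q <= f q" "c < g p"
  unfolding lsc_envelope_def less_SUP_iff by auto
 then obtain U where "open U" "p \<in> U" "\<forall>q\<in>U \<inter> S. c < g q"
  using p(1) unfolding lsc_on_iff by blast
 then show "\<exists>U. open U & p \<in> U & (\<forall>q\<in>U \<inter> S. c < lsc_envelope S f q)"
  using lsc_envelope_ge[OF g(1), of f] g(2) by (intro exI[of _ U]) (auto intro: less_le_trans)
qed

lemma lsc_on_borel:
 fixes g :: "'b::topological_space => ennreal"
 assumes "lsc_on S g" "S \<in> sets borel"
 shows "(%p. if p \<in> S then g p else 0) \<in> Bor borel"
proof (rule borel_measurableI_greater)
 fix c
 define U where "U = \<Union>{U. open U & (\<forall>q\<in>U \<inter> S. c < g q)}"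
 have "{p\<in>S. c < g p} = S \<inter> U"
 proof (intro equalityI subsetI)
  fix p assume "p \<in> {p\<in>S. c < g p}"
  moreover from this obtain V where "open V" "p \<in> V" "\<forall>q\<in>V \<inter> S. c < g q"
   using assms(1) unfolding lsc_on_iff by blast
  ultimately show "p \<in> S \<inter> U" unfolding U_def by blast
 qed (auto simp: U_def)
 moreover have "open U" unfolding U_def by auto
 ultimately have "{p\<in>S. c < g p} \<in> sets borel" using assms(2) by simp
 moreover have "{p. c < (if p \<in> S then g p else 0)} = {p\<in>S. c < g p}" by auto
 ultimately show "{p \<in> space borel. c < (if p \<in> S then g p else 0)} \<in> sets borel" by simp
qed

lemma lsc_on_sequentially:
 assumes "lsc_on S g" "p \<in> S" "!!n::nat. x n \<in> S" "x \<longlonglongrightarrow> p"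
 shows "g p <= liminf (%n. g (x n))"
 unfolding le_Liminf_iff
proof (intro allI impI)
 fix c assume "c < g p"
 then obtain U where U: "open U" "p \<in> U" "\<forall>q\<in>U \<inter> S. c < g q"
  using assms(1,2) unfolding lsc_on_iff by blast
 have "eventually (%n. x n \<in> U) sequentially"
  using topological_tendstoD[OF assms(4) U(1,2)] .
 then show "\<forall>\<^sub>F n in sequentially. c < g (x n)"
  by eventually_elim (use U(3) assms(3) in auto)
qed

text \<open>This bounds the envelope above at points where \<open>f\<close> itself is infinite:
  values along a single approaching sequence are enough.\<close>

lemma lsc_envelope_le_limit:
 assumes "p \<in> S" "!!n::nat. x n \<in> S" "x \<longlonglongrightarrow> p" "(%n. f (x n)) \<longlonglongrightarrow> l"
 shows "lsc_envelope S f p <= l"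
proof -
 have "lsc_envelope S f p <= liminf (%n. lsc_envelope S f (x n))"
  using lsc_on_sequentially[OF lsc_on_lsc_envelope assms(1-3)] .
 also have "... <= liminf (%n. f (x n))"
  using assms(2) by (intro Liminf_mono always_eventually allI lsc_envelope_le)
 also have "... = l" using assms(4) by (intro lim_imp_Liminf) auto
 finally show ?thesis .
qed

section \<open>The densities\<close>

locale densities =
 fixes \<phi> \<psi>s :: "real => real" and \<alpha> :: "real \<times> real => real"
 assumes phi: "entropy_density \<phi>" and psis: "dual_dissipation_density \<psi>s" and alpha: "mobility_density \<alpha>"
begin

abbreviation "\<psi> \<equiv> convex_conjugate \<psi>s"

section \<open>The dual dissipation density near 0 and on bounded sets\<close>

lemma psis_nonneg[simp]: "0 <= \<psi>s \<xi>" and psis_0[simp]: "\<psi>s 0 = 0" and psis_even[simp]: "\<psi>s (- \<xi>) = \<psi>s \<xi>"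
 and psis_convex: "convex_on UNIV \<psi>s"
 using psis by (auto simp: dual_dissipation_density_def)

lemma psis_continuous: "continuous_on A \<psi>s"
proof -
 have "isCont \<psi>s x" for x
  using psis unfolding dual_dissipation_density_def by (intro differentiable_imp_continuous_within) blast
 then show ?thesis by (simp add: continuous_at_imp_continuous_on)
qed

lemma psis_measurable[measurable]: "\<psi>s \<in> Bor borel"
 using psis_continuous by (rule borel_measurable_continuous_onI)

lemma psis_abs[simp]: "\<psi>s \<bar>\<xi>\<bar> = \<psi>s \<xi>"
 by (cases "0 <= \<xi>") auto

lemma psis_scale: "0 <= t ==> t <= 1 ==> \<psi>s (t * \<xi>) <= t * \<psi>s \<xi>"
 using convex_onD[OF psis_convex, of t 0 \<xi>] by simp

text \<open>After passing to absolute values, the smaller argument is the larger one shrunk towards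
  0, where the convex function vanishes.\<close>

lemma psis_mono: assumes "\<bar>\<xi>\<bar> <= \<bar>\<eta>\<bar>" shows "\<psi>s \<xi> <= \<psi>s \<eta>"
proof (cases "\<eta> = 0")
 case False
 let ?t = "\<bar>\<xi>\<bar> / \<bar>\<eta>\<bar>"
 have t: "0 <= ?t" "?t <= 1" using assms False by (auto simp: divide_le_eq)
 have "\<psi>s \<bar>\<xi>\<bar> = \<psi>s (?t * \<bar>\<eta>\<bar>)" using False by simp
 also have "... <= ?t * \<psi>s \<bar>\<eta>\<bar>" using t by (rule psis_scale)
 also have "... <= 1 * \<psi>s \<bar>\<eta>\<bar>" using t by (intro mult_right_mono) auto
 finally show ?thesis by simp
qed (use assms in simp)

lemma psis_near_0:
 obtains c \<delta> where "0 < c" "0 < \<delta>" "!!\<xi>. \<bar>\<xi>\<bar> <= \<delta> ==> c * \<xi>\<^sup>2 <= \<psi>s \<xi>" "!!\<xi>. \<bar>\<xi>\<bar> <= \<delta> ==> \<psi>s \<xi> <= 3 * c * \<xi>\<^sup>2"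
proof -
 obtain c where c: "0 < c" "((%\<xi>. \<psi>s \<xi> / \<bar>\<xi>\<bar>\<^sup>2) \<longlongrightarrow> c) (at 0)"
  using psis unfolding dual_dissipation_density_def by blast
 \<comment> \<open>The bounds are half and three halves of the limit \<open>c\<close>. The constant
   handed out is half of the limit, hence the factor 3.\<close>
 have "eventually (%\<xi>. c / 2 < \<psi>s \<xi> / \<bar>\<xi>\<bar>\<^sup>2 & \<psi>s \<xi> / \<bar>\<xi>\<bar>\<^sup>2 < 3 * (c / 2)) (at 0)"
  using order_tendstoD(1)[OF c(2), of "c / 2"] order_tendstoD(2)[OF c(2), of "3 * (c / 2)"] c(1)
  by (intro eventually_conj) simp_all
 then obtain d where d: "0 < d" "!!\<xi>. \<xi> ~= 0 ==> \<bar>\<xi>\<bar> < d ==>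
   c / 2 < \<psi>s \<xi> / \<bar>\<xi>\<bar>\<^sup>2 & \<psi>s \<xi> / \<bar>\<xi>\<bar>\<^sup>2 < 3 * (c / 2)"
  unfolding eventually_at by (auto simp: dist_real_def)
 have "c / 2 * \<xi>\<^sup>2 <= \<psi>s \<xi> & \<psi>s \<xi> <= 3 * (c / 2) * \<xi>\<^sup>2" if "\<bar>\<xi>\<bar> <= d / 2" for \<xi>
 proof (cases "\<xi> = 0")
  case False
  then have "c / 2 < \<psi>s \<xi> / \<xi>\<^sup>2" "\<psi>s \<xi> / \<xi>\<^sup>2 < 3 * (c / 2)" "0 < \<xi>\<^sup>2"
   using d(2)[of \<xi>] d(1) that by auto
  then show ?thesis by (simp add: pos_less_divide_eq pos_divide_less_eq less_imp_le)
 qed simp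
 then show ?thesis using that[of "c / 2" "d / 2"] c(1) d(1) by auto
qed

lemma psis_lower: obtains c where "0 < c" "!!\<xi>. \<bar>\<xi>\<bar> <= B ==> c * \<xi>\<^sup>2 <= \<psi>s \<xi>"
proof -
 obtain c \<delta> where c: "0 < c" "0 < \<delta>" "!!\<xi>. \<bar>\<xi>\<bar> <= \<delta> ==> c * \<xi>\<^sup>2 <= \<psi>s \<xi>"
  using psis_near_0 by metis
 define B' where "B' = max \<bar>B\<bar> \<delta>"
 have B': "0 < B'" "\<delta> <= B'" using c(2) by (auto simp: B'_def)
 \<comment> \<open>Beyond \<delta> monotonicity yields only the value at \<delta>, at least
   \<open>c * \<delta>\<^sup>2\<close>. The quotient scales the quadratic bound down so that it does
   not exceed this up to \<open>B'\<close>.\<close>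
 define k where "k = c * (\<delta>\<^sup>2 / B'\<^sup>2)"
 have k: "0 < k" "k <= c"
  using c(1,2) B' by (auto simp: k_def divide_le_eq intro!: mult_left_le power_mono)
 have "k * \<xi>\<^sup>2 <= \<psi>s \<xi>" if "\<bar>\<xi>\<bar> <= B" for \<xi>
 proof (cases "\<bar>\<xi>\<bar> <= \<delta>")
  case True
  have "k * \<xi>\<^sup>2 <= c * \<xi>\<^sup>2" using k(2) by (intro mult_right_mono) auto
  with c(3)[OF True] show ?thesis by simp
 next
  case False
  have "\<xi>\<^sup>2 <= B'\<^sup>2" using that B'(1) by (auto simp: abs_le_square_iff[symmetric] B'_def)
  then have "k * \<xi>\<^sup>2 <= k * B'\<^sup>2" using k(1) by (intro mult_left_mono) auto
  also have "... = c * \<delta>\<^sup>2" using B'(1) by (simp add: k_def)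
  also have "... <= \<psi>s \<delta>" using c(3)[of \<delta>] c(2) by simp
  also have "... <= \<psi>s \<xi>" using False c(2) by (intro psis_mono) auto
  finally show ?thesis .
 qed
 with k(1) that show ?thesis by blast
qed

lemma psis_upper: obtains c where "0 <= c" "!!\<xi>. \<bar>\<xi>\<bar> <= B ==> \<psi>s \<xi> <= c * \<xi>\<^sup>2"
proof -
 obtain c \<delta> where c: "0 < c" "0 < \<delta>" "!!\<xi>. \<bar>\<xi>\<bar> <= \<delta> ==> \<psi>s \<xi> <= 3 * c * \<xi>\<^sup>2"
  using psis_near_0 by metis
 define k where "k = max (3 * c) (\<psi>s B / \<delta>\<^sup>2)"
 have "\<psi>s \<xi> <= k * \<xi>\<^sup>2" if "\<bar>\<xi>\<bar> <= B" for \<xi>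
 proof (cases "\<bar>\<xi>\<bar> <= \<delta>")
  case True
  have "3 * c * \<xi>\<^sup>2 <= k * \<xi>\<^sup>2" by (intro mult_right_mono) (auto simp: k_def)
  with c(3)[OF True] show ?thesis by simp
 next
  case False
  have "\<psi>s \<xi> <= \<psi>s B" using that by (intro psis_mono) auto
  also have "... = \<psi>s B / \<delta>\<^sup>2 * \<delta>\<^sup>2" using c(2) by simp
  also have "... <= \<psi>s B / \<delta>\<^sup>2 * \<xi>\<^sup>2"
   using False c(2) by (intro mult_left_mono) (auto simp: abs_le_square_iff[symmetric])
  also have "... <= k * \<xi>\<^sup>2" by (intro mult_right_mono) (auto simp: k_def)
  finally show ?thesis .
 qed
 then show ?thesis using that[of k] c(1) by (auto simp: k_def)
qed

lemma psis_pos: assumes "\<xi> ~= 0" shows "0 < \<psi>s \<xi>"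
proof -
 obtain c where c: "0 < c" "!!x. \<bar>x\<bar> <= \<bar>\<xi>\<bar> ==> c * x\<^sup>2 <= \<psi>s x"
  using psis_lower by blast
 have "0 < c * \<xi>\<^sup>2" using assms c(1) by simp
 also have "... <= \<psi>s \<xi>" using c(2)[of \<xi>] by simp
 finally show ?thesis .
qed

section \<open>Growth at infinity and the convex conjugate\<close>

lemma psis_superlinear: obtains R where "0 <= R" "!!\<xi>. R <= \<bar>\<xi>\<bar> ==> s * \<bar>\<xi>\<bar> <= \<psi>s \<xi>"
proof -
 have "filterlim (%\<xi>. \<psi>s \<xi> / \<bar>\<xi>\<bar>) at_top at_infinity"
  using psis by (simp add: dual_dissipation_density_def)
 then have "eventually (%\<xi>. s <= \<psi>s \<xi> / \<bar>\<xi>\<bar>) at_infinity"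
  by (simp add: filterlim_at_top)
 then obtain b where b: "!!\<xi>. b <= norm \<xi> ==> s <= \<psi>s \<xi> / \<bar>\<xi>\<bar>"
  unfolding eventually_at_infinity by auto
 have "s * \<bar>\<xi>\<bar> <= \<psi>s \<xi>" if "max b 1 <= \<bar>\<xi>\<bar>" for \<xi>
  using b[of \<xi>] that by (simp add: pos_le_divide_eq)
 then show ?thesis using that[of "max b 1"] by auto
qed

text \<open>Makes the real supremum in \<open>convex_conjugate\<close> a genuine one: beyond
  \<open>R\<close> the superlinear growth beats the linear term.\<close>

lemma psi_bdd: "bdd_above (range (%\<xi>. s * \<xi> - \<psi>s \<xi>))"
proof -
 obtain R where R: "0 <= R" "!!\<xi>. R <= \<bar>\<xi>\<bar> ==> \<bar>s\<bar> * \<bar>\<xi>\<bar> <= \<psi>s \<xi>"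
  using psis_superlinear by blast
 have "s * \<xi> - \<psi>s \<xi> <= \<bar>s\<bar> * R" for \<xi>
 proof -
  have 1: "s * \<xi> <= \<bar>s\<bar> * \<bar>\<xi>\<bar>" by (metis abs_ge_self abs_mult)
  show ?thesis
  proof (cases "R <= \<bar>\<xi>\<bar>")
   case True
   have "0 <= \<bar>s\<bar> * R" using R(1) by simp
   with 1 R(2)[OF True] show ?thesis by linarith
  next
   case False
   then have "\<bar>s\<bar> * \<bar>\<xi>\<bar> <= \<bar>s\<bar> * R" by (intro mult_left_mono) auto
   with 1 psis_nonneg[of \<xi>] show ?thesis by linarith
  qed
 qed
 then show ?thesis by (intro bdd_aboveI2[where M="\<bar>s\<bar> * R"])
qed

lemma fenchel: "s * \<xi> <= \<psi> s + \<psi>s \<xi>"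
 using cSUP_upper[OF UNIV_I psi_bdd, of s \<xi>] by (simp add: convex_conjugate_def algebra_simps)

lemma psi_nonneg[simp]: "0 <= \<psi> s"
 using fenchel[of s 0] by simp

lemma psi_0[simp]: "\<psi> 0 = 0"
proof (rule antisym)
 show "\<psi> 0 <= 0" unfolding convex_conjugate_def by (rule cSUP_least) auto
qed simp

lemma psi_leI: "(!!\<xi>. s * \<xi> - \<psi>s \<xi> <= b) ==> \<psi> s <= b"
 unfolding convex_conjugate_def by (rule cSUP_least) auto

lemma psi_convex: "convex_on UNIV \<psi>"
proof (rule convex_onI)
 fix t x y :: real assume t: "0 < t" "t < 1"
 show "\<psi> ((1 - t) *\<^sub>R x + t *\<^sub>R y) <= (1 - t) * \<psi> x + t * \<psi> y"
 proof (rule psi_leI)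
  fix \<xi>
  have "(1 - t) * (x * \<xi>) <= (1 - t) * (\<psi> x + \<psi>s \<xi>)" "t * (y * \<xi>) <= t * (\<psi> y + \<psi>s \<xi>)"
   using t fenchel by (auto intro!: mult_left_mono)
  then show "((1 - t) *\<^sub>R x + t *\<^sub>R y) * \<xi> - \<psi>s \<xi> <= (1 - t) * \<psi> x + t * \<psi> y"
   by (simp add: algebra_simps)
 qed
qed simp

lemma psi_even[simp]: "\<psi> (- s) = \<psi> s"
proof -
 have "\<psi> (- s) <= \<psi> s" for s
 proof (rule psi_leI)
  fix \<xi> show "- s * \<xi> - \<psi>s \<xi> <= \<psi> s" using fenchel[of s "- \<xi>"] by simp
 qed
 from this[of s] this[of "- s"] show ?thesis by simp
qed

lemma psi_abs[simp]: "\<psi> \<bar>s\<bar> = \<psi> s"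
 by (cases "0 <= s") auto

lemma psi_measurable[measurable]: "\<psi> \<in> Bor borel"
 by (intro borel_measurable_continuous_onI convex_on_continuous psi_convex) simp

lemma fenchel_abs: "\<bar>s\<bar> * \<bar>\<xi>\<bar> <= \<psi> s + \<psi>s \<xi>"
 using fenchel[of "\<bar>s\<bar>" "\<bar>\<xi>\<bar>"] by simp

section \<open>The mobility density\<close>

lemma alpha_nonneg: "0 <= u ==> 0 <= v ==> 0 <= \<alpha> (u, v)"
 and alpha_cont: "continuous_on quadrant \<alpha>"
 and alpha_sym: "0 <= u ==> 0 <= v ==> \<alpha> (u, v) = \<alpha> (v, u)"
 using alpha by (auto simp: mobility_density_def)

lemma alpha_concave:
 assumes "0 <= u" "0 <= v" "0 <= u'" "0 <= v'" "0 <= t" "t <= 1"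
 shows "(1 - t) * \<alpha> (u, v) + t * \<alpha> (u', v') <= \<alpha> ((1 - t) * u + t * u', (1 - t) * v + t * v')"
proof -
 have "convex_on quadrant (%p. - \<alpha> p)" using alpha by (simp add: mobility_density_def concave_on_def)
 from convex_onD[OF this, of t "(u, v)" "(u', v')"] assms show ?thesis by simp
qed

text \<open>The point \<open>(u, v)\<close> is a convex combination of \<open>(a, b)\<close>, with
  weight \<open>l\<close>, and another point of the quadrant, where the mobility is nonnegative.
  This gives positivity in the interior and propagates zeros along an axis.\<close>

lemma alpha_dominates:
 assumes "0 <= u" "0 <= v" "0 <= a" "0 <= b" "0 < l" "l < 1" "l * a <= u" "l * b <= v"
 shows "l * \<alpha> (a, b) <= \<alpha> (u, v)"
proof -
 let ?x = "(u - l * a) / (1 - l)" and ?y = "(v - l * b) / (1 - l)"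
 have nn: "0 <= ?x" "0 <= ?y" using assms by auto
 have "(1 - l) * \<alpha> (?x, ?y) + l * \<alpha> (a, b) <= \<alpha> ((1 - l) * ?x + l * a, (1 - l) * ?y + l * b)"
  using assms nn by (intro alpha_concave) auto
 moreover have "(1 - l) * ?x + l * a = u" "(1 - l) * ?y + l * b = v" using assms by auto
 moreover have "0 <= (1 - l) * \<alpha> (?x, ?y)" using alpha_nonneg[OF nn] assms by simp
 ultimately show ?thesis by simp
qed

lemma small_scale:
 assumes "0 < u" "0 <= (a::real)" obtains l where "0 < l" "l < 1" "l * a <= u"
proof
 let ?l = "u / (u + a + 1) / 2"
 show "0 < ?l" "?l < 1" using assms by (auto simp: field_simps)
 have "a * u <= u * (u + a + 1) * 2" using assms by (simp add: algebra_simps)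
 then show "?l * a <= u" using assms by (simp add: field_simps)
qed

lemma alpha_pos: assumes "0 < u" "0 < v" shows "0 < \<alpha> (u, v)"
proof -
 obtain a b where ab: "0 <= a" "0 <= b" "\<alpha> (a, b) ~= 0"
  using alpha by (auto simp: mobility_density_def)
 then have p: "0 < \<alpha> (a, b)" using alpha_nonneg[of a b] by simp
 obtain l m where l: "0 < l" "l < 1" "l * a <= u" and m: "0 < m" "m < 1" "m * b <= v"
  using small_scale[OF assms(1) ab(1)] small_scale[OF assms(2) ab(2)] by metis
 have "min l m * \<alpha> (a, b) <= \<alpha> (u, v)"
 proof (rule alpha_dominates)
  show "min l m * a <= u" using l(3) ab(1) mult_right_mono[of "min l m" l a] by linarith
  show "min l m * b <= v" using m(3) ab(2) mult_right_mono[of "min l m" m b] by linarith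
 qed (use l m ab assms in auto)
 moreover have "0 < min l m * \<alpha> (a, b)" using p l m by simp
 ultimately show ?thesis by simp
qed

lemma alpha_axis: assumes "0 < v" "\<alpha> (0, v) = 0" "0 <= w" shows "\<alpha> (0, w) = 0"
proof -
 obtain l where l: "0 < l" "l < 1" "l * w <= v" using small_scale[OF assms(1,3)] .
 have "l * \<alpha> (0, w) <= \<alpha> (0, v)" using l assms by (intro alpha_dominates) auto
 with l(1) assms(2) have "\<alpha> (0, w) <= 0" by (simp add: mult_le_0_iff)
 with alpha_nonneg[of 0 w] assms(3) show ?thesis by simp
qed

lemma alpha_bounded: obtains A where "0 <= A" "!!u v. 0 <= u ==> u <= C ==> 0 <= v ==> v <= C ==> \<alpha> (u, v) <= A"
proof -
 have "compact (\<alpha> ` ({0..C} \<times> {0..C}))"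
  by (intro compact_continuous_image continuous_on_subset[OF alpha_cont] compact_Times) auto
 then have "bounded (\<alpha> ` ({0..C} \<times> {0..C}))" by (rule compact_imp_bounded)
 then obtain A where A: "!!x. x \<in> \<alpha> ` ({0..C} \<times> {0..C}) ==> norm x <= A"
  unfolding bounded_iff by blast
 have "\<alpha> (u, v) <= max A 0" if "0 <= u" "u <= C" "0 <= v" "v <= C" for u v
  using A[of "\<alpha> (u, v)"] that by force
 then show ?thesis using that[of "max A 0"] by auto
qed

lemma quadrant_borel[measurable]: "quadrant \<in> sets borel"
 by (intro borel_closed closed_Times) auto

lemma alpha_measurable:
 assumes [measurable]: "u \<in> Bor M" "v \<in> Bor M"
  and "!!x. 0 <= u x" "!!x. 0 <= v x"
 shows "(%x. \<alpha> (u x, v x)) \<in> Bor M"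
proof -
 have "(%p. if p \<in> quadrant then \<alpha> p else 0) \<in> Bor borel"
  using alpha_cont by (intro borel_measurable_continuous_on_if) auto
 then have "(%x. if (u x, v x) \<in> quadrant then \<alpha> (u x, v x) else 0) \<in> Bor M"
  by (rule measurable_compose[rotated]) measurable
 with assms(3,4) show ?thesis by simp
qed

section \<open>The entropy density, its slope and their truncations\<close>

abbreviation "d\<phi> \<equiv> deriv \<phi>"

lemma phi_cont: "continuous_on {0..} \<phi>" and dphi_cont: "continuous_on {0<..} d\<phi>"
 and phi_convex: "convex_on {0..} \<phi>" and phi_nonneg: "0 <= r ==> 0 <= \<phi> r"
 using phi by (auto simp: entropy_density_def)

lemma phi_deriv: "0 < r ==> (\<phi> has_real_derivative d\<phi> r) (at r)"
 using phi by (auto simp: entropy_density_def intro: DERIV_deriv_iff_real_differentiable[THEN iffD2])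

lemma phi_tangent: assumes "0 < a" "0 <= b" shows "\<phi> a + d\<phi> a * (b - a) <= \<phi> b"
proof -
 have "\<phi> b - \<phi> a \<ge> d\<phi> a * (b - a)"
  using assms by (intro convex_on_imp_above_tangent[OF phi_convex])
   (auto intro!: phi_deriv[THEN DERIV_subset])
 then show ?thesis by simp
qed

lemma dphi_mono: assumes "0 < a" "a <= b" shows "d\<phi> a <= d\<phi> b"
proof (cases "a = b")
 case False
 have "\<phi> a + d\<phi> a * (b - a) <= \<phi> b" "\<phi> b + d\<phi> b * (a - b) <= \<phi> a"
  using assms by (auto intro!: phi_tangent)
 then have "d\<phi> a * (b - a) <= d\<phi> b * (b - a)" by (simp add: algebra_simps)
 then show ?thesis using assms False by (simp add: mult_le_cancel_right)
qed simp

text \<open>A constant slope would let \<phi> grow at most linearly. This is the contradiction in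
  which the positivity of the Fisher density on the axes ends.\<close>

lemma dphi_not_const: "\<exists>r>0. d\<phi> r ~= c"
proof (rule ccontr)
 assume "~ (\<exists>r>0. d\<phi> r ~= c)"
 then have c: "d\<phi> r = c" if "0 < r" for r using that by blast
 have "filterlim (%r. \<phi> r / r) at_top at_top"
  using phi by (simp add: entropy_density_def)
 then have "eventually (%r. \<phi> 1 + \<bar>c\<bar> + 1 <= \<phi> r / r) at_top"
  unfolding filterlim_at_top by blast
 then have "eventually (%r. \<phi> 1 + \<bar>c\<bar> + 1 <= \<phi> r / r & 1 <= r) at_top"
  using eventually_ge_at_top by (rule eventually_conj)
 then obtain r where r: "\<phi> 1 + \<bar>c\<bar> + 1 <= \<phi> r / r" "1 <= r"
  using eventually_happens'[OF trivial_limit_at_top_linorder] by blast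
 have "\<phi> r <= \<phi> 1 + c * (r - 1)" using phi_tangent[of r 1] c[of r] r(2) by (simp add: algebra_simps)
 also have "... <= \<phi> 1 * r + \<bar>c\<bar> * r"
 proof (rule add_mono)
  show "\<phi> 1 <= \<phi> 1 * r" using phi_nonneg[of 1] r(2) by (simp add: mult_le_cancel_left1)
  have "c * (r - 1) <= \<bar>c\<bar> * (r - 1)" using r(2) by (intro mult_right_mono) auto
  then show "c * (r - 1) <= \<bar>c\<bar> * r" by (simp add: algebra_simps)
 qed
 finally have "\<phi> r / r <= \<phi> 1 + \<bar>c\<bar>" using r(2) by (simp add: pos_divide_le_eq algebra_simps)
 with r(1) show False by simp
qed

text \<open>Since \<phi>' is monotone, the limit at 0 exists as an infimum over the positive half
  line. It can be -\<infinity>, but never +\<infinity>.\<close>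

lemma slope_0_tendsto: "((%s. ereal (d\<phi> s)) \<longlongrightarrow> entropy_slope \<phi> 0) (at_right 0)"
 and slope_0_le: "0 < s ==> entropy_slope \<phi> 0 <= ereal (d\<phi> s)"
proof -
 let ?I = "INF s\<in>{0<..}. ereal (d\<phi> s)"
 have lim: "((%s. ereal (d\<phi> s)) \<longlongrightarrow> ?I) (at_right 0)"
 proof (rule order_tendstoI)
  fix a assume a: "a < ?I"
  have "a < ereal (d\<phi> s)" if "0 < s" for s
   using a that by (auto intro: less_le_trans INF_lower)
  then show "eventually (%s. a < ereal (d\<phi> s)) (at_right 0)"
   by (intro eventually_at_rightI[of 0 1]) auto
 next
  fix a assume "?I < a"
  then obtain s where s: "0 < s" "ereal (d\<phi> s) < a" by (auto simp: INF_less_iff)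
  have "ereal (d\<phi> r) < a" if "0 < r" "r < s" for r
   using dphi_mono[of r s] that s(2) by (auto intro: le_less_trans[of "ereal (d\<phi> r)" "ereal (d\<phi> s)"])
  then show "eventually (%s. ereal (d\<phi> s) < a) (at_right 0)"
   using s(1) by (intro eventually_at_rightI[of 0 s]) auto
 qed
 then have e: "entropy_slope \<phi> 0 = ?I"
  unfolding entropy_slope_def by (simp add: tendsto_Lim)
 show "((%s. ereal (d\<phi> s)) \<longlongrightarrow> entropy_slope \<phi> 0) (at_right 0)" using lim unfolding e .
 show "entropy_slope \<phi> 0 <= ereal (d\<phi> s)" if "0 < s" unfolding e using that by (intro INF_lower) auto
qed

lemma slope_pos: "0 < s ==> entropy_slope \<phi> s = ereal (d\<phi> s)"
 by (simp add: entropy_slope_def)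

lemma slope_not_PInf: "entropy_slope \<phi> s ~= \<infinity>" if "0 <= s"
 using that slope_0_le[of 1] slope_pos[of s] by (cases "s = 0") auto

lemma slope_mono: assumes "0 <= a" "a <= b" shows "entropy_slope \<phi> a <= entropy_slope \<phi> b"
proof (cases "a = 0")
 case True
 then show ?thesis using slope_0_le[of b] slope_pos[of b] assms by (cases "b = 0") auto
next
 case False
 then show ?thesis using dphi_mono[of a b] slope_pos[of a] slope_pos[of b] assms by auto
qed

text \<open>Truncating \<open>\<phi>'\<close> near \<open>0\<close> replaces \<open>\<phi>\<close> by its tangent line on \<open>[0, e]\<close>.\<close>

definition tr_deriv :: "real => real => real" where "tr_deriv e u = d\<phi> (max u e)"

definition tr_phi :: "real => real => real" where
 "tr_phi e u = (if e <= u then \<phi> u else \<phi> e + d\<phi> e * (u - e))"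

text \<open>Convexity of the truncated entropy, with \<open>tr_deriv e\<close> as its derivative.
  The mixed cases pass through the junction point \<open>e\<close>.\<close>

lemma tr_phi_tangent:
 assumes "0 < e" "0 <= a" "0 <= b"
 shows "tr_phi e a + tr_deriv e a * (b - a) <= tr_phi e b"
proof -
 consider "e <= a" "e <= b" | "e <= a" "b < e" | "a < e" "e <= b" | "a < e" "b < e" by linarith
 then show ?thesis
 proof cases
  case 1 then show ?thesis using phi_tangent[of a b] assms by (simp add: tr_phi_def tr_deriv_def max_def)
 next
  case 2
  have "\<phi> a + d\<phi> a * (e - a) <= \<phi> e" using phi_tangent[of a e] assms 2 by simp
  moreover have "d\<phi> a * (b - e) <= d\<phi> e * (b - e)"
   using dphi_mono[of e a] assms 2 by (intro mult_right_mono_neg) auto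
  ultimately show ?thesis using 2 by (simp add: tr_phi_def tr_deriv_def max_def algebra_simps)
 next
  case 3
  have "\<phi> e + d\<phi> e * (b - e) <= \<phi> b" using phi_tangent[of e b] assms 3 by simp
  then show ?thesis using 3 by (simp add: tr_phi_def tr_deriv_def max_def algebra_simps)
 next
  case 4 then show ?thesis by (simp add: tr_phi_def tr_deriv_def max_def algebra_simps)
 qed
qed

lemma tr_phi_le: "0 < e ==> 0 <= u ==> tr_phi e u <= \<phi> u"
 using phi_tangent[of e u] by (auto simp: tr_phi_def)

lemma tr_phi_tendsto: assumes "0 <= u" shows "((%e. tr_phi e u) \<longlongrightarrow> \<phi> u) (at_right 0)"
proof (cases "u = 0")
 case False
 then have "eventually (%e. tr_phi e u = \<phi> u) (at_right 0)"
  using assms by (intro eventually_at_rightI[of 0 u]) (auto simp: tr_phi_def)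
 then show ?thesis by (rule tendsto_eventually)
next
 case True
 have c0: "(\<phi> \<longlongrightarrow> \<phi> 0) (at 0 within {0..})"
  using phi_cont by (auto simp: continuous_on)
 have r: "(\<phi> \<longlongrightarrow> \<phi> 0) (at_right 0)"
  using c0 by (rule tendsto_within_subset) auto
 \<comment> \<open>At 0 the truncated value is \<open>\<phi> e - e * d\<phi> e\<close>, where the
   slope may diverge. The tangent at \<open>e\<close>, compared with the value at
   \<open>2 * e\<close>, bounds the product \<open>e * d\<phi> e\<close> by a difference that tends
   to 0.\<close>
 have r2: "((%e. \<phi> (2 * e)) \<longlongrightarrow> \<phi> 0) (at_right 0)"
 proof (rule filterlim_compose[OF r])
  show "filterlim (%e. 2 * e) (at_right 0) (at_right (0::real))"
   unfolding filterlim_at by (auto intro!: tendsto_eq_intros eventually_at_rightI[of 0 1])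
 qed
 have "((%e. \<phi> e - (\<phi> (2 * e) - \<phi> e)) \<longlongrightarrow> \<phi> 0 - (\<phi> 0 - \<phi> 0)) (at_right 0)"
  by (intro tendsto_intros r r2)
 then have lo: "((%e. \<phi> e - (\<phi> (2 * e) - \<phi> e)) \<longlongrightarrow> \<phi> 0) (at_right 0)" by simp
 have "eventually (%e. \<phi> e - (\<phi> (2 * e) - \<phi> e) <= tr_phi e 0) (at_right 0)"
 proof (rule eventually_at_rightI[of 0 1])
  fix e :: real assume "e \<in> {0<..<1}"
  then show "\<phi> e - (\<phi> (2 * e) - \<phi> e) <= tr_phi e 0"
   using phi_tangent[of e "2 * e"] by (simp add: tr_phi_def algebra_simps)
 qed simp
 moreover have "eventually (%e. tr_phi e 0 <= \<phi> 0) (at_right 0)"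
  by (intro eventually_at_rightI[of 0 1]) (auto intro!: tr_phi_le)
 ultimately show ?thesis unfolding True
  by (rule tendsto_sandwich[OF _ _ lo tendsto_const])
qed

lemma tr_deriv_cont: "0 < e ==> continuous_on A (tr_deriv e)"
 unfolding tr_deriv_def[abs_def]
 by (rule continuous_on_compose2[OF dphi_cont]) (auto intro!: continuous_intros)

lemma tr_deriv_measurable[measurable]: "0 < e ==> tr_deriv e \<in> Bor borel"
 by (intro borel_measurable_continuous_onI tr_deriv_cont)

lemma tr_phi_measurable:
 assumes [measurable]: "u \<in> Bor M" and "0 < e"
 shows "(%x. tr_phi e (u x)) \<in> Bor M"
proof -
 have "(%x. if x \<in> {e..} then \<phi> x else 0) \<in> Bor borel"
  using assms(2) by (intro borel_measurable_continuous_on_if continuous_on_subset[OF phi_cont]) auto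
 then have "(%x. if e <= x then \<phi> x else 0) \<in> Bor borel" by simp
 from measurable_compose[OF assms(1) this]
 have "(%x. if e <= u x then (if e <= u x then \<phi> (u x) else 0) else \<phi> e + d\<phi> e * (u x - e)) \<in> Bor M"
  by measurable
 also have "(%x. if e <= u x then (if e <= u x then \<phi> (u x) else 0) else \<phi> e + d\<phi> e * (u x - e)) =
   (%x. tr_phi e (u x))"
  by (auto simp: tr_phi_def)
 finally show ?thesis .
qed

lemma phi_measurable:
 assumes [measurable]: "u \<in> Bor M" and "!!x. 0 <= u x"
 shows "(%x. \<phi> (u x)) \<in> Bor M"
proof -
 have "(%x. if x \<in> {0..} then \<phi> x else 0) \<in> Bor borel"
  by (intro borel_measurable_continuous_on_if phi_cont) auto
 then have "(%x. if 0 <= x then \<phi> x else 0) \<in> Bor borel" by simp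
 from measurable_compose[OF assms(1) this] assms(2) show ?thesis by simp
qed

lemma tr_deriv_bound:
 assumes "0 < e" "0 <= u" "u <= C"
 shows "\<bar>tr_deriv e u\<bar> <= \<bar>d\<phi> e\<bar> + \<bar>d\<phi> (max C e)\<bar>"
proof -
 have "d\<phi> e <= tr_deriv e u" "tr_deriv e u <= d\<phi> (max C e)"
  using assms unfolding tr_deriv_def by (auto intro!: dphi_mono)
 then show ?thesis by linarith
qed

lemma phi_bounded_on: obtains B where "0 <= B" "!!u. 0 <= u ==> u <= C ==> \<phi> u <= B"
proof -
 have "compact (\<phi> ` {0..C})"
  by (intro compact_continuous_image continuous_on_subset[OF phi_cont]) auto
 then have "bounded (\<phi> ` {0..C})" by (rule compact_imp_bounded)
 then obtain A where A: "!!x. x \<in> \<phi> ` {0..C} ==> norm x <= A"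
  unfolding bounded_iff by blast
 have "\<phi> u <= max A 0" if "0 <= u" "u <= C" for u
  using A[of "\<phi> u"] that by force
 then show ?thesis using that[of "max A 0"] by auto
qed

text \<open>Extended subtraction is antisymmetric here because the slopes are never +\<infinity>,
  and they are not both -\<infinity> except at the origin, where \<open>slope_diff\<close> is set to
  0.\<close>

lemma slope_diff_swap:
 assumes "0 <= u" "0 <= v" shows "slope_diff \<phi> (v, u) = - slope_diff \<phi> (u, v)"
proof -
 have "entropy_slope \<phi> u ~= \<infinity>" "entropy_slope \<phi> v ~= \<infinity>"
  using slope_not_PInf assms by auto
 moreover have "entropy_slope \<phi> u ~= -\<infinity> \<or> entropy_slope \<phi> v ~= -\<infinity>" if "~ (u = 0 & v = 0)"
  using that assms slope_pos[of u] slope_pos[of v] by (cases "u = 0") auto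
 ultimately show ?thesis
  unfolding slope_diff_def
  by (cases "entropy_slope \<phi> u"; cases "entropy_slope \<phi> v") auto
qed

text \<open>If \<open>e <= v\<close>, the slope at \<open>v\<close> is kept and the one at
  \<open>u\<close> can only rise; otherwise the two truncated slopes coincide. So truncation never
  enlarges a difference of slopes.\<close>

lemma tr_deriv_diff_le_aux:
 assumes "0 < e" "0 <= u" "u <= v" "\<bar>slope_diff \<phi> (u, v)\<bar> ~= \<infinity>"
 shows "0 <= tr_deriv e v - tr_deriv e u" "tr_deriv e v - tr_deriv e u <= real_of_ereal (slope_diff \<phi> (u, v))"
proof -
 show "0 <= tr_deriv e v - tr_deriv e u"
  using assms dphi_mono[of "max u e" "max v e"] by (auto simp: tr_deriv_def)
 show "tr_deriv e v - tr_deriv e u <= real_of_ereal (slope_diff \<phi> (u, v))"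
 proof (cases "v = 0")
  case True then show ?thesis using assms by (simp add: tr_deriv_def slope_diff_def)
 next
  case False
  then have v: "entropy_slope \<phi> v = ereal (d\<phi> v)" using assms slope_pos[of v] by simp
  then have sd: "slope_diff \<phi> (u, v) = ereal (d\<phi> v) - entropy_slope \<phi> u" using False by (simp add: slope_diff_def)
  obtain a where a: "entropy_slope \<phi> u = ereal a"
   using assms(4) unfolding sd by (cases "entropy_slope \<phi> u") auto
  have "a <= d\<phi> r" if "max u 0 <= r" "0 < r" for r
   using slope_mono[of u r] assms that a slope_pos[of r] by simp
  have ge: "a <= tr_deriv e u" unfolding tr_deriv_def
   using slope_mono[of u "max u e"] assms a slope_pos[of "max u e"] by simp
  show ?thesis
  proof (cases "e <= v")
   case True then show ?thesis using ge a unfolding sd by (simp add: tr_deriv_def max_def)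
  next
   case False
   then have "tr_deriv e v = tr_deriv e u" using assms by (simp add: tr_deriv_def max_def)
   moreover have "a <= d\<phi> v" using slope_mono[of u v] assms a v by simp
   ultimately show ?thesis unfolding sd a by simp
  qed
 qed
qed

lemma tr_deriv_diff_le:
 assumes "0 < e" "0 <= u" "0 <= v" "\<bar>slope_diff \<phi> (u, v)\<bar> ~= \<infinity>"
 shows "\<bar>tr_deriv e v - tr_deriv e u\<bar> <= \<bar>real_of_ereal (slope_diff \<phi> (u, v))\<bar>"
proof (cases "u <= v")
 case True
 from tr_deriv_diff_le_aux[OF assms(1,2) True assms(4)] show ?thesis by linarith
next
 case False
 note s = slope_diff_swap[OF assms(2,3)]
 have r: "real_of_ereal (slope_diff \<phi> (v, u)) = - real_of_ereal (slope_diff \<phi> (u, v))"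
  unfolding s by (cases "slope_diff \<phi> (u, v)") auto
 have n: "\<bar>slope_diff \<phi> (v, u)\<bar> ~= \<infinity>"
  unfolding s using assms(4) by (cases "slope_diff \<phi> (u, v)") auto
 have "v <= u" using False by simp
 from tr_deriv_diff_le_aux[OF assms(1,3) this n] r show ?thesis by linarith
qed

lemma tr_deriv_diff_tendsto:
 assumes "0 <= u" "0 <= v" "\<bar>slope_diff \<phi> (u, v)\<bar> ~= \<infinity>"
 shows "((%e. tr_deriv e v - tr_deriv e u) \<longlongrightarrow> real_of_ereal (slope_diff \<phi> (u, v))) (at_right 0)"
proof (cases "u = 0 & v = 0")
 case True then show ?thesis by (simp add: slope_diff_def)
next
 case False
 have sd: "slope_diff \<phi> (u, v) = entropy_slope \<phi> v - entropy_slope \<phi> u" using False by (auto simp: slope_diff_def)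
 have n: "\<bar>entropy_slope \<phi> u\<bar> ~= \<infinity>" "\<bar>entropy_slope \<phi> v\<bar> ~= \<infinity>"
  using assms(3) slope_not_PInf[OF assms(1)] slope_not_PInf[OF assms(2)] unfolding sd
  by (cases "entropy_slope \<phi> u"; cases "entropy_slope \<phi> v"; auto)+
 have t: "((%e. tr_deriv e w) \<longlongrightarrow> real_of_ereal (entropy_slope \<phi> w)) (at_right 0)"
  if "0 <= w" "\<bar>entropy_slope \<phi> w\<bar> ~= \<infinity>" for w
 proof (cases "w = 0")
  case True
  have "((%e. d\<phi> e) \<longlongrightarrow> real_of_ereal (entropy_slope \<phi> 0)) (at_right 0)"
   using slope_0_tendsto that True lim_real_of_ereal[of "%e. ereal (d\<phi> e)" "real_of_ereal (entropy_slope \<phi> 0)"]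
   by (simp add: ereal_real)
  moreover have "eventually (%e. d\<phi> e = tr_deriv e w) (at_right 0)"
   using True by (intro eventually_at_rightI[of 0 1]) (auto simp: tr_deriv_def max_def)
  ultimately show ?thesis unfolding True by (rule Lim_transform_eventually)
 next
  case False
  then have "eventually (%e. tr_deriv e w = d\<phi> w) (at_right 0)"
   using that by (intro eventually_at_rightI[of 0 w]) (auto simp: tr_deriv_def max_def)
  with False that slope_pos[of w] show ?thesis by (simp add: tendsto_eventually)
 qed
 have "real_of_ereal (slope_diff \<phi> (u, v)) = real_of_ereal (entropy_slope \<phi> v) - real_of_ereal (entropy_slope \<phi> u)"
  unfolding sd using n by (cases "entropy_slope \<phi> u"; cases "entropy_slope \<phi> v") auto
 then show ?thesis using t[OF assms(1) n(1)] t[OF assms(2) n(2)] by (auto intro: tendsto_diff)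
qed

end

section \<open>The Fisher density\<close>

context densities
begin

abbreviation "D \<equiv> fisher_density \<phi> \<psi>s \<alpha>"

lemma fisher_le_plus: "0 <= u ==> 0 <= v ==> D (u, v) <= fisher_density_plus \<phi> \<psi>s \<alpha> (u, v)"
 unfolding fisher_density_def by (rule lsc_envelope_le) simp

text \<open>The truncated density is continuous on the quadrant and lies below
  \<open>fisher_density_plus\<close>, because truncation shrinks slope differences and
  \<open>\<psi>s\<close> grows with the absolute value. Hence it competes in the supremum that
  defines the envelope.\<close>

lemma fisher_ge_truncated:
 assumes e: "0 < e" and "0 <= u" "0 <= v"
 shows "ennreal (\<psi>s (tr_deriv e v - tr_deriv e u) * \<alpha> (u, v)) <= D (u, v)"
proof -
 let ?h = "%p. \<psi>s (tr_deriv e (snd p) - tr_deriv e (fst p)) * \<alpha> p"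
 have c: "continuous_on quadrant (%p. tr_deriv e (f p))" if "continuous_on quadrant f" for f
  using that by (rule continuous_on_compose2[OF tr_deriv_cont[OF e, of UNIV]]) simp
 have "continuous_on quadrant ?h"
  by (intro continuous_on_mult alpha_cont continuous_on_compose2[OF psis_continuous[of UNIV]]
    continuous_on_diff c continuous_intros) simp
 then have lsc: "lsc_on quadrant (%p. ennreal (?h p))" by (rule lsc_on_continuous)
 have "ennreal (?h q) <= fisher_density_plus \<phi> \<psi>s \<alpha> q" if quad: "q \<in> quadrant" for q
 proof -
  obtain a b where q: "q = (a, b)" "0 <= a" "0 <= b" using quad by (cases q) auto
  show ?thesis
  proof (cases "0 < \<alpha> q")
   case True
   show ?thesis
   proof (cases "\<bar>slope_diff \<phi> q\<bar> = \<infinity>")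
    case True with \<open>0 < \<alpha> q\<close> show ?thesis
     by (simp add: fisher_density_plus_def ext_fun_def ennreal_top_mult)
   next
    case False
    then have "\<psi>s (tr_deriv e b - tr_deriv e a) <= \<psi>s (real_of_ereal (slope_diff \<phi> q))"
     using tr_deriv_diff_le[OF e q(2,3)] q(1) by (intro psis_mono) simp
    then have "?h q <= \<psi>s (real_of_ereal (slope_diff \<phi> q)) * \<alpha> q"
     using True q(1) by (auto intro!: mult_right_mono)
    with True False show ?thesis
     by (simp add: fisher_density_plus_def ext_fun_def ennreal_mult[symmetric] ennreal_leI)
   qed
  next
   case False
   then have "\<alpha> q = 0" using alpha_nonneg[OF q(2,3)] q(1) by simp
   then show ?thesis by simp
  qed
 qed
 from lsc_envelope_ge[OF lsc this, of "(u, v)"] show ?thesis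
  unfolding fisher_density_def by simp
qed

text \<open>Obtained from the truncated bound as \<open>e\<close> tends to 0. An infinite slope
  difference would make the truncated differences diverge, and by superlinear growth of
  \<open>\<psi>s\<close> the bound would exceed any finite value of \<open>D\<close>.\<close>

lemma fisher_ge_slope:
 assumes uv: "0 <= u" "0 <= v" and fin: "D (u, v) < \<infinity>" and a: "0 < \<alpha> (u, v)"
 shows "\<bar>slope_diff \<phi> (u, v)\<bar> ~= \<infinity>"
  "ennreal (\<psi>s (real_of_ereal (slope_diff \<phi> (u, v))) * \<alpha> (u, v)) <= D (u, v)"
proof -
 have le: "eventually (%e. ennreal (\<psi>s (tr_deriv e v - tr_deriv e u) * \<alpha> (u, v)) <= D (u, v)) (at_right 0)"
  using fisher_ge_truncated uv by (intro eventually_at_rightI[of 0 1]) auto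
 show fs: "\<bar>slope_diff \<phi> (u, v)\<bar> ~= \<infinity>"
 proof (rule ccontr)
  assume inf: "~ ?thesis"
  obtain b where b: "D (u, v) = ennreal b" "0 <= b" using fin by (cases "D (u, v)") auto
  obtain R where R: "0 <= R" "!!\<xi>. R <= \<bar>\<xi>\<bar> ==> 1 * \<bar>\<xi>\<bar> <= \<psi>s \<xi>"
   using psis_superlinear by blast
  define w where "w = max u v"
  have nn: "~ (u = 0 & v = 0)" using inf by (auto simp: slope_diff_def)
  have s0: "entropy_slope \<phi> 0 = -\<infinity>" and z: "min u v = 0"
  proof -
   have "\<bar>entropy_slope \<phi> v - entropy_slope \<phi> u\<bar> = \<infinity>" using inf nn by (auto simp: slope_diff_def)
   then have "entropy_slope \<phi> u = -\<infinity> \<or> entropy_slope \<phi> v = -\<infinity>"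
    using slope_not_PInf[OF uv(1)] slope_not_PInf[OF uv(2)]
    by (cases "entropy_slope \<phi> u"; cases "entropy_slope \<phi> v") auto
   then have "u = 0 & entropy_slope \<phi> u = -\<infinity> \<or> v = 0 & entropy_slope \<phi> v = -\<infinity>"
    using uv slope_pos[of u] slope_pos[of v] by (cases "u = 0"; cases "v = 0") auto
   then show "entropy_slope \<phi> 0 = -\<infinity>" "min u v = 0" using uv by auto
  qed
  have w: "0 < w" using nn uv by (auto simp: w_def)
  have diff: "\<bar>tr_deriv e v - tr_deriv e u\<bar> = d\<phi> w - d\<phi> e" if "0 < e" "e < w" for e
   using that z uv dphi_mono[of e w] unfolding w_def tr_deriv_def
   by (auto simp: min_def max_def split: if_splits)
  \<comment> \<open>Large enough for the growth bound on \<open>\<psi>s\<close> to apply, and for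
    \<open>\<psi>s\<close> times the mobility to exceed \<open>b\<close>.\<close>
  define k where "k = max R (b / \<alpha> (u, v) + 1)"
  have "eventually (%s. ereal (d\<phi> s) < ereal (d\<phi> w - k)) (at_right 0)"
   using slope_0_tendsto unfolding s0 by (rule order_tendstoD) simp
  moreover have "eventually (%s. s < w) (at_right 0)" "eventually (%s. 0 < s) (at_right (0::real))"
   using w by (auto intro: eventually_at_rightI[of 0 w] eventually_at_rightI[of 0 1])
  ultimately have "eventually (%e. 0 < e & e < w & d\<phi> e < d\<phi> w - k &
    ennreal (\<psi>s (tr_deriv e v - tr_deriv e u) * \<alpha> (u, v)) <= D (u, v)) (at_right 0)"
   using le by eventually_elim simp
  then obtain e where e: "0 < e" "e < w" "d\<phi> e < d\<phi> w - k"
   "ennreal (\<psi>s (tr_deriv e v - tr_deriv e u) * \<alpha> (u, v)) <= D (u, v)"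
   using eventually_happens'[OF trivial_limit_at_right_real] by blast
  have "k <= \<bar>tr_deriv e v - tr_deriv e u\<bar>" using diff[OF e(1,2)] e(3) by simp
  then have "k <= \<psi>s (tr_deriv e v - tr_deriv e u)"
   using R(2)[of "tr_deriv e v - tr_deriv e u"] by (simp add: k_def)
  then have "b / \<alpha> (u, v) + 1 <= \<psi>s (tr_deriv e v - tr_deriv e u)" by (simp add: k_def)
  then have "(b / \<alpha> (u, v) + 1) * \<alpha> (u, v) <= \<psi>s (tr_deriv e v - tr_deriv e u) * \<alpha> (u, v)"
   using a by (intro mult_right_mono) auto
  moreover have "(b / \<alpha> (u, v) + 1) * \<alpha> (u, v) = b + \<alpha> (u, v)" using a by (simp add: field_simps)
  moreover have "\<psi>s (tr_deriv e v - tr_deriv e u) * \<alpha> (u, v) <= b"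
   using e(4) b a by (simp add: ennreal_le_iff)
  ultimately show False using a by linarith
 qed
 have "((%e. ennreal (\<psi>s (tr_deriv e v - tr_deriv e u) * \<alpha> (u, v))) \<longlongrightarrow>
   ennreal (\<psi>s (real_of_ereal (slope_diff \<phi> (u, v))) * \<alpha> (u, v))) (at_right 0)"
  by (intro tendsto_ennrealI tendsto_mult_right isCont_tendsto_compose[OF _ tr_deriv_diff_tendsto[OF uv fs]])
   (use psis_continuous[of UNIV] in \<open>simp add: continuous_on_eq_continuous_at\<close>)
 then show "ennreal (\<psi>s (real_of_ereal (slope_diff \<phi> (u, v))) * \<alpha> (u, v)) <= D (u, v)"
  by (rule tendsto_upperbound[OF _ le]) simp
qed

lemma fisher_diag: assumes "0 <= u" shows "D (u, u) = 0"
proof -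
 have "fisher_density_plus \<phi> \<psi>s \<alpha> (u, u) = 0"
 proof (cases "u = 0")
  case True then show ?thesis by (simp add: fisher_density_plus_def slope_diff_def ext_fun_def)
 next
  case False
  then show ?thesis
   using assms alpha_pos[of u u] slope_pos[of u]
   by (simp add: fisher_density_plus_def slope_diff_def ext_fun_def)
 qed
 with fisher_le_plus[OF assms assms] show ?thesis by simp
qed

lemma fisher_measurable:
 assumes [measurable]: "u \<in> Bor M" "v \<in> Bor M"
  and "!!x. 0 <= u x" "!!x. 0 <= v x"
 shows "(%x. D (u x, v x)) \<in> Bor M"
proof -
 have "(%p. if p \<in> quadrant then D p else 0) \<in> Bor borel"
  unfolding fisher_density_def by (intro lsc_on_borel lsc_on_lsc_envelope quadrant_borel)
 then have "(%x. if (u x, v x) \<in> quadrant then D (u x, v x) else 0) \<in> Bor M"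
  by (rule measurable_compose[rotated]) measurable
 with assms(3,4) show ?thesis by simp
qed

lemma fisher_plus_sym:
 assumes "0 <= u" "0 <= v"
 shows "fisher_density_plus \<phi> \<psi>s \<alpha> (v, u) = fisher_density_plus \<phi> \<psi>s \<alpha> (u, v)"
proof -
 have "ext_fun \<psi>s (- z) = ext_fun \<psi>s z" for z by (simp add: ext_fun_def)
 then show ?thesis
  using slope_diff_swap[OF assms] alpha_sym[OF assms] by (auto simp: fisher_density_plus_def)
qed

text \<open>The envelope with exchanged arguments is again lower semicontinuous and lies below the
  symmetric function \<open>fisher_density_plus\<close>, so it competes in the envelope.\<close>

lemma fisher_sym: assumes "0 <= u" "0 <= v" shows "D (u, v) <= D (v, u)"
proof -
 let ?g = "%p. D (snd p, fst p)"
 have "lsc_on quadrant ?g"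
  unfolding lsc_on_iff
 proof (intro ballI allI impI)
  fix p c assume "p \<in> quadrant" "c < ?g p"
  then have "(snd p, fst p) \<in> quadrant" "c < D (snd p, fst p)" by auto
  then obtain U where U: "open U" "(snd p, fst p) \<in> U" "\<forall>q\<in>U \<inter> quadrant. c < D q"
   using lsc_on_lsc_envelope[of quadrant "fisher_density_plus \<phi> \<psi>s \<alpha>"]
   unfolding fisher_density_def[symmetric] lsc_on_iff by blast
  have "open ((%p. (snd p, fst p)) -` U)"
   using U(1) by (intro open_vimage continuous_intros) auto
  then show "\<exists>V. open V & p \<in> V & (\<forall>q\<in>V \<inter> quadrant. c < ?g q)"
   using U(2,3) by (intro exI[of _ "(%p. (snd p, fst p)) -` U"]) auto
 qed
 moreover have "?g q <= fisher_density_plus \<phi> \<psi>s \<alpha> q" if q: "q \<in> quadrant" for q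
  using q fisher_le_plus[of "snd q" "fst q"] fisher_plus_sym[of "fst q" "snd q"]
  by (auto simp: prod_eq_iff)
 ultimately have "?g (v, u) <= D (v, u)"
  unfolding fisher_density_def by (intro lsc_envelope_ge)
 then show ?thesis by simp
qed

text \<open>The degenerate case that convexity of the Fisher information excludes: mobility vanishing on
  the axes together with a finite slope at \<open>0\<close>.\<close>

lemma fisher_axis_degenerate:
 assumes sl: "entropy_slope \<phi> 0 = ereal c" and ax: "\<alpha> (0, v) = 0" and v: "0 < v"
 shows "D (0, v) = 0"
proof -
 define x where "x n = (1 / real (Suc n), v)" for n
 have lim0: "(%n. 1 / real (Suc n)) \<longlonglongrightarrow> 0" by (rule LIMSEQ_Suc[OF lim_1_over_n])
 have x: "x n \<in> quadrant" for n using v by (simp add: x_def)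
 have xl: "x \<longlonglongrightarrow> (0, v)" unfolding x_def[abs_def] by (intro tendsto_intros lim0)
 have fl: "filterlim (%n. 1 / real (Suc n)) (at_right 0) sequentially"
  unfolding filterlim_at using lim0 by auto
 have "(%n. ereal (d\<phi> (1 / real (Suc n)))) \<longlonglongrightarrow> ereal c"
  using filterlim_compose[OF slope_0_tendsto fl] unfolding sl .
 then have dl: "(%n. d\<phi> (1 / real (Suc n))) \<longlonglongrightarrow> c" by simp
 have al: "(%n. \<alpha> (x n)) \<longlonglongrightarrow> \<alpha> (0, v)"
  by (rule continuous_on_tendsto_compose[OF alpha_cont xl]) (use x v in auto)
 have pl: "(%n. \<psi>s (d\<phi> v - d\<phi> (1 / real (Suc n)))) \<longlonglongrightarrow> \<psi>s (d\<phi> v - c)"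
  by (rule isCont_tendsto_compose[OF _ tendsto_diff[OF tendsto_const dl]])
   (use psis_continuous[of UNIV] in \<open>simp add: continuous_on_eq_continuous_at\<close>)
 have "(%n. ennreal (\<psi>s (d\<phi> v - d\<phi> (1 / real (Suc n))) * \<alpha> (x n))) \<longlonglongrightarrow> ennreal (\<psi>s (d\<phi> v - c) * \<alpha> (0, v))"
  by (intro tendsto_ennrealI tendsto_mult pl al)
 moreover have "fisher_density_plus \<phi> \<psi>s \<alpha> (x n) = ennreal (\<psi>s (d\<phi> v - d\<phi> (1 / real (Suc n))) * \<alpha> (x n))" for n
  using alpha_pos[of "1 / real (Suc n)" v] v slope_pos[of "1 / real (Suc n)"] slope_pos[of v]
  by (simp add: fisher_density_plus_def x_def slope_diff_def ext_fun_def ennreal_mult)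
 ultimately have "(%n. fisher_density_plus \<phi> \<psi>s \<alpha> (x n)) \<longlonglongrightarrow> 0" using ax by simp
 from lsc_envelope_le_limit[OF _ x xl this] v show ?thesis
  unfolding fisher_density_def by simp
qed

end

section \<open>Consequences of a convex Fisher information\<close>

locale entropy_space = jump_space \<pi> \<kappa> + densities \<phi> \<psi>s \<alpha>
 for \<pi> :: "'v::{metric_space, second_countable_topology} measure" and \<kappa> \<phi> \<psi>s \<alpha> +
 assumes fconv: "fisher_convex \<pi> \<kappa> \<phi> \<psi>s \<alpha>"
begin

abbreviation "Ent \<equiv> entropy \<pi> \<phi>"
abbreviation "Fis \<equiv> fisher \<pi> \<kappa> \<phi> \<psi>s \<alpha>"
abbreviation "Dis \<equiv> dissipation \<pi> \<kappa> \<psi>s \<alpha>"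

lemma measurable_pi_borel: "Bor \<pi> = Bor borel"
 by (intro measurable_cong_sets) simp_all

lemma pos_deriv_pi_measurable[measurable]: "pos_deriv \<pi> \<rho> \<in> Bor borel"
 using pos_deriv_measurable[of \<pi> \<rho>] by (simp add: measurable_pi_borel)

definition dens :: "('v => real) => 'v measure" where "dens u = density \<pi> (%x. ennreal (u x))"

lemma pos_deriv_dens:
 assumes "u \<in> Bor borel" "!!x. 0 <= u x"
 shows "AE x in \<pi>. pos_deriv \<pi> (dens u) x = u x"
 unfolding dens_def using assms
 by (intro pos_deriv_of_density) (simp_all add: pi.sigma_finite_measure_axioms measurable_pi_borel)

lemma fisher_cong:
 assumes "AE x in \<pi>. pos_deriv \<pi> \<rho> x = u x"
 shows "Fis \<rho> = (\<integral>\<^sup>+ p. D (u (fst p), u (snd p)) \<partial>\<theta>) / 2"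
proof -
 have "(\<integral>\<^sup>+ p. D (pos_deriv \<pi> \<rho> (fst p), pos_deriv \<pi> \<rho> (snd p)) \<partial>\<theta>) =
   (\<integral>\<^sup>+ p. D (u (fst p), u (snd p)) \<partial>\<theta>)"
  using AE_edge[OF assms] by (intro nn_integral_cong_AE, elim eventually_mono) simp
 then show ?thesis by (simp add: fisher_def split_def)
qed

lemma ac_dens: "u \<in> Bor borel ==> absolutely_continuous \<pi> (dens u)"
 unfolding dens_def by (intro absolutely_continuousI_density) (simp add: measurable_pi_borel)

lemma entropy_dens:
 assumes "u \<in> Bor borel" "!!x. 0 <= u x"
 shows "Ent (dens u) = (\<integral>\<^sup>+ x. ennreal (\<phi> (u x)) \<partial>\<pi>)"
 using pos_deriv_dens[OF assms] ac_dens[OF assms(1)]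
 by (simp add: entropy_def) (intro nn_integral_cong_AE, auto elim!: eventually_mono)

lemma bounded_nn_integral_finite: "(!!x. f x <= ennreal C) ==> (\<integral>\<^sup>+ x. f x \<partial>\<pi>) < \<infinity>"
proof -
 assume "!!x. f x <= ennreal C"
 then have "(\<integral>\<^sup>+ x. f x \<partial>\<pi>) <= (\<integral>\<^sup>+ x. ennreal C \<partial>\<pi>)" by (intro nn_integral_mono)
 also have "... = ennreal C * em \<pi> UNIV" by simp
 also have "... < \<infinity>"
 proof -
  have "em \<pi> UNIV < top" by (metis pi.emeasure_finite less_top)
  then show ?thesis by (simp add: ennreal_mult_less_top)
 qed
 finally show ?thesis .
qed

lemma dens_bounded:
 assumes u: "u \<in> Bor borel" "!!x. 0 <= u x" "!!x. u x <= C"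
 shows "dens u \<in> finite_borel_measures" "Ent (dens u) < \<infinity>"
proof -
 have "em (dens u) (space (dens u)) = (\<integral>\<^sup>+ x. ennreal (u x) \<partial>\<pi>)"
  using nn_integral_density[of "%x. ennreal (u x)" \<pi> "%_. 1"] u(1)
  by (simp add: dens_def measurable_pi_borel)
 also have "... < \<infinity>" using u(3) by (intro bounded_nn_integral_finite ennreal_leI)
 finally show "dens u \<in> finite_borel_measures"
  by (auto simp: finite_borel_measures_def dens_def intro!: finite_measureI)
 obtain B where "!!r. 0 <= r ==> r <= C ==> \<phi> r <= B" using phi_bounded_on by blast
 then show "Ent (dens u) < \<infinity>"
  unfolding entropy_dens[OF u(1,2)] using u by (intro bounded_nn_integral_finite ennreal_leI) auto
qed

text \<open>Countably many sets \<open>A \<times> - A\<close>, with \<open>A\<close> from a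
  countable base, cover the off-diagonal pairs, so one of them is charged.\<close>

lemma offdiag_split:
 assumes "em \<theta> offdiag ~= 0"
 obtains A where "A \<in> sets borel" "em \<theta> (A \<times> - A) ~= 0"
proof -
 obtain B :: "'v set set" where B: "countable B" "topological_basis B"
  using ex_countable_basis by auto
 have Bb: "A \<in> sets borel" if "A \<in> B" for A
  using topological_basis_open[OF B(2) that] by simp
 show ?thesis
 proof (rule ccontr)
  assume neg: "~ thesis"
  have N: "(\<Union>A\<in>B. A \<times> - A) \<in> null_sets \<theta>"
  proof (rule null_sets_UN')
   fix A assume "A \<in> B"
   then have "A \<times> - A \<in> sets borel"
    unfolding borel_prod[symmetric] using Bb by (intro pair_measureI) auto
   moreover have "em \<theta> (A \<times> - A) = 0" using neg that Bb[OF \<open>A \<in> B\<close>] by blast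
   ultimately show "A \<times> - A \<in> null_sets \<theta>" by (auto simp: null_sets_def)
  qed fact
  have S: "offdiag \<subseteq> (\<Union>A\<in>B. A \<times> - A)"
  proof
   fix p :: "'v \<times> 'v" assume "p \<in> offdiag"
   then obtain x y where p: "p = (x, y)" "x ~= y" by auto
   then have "open (- {y})" "x \<in> - {y}" by auto
   then obtain A where "A \<in> B" "x \<in> A" "A \<subseteq> - {y}" using topological_basisE[OF B(2)] by metis
   with p show "p \<in> (\<Union>A\<in>B. A \<times> - A)" by auto
  qed
  have "offdiag \<in> null_sets \<theta>"
   by (rule null_sets_subset[OF N _ S]) (simp only: sets_edge offdiag_borel)
  from null_setsD1[OF this] assms show False by contradiction
 qed
qed

text \<open>Both \<open>v 1\<^sub>A\<close> and \<open>v 1\<^sub>B\<close>, with \<open>B\<close> the complement of \<open>A\<close>, have zero Fisher information if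
  \<open>D (0, v) = 0\<close>, hence so do their convex combinations.\<close>

lemma fisher_axis_zero_imp:
 assumes od: "em \<theta> offdiag ~= 0" and v: "0 < v" and z: "D (0, v) = 0" and s: "0 < s" "s < 1"
 shows "D ((1 - s) * v, s * v) = 0"
proof -
 obtain A where A[measurable]: "A \<in> sets borel" and pos: "em \<theta> (A \<times> - A) ~= 0"
  using offdiag_split[OF od] .
 have z': "D (v, 0) = 0" using fisher_sym[of v 0] z v by simp
 let ?ua = "%x. v * ind A x" and ?ub = "%x. v * ind (- A) x"
 let ?uc = "%x. (1 - s) * ?ua x + s * ?ub x"
 have m: "?ua \<in> Bor borel" "?ub \<in> Bor borel" by measurable
 have b0: "0 <= ?ua x" "?ua x <= v" and b1: "0 <= ?ub x" "?ub x <= v" for x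
  using v by (auto simp: indicator_def)
 have zz: "D (v * ind S x, v * ind S y) = 0" for S and x y :: 'v
  using v z z' fisher_diag[of 0] fisher_diag[of v] by (simp split: split_indicator)
 have z0: "Fis (dens ?ua) = 0"
  unfolding fisher_cong[OF pos_deriv_dens[OF m(1) b0(1)]]
  by (simp add: zz)
 have z1: "Fis (dens ?ub) = 0"
  unfolding fisher_cong[OF pos_deriv_dens[OF m(2) b1(1)]]
  by (simp add: zz)
 have mix: "mix_measure s (dens ?ua) (dens ?ub) = dens ?uc"
  unfolding dens_def by (rule mix_measure_density) (use m b0(1) b1(1) s in \<open>simp_all only: measurable_pi_borel less_imp_le\<close>)
 have "Fis (mix_measure s (dens ?ua) (dens ?ub)) <= ennreal (1 - s) * Fis (dens ?ua) + ennreal s * Fis (dens ?ub)"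
  using fconv dens_bounded[OF m(1) b0] dens_bounded[OF m(2) b1] s unfolding fisher_convex_def by blast
 then have zero: "Fis (dens ?uc) = 0" unfolding mix z0 z1 by simp
 have mu: "?uc \<in> Bor borel" by measurable
 have nu: "0 <= ?uc x" for x using b0(1)[of x] b1(1)[of x] s by simp
 have int0: "(\<integral>\<^sup>+ p. D (?uc (fst p), ?uc (snd p)) \<partial>\<theta>) = 0"
  using zero unfolding fisher_cong[OF pos_deriv_dens[OF mu nu]]
  by (simp add: ennreal_divide_eq_0_iff)
 have Ab: "A \<times> - A \<in> sets \<theta>"
  unfolding sets_edge borel_prod[symmetric] by (intro pair_measureI) auto
 \<comment> \<open>On \<open>A \<times> - A\<close> the mixture takes the constant pair of values
   \<open>(1 - s) * v\<close> and \<open>s * v\<close>, and this rectangle has positive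
   measure.\<close>
 have "D ((1 - s) * v, s * v) * em \<theta> (A \<times> - A) =
   (\<integral>\<^sup>+ p. D ((1 - s) * v, s * v) * ind (A \<times> - A) p \<partial>\<theta>)"
  using Ab by (simp add: nn_integral_cmult_indicator)
 also have "... <= (\<integral>\<^sup>+ p. D (?uc (fst p), ?uc (snd p)) \<partial>\<theta>)"
  by (intro nn_integral_mono) (auto simp: indicator_def)
 finally show ?thesis using int0 pos by simp
qed

text \<open>Suppose \<open>D\<close> vanishes at \<open>(0, w)\<close>. It then vanishes at
  \<open>((1 - s) * w, s * w)\<close>, where the mobility is positive, so \<phi>' takes equal values
  at points symmetric about \<open>w / 2\<close> and, being monotone, is constant below
  \<open>w / 2\<close>. With \<open>w = v\<close> this makes the slope at 0 finite, so
  \<open>D\<close> vanishes along the whole axis. Then every \<open>w\<close> can be used and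
  \<phi>' is constant everywhere.\<close>

lemma fisher_axis_pos:
 assumes od: "em \<theta> offdiag ~= 0" and v: "0 < v" and ax: "\<alpha> (0, v) = 0"
 shows "0 < D (0, v)"
proof (rule ccontr)
 have const: "d\<phi> a = d\<phi> b" if w: "0 < w" "D (0, w) = 0" and ab: "0 < a" "a < b" "b < w / 2" for w a b
 proof -
  have eq: "d\<phi> (s * w) = d\<phi> ((1 - s) * w)" if s: "0 < s" "s < 1" for s
  proof -
   have z: "D ((1 - s) * w, s * w) = 0" by (rule fisher_axis_zero_imp[OF od w s])
   have ap: "0 < \<alpha> ((1 - s) * w, s * w)" using s w by (intro alpha_pos) auto
   have "ennreal (\<psi>s (real_of_ereal (slope_diff \<phi> ((1 - s) * w, s * w))) * \<alpha> ((1 - s) * w, s * w)) <= 0"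
    using fisher_ge_slope(2)[of "(1 - s) * w" "s * w"] s w z ap by simp
   then have "\<psi>s (real_of_ereal (slope_diff \<phi> ((1 - s) * w, s * w))) <= 0"
    using ap by (simp add: ennreal_eq_0_iff mult_le_0_iff)
   then have "real_of_ereal (slope_diff \<phi> ((1 - s) * w, s * w)) = 0"
    using psis_pos by (meson not_le)
   then show ?thesis using s w slope_pos[of "(1 - s) * w"] slope_pos[of "s * w"] by (simp add: slope_diff_def)
  qed
  have "d\<phi> a = d\<phi> (w - a)" using eq[of "a / w"] w ab by (simp add: left_diff_distrib)
  moreover have "d\<phi> a <= d\<phi> b" "d\<phi> b <= d\<phi> (w - a)" using ab w by (auto intro!: dphi_mono)
  ultimately show ?thesis by linarith
 qed
 assume "~ 0 < D (0, v)"
 then have z: "D (0, v) = 0" by simp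
 define c where "c = d\<phi> (v / 4)"
 have cc: "d\<phi> a = c" if "0 < a" "a < v / 4" for a
  unfolding c_def using that v by (intro const[OF v z]) auto
 have "eventually (%s. ereal (d\<phi> s) = ereal c) (at_right 0)"
  using cc v by (intro eventually_at_rightI[of 0 "v / 4"]) auto
 then have "((%s. ereal (d\<phi> s)) \<longlongrightarrow> ereal c) (at_right 0)" by (rule tendsto_eventually)
 then have sl: "entropy_slope \<phi> 0 = ereal c"
  by (intro tendsto_unique[OF _ slope_0_tendsto]) simp_all
 have zw: "D (0, w) = 0" if "0 < w" for w
  using fisher_axis_degenerate[OF sl _ that] alpha_axis[OF v ax, of w] that by simp
 obtain r where r: "0 < r" "d\<phi> r ~= c" using dphi_not_const by blast
 define a where "a = min r (v / 4) / 2"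
 have a: "0 < a" "a < r" "a < v / 4" using r v by (auto simp: a_def min_def)
 have "d\<phi> a = d\<phi> r" using r a by (intro const[OF _ zw, of "4 * r"]) auto
 with cc[OF a(1,3)] r show False by simp
qed

text \<open>By compactness, points violating the bound with constants tending to infinity accumulate
  at some \<open>p\<close>. A positive mobility at \<open>p\<close> is excluded by the quadratic
  lower bound for \<open>\<psi>s\<close>. Near the origin both arguments fall below \<open>e\<close>
  and the truncated slopes coincide. At any other zero of the mobility \<open>D\<close> is positive,
  and lower semicontinuity keeps it away from 0 while the slope differences stay bounded.\<close>

lemma truncated_gradient_pointwise:
 assumes od: "em \<theta> offdiag ~= 0" and e: "0 < e"
 shows "\<exists>K\<ge>0. \<forall>u v. 0 <= u --> u <= C --> 0 <= v --> v <= C -->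
  ennreal ((tr_deriv e v - tr_deriv e u)\<^sup>2) <= ennreal K * D (u, v)"
proof (rule ccontr)
 let ?g = "%p. tr_deriv e (snd p) - tr_deriv e (fst p)"
 assume "~ ?thesis"
 then have "\<exists>p. p \<in> {0..C} \<times> {0..C} & ~ ennreal ((?g p)\<^sup>2) <= ennreal (real n) * D p" for n :: nat
  by (metis (no_types, lifting) SigmaI atLeastAtMost_iff fst_conv of_nat_0_le_iff snd_conv)
 then obtain x where x: "!!n::nat. x n \<in> {0..C} \<times> {0..C}"
  "!!n. ennreal (real n) * D (x n) < ennreal ((?g (x n))\<^sup>2)"
  unfolding not_le by metis
 have "compact ({0..C} \<times> {0..C})" by (intro compact_Times) auto
 then obtain p r where p: "p \<in> {0..C} \<times> {0..C}" "strict_mono r" "(x \<circ> r) \<longlonglongrightarrow> p"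
  using x(1) unfolding compact_def by blast
 define y where "y n = x (r n)" for n
 have y: "y n \<in> {0..C} \<times> {0..C}" "y \<longlonglongrightarrow> p" for n
  using x(1) p(3) by (simp_all add: y_def[abs_def] comp_def)
 have ylt: "ennreal (real n) * D (y n) < ennreal ((?g (y n))\<^sup>2)" for n
 proof -
  have "ennreal (real n) <= ennreal (real (r n))"
   using seq_suble[OF p(2), of n] by (intro ennreal_leI) simp
  then have "ennreal (real n) * D (y n) <= ennreal (real (r n)) * D (y n)" by (rule mult_right_mono) simp
  also have "... < ennreal ((?g (y n))\<^sup>2)" unfolding y_def by (rule x(2))
  finally show ?thesis .
 qed
 have C: "0 <= C" using p(1) by auto
 have yq: "0 <= fst (y n)" "fst (y n) <= C" "0 <= snd (y n)" "snd (y n) <= C" for n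
  using y(1)[of n] by (cases "y n"; simp)+
 define B where "B = 2 * (\<bar>d\<phi> e\<bar> + \<bar>d\<phi> (max C e)\<bar>)"
 have gB: "\<bar>?g (y n)\<bar> <= B" for n
  using tr_deriv_bound[OF e yq(1,2)[of n]] tr_deriv_bound[OF e yq(3,4)[of n]] unfolding B_def by (auto simp: abs_le_iff)
 obtain k where k: "0 < k" "!!\<xi>. \<bar>\<xi>\<bar> <= B ==> k * \<xi>\<^sup>2 <= \<psi>s \<xi>" using psis_lower by blast
 have low: "ennreal (k * (?g (y n))\<^sup>2 * \<alpha> (y n)) <= D (y n)" for n
 proof -
  have "k * (?g (y n))\<^sup>2 * \<alpha> (y n) <= \<psi>s (?g (y n)) * \<alpha> (y n)"
   using k(2)[OF gB] alpha_nonneg[OF yq(1,3)[of n]] by (intro mult_right_mono) auto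
  then have "ennreal (k * (?g (y n))\<^sup>2 * \<alpha> (y n)) <= ennreal (\<psi>s (?g (y n)) * \<alpha> (y n))" by (rule ennreal_leI)
  also have "... <= D (y n)" using fisher_ge_truncated[OF e yq(1,3)[of n]] by simp
  finally show ?thesis .
 qed
 have quad: "p \<in> quadrant" "y n \<in> quadrant" for n using p(1) y(1)[of n] by auto
 have al: "(%n. \<alpha> (y n)) \<longlonglongrightarrow> \<alpha> p"
  by (rule continuous_on_tendsto_compose[OF alpha_cont y(2)]) (use quad in auto)
 obtain a b where ab: "p = (a, b)" "0 <= a" "0 <= b" using quad(1) by auto
 have gpos: "(?g (y n))\<^sup>2 > 0" for n
 proof -
  have "0 < ennreal ((?g (y n))\<^sup>2)" using ylt[of n] by (rule le_less_trans[OF zero_le])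
  then show ?thesis by simp
 qed
 have api: "\<alpha> p = 0"
 proof (rule ccontr)
  assume "\<alpha> p ~= 0"
  then have ap: "0 < \<alpha> p" using alpha_nonneg[OF ab(2,3)] ab(1) by simp
  have "eventually (%n. \<alpha> p / 2 < \<alpha> (y n)) sequentially"
   using order_tendstoD(1)[OF al, of "\<alpha> p / 2"] ap by simp
  moreover have "eventually (%n. 2 / (k * \<alpha> p) <= real n) sequentially"
   by (rule filterlim_real_sequentially[unfolded filterlim_at_top, rule_format])
  ultimately obtain n where n: "\<alpha> p / 2 < \<alpha> (y n)" "2 / (k * \<alpha> p) <= real n"
   using eventually_happens'[OF sequentially_bot] eventually_conj by blast
  have "(?g (y n))\<^sup>2 = 2 / (k * \<alpha> p) * (k * (?g (y n))\<^sup>2 * (\<alpha> p / 2))" using k(1) ap by simp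
  also have "... <= real n * (k * (?g (y n))\<^sup>2 * \<alpha> (y n))"
   using n k(1) ap by (intro mult_mono) auto
  finally have "ennreal ((?g (y n))\<^sup>2) <= ennreal (real n) * ennreal (k * (?g (y n))\<^sup>2 * \<alpha> (y n))"
   by (subst ennreal_mult'[symmetric]) (simp_all add: ennreal_leI)
  also have "... <= ennreal (real n) * D (y n)" by (intro mult_left_mono low) simp
  finally show False using ylt[of n] by simp
 qed
 have "~ (a = 0 & b = 0)"
 proof
  assume "a = 0 & b = 0"
  then have "(%n. fst (y n)) \<longlonglongrightarrow> 0" "(%n. snd (y n)) \<longlonglongrightarrow> 0"
   using tendsto_fst[OF y(2)] tendsto_snd[OF y(2)] ab by auto
  then have "eventually (%n. fst (y n) < e) sequentially" "eventually (%n. snd (y n) < e) sequentially"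
   using e by (auto dest: order_tendstoD)
  then have "eventually (%n. ?g (y n) = 0) sequentially"
   by eventually_elim (simp add: tr_deriv_def max_def)
  then obtain n where "?g (y n) = 0" using eventually_happens'[OF sequentially_bot] by blast
  with gpos[of n] show False by simp
 qed
 moreover have "a = 0 \<or> b = 0" using alpha_pos[of a b] api ab by force
 ultimately have "0 < D p"
  using fisher_axis_pos[OF od, of b] fisher_axis_pos[OF od, of a] fisher_sym[of 0 a] ab api alpha_sym[of a b]
  by (auto intro: less_le_trans)
 then obtain \<delta> where \<delta>: "0 < \<delta>" "\<delta> < D p" using dense by blast
 then obtain d where d: "\<delta> = ennreal d" "0 < d" by (cases \<delta>) auto
 have "\<delta> < liminf (%n. D (y n))"
  using \<delta>(2) lsc_on_sequentially[OF lsc_on_lsc_envelope quad y(2), of "fisher_density_plus \<phi> \<psi>s \<alpha>"]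
  unfolding fisher_density_def by (rule less_le_trans)
 then have "eventually (%n. \<delta> < D (y n)) sequentially" by (rule less_LiminfD)
 moreover have "eventually (%n. B\<^sup>2 / d <= real n) sequentially" by (rule filterlim_real_sequentially[unfolded filterlim_at_top, rule_format])
 ultimately obtain n where n: "\<delta> < D (y n)" "B\<^sup>2 / d <= real n"
  using eventually_happens'[OF sequentially_bot] eventually_conj by blast
 have "(?g (y n))\<^sup>2 <= B\<^sup>2" using gB[of n] by (metis abs_le_square_iff abs_ge_self abs_of_nonneg abs_ge_zero order_trans)
 also have "... <= real n * d" using n(2) d(2) by (simp add: pos_divide_le_eq)
 finally have "ennreal ((?g (y n))\<^sup>2) <= ennreal (real n) * \<delta>"
  unfolding d(1) using d(2) by (subst ennreal_mult'[symmetric]) (simp_all add: ennreal_leI)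
 also have "... <= ennreal (real n) * D (y n)" using n(1) by (intro mult_left_mono) auto
 finally show False using ylt[of n] by simp
qed

lemma truncated_gradient_bound:
 assumes e: "0 < e"
 obtains K where "0 <= K" "!!u. u \<in> Bor borel ==> (!!x. 0 <= u x) ==> (!!x. u x <= C) ==>
  (\<integral>\<^sup>+ p. ennreal ((tr_deriv e (u (snd p)) - tr_deriv e (u (fst p)))\<^sup>2) \<partial>\<theta>)
   <= ennreal K * (\<integral>\<^sup>+ p. D (u (fst p), u (snd p)) \<partial>\<theta>)"
proof (cases "em \<theta> offdiag = 0")
 case True
 \<comment> \<open>As the diagonal is not charged either, \<theta> is the zero measure.\<close>
 then have "AE p in \<theta>. p \<notin> offdiag" by (intro AE_not_in) (simp add: null_sets_def)
 with AE_edge_offdiag have "AE p in \<theta>. False" by eventually_elim auto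
 then have "(\<integral>\<^sup>+ p. f p \<partial>\<theta>) = (\<integral>\<^sup>+ p. 0 \<partial>\<theta>)" for f by (intro nn_integral_cong_AE) auto
 then show ?thesis using that[of 0] by simp
next
 case False
 obtain K where K: "0 <= K" "!!u v. 0 <= u ==> u <= C ==> 0 <= v ==> v <= C ==>
  ennreal ((tr_deriv e v - tr_deriv e u)\<^sup>2) <= ennreal K * D (u, v)"
  using truncated_gradient_pointwise[OF False e, of C] by metis
 show ?thesis
 proof (rule that[OF K(1)])
  fix u :: "'v => real" assume u: "u \<in> Bor borel" "!!x. 0 <= u x" "!!x. u x <= C"
  note [measurable] = u(1)
  have "(\<integral>\<^sup>+ p. ennreal ((tr_deriv e (u (snd p)) - tr_deriv e (u (fst p)))\<^sup>2) \<partial>\<theta>)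
    <= (\<integral>\<^sup>+ p. ennreal K * D (u (fst p), u (snd p)) \<partial>\<theta>)"
   using K(2) u by (intro nn_integral_mono) auto
  also have "... = ennreal K * (\<integral>\<^sup>+ p. D (u (fst p), u (snd p)) \<partial>\<theta>)"
   using u by (intro nn_integral_cmult) (simp cong: measurable_cong_sets add: fisher_measurable)
  finally show "(\<integral>\<^sup>+ p. ennreal ((tr_deriv e (u (snd p)) - tr_deriv e (u (fst p)))\<^sup>2) \<partial>\<theta>)
   <= ennreal K * (\<integral>\<^sup>+ p. D (u (fst p), u (snd p)) \<partial>\<theta>)" .
 qed
qed

end

section \<open>Bounded Lipschitz functions are dense\<close>

lemma Lip_bI: "L-lipschitz_on UNIV \<phi> ==> (!!x. \<bar>\<phi> x\<bar> <= B) ==> \<phi> \<in> Lip_b"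
 by (auto simp: Lip_b_def bounded_iff)

lemma Lip_bE:
 assumes "\<phi> \<in> Lip_b"
 obtains L B where "L-lipschitz_on UNIV \<phi>" "0 <= B" "!!x. \<bar>\<phi> x\<bar> <= B"
proof -
 obtain B where B: "!!x. \<bar>\<phi> x\<bar> <= B" using assms by (auto simp: Lip_b_def bounded_iff)
 then have "0 <= B" using abs_ge_zero order_trans by blast
 with B assms that show ?thesis by (auto simp: Lip_b_def)
qed

lemma Lip_b_borel: "\<phi> \<in> Lip_b ==> \<phi> \<in> Bor borel"
 unfolding Lip_b_def by (blast intro: borel_measurable_continuous_onI lipschitz_on_continuous_on)

lemma Lip_b_const: "(%_. c) \<in> Lip_b"
 by (rule Lip_bI[of 0 _ "\<bar>c\<bar>"]) (auto intro: lipschitz_onI)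

lemma Lip_b_add: assumes "f \<in> Lip_b" "g \<in> Lip_b" shows "(%x. f x + g x) \<in> Lip_b"
proof -
 obtain L B where f: "L-lipschitz_on UNIV f" "0 <= B" "!!x. \<bar>f x\<bar> <= B" using Lip_bE[OF assms(1)] by metis
 obtain L' B' where g: "L'-lipschitz_on UNIV g" "0 <= B'" "!!x. \<bar>g x\<bar> <= B'" using Lip_bE[OF assms(2)] by metis
 have "\<bar>f x + g x\<bar> <= B + B'" for x using f(3)[of x] g(3)[of x] by linarith
 with lipschitz_on_add[OF f(1) g(1)] show ?thesis by (rule Lip_bI)
qed

lemma Lip_b_cmult: assumes "f \<in> Lip_b" shows "(%x. c * f x) \<in> Lip_b"
proof -
 obtain L B where f: "L-lipschitz_on UNIV f" "0 <= B" "!!x. \<bar>f x\<bar> <= B" using Lip_bE[OF assms] by metis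
 have "\<bar>c * f x\<bar> <= \<bar>c\<bar> * B" for x using f(3)[of x] by (simp add: abs_mult mult_left_mono)
 with lipschitz_on_cmult_real[OF f(1), of c] show ?thesis by (rule Lip_bI)
qed

lemma Lip_b_max0: assumes "f \<in> Lip_b" shows "(%x. max 0 (f x)) \<in> Lip_b"
proof -
 obtain L B where f: "L-lipschitz_on UNIV f" "0 <= B" "!!x. \<bar>f x\<bar> <= B" using Lip_bE[OF assms] by metis
 have "L-lipschitz_on UNIV (%x. max 0 (f x))"
 proof (rule lipschitz_onI)
  fix x y
  have "dist (max 0 (f x)) (max 0 (f y)) <= dist (f x) (f y)" by (auto simp: dist_real_def)
  also have "... <= L * dist x y" using f(1) by (rule lipschitz_onD) auto
  finally show "dist (max 0 (f x)) (max 0 (f y)) <= L * dist x y" .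
 qed (use lipschitz_on_nonneg[OF f(1)] in auto)
 moreover have "\<bar>max 0 (f x)\<bar> <= B" for x using f(2) f(3)[of x] by auto
 ultimately show ?thesis by (rule Lip_bI)
qed

lemma Lip_b_infdist: "(%x. min 1 (real n * infdist x S)) \<in> Lip_b"
proof (rule Lip_bI)
 show "(real n)-lipschitz_on UNIV (%x. min 1 (real n * infdist x S))"
 proof (rule lipschitz_onI)
  fix x y
  have "dist (min 1 (real n * infdist x S)) (min 1 (real n * infdist y S)) <=
    \<bar>real n * infdist x S - real n * infdist y S\<bar>" by (auto simp: dist_real_def)
  also have "... = real n * \<bar>infdist x S - infdist y S\<bar>" by (simp add: abs_mult flip: right_diff_distrib)
  also have "... <= real n * dist x y" by (intro mult_left_mono infdist_triangle_abs) auto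
  finally show "dist (min 1 (real n * infdist x S)) (min 1 (real n * infdist y S)) <= real n * dist x y" .
 qed simp
 show "\<bar>min 1 (real n * infdist x S)\<bar> <= 1" for x
  using infdist_nonneg[of x S] by (auto simp: min_def)
qed

lemma Lip_b_integrable:
 fixes M :: "'a::metric_space measure"
 assumes "finite_measure M" "sets M = sets borel" "\<phi> \<in> Lip_b"
 shows "integrable M \<phi>"
proof -
 interpret finite_measure M by fact
 obtain L B where "0 <= B" "!!x. \<bar>\<phi> x\<bar> <= B" using Lip_bE[OF assms(3)] by metis
 then show ?thesis
  using Lip_b_borel[OF assms(3)] assms(2)
  by (intro integrable_const_bound[of _ B]) (simp_all cong: measurable_cong_sets)
qed

text \<open>The functions that can be approximated in L1 are closed under sums, multiples and
  dominated limits. They contain indicators of open sets, as limits of \<open>min 1\<close> of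
  multiples of the distance to the complement; Dynkin's argument then reaches all Borel
  sets.\<close>

lemma Lip_b_dense:
 fixes M :: "'a::metric_space measure" and f :: "'a => real"
 assumes fin: "finite_measure M" and sb: "sets M = sets borel" and f: "integrable M f" and e: "0 < e"
 obtains \<phi> where "\<phi> \<in> Lip_b" "(\<integral>x. \<bar>f x - \<phi> x\<bar> \<partial>M) < e"
proof -
 interpret finite_measure M by fact
 note Li = Lip_b_integrable[OF fin sb]
 define P where "P f \<longleftrightarrow> integrable M f & (\<forall>e>0. \<exists>\<phi>\<in>Lip_b. (\<integral>x. \<bar>f x - \<phi> x\<bar> \<partial>M) < e)" for f :: "'a => real"
 have P_Lip: "P \<phi>" if "\<phi> \<in> Lip_b" for \<phi> unfolding P_def using that Li by (auto intro!: bexI[of _ \<phi>])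
 have P_add: "P (%x. f x + g x)" if Pf: "P f" and Pg: "P g" for f g
  unfolding P_def
 proof (intro conjI allI impI)
  have i: "integrable M f" "integrable M g" using Pf Pg by (auto simp: P_def)
  then show "integrable M (%x. f x + g x)" by simp
  fix e :: real assume e: "0 < e"
  obtain \<phi> where \<phi>: "\<phi> \<in> Lip_b" "(\<integral>x. \<bar>f x - \<phi> x\<bar> \<partial>M) < e / 2"
   using Pf e unfolding P_def by (meson half_gt_zero)
  obtain h where h: "h \<in> Lip_b" "(\<integral>x. \<bar>g x - h x\<bar> \<partial>M) < e / 2"
   using Pg e unfolding P_def by (meson half_gt_zero)
  have "(\<integral>x. \<bar>f x + g x - (\<phi> x + h x)\<bar> \<partial>M) <= (\<integral>x. \<bar>f x - \<phi> x\<bar> + \<bar>g x - h x\<bar> \<partial>M)"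
   using i Li[OF \<phi>(1)] Li[OF h(1)] by (intro integral_mono) auto
  also have "... < e" using \<phi>(2) h(2) i Li[OF \<phi>(1)] Li[OF h(1)] by simp
  finally show "\<exists>\<phi>\<in>Lip_b. (\<integral>x. \<bar>f x + g x - \<phi> x\<bar> \<partial>M) < e"
   using Lip_b_add[OF \<phi>(1) h(1)] by auto
 qed
 have P_cmult: "P (%x. c * f x)" if Pf: "P f" for f c
 proof (cases "c = 0")
  case True then show ?thesis using P_Lip[OF Lip_b_const[of 0]] by simp
 next
  case False
  show ?thesis unfolding P_def
  proof (intro conjI allI impI)
   have i: "integrable M f" using Pf by (auto simp: P_def)
   then show "integrable M (%x. c * f x)" by simp
   fix e :: real assume e: "0 < e"
   obtain \<phi> where \<phi>: "\<phi> \<in> Lip_b" "(\<integral>x. \<bar>f x - \<phi> x\<bar> \<partial>M) < e / \<bar>c\<bar>"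
    using Pf e False unfolding P_def by (meson divide_pos_pos zero_less_abs_iff)
   have "(\<integral>x. \<bar>c * f x - c * \<phi> x\<bar> \<partial>M) = \<bar>c\<bar> * (\<integral>x. \<bar>f x - \<phi> x\<bar> \<partial>M)"
    by (simp add: abs_mult flip: right_diff_distrib)
   also have "... < e" using \<phi>(2) False by (simp add: pos_less_divide_eq mult.commute)
   finally show "\<exists>\<phi>\<in>Lip_b. (\<integral>x. \<bar>c * f x - \<phi> x\<bar> \<partial>M) < e"
    using Lip_b_cmult[OF \<phi>(1)] by auto
  qed
 qed
 have P_lim: "P f" if s: "!!i::nat. P (s i)" and l: "!!x. x \<in> space M ==> (%i. s i x) \<longlonglongrightarrow> f x"
  and b: "!!i x. x \<in> space M ==> \<bar>s i x\<bar> <= g x" "integrable M g" and m: "f \<in> Bor M" for f g s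
 proof -
  have si: "integrable M (s i)" for i using s by (auto simp: P_def)
  have fi: "integrable M f"
  proof (rule integrable_dominated_convergence[where s=s and w=g])
   show "AE x in M. (%i. s i x) \<longlonglongrightarrow> f x" using l by (rule AE_I2)
   show "AE x in M. norm (s i x) <= g x" for i using b(1) by (intro AE_I2) simp
  qed (use m b(2) si in simp_all)
  have "(%i. \<integral>x. \<bar>f x - s i x\<bar> \<partial>M) \<longlonglongrightarrow> (\<integral>x. 0 \<partial>M)"
  proof (rule integral_dominated_convergence[where w="%x. \<bar>f x\<bar> + g x"])
   show "AE x in M. (%i. \<bar>f x - s i x\<bar>) \<longlonglongrightarrow> 0"
   proof (rule AE_I2)
    fix x assume "x \<in> space M"
    from tendsto_rabs[OF tendsto_diff[OF tendsto_const l[OF this], of "f x"]]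
    show "(%i. \<bar>f x - s i x\<bar>) \<longlonglongrightarrow> 0" by simp
   qed
   show "AE x in M. norm \<bar>f x - s i x\<bar> <= \<bar>f x\<bar> + g x" for i
   proof (rule AE_I2)
    fix x assume "x \<in> space M"
    with b(1)[of x i] show "norm \<bar>f x - s i x\<bar> <= \<bar>f x\<bar> + g x" by auto
   qed
  qed (use fi b(2) si in auto)
  then have lim: "(%i. \<integral>x. \<bar>f x - s i x\<bar> \<partial>M) \<longlonglongrightarrow> 0" by simp
  show ?thesis unfolding P_def
  proof (intro conjI allI impI fi)
   fix e :: real assume e: "0 < e"
   then have "eventually (%i. (\<integral>x. \<bar>f x - s i x\<bar> \<partial>M) < e / 2) sequentially"
    by (intro order_tendstoD(2)[OF lim]) simp
   then obtain i where i: "(\<integral>x. \<bar>f x - s i x\<bar> \<partial>M) < e / 2"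
    using eventually_happens'[OF sequentially_bot] by blast
   obtain \<phi> where \<phi>: "\<phi> \<in> Lip_b" "(\<integral>x. \<bar>s i x - \<phi> x\<bar> \<partial>M) < e / 2"
    using s[of i] e unfolding P_def by (meson half_gt_zero)
   have "(\<integral>x. \<bar>f x - \<phi> x\<bar> \<partial>M) <= (\<integral>x. \<bar>f x - s i x\<bar> + \<bar>s i x - \<phi> x\<bar> \<partial>M)"
    using fi si Li[OF \<phi>(1)] by (intro integral_mono) auto
   also have "... < e" using i \<phi>(2) fi si Li[OF \<phi>(1)] by simp
   finally show "\<exists>\<phi>\<in>Lip_b. (\<integral>x. \<bar>f x - \<phi> x\<bar> \<partial>M) < e" using \<phi>(1) by blast
  qed
 qed
 have sp: "space M = UNIV" using sets_eq_imp_space_eq[OF sb] by simp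
 have P_ind: "P (ind A)" if A: "A \<in> sets M" for A
 proof -
  have Is: "Int_stable {S :: 'a set. open S}" by (auto simp: Int_stable_def)
  have "A \<in> sigma_sets UNIV {S. open S}" using A sb by (simp add: borel_def)
  with Is subset_UNIV[of "{S :: 'a set. open S}", folded Pow_UNIV] show ?thesis
  proof (induct rule: sigma_sets_induct_disjoint)
   case (basic U)
   then have U: "open U" by simp
   then have [measurable]: "U \<in> sets M" using sb by simp
   show ?case
   \<comment> \<open>\<open>infdist\<close> to the empty set is 0, so the approximation by distances
     fails for the whole space.\<close>
   proof (cases "- U = {}")
    case True
    then have "U = UNIV" by blast
    then show ?thesis using P_Lip[OF Lip_b_const[of 1]] by (simp add: indicator_def)
   next
    case False
    show ?thesis
    proof (rule P_lim[where s="%n x. min 1 (real n * infdist x (- U))" and g="%_. 1"])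
     show "P (%x. min 1 (real n * infdist x (- U)))" for n by (rule P_Lip[OF Lip_b_infdist])
     fix x
     show "(%n. min 1 (real n * infdist x (- U))) \<longlonglongrightarrow> ind U x"
     proof (cases "x \<in> U")
      case True
      have "closed (- U)" using U by auto
      then have "infdist x (- U) ~= 0" using True False in_closed_iff_infdist_zero by fastforce
      then have d: "0 < infdist x (- U)" using infdist_nonneg[of x "- U"] by linarith
      have "eventually (%n. 1 / infdist x (- U) <= real n) sequentially"
       by (rule filterlim_real_sequentially[unfolded filterlim_at_top, rule_format])
      then have "eventually (%n. min 1 (real n * infdist x (- U)) = ind U x) sequentially"
       by eventually_elim (use d True in \<open>simp add: pos_divide_le_eq min_def\<close>)
      then show ?thesis by (rule tendsto_eventually)
     next
      case False then show ?thesis by simp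
     qed
     show "\<bar>min 1 (real n * infdist x (- U))\<bar> <= 1" for n
      using infdist_nonneg[of x "- U"] by (auto simp: min_def)
    qed (use U sb in auto)
   qed
  next
   case empty then show ?case using P_Lip[OF Lip_b_const[of 0]] by (simp add: indicator_def)
  next
   case (compl A)
   have "(ind (UNIV - A) :: 'a => real) = (%x. 1 + (- 1) * ind A x)"
    by (auto simp: indicator_def)
   then show ?case using P_add[OF P_Lip[OF Lip_b_const[of 1]] P_cmult[OF compl(2), of "- 1"]] by simp
  next
   case (union F)
   have Fm: "F i \<in> sets M" for i using union(2) sb by (auto simp: borel_def)
   have fsum: "P (%x. \<Sum>i<n. ind (F i) x)" for n
   proof (induct n)
    case 0 then show ?case using P_Lip[OF Lip_b_const[of 0]] by simp
   next
    case (Suc n) then show ?case using P_add[OF Suc union(3)[of n]] by simp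
   qed
   have dj: "(\<Sum>i<n. ind (F i) x) = (ind (\<Union>i<n. F i) x :: real)" for n x
    using union(1) by (intro indicator_UN_disjoint[symmetric]) (auto intro: disjoint_family_on_mono)
   show ?case
   proof (rule P_lim[OF fsum, where g="%_. 1"])
    show "(%n. (\<Sum>i<n. ind (F i) x) :: real) \<longlonglongrightarrow> ind (\<Union> (range F)) x" for x
     unfolding dj by (rule LIMSEQ_indicator_UN)
    show "\<bar>\<Sum>i<n. ind (F i) x :: real\<bar> <= 1" for n x
     unfolding dj by (simp add: indicator_def)
   qed (use Fm in auto)
  qed
 qed
 have "P f"
  using f
 proof (induct rule: integrable_induct)
  case (base A c)
  have "(%x. ind A x *\<^sub>R c) = (%x. c * ind A x)" by auto
  then show ?case using P_cmult[OF P_ind[OF base(1)], of c] by simp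
 next
  case (add f g) then show ?case by (intro P_add)
 next
  case (lim f s)
  show ?case by (rule P_lim[OF lim(2,3), where g="%x. 2 * \<bar>f x\<bar>"]) (use lim in auto)
 qed
 with e that show ?thesis unfolding P_def by blast
qed


section \<open>Preliminaries on time integrals\<close>

lemma nn_integral_lebesgue_on:
 "S \<in> sets lebesgue ==> (\<integral>\<^sup>+ t\<in>S. f t \<partial>lebesgue) = (\<integral>\<^sup>+ t. f t \<partial>lebesgue_on S)"
 by (simp add: nn_integral_restrict_space)

lemma AE_lebesgue_on: "S \<in> sets lebesgue ==> (AE t in lebesgue_on S. P t) \<longleftrightarrow> (AE t in lebesgue. t \<in> S --> P t)"
 by (simp add: AE_restrict_space_iff)

text \<open>A Bochner integral that does not exist is 0 by convention, so the bound is available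
  before integrability is known.\<close>

lemma norm_integral_le_nn: "ennreal \<bar>\<integral>x. f x \<partial>M\<bar> <= (\<integral>\<^sup>+ x. ennreal \<bar>f x\<bar> \<partial>M)" for f :: "'a => real"
 by (cases "integrable M f") (use integral_norm_bound_ennreal[of M f] in \<open>auto simp: not_integrable_integral_eq\<close>)

lemma signed_integral_bound:
 assumes s: "sets (snd \<mu>) = sets (fst \<mu>)" and h: "h \<in> Bor (fst \<mu>)"
 shows "ennreal \<bar>signed_integral \<mu> S h\<bar> <= (\<integral>\<^sup>+ x. ennreal \<bar>h x\<bar> \<partial>total_var \<mu>)"
proof -
 have b: "ennreal \<bar>LINT x:S|M. h x\<bar> <= (\<integral>\<^sup>+ x. ennreal \<bar>h x\<bar> \<partial>M)" for M
  unfolding set_lebesgue_integral_def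
  by (rule order_trans[OF norm_integral_le_nn]) (intro nn_integral_mono, auto simp: indicator_def)
 have "ennreal \<bar>signed_integral \<mu> S h\<bar> <= ennreal (\<bar>LINT x:S|fst \<mu>. h x\<bar> + \<bar>LINT x:S|snd \<mu>. h x\<bar>)"
  unfolding signed_integral_def by (intro ennreal_leI) linarith
 also have "... = ennreal \<bar>LINT x:S|fst \<mu>. h x\<bar> + ennreal \<bar>LINT x:S|snd \<mu>. h x\<bar>" by simp
 also have "... <= (\<integral>\<^sup>+ x. ennreal \<bar>h x\<bar> \<partial>fst \<mu>) + (\<integral>\<^sup>+ x. ennreal \<bar>h x\<bar> \<partial>snd \<mu>)"
  by (intro add_mono b)
 also have "... = (\<integral>\<^sup>+ x. ennreal \<bar>h x\<bar> \<partial>total_var \<mu>)"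
  unfolding total_var_def using h by (subst nn_integral_add_measure[OF s]) simp_all
 finally show ?thesis .
qed

section \<open>Elementary regularity in time of a reflecting curve\<close>

locale curve = entropy_space \<pi> \<kappa> \<phi> \<psi>s \<alpha>
 for \<pi> :: "'v::{metric_space, second_countable_topology} measure" and \<kappa> \<phi> \<psi>s \<alpha> +
 fixes T :: real and \<rho> :: "real => 'v measure" and j :: "real => ('v \<times> 'v) signed"
 assumes T: "0 < T" and rce: "(\<rho>, j) \<in> RCE \<pi> \<kappa> \<phi> \<psi>s \<alpha> T"
begin

abbreviation "TT \<equiv> lebesgue_on {0..T}"

lemma finite_TT: "finite_measure TT"
proof (rule finite_measureI)
 have "em lebesgue {0..T} = ennreal T" using T by simp
 then show "em TT (space TT) ~= \<infinity>" by (simp add: emeasure_restrict_space space_restrict_space del: emeasure_completion)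
qed

lemma complete_TT: "complete_measure TT"
 by (rule complete_measure_lebesgue_on) simp

sublocale TT: finite_measure TT by (rule finite_TT)
sublocale TTc: complete_measure TT by (rule complete_TT)

lemma space_TT[simp]: "space TT = {0..T}"
 by (simp add: space_restrict_space)

lemma rho_fbm: "t \<in> {0..T} ==> \<rho> t \<in> finite_borel_measures"
 and j_sigma: "t \<in> {0..T} ==> j t \<in> sigma_signed"
 and j_diag: "t \<in> {0..T} ==> em (total_var (j t)) (- offdiag) = 0"
 and j_meas: "measurable_flux T j"
 and j_fin: "(\<integral>\<^sup>+ t. (\<integral>\<^sup>+ (x, y). ennreal (min 1 (dist x y)) \<partial>total_var (j t)) \<partial>TT) < \<infinity>"
 and ce_lip: "satisfies_ce T Lip_b \<rho> j"
 and ent_sup: "(SUP t\<in>{0..T}. Ent (\<rho> t)) < \<infinity>"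
 and dis_fin: "(\<integral>\<^sup>+ t. (Dis (\<rho> t) (j t) + Fis (\<rho> t)) \<partial>TT) < \<infinity>"
 and ce_X2: "satisfies_ce T (X2 \<pi> \<kappa>) \<rho> j"
proof -
 note all = rce[unfolded RCE_def ACE_def CE_def mem_Collect_eq prod.case]
 note ace = conjunct1[OF all] and ce = conjunct1[OF conjunct1[OF all]]
 have S: "{0..T} \<in> sets lebesgue" by simp
 show "\<rho> t \<in> finite_borel_measures" if "t \<in> {0..T}" by (rule bspec[OF conjunct1[OF ce] that])
 note c2 = conjunct2[OF ce]
 show "j t \<in> sigma_signed" if "t \<in> {0..T}" by (rule conjunct1[OF bspec[OF conjunct1[OF c2] that]])
 show "em (total_var (j t)) (- offdiag) = 0" if "t \<in> {0..T}"
  by (rule conjunct2[OF bspec[OF conjunct1[OF c2] that]])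
 note c3 = conjunct2[OF c2]
 show "measurable_flux T j" by (rule conjunct1[OF c3])
 show "(\<integral>\<^sup>+ t. (\<integral>\<^sup>+ (x, y). ennreal (min 1 (dist x y)) \<partial>total_var (j t)) \<partial>TT) < \<infinity>"
  unfolding nn_integral_lebesgue_on[OF S, symmetric] by (rule conjunct1[OF conjunct2[OF c3]])
 show "satisfies_ce T Lip_b \<rho> j" by (rule conjunct2[OF conjunct2[OF c3]])
 show "(SUP t\<in>{0..T}. Ent (\<rho> t)) < \<infinity>" by (rule conjunct1[OF conjunct2[OF ace]])
 show "(\<integral>\<^sup>+ t. (Dis (\<rho> t) (j t) + Fis (\<rho> t)) \<partial>TT) < \<infinity>"
  unfolding nn_integral_lebesgue_on[OF S, symmetric] by (rule conjunct2[OF conjunct2[OF ace]])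
 show "satisfies_ce T (X2 \<pi> \<kappa>) \<rho> j" by (rule conjunct2[OF conjunct2[OF all]])
qed

lemma ent_fin: "t \<in> {0..T} ==> Ent (\<rho> t) < \<infinity>"
 by (rule le_less_trans[OF SUP_upper ent_sup])

lemma rho_ac: "t \<in> {0..T} ==> absolutely_continuous \<pi> (\<rho> t)"
 using ent_fin[of t] by (auto simp: entropy_def split: if_splits)

definition u :: "real => 'v => real" where "u t = pos_deriv \<pi> (\<rho> t)"

lemma u_meas[measurable]: "u t \<in> Bor borel" and u_nonneg[simp]: "0 <= u t x"
 by (simp_all add: u_def)

lemma rho_sets: "t \<in> {0..T} ==> sets (\<rho> t) = sets borel"
 and rho_finite: "t \<in> {0..T} ==> finite_measure (\<rho> t)"
 using rho_fbm by (auto simp: finite_borel_measures_def)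

lemma rho_dens: assumes "t \<in> {0..T}" shows "\<rho> t = dens (u t)"
 unfolding dens_def u_def
proof (rule pos_deriv_density[symmetric])
 show "sigma_finite_measure (\<rho> t)" using rho_finite[OF assms] by (rule finite_measure.axioms)
qed (use assms rho_sets rho_ac in \<open>simp_all add: pi.sigma_finite_measure_axioms\<close>)

lemma integral_rho:
 fixes f :: "'v => real"
 assumes "t \<in> {0..T}" "f \<in> Bor borel"
 shows "(\<integral>x. f x \<partial>\<rho> t) = (\<integral>x. u t x * f x \<partial>\<pi>)" "integrable (\<rho> t) f \<longleftrightarrow> integrable \<pi> (%x. u t x * f x)"
 using assms(2) unfolding rho_dens[OF assms(1)] dens_def
 by (simp_all add: integral_real_density integrable_real_density measurable_pi_borel)

lemma u_integrable: assumes "t \<in> {0..T}" shows "integrable \<pi> (u t)"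
proof -
 interpret finite_measure "\<rho> t" by (rule rho_finite[OF assms])
 have "integrable (\<rho> t) (%x. 1::real)" by simp
 then show ?thesis using integral_rho(2)[OF assms, of "%_. 1"] by simp
qed

definition mass :: "real => ennreal" where
 "mass t = (\<integral>\<^sup>+ p. ennreal (min 1 (dist (fst p) (snd p))) \<partial>total_var (j t))"

lemma tv_sets: "t \<in> {0..T} ==> sets (total_var (j t)) = sets borel"
 using sigma_signedD(3)[OF j_sigma] .

lemma min_dist1_measurable[measurable]:
 "(%p :: 'v \<times> 'v. min 1 (dist (fst p) (snd p))) \<in> Bor borel"
 by (intro borel_measurable_continuous_onI continuous_intros)

lemma j_emeasure_meas:
 assumes "B \<in> sets borel"
 shows "(%t. em (fst (j t)) B) \<in> Bor TT" "(%t. em (snd (j t)) B) \<in> Bor TT"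
 using j_meas assms by (auto simp: measurable_flux_def)

lemma tv_emeasure_meas:
 assumes B: "B \<in> sets borel"
 shows "(%t. em (total_var (j t)) B) \<in> Bor TT"
proof -
 have "em (total_var (j t)) B = em (fst (j t)) B + em (snd (j t)) B" if "t \<in> {0..T}" for t
  unfolding total_var_def using sigma_signedD(1,2)[OF j_sigma[OF that]] B by (subst emeasure_add_measure) auto
 note e = this
 show ?thesis
  by (subst measurable_cong[OF e]) (use j_emeasure_meas[OF B] in simp_all)
qed

lemma tv_nn_integral_meas:
 assumes "h \<in> Bor borel"
 shows "(%t. \<integral>\<^sup>+ p. h p \<partial>total_var (j t)) \<in> Bor TT"
 using tv_sets tv_emeasure_meas assms by (intro nn_integral_measurable_of_emeasure[where N=borel]) auto

lemma mass_meas[measurable]: "mass \<in> Bor TT"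
 unfolding mass_def[abs_def] by (intro tv_nn_integral_meas) simp

lemma mass_fin: "(\<integral>\<^sup>+ t. mass t \<partial>TT) < \<infinity>"
 using j_fin by (simp add: mass_def split_def)

lemma AE_mass: "AE t in TT. mass t < \<infinity>"
 using nn_integral_PInf_AE[OF mass_meas] mass_fin by (simp add: top.not_eq_extremum)

lemma mass_integrable: "integrable TT (%t. enn2real (mass t))"
proof (rule integrableI_bounded)
 have "(\<integral>\<^sup>+ t. ennreal (norm (enn2real (mass t))) \<partial>TT) <= (\<integral>\<^sup>+ t. mass t \<partial>TT)"
  by (intro nn_integral_mono) (simp add: ennreal_enn2real_if)
 with mass_fin show "(\<integral>\<^sup>+ t. ennreal (norm (enn2real (mass t))) \<partial>TT) < \<infinity>" by (rule le_less_trans[rotated])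
qed simp

lemma indefinite_integral_continuous_TT:
 fixes G :: "real => real"
 assumes "integrable TT G"
 shows "continuous_on {0..T} (%t. LINT r:{0..t}|lebesgue. G r)"
  and "!!s t. 0 <= s ==> s <= t ==> t <= T ==> set_integrable lebesgue {s..t} G"
  and "!!s t. 0 <= s ==> s <= t ==> t <= T ==>
   (LINT r:{s..t}|lebesgue. G r) = (LINT r:{0..t}|lebesgue. G r) - (LINT r:{0..s}|lebesgue. G r)"
proof -
 have si: "set_integrable lebesgue {0..T} G"
  using assms by (simp add: set_integrable_def integrable_restrict_space)
 show sub: "set_integrable lebesgue {s..t} G" if "0 <= s" "s <= t" "t <= T" for s t
  using that by (intro set_integrable_subset[OF si]) auto
 have e: "(LINT r:{s..t}|lebesgue. G r) = integral {s..t} G" "G integrable_on {s..t}"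
  if "0 <= s" "s <= t" "t <= T" for s t
  using set_lebesgue_integral_eq_integral[OF sub[OF that]] by auto
 have "continuous_on {0..T} (%t. integral {0..t} G)"
  using e(2)[of 0 T] T by (intro indefinite_integral_continuous_1) auto
 then show "continuous_on {0..T} (%t. LINT r:{0..t}|lebesgue. G r)"
  by (rule continuous_on_eq) (simp add: e)
 show "(LINT r:{s..t}|lebesgue. G r) = (LINT r:{0..t}|lebesgue. G r) - (LINT r:{0..s}|lebesgue. G r)"
  if "0 <= s" "s <= t" "t <= T" for s t
  using that e Henstock_Kurzweil_Integration.integral_combine[of 0 s t G] by simp
qed

lemma time_integral_bound:
 fixes F G :: "real => real"
 assumes G: "integrable TT G" and b: "AE r in TT. \<bar>F r\<bar> <= G r" and st: "0 <= s" "s <= t" "t <= T"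
 shows "\<bar>LINT r:{s..t}|lebesgue. F r\<bar> <= (LINT r:{s..t}|lebesgue. G r)"
proof -
 have gi: "set_integrable lebesgue {s..t} G" using indefinite_integral_continuous_TT(2)[OF G st] .
 have ae: "AE r in lebesgue. \<bar>ind {s..t} r * F r\<bar> <= ind {s..t} r * G r"
  using b unfolding AE_lebesgue_on[of "{0..T}", simplified]
  by eventually_elim (use st in \<open>auto simp: indicator_def\<close>)
 have "ennreal \<bar>LINT r:{s..t}|lebesgue. F r\<bar> <= (\<integral>\<^sup>+ r. ennreal \<bar>ind {s..t} r * F r\<bar> \<partial>lebesgue)"
  unfolding set_lebesgue_integral_def real_scaleR_def by (rule norm_integral_le_nn)
 also have "... <= (\<integral>\<^sup>+ r. ennreal (ind {s..t} r * G r) \<partial>lebesgue)"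
  using ae by (intro nn_integral_mono_AE) (auto elim!: eventually_mono intro: ennreal_leI)
 also have "... = ennreal (LINT r:{s..t}|lebesgue. G r)"
  unfolding set_lebesgue_integral_def real_scaleR_def
  using gi ae by (intro nn_integral_eq_integral)
   (auto simp: set_integrable_def elim!: eventually_mono)
 finally have "ennreal \<bar>LINT r:{s..t}|lebesgue. F r\<bar> <= ennreal (LINT r:{s..t}|lebesgue. G r)" .
 moreover have "0 <= (LINT r:{s..t}|lebesgue. G r)"
  unfolding set_lebesgue_integral_def real_scaleR_def
  using ae by (intro integral_nonneg_AE) (auto elim!: eventually_mono)
 ultimately show ?thesis by (simp add: ennreal_le_iff)
qed

lemma ograd_measurable: "f \<in> Bor borel ==> ograd f \<in> Bor (borel :: ('v \<times> 'v) measure)"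
 unfolding ograd_def split_def
 by (intro borel_measurable_diff measurable_compose[OF borel_measurable_fst_snd(1)]
   measurable_compose[OF borel_measurable_fst_snd(2)])

lemma si_bound:
 assumes "t \<in> {0..T}" "h \<in> Bor borel"
 shows "ennreal \<bar>signed_integral (j t) S h\<bar> <= (\<integral>\<^sup>+ p. ennreal \<bar>h p\<bar> \<partial>total_var (j t))"
 using sigma_signedD(1,2)[OF j_sigma[OF assms(1)]] assms(2)
 by (intro signed_integral_bound) (auto cong: measurable_cong_sets)

lemma Lip_ograd_bound:
 assumes "f \<in> Lip_b"
 obtains K where "0 <= K" "!!p :: 'v \<times> 'v. \<bar>ograd f p\<bar> <= K * min 1 (dist (fst p) (snd p))"
proof -
 obtain L B where f: "L-lipschitz_on UNIV f" "0 <= B" "!!x. \<bar>f x\<bar> <= B" using Lip_bE[OF assms] by metis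
 have L: "0 <= L" using lipschitz_on_nonneg[OF f(1)] .
 have "\<bar>ograd f p\<bar> <= (2 * B + L) * min 1 (dist (fst p) (snd p))" for p :: "'v \<times> 'v"
 proof -
  obtain x y where p: "p = (x, y)" by (cases p)
  have 1: "\<bar>f y - f x\<bar> <= L * dist x y"
   using lipschitz_onD[OF f(1), of x y] by (simp add: dist_real_def abs_minus_commute)
  have 2: "\<bar>f y - f x\<bar> <= 2 * B" using f(3)[of x] f(3)[of y] by linarith
  show ?thesis
  proof (cases "dist x y <= 1")
   case True
   have "0 <= 2 * B * dist x y" using f(2) by simp
   with True 1 show ?thesis by (simp add: p ograd_def algebra_simps)
  next
   case False then show ?thesis using 2 L by (simp add: p ograd_def)
  qed
 qed
 then show ?thesis using that[of "2 * B + L"] f(2) L by simp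
qed

text \<open>By the continuity equation, the primitive of a multiple of the flux mass serves as a
  modulus of continuity.\<close>

lemma rho_continuous_Lip:
 assumes f: "f \<in> Lip_b"
 shows "continuous_on {0..T} (%t. \<integral>x. f x \<partial>\<rho> t)"
proof -
 obtain K where K: "0 <= K" "!!p :: 'v \<times> 'v. \<bar>ograd f p\<bar> <= K * min 1 (dist (fst p) (snd p))"
  using Lip_ograd_bound[OF f] by metis
 note [measurable] = Lip_b_borel[OF f]
 let ?G = "%t. K * enn2real (mass t)"
 have Gi: "integrable TT ?G" using mass_integrable by simp
 have ae: "AE r in TT. \<bar>signed_integral (j r) offdiag (ograd f)\<bar> <= ?G r"
  using AE_mass AE_space
 proof eventually_elim
  case (elim r)
  then have r: "r \<in> {0..T}" by simp
  have "ennreal \<bar>signed_integral (j r) offdiag (ograd f)\<bar> <= (\<integral>\<^sup>+ p. ennreal \<bar>ograd f p\<bar> \<partial>total_var (j r))"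
   by (intro si_bound r ograd_measurable) simp
  also have "... <= (\<integral>\<^sup>+ p. ennreal K * ennreal (min 1 (dist (fst p) (snd p))) \<partial>total_var (j r))"
   using K by (intro nn_integral_mono) (auto simp: ennreal_mult[symmetric] intro!: ennreal_leI)
  also have "... = ennreal K * mass r"
   unfolding mass_def using tv_sets[OF r]
   by (intro nn_integral_cmult) (simp cong: measurable_cong_sets)
  also have "... = ennreal (?G r)" using elim(1) K(1) by (simp add: ennreal_mult ennreal_enn2real_if)
  finally show ?case using K(1) by (simp add: ennreal_le_iff)
 qed
 let ?\<Gamma> = "%t. LINT r:{0..t}|lebesgue. ?G r"
 have b: "\<bar>(\<integral>x. f x \<partial>\<rho> t) - (\<integral>x. f x \<partial>\<rho> s)\<bar> <= \<bar>?\<Gamma> t - ?\<Gamma> s\<bar>" if "s \<in> {0..T}" "t \<in> {0..T}" "s <= t" for s t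
 proof -
  have st: "0 <= s" "s <= t" "t <= T" using that by auto
  have "(\<integral>x. f x \<partial>\<rho> t) - (\<integral>x. f x \<partial>\<rho> s) = (LINT r:{s..t}|lebesgue. signed_integral (j r) offdiag (ograd f))"
   using ce_lip f st unfolding satisfies_ce_def by blast
  with time_integral_bound[OF Gi ae st] indefinite_integral_continuous_TT(3)[OF Gi st]
  show ?thesis by linarith
 qed
 have b': "dist (\<integral>x. f x \<partial>\<rho> t) (\<integral>x. f x \<partial>\<rho> s) <= dist (?\<Gamma> t) (?\<Gamma> s)" if "s \<in> {0..T}" "t \<in> {0..T}" for s t
  using b[of s t] b[of t s] that by (cases "s <= t") (auto simp: dist_real_def abs_minus_commute)
 have "continuous_on {0..T} ?\<Gamma>" by (rule indefinite_integral_continuous_TT(1)[OF Gi])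
 then show ?thesis
  unfolding continuous_on_iff using b' by (meson le_less_trans)
qed

lemma AE_TT_ex:
 assumes "AE t in TT. P t" "0 <= a" "a < b" "b <= T"
 shows "\<exists>t. a < t & t < b & P t"
proof (rule ccontr)
 assume n: "~ ?thesis"
 have "AE t in lebesgue. t \<in> {0..T} --> P t" using assms(1) by (simp add: AE_lebesgue_on)
 then have "AE t in lebesgue. t \<notin> {a<..<b}"
  by eventually_elim (use n assms in auto)
 then have "{a<..<b} \<in> null_sets lebesgue" by (simp add: AE_iff_null_sets)
 then show False using assms(3) by (auto simp: null_sets_def)
qed

lemma AE_TT_seq:
 assumes "AE t in TT. P t" "b \<in> {0..T}"
 obtains s where "!!n::nat. s n \<in> {0..T}" "!!n. P (s n)" "s \<longlonglongrightarrow> b"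
proof -
 have "\<exists>t. t \<in> {0..T} & P t & dist t b < 1 / real (Suc n)" for n
 proof (cases "b < T")
  case True
  define c where "c = min T (b + 1 / real (Suc n))"
  have "b < c" "c <= T" "c <= b + 1 / real (Suc n)" using True by (auto simp: c_def)
  then obtain t where "b < t" "t < c" "P t" using AE_TT_ex[OF assms(1), of b c] assms(2) by auto
  then show ?thesis using \<open>c <= T\<close> \<open>c <= b + _\<close> assms(2)
   by (intro exI[of _ t]) (auto simp: dist_real_def)
 next
  case False
  then have bT: "b = T" using assms(2) by auto
  define c where "c = max 0 (b - 1 / real (Suc n))"
  have "c < b" "0 <= c" "b - 1 / real (Suc n) <= c" using bT T by (auto simp: c_def)
  then obtain t where "c < t" "t < b" "P t" using AE_TT_ex[OF assms(1), of c b] bT by auto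
  then show ?thesis using \<open>0 <= c\<close> \<open>b - _ <= c\<close> bT
   by (intro exI[of _ t]) (auto simp: dist_real_def)
 qed
 then obtain s where s: "!!n. s n \<in> {0..T}" "!!n. P (s n)" "!!n. dist (s n) b < 1 / real (Suc n)" by metis
 have "s \<longlonglongrightarrow> b"
 proof (rule tendsto_dist_iff[THEN iffD2], rule tendsto_sandwich[OF _ _ tendsto_const])
  show "(%n. 1 / real (Suc n)) \<longlonglongrightarrow> 0" by (rule LIMSEQ_Suc[OF lim_1_over_n])
  show "\<forall>\<^sub>F n in sequentially. dist (s n) b <= 1 / real (Suc n)"
   using s(3) by (intro always_eventually allI less_imp_le)
 qed simp
 with s show ?thesis by (intro that)
qed

end

context curve
begin

section \<open>Structure of a reflecting curve\<close>

text \<open>\<open>RCE\<close> bounds the density at a.e. time only. Weak continuity carries the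
  resulting bound on integrals of nonnegative functions in \<open>Lip_b\<close> to every time, end
  points included. Density of \<open>Lip_b\<close> then admits the indicator of the set where
  \<open>u t\<close> exceeds \<open>C\<close> as a test function.\<close>

lemma density_bound_ex: "\<exists>C\<ge>0. \<forall>t\<in>{0..T}. AE x in \<pi>. u t x <= C"
proof -
 obtain C0 where C0: "AE t\<in>{0<..<T} in lebesgue. AE x in \<pi>. pos_deriv \<pi> (\<rho> t) x <= C0"
  using rce[unfolded RCE_def mem_Collect_eq prod.case] by blast
 define C where "C = max C0 0"
 have "AE t in lebesgue. t \<notin> {0, T}"
  by (intro AE_not_in null_sets_completionI countable_imp_null_set_lborel) simp
 with C0 have "AE t in lebesgue. t \<in> {0..T} --> (AE x in \<pi>. u t x <= C)"
 proof eventually_elim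
  case (elim t)
  show ?case
  proof
   assume "t \<in> {0..T}"
   then have "AE x in \<pi>. pos_deriv \<pi> (\<rho> t) x <= C0" using elim by auto
   then show "AE x in \<pi>. u t x <= C" by eventually_elim (simp add: u_def C_def)
  qed
 qed
 then have ae: "AE t in TT. AE x in \<pi>. u t x <= C" by (simp add: AE_lebesgue_on)
 have lip: "(\<integral>x. f x \<partial>\<rho> t) <= C * (\<integral>x. f x \<partial>\<pi>)" if t: "t \<in> {0..T}" and f: "f \<in> Lip_b" "!!x. 0 <= f x" for f t
 proof -
  obtain s where s: "!!n::nat. s n \<in> {0..T}" "!!n. AE x in \<pi>. u (s n) x <= C" "s \<longlonglongrightarrow> t"
   using AE_TT_seq[OF ae t] by metis
  note fm = Lip_b_borel[OF f(1)]
  have fi: "integrable \<pi> f" by (rule Lip_b_integrable[OF fin_pi sets_pi f(1)])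
  have le: "(\<integral>x. f x \<partial>\<rho> (s n)) <= C * (\<integral>x. f x \<partial>\<pi>)" for n
  proof -
   have "(\<integral>x. f x \<partial>\<rho> (s n)) = (\<integral>x. u (s n) x * f x \<partial>\<pi>)" by (rule integral_rho(1)[OF s(1) fm])
   also have "... <= (\<integral>x. C * f x \<partial>\<pi>)"
   proof (rule integral_mono_AE)
    show "integrable \<pi> (%x. u (s n) x * f x)"
     using Lip_b_integrable[OF rho_finite[OF s(1)] rho_sets[OF s(1)] f(1)] integral_rho(2)[OF s(1) fm] by simp
    show "AE x in \<pi>. u (s n) x * f x <= C * f x"
     using s(2)[of n] by eventually_elim (rule mult_right_mono[OF _ f(2)])
   qed (use fi in simp)
   finally show ?thesis by simp
  qed
  have "(%n. \<integral>x. f x \<partial>\<rho> (s n)) \<longlonglongrightarrow> (\<integral>x. f x \<partial>\<rho> t)"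
   by (rule continuous_on_tendsto_compose[OF rho_continuous_Lip[OF f(1)] s(3) t]) (use s(1) in simp)
  then show ?thesis by (rule LIMSEQ_le_const2) (use le in auto)
 qed
 have "AE x in \<pi>. u t x <= C" if t: "t \<in> {0..T}" for t
 proof -
  define B where "B = {x. C < u t x}"
  have B[measurable]: "B \<in> sets borel" unfolding B_def by measurable
  \<comment> \<open>Approximation in L1 of this measure is approximation for \<pi> and for
    \<open>\<rho> t\<close> at once.\<close>
  define M where "M = dens (%x. 1 + u t x)"
  have ui: "integrable \<pi> (u t)" by (rule u_integrable[OF t])
  have Mfin: "finite_measure M"
  proof (rule finite_measureI)
   have "em M (space M) = (\<integral>\<^sup>+ x. ennreal (1 + u t x) \<partial>\<pi>)"
    unfolding M_def dens_def using nn_integral_density[of "%x. ennreal (1 + u t x)" \<pi> "%_. 1"] by simp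
   also have "... < \<infinity>"
   proof -
    have "integrable \<pi> (%x. 1 + u t x)" using ui by simp
    then have "(\<integral>\<^sup>+ x. ennreal (norm (1 + u t x)) \<partial>\<pi>) < \<infinity>" by (simp add: integrable_iff_bounded)
    then show ?thesis by simp
   qed
   finally show "em M (space M) ~= \<infinity>" by simp
  qed
  have Ms: "sets M = sets borel" by (simp add: M_def dens_def)
  have iM: "(\<integral>x. f x \<partial>M) = (\<integral>x. (1 + u t x) * f x \<partial>\<pi>)" "integrable M f \<longleftrightarrow> integrable \<pi> (%x. (1 + u t x) * f x)"
   if "f \<in> Bor borel" for f :: "'v => real"
   using that unfolding M_def dens_def
   by (subst integral_real_density integrable_real_density; auto simp: measurable_pi_borel)+
  have bi: "integrable \<pi> (%x. u t x * h x)" "integrable \<pi> h"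
   if h: "h \<in> Bor borel" "!!x. \<bar>h x\<bar> <= K" for h :: "'v => real" and K
  proof -
   have "\<bar>u t x * h x\<bar> <= K * u t x" for x
    using h(2)[of x] u_nonneg[of t x] mult_right_mono[of "\<bar>h x\<bar>" K "u t x"] by (simp add: abs_mult mult.commute)
   then have le: "norm (u t x * h x) <= norm (K * u t x)" for x
    unfolding real_norm_def by (rule order_trans[OF _ abs_ge_self])
   have "(%x. u t x * h x) \<in> Bor \<pi>"
    unfolding measurable_pi_borel using h(1) u_meas by (intro borel_measurable_times)
   then show "integrable \<pi> (%x. u t x * h x)"
   proof (rule Bochner_Integration.integrable_bound[of \<pi> "%x. K * u t x", rotated])
    show "integrable \<pi> (%x. K * u t x)" using ui by simp
    show "AE x in \<pi>. norm (u t x * h x) <= norm (K * u t x)" by (rule AE_I2) (rule le)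
   qed
   show "integrable \<pi> h"
    using h by (intro pi.integrable_const_bound[of _ K]) (auto simp: measurable_pi_borel)
  qed
  have iB: "\<bar>ind B x :: real\<bar> <= 1" for x by (simp add: indicator_def)
  have iBm: "(ind B :: 'v => real) \<in> Bor borel" by measurable
  have i1: "integrable \<pi> (%x. u t x * ind B x)" "integrable \<pi> (%x. ind B x :: real)"
   by (rule bi[OF iBm iB])+
  have key: "(\<integral>x. (u t x - C) * ind B x \<partial>\<pi>) <= (1 + C) * e" if e: "0 < e" for e
  proof -
   have Bi: "integrable M (ind B :: 'v => real)"
    using Ms finite_measure.emeasure_finite[OF Mfin] by (intro integrable_real_indicator) (auto simp: top.not_eq_extremum)
   obtain f0 where f0: "f0 \<in> Lip_b" "(\<integral>x. \<bar>ind B x - f0 x\<bar> \<partial>M) < e"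
    using Lip_b_dense[OF Mfin Ms Bi e] .
   define f where "f x = max 0 (f0 x)" for x
   have f: "f \<in> Lip_b" "!!x. 0 <= f x" unfolding f_def using Lip_b_max0[OF f0(1)] by auto
   note fm[measurable] = Lip_b_borel[OF f(1)] and f0m[measurable] = Lip_b_borel[OF f0(1)]
   obtain K where K: "!!x. \<bar>f x\<bar> <= K" using Lip_bE[OF f(1)] by metis
   have dm: "(%x. \<bar>ind B x - f x\<bar>) \<in> Bor borel" by measurable
   have db: "\<bar>\<bar>ind B x - f x\<bar>\<bar> <= 1 + K" for x using K[of x] iB[of x] by linarith
   have "(\<integral>x. \<bar>ind B x - f x\<bar> \<partial>M) <= (\<integral>x. \<bar>ind B x - f0 x\<bar> \<partial>M)"
   proof (rule integral_mono)
    show "integrable M (%x. \<bar>ind B x - f x\<bar>)" "integrable M (%x. \<bar>ind B x - f0 x\<bar>)"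
     by (intro integrable_abs Bochner_Integration.integrable_diff Bi Lip_b_integrable[OF Mfin Ms] f(1) f0(1))+
    show "\<bar>ind B x - f x\<bar> <= \<bar>ind B x - f0 x\<bar>" for x
     by (auto simp: f_def indicator_def)
   qed
   with f0(2) have small: "(\<integral>x. (1 + u t x) * \<bar>ind B x - f x\<bar> \<partial>\<pi>) <= e"
    using iM(1)[OF dm] by simp
   have i2: "integrable \<pi> (%x. u t x * f x)" "integrable \<pi> f" by (rule bi[OF fm K])+
   have i3: "integrable \<pi> (%x. u t x * \<bar>ind B x - f x\<bar>)" "integrable \<pi> (%x. \<bar>ind B x - f x\<bar>)"
    by (rule bi[OF dm db])+
   have sum3: "(\<integral>x. u t x * \<bar>ind B x - f x\<bar> \<partial>\<pi>) + (\<integral>x. \<bar>ind B x - f x\<bar> \<partial>\<pi>) <= e"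
    using small i3 by (simp add: distrib_right)
   have n3: "0 <= (\<integral>x. u t x * \<bar>ind B x - f x\<bar> \<partial>\<pi>)" "0 <= (\<integral>x. \<bar>ind B x - f x\<bar> \<partial>\<pi>)"
    by (auto intro!: integral_nonneg_AE)
   have "(\<integral>x. u t x * ind B x \<partial>\<pi>) <= (\<integral>x. u t x * f x + u t x * \<bar>ind B x - f x\<bar> \<partial>\<pi>)"
   proof (rule integral_mono[OF i1(1) Bochner_Integration.integrable_add[OF i2(1) i3(1)]])
    fix x
    have "u t x * ind B x <= u t x * (f x + \<bar>ind B x - f x\<bar>)"
     by (rule mult_left_mono) auto
    then show "u t x * ind B x <= u t x * f x + u t x * \<bar>ind B x - f x\<bar>"
     by (simp only: distrib_left)
   qed
   also have "... = (\<integral>x. u t x * f x \<partial>\<pi>) + (\<integral>x. u t x * \<bar>ind B x - f x\<bar> \<partial>\<pi>)"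
    using i2 i3 by simp
   finally have 1: "(\<integral>x. u t x * ind B x \<partial>\<pi>) <= (\<integral>x. f x \<partial>\<rho> t) + e"
    unfolding integral_rho(1)[OF t fm] using sum3 n3 by linarith
   have "(\<integral>x. f x \<partial>\<pi>) <= (\<integral>x. ind B x + \<bar>ind B x - f x\<bar> \<partial>\<pi>)"
    by (rule integral_mono[OF i2(2) Bochner_Integration.integrable_add[OF i1(2) i3(2)]]) linarith
   also have "... = (\<integral>x. ind B x \<partial>\<pi>) + (\<integral>x. \<bar>ind B x - f x\<bar> \<partial>\<pi>)" using i1 i3 by simp
   finally have "(\<integral>x. f x \<partial>\<pi>) <= (\<integral>x. ind B x \<partial>\<pi>) + e" using sum3 n3 by linarith
   then have "C * (\<integral>x. f x \<partial>\<pi>) <= C * ((\<integral>x. ind B x \<partial>\<pi>) + e)"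
    by (rule mult_left_mono) (simp add: C_def)
   then have 2: "C * (\<integral>x. f x \<partial>\<pi>) <= C * (\<integral>x. ind B x \<partial>\<pi>) + C * e"
    by (simp only: distrib_left)
   have "(\<integral>x. (u t x - C) * ind B x \<partial>\<pi>) = (\<integral>x. u t x * ind B x \<partial>\<pi>) - C * (\<integral>x. ind B x \<partial>\<pi>)"
    using i1 by (simp add: left_diff_distrib)
   moreover have "(1 + C) * e = e + C * e" by (simp add: distrib_right)
   ultimately show ?thesis using 1 2 lip[OF t f] by linarith
  qed
  have iBC: "integrable \<pi> (%x. (u t x - C) * ind B x)"
   unfolding left_diff_distrib using i1 by simp
  have nn: "0 <= (u t x - C) * ind B x" for x by (simp add: B_def indicator_def)
  have "(\<integral>x. (u t x - C) * ind B x \<partial>\<pi>) <= 0"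
  proof (rule field_le_epsilon)
   fix e :: real assume "0 < e"
   then have "(\<integral>x. (u t x - C) * ind B x \<partial>\<pi>) <= (1 + C) * (e / (1 + C))"
    by (intro key) (auto simp: C_def intro!: divide_pos_pos)
   then show "(\<integral>x. (u t x - C) * ind B x \<partial>\<pi>) <= 0 + e" by (auto simp: C_def split: if_splits)
  qed
  then have "(\<integral>x. (u t x - C) * ind B x \<partial>\<pi>) = 0"
   using nn by (intro antisym integral_nonneg_AE) auto
  then have "AE x in \<pi>. (u t x - C) * ind B x = 0"
   using integral_nonneg_eq_0_iff_AE[OF iBC] nn by simp
  then show ?thesis by eventually_elim (auto simp: B_def indicator_def split: if_splits)
 qed
 then show ?thesis by (intro exI[of _ C]) (auto simp: C_def)
qed

definition C :: real where "C = (SOME C. 0 <= C & (\<forall>t\<in>{0..T}. AE x in \<pi>. u t x <= C))"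

lemma C_nonneg: "0 <= C" and u_le_C: "t \<in> {0..T} ==> AE x in \<pi>. u t x <= C"
proof -
 have *: "0 <= C & (\<forall>t\<in>{0..T}. AE x in \<pi>. u t x <= C)"
  unfolding C_def by (rule someI_ex[OF density_bound_ex])
 show "0 <= C" by (rule conjunct1[OF *])
 show "AE x in \<pi>. u t x <= C" if "t \<in> {0..T}" by (rule bspec[OF conjunct2[OF *] that])
qed

lemma u_mult_integrable:
 fixes h :: "'v => real"
 assumes t: "t \<in> {0..T}" and h: "integrable \<pi> h"
 shows "integrable \<pi> (%x. u t x * h x)"
proof (rule Bochner_Integration.integrable_bound[of \<pi> "%x. C * h x"])
 show "AE x in \<pi>. norm (u t x * h x) <= norm (C * h x)"
  using u_le_C[OF t] by eventually_elim (simp add: abs_mult mult_right_mono C_nonneg)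
 have "h \<in> Bor \<pi>" using h by simp
 then show "(%x. u t x * h x) \<in> Bor \<pi>" unfolding measurable_pi_borel by measurable
qed (use h in simp)

lemma bounded_pi_integrable:
 "f \<in> Bor borel ==> (!!x. \<bar>f x\<bar> <= B) ==> integrable \<pi> (f :: 'v => real)"
 by (intro pi.integrable_const_bound[of _ B]) (auto simp: measurable_pi_borel)

text \<open>The bound of the densities by \<open>C\<close> makes L1 approximation with respect to
  \<pi> uniform in time, so continuity extends from \<open>Lip_b\<close> to bounded Borel functions.
  In particular the mass of every Borel set is continuous in time.\<close>

lemma rho_continuous:
 fixes f :: "'v => real"
 assumes f: "f \<in> Bor borel" "!!x. \<bar>f x\<bar> <= B"
 shows "continuous_on {0..T} (%t. \<integral>x. f x \<partial>\<rho> t)"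
 unfolding continuous_on_iff
proof (intro ballI allI impI)
 fix b e :: real assume b: "b \<in> {0..T}" and e: "0 < e"
 note fi = bounded_pi_integrable[OF f]
 define e' where "e' = e / (3 * (C + 1))"
 have e': "0 < e'" "C * e' < e / 3" using e C_nonneg by (auto simp: e'_def field_simps)
 obtain g where g: "g \<in> Lip_b" "(\<integral>x. \<bar>f x - g x\<bar> \<partial>\<pi>) < e'"
  using Lip_b_dense[OF fin_pi sets_pi fi e'(1)] by metis
 note gm = Lip_b_borel[OF g(1)] and gi = Lip_b_integrable[OF fin_pi sets_pi g(1)]
 have close: "\<bar>(\<integral>x. f x \<partial>\<rho> t) - (\<integral>x. g x \<partial>\<rho> t)\<bar> < e / 3" if t: "t \<in> {0..T}" for t
 proof -
  have "\<bar>(\<integral>x. f x \<partial>\<rho> t) - (\<integral>x. g x \<partial>\<rho> t)\<bar> = \<bar>\<integral>x. u t x * (f x - g x) \<partial>\<pi>\<bar>"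
   using u_mult_integrable[OF t fi] u_mult_integrable[OF t gi] integral_rho(1)[OF t f(1)] integral_rho(1)[OF t gm]
   by (simp add: right_diff_distrib)
  also have "... <= (\<integral>x. C * \<bar>f x - g x\<bar> \<partial>\<pi>)"
  proof (rule order_trans[OF integral_abs_bound integral_mono_AE])
   show "integrable \<pi> (%x. \<bar>u t x * (f x - g x)\<bar>)"
    using u_mult_integrable[OF t, of "%x. f x - g x"] fi gi by simp
   show "AE x in \<pi>. \<bar>u t x * (f x - g x)\<bar> <= C * \<bar>f x - g x\<bar>"
    using u_le_C[OF t] by eventually_elim (simp add: abs_mult mult_right_mono)
  qed (use fi gi in simp)
  also have "... = C * (\<integral>x. \<bar>f x - g x\<bar> \<partial>\<pi>)" by simp
  also have "... <= C * e'" using g(2) C_nonneg by (intro mult_left_mono) auto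
  finally show ?thesis using e'(2) by simp
 qed
 obtain d where d: "0 < d" "!!t. t \<in> {0..T} ==> dist t b < d ==> dist (\<integral>x. g x \<partial>\<rho> t) (\<integral>x. g x \<partial>\<rho> b) < e / 3"
  using rho_continuous_Lip[OF g(1)] b e unfolding continuous_on_iff by (metis divide_pos_pos zero_less_numeral)
 show "\<exists>d>0. \<forall>t\<in>{0..T}. dist t b < d --> dist (\<integral>x. f x \<partial>\<rho> t) (\<integral>x. f x \<partial>\<rho> b) < e"
 proof (intro exI[of _ d] conjI ballI impI d(1))
  fix t assume t: "t \<in> {0..T}" "dist t b < d"
  show "dist (\<integral>x. f x \<partial>\<rho> t) (\<integral>x. f x \<partial>\<rho> b) < e"
   using d(2)[OF t] close[OF t(1)] close[OF b] unfolding dist_real_def by linarith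
 qed
qed

abbreviation "TB \<equiv> restrict_space lborel {0..T}"

text \<open>Continuity of the mass of each Borel set makes \<rho> a kernel over Borel time, so the
  densities have a jointly Borel version. It is cut off at \<open>C\<close> and set to 0 outside
  \<open>[0,T]\<close>, so that its bounds hold everywhere. Borel rather than Lebesgue measurability
  is kept because translations of time are composed with it later.\<close>

lemma joint_density_ex:
 "\<exists>U. U \<in> Bor (borel :: (real \<times> 'v) measure) & (\<forall>p. 0 <= U p & U p <= C) &
  (AE t in TT. AE x in \<pi>. u t x = U (t, x))"
proof -
 have sTB: "space TB = {0..T}" by (simp add: space_restrict_space)
 have finTB: "finite_measure TB"
 proof (rule finite_measureI)
  show "em TB (space TB) ~= \<infinity>" using T unfolding sTB by (subst emeasure_restrict_space) auto
 qed
 have sb: "sets TB = sets (restrict_space borel {0..T})" by (rule sets_restrict_space_cong) simp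
 have k: "finite_kernel TB borel \<rho>"
  unfolding finite_kernel_def sTB
 proof (intro conjI ballI)
  fix B :: "'v set" assume B: "B \<in> sets borel"
  have e: "em (\<rho> t) B = ennreal (\<integral>x. ind B x \<partial>\<rho> t)" if "t \<in> space TB" for t
  proof -
   interpret finite_measure "\<rho> t" by (rule rho_finite) (use that sTB in simp)
   show ?thesis using rho_sets[of t] that B unfolding sTB by (simp add: emeasure_eq_measure)
  qed
  have "continuous_on {0..T} (%t. \<integral>x. ind B x \<partial>\<rho> t :: real)"
   using B by (intro rho_continuous[of _ 1]) (auto simp: indicator_def)
  then have "(%t. \<integral>x. ind B x \<partial>\<rho> t :: real) \<in> Bor (restrict_space borel {0..T})"
   by (rule borel_measurable_continuous_on_restrict)
  then have "(%t. \<integral>x. ind B x \<partial>\<rho> t :: real) \<in> Bor TB"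
   by (simp add: measurable_cong_sets[OF sb refl])
  then show "(%t. em (\<rho> t) B) \<in> Bor TB"
   by (subst measurable_cong[OF e]) simp_all
 qed (auto simp: rho_sets rho_finite)
 have kp: "finite_kernel TB borel (%_. \<pi>)" by (rule finite_kernel_const[OF fin_pi sets_pi])
 have acs: "AE t in TB. absolutely_continuous \<pi> (\<rho> t)"
  by (rule AE_I2) (use rho_ac sTB in simp)
 obtain f where f: "f \<in> Bor (TB \<Otimes>\<^sub>M borel)" "AE t in TB. \<rho> t = density \<pi> (%y. f (t, y))"
  using kernel_density[OF finTB k kp acs] by metis
 define U where "U p = (if fst p \<in> {0..T} then min C (enn2real (f p)) else 0)" for p
 have "U \<in> Bor (borel :: (real \<times> 'v) measure)"
 proof -
  \<comment> \<open>\<open>f\<close> is measurable only over times in \<open>[0,T]\<close>. Sending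
    all other times to 0 makes the composition Borel on the whole line without changing the values
    that count.\<close>
  let ?r = "%p :: real \<times> 'v. (if fst p \<in> {0..T} then fst p else 0, snd p)"
  have "(%p :: real \<times> 'v. if fst p \<in> {0..T} then fst p else 0) \<in> borel \<rightarrow>\<^sub>M TB"
   using T by (intro measurable_restrict_space2) (auto simp: measurable_lborel1)
  then have "?r \<in> borel \<rightarrow>\<^sub>M TB \<Otimes>\<^sub>M borel" by (rule measurable_Pair) (rule borel_measurable_fst_snd(2))
  from measurable_compose[OF this f(1)]
  have [measurable]: "(%p. f (?r p)) \<in> Bor borel" .
  have "(%p. if fst p \<in> {0..T} then min C (enn2real (f (?r p))) else 0) \<in> Bor (borel :: (real \<times> 'v) measure)"
   by measurable
  moreover have "U = (%p. if fst p \<in> {0..T} then min C (enn2real (f (?r p))) else 0)"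
   by (auto simp: U_def fun_eq_iff)
  ultimately show ?thesis by simp
 qed
 moreover have "0 <= U p & U p <= C" for p by (auto simp: U_def C_nonneg)
 moreover have "AE t in TT. AE x in \<pi>. u t x = U (t, x)"
 proof -
  have "AE t in TB. AE x in \<pi>. u t x = U (t, x)"
   using f(2) AE_space
  proof eventually_elim
   case (elim t)
   then have t: "t \<in> {0..T}" by (simp add: sTB)
   have "(%y. f (t, y)) \<in> Bor borel"
    using f(1) elim(2) by measurable
   then have ft: "(%y. f (t, y)) \<in> Bor \<pi>" by (simp add: measurable_pi_borel)
   have "density \<pi> (%y. f (t, y)) = density \<pi> (%y. ennreal (u t y))"
    using elim(1) rho_dens[OF t] by (simp add: dens_def)
   then have "AE y in \<pi>. f (t, y) = ennreal (u t y)"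
    using ft by (subst (asm) pi.density_unique_iff) (simp_all add: measurable_pi_borel)
   with u_le_C[OF t] show ?case
    by eventually_elim (use t in \<open>simp add: U_def\<close>)
  qed
  then have "AE t in lborel. t \<in> {0..T} --> (AE x in \<pi>. u t x = U (t, x))"
   by (simp add: AE_restrict_space_iff)
  then have "AE t in lebesgue. t \<in> {0..T} --> (AE x in \<pi>. u t x = U (t, x))"
   by (rule AE_completion)
  then show ?thesis by (simp add: AE_lebesgue_on)
 qed
 ultimately show ?thesis by blast
qed

definition U :: "real \<times> 'v => real" where
 "U = (SOME U. U \<in> Bor (borel :: (real \<times> 'v) measure) & (\<forall>p. 0 <= U p & U p <= C) &
  (AE t in TT. AE x in \<pi>. u t x = U (t, x)))"

lemma U_meas[measurable]: "U \<in> Bor borel" and U_nonneg[simp]: "0 <= U p" and U_le: "U p <= C"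
 and u_eq_U: "AE t in TT. AE x in \<pi>. u t x = U (t, x)"
 using someI_ex[OF joint_density_ex] unfolding U_def[symmetric] by blast+

definition A :: "real => 'v \<times> 'v => real" where "A t p = \<alpha> (U (t, fst p), U (t, snd p))"

definition \<nu> :: "real => ('v \<times> 'v) measure" where "\<nu> t = flux_ref \<pi> \<kappa> \<alpha> (\<rho> t)"

lemma U_section_meas:
 "(%q::real \<times> ('v \<times> 'v). U (fst q, fst (snd q))) \<in> Bor (borel \<Otimes>\<^sub>M borel)"
 "(%q::real \<times> ('v \<times> 'v). U (fst q, snd (snd q))) \<in> Bor (borel \<Otimes>\<^sub>M borel)"
proof -
 have p: "(%q::real \<times> ('v \<times> 'v). (fst q, fst (snd q))) \<in> borel \<Otimes>\<^sub>M borel \<rightarrow>\<^sub>M (borel :: (real \<times> 'v) measure)"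
  "(%q::real \<times> ('v \<times> 'v). (fst q, snd (snd q))) \<in> borel \<Otimes>\<^sub>M borel \<rightarrow>\<^sub>M (borel :: (real \<times> 'v) measure)"
  unfolding borel_prod by (auto intro!: borel_measurable_continuous_onI continuous_intros)
 show "(%q::real \<times> ('v \<times> 'v). U (fst q, fst (snd q))) \<in> Bor (borel \<Otimes>\<^sub>M borel)"
  "(%q::real \<times> ('v \<times> 'v). U (fst q, snd (snd q))) \<in> Bor (borel \<Otimes>\<^sub>M borel)"
  using measurable_compose[OF p(1) U_meas] measurable_compose[OF p(2) U_meas] by simp_all
qed

lemma U_fixed_meas[measurable]: "(%x. U (t, x)) \<in> Bor borel"
 by (rule measurable_compose[OF _ U_meas]) (auto intro!: borel_measurable_continuous_onI continuous_intros)

lemma measurable_edge_borel: "Bor \<theta> = Bor borel"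
 by (intro measurable_cong_sets) simp_all

lemma A_joint_meas: "(%q. A (fst q) (snd q)) \<in> Bor (borel \<Otimes>\<^sub>M borel)"
 unfolding A_def by (intro alpha_measurable U_section_meas) simp_all

lemma A_meas[measurable]: "A t \<in> Bor borel"
 unfolding A_def[abs_def]
 by (intro alpha_measurable measurable_compose[OF borel_measurable_fst_snd(1) U_fixed_meas]
   measurable_compose[OF borel_measurable_fst_snd(2) U_fixed_meas]) simp_all

lemma A_nonneg[simp]: "0 <= A t p"
 by (simp add: A_def alpha_nonneg)

lemma A_bounded: obtains K where "0 <= K" "!!t p. A t p <= K"
proof -
 obtain K where "0 <= K" "!!u v. 0 <= u ==> u <= C ==> 0 <= v ==> v <= C ==> \<alpha> (u, v) <= K"
  using alpha_bounded[of C] by metis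
 then show ?thesis using that[of K] U_le by (simp add: A_def)
qed

lemma nu_meas_fun: "(%p. \<alpha> (u t (fst p), u t (snd p))) \<in> Bor borel"
 by (intro alpha_measurable measurable_compose[OF borel_measurable_fst_snd(1) u_meas]
   measurable_compose[OF borel_measurable_fst_snd(2) u_meas]) simp_all

lemma nu_def': "\<nu> t = density \<theta> (%p. ennreal (\<alpha> (u t (fst p), u t (snd p))))"
 by (simp add: \<nu>_def flux_ref_def u_def split_def)

lemma sets_nu[simp]: "sets (\<nu> t) = sets borel"
 by (simp add: nu_def')

lemma nu_sigma_finite: "sigma_finite_measure (\<nu> t)"
 unfolding nu_def' by (rule sigma_finite_density_real[OF edge.sigma_finite_measure_axioms])
  (simp add: measurable_edge_borel nu_meas_fun)

lemma nu_eq_A: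
 assumes "AE x in \<pi>. u t x = U (t, x)"
 shows "\<nu> t = density \<theta> (%p. ennreal (A t p))"
 unfolding nu_def'
proof (rule density_cong)
 show "AE p in \<theta>. ennreal (\<alpha> (u t (fst p), u t (snd p))) = ennreal (A t p)"
  using AE_edge[OF assms] by eventually_elim (simp add: A_def)
 show "(%p. ennreal (\<alpha> (u t (fst p), u t (snd p)))) \<in> Bor \<theta>"
  unfolding measurable_edge_borel by (rule measurable_compose[OF nu_meas_fun measurable_ennreal])
qed (simp add: measurable_edge_borel)

lemma joint_nn_integral_meas:
 assumes "h \<in> Bor (borel \<Otimes>\<^sub>M borel)"
 shows "(%t. \<integral>\<^sup>+ p. h (t, p) \<partial>\<theta>) \<in> Bor (borel :: real measure)"
proof -
 have "h \<in> Bor ((borel :: real measure) \<Otimes>\<^sub>M \<theta>)"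
  using assms by (simp cong: measurable_cong_sets sets_pair_measure_cong add: measurable_cong_sets[OF sets_pair_measure_cong[OF refl sets_edge] refl])
 then show ?thesis by (intro edge.borel_measurable_nn_integral) (simp add: split_def)
qed

lemma borel_to_TT: "f \<in> Bor borel ==> f \<in> Bor TT"
 by (intro measurable_restrict_space1 measurable_completion) simp

definition Dm :: "real => ennreal" where
 "Dm t = (\<integral>\<^sup>+ p. D (U (t, fst p), U (t, snd p)) \<partial>\<theta>) / 2"

lemma Dm_meas: "Dm \<in> Bor borel"
proof -
 have "(%t. \<integral>\<^sup>+ p. D (U (t, fst p), U (t, snd p)) \<partial>\<theta>) \<in> Bor borel"
  using joint_nn_integral_meas[of "%q. D (U (fst q, fst (snd q)), U (fst q, snd (snd q)))"]
   fisher_measurable[OF U_section_meas] by simp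
 then show ?thesis unfolding Dm_def[abs_def] by simp
qed

lemma Fis_eq_Dm: assumes "AE x in \<pi>. u t x = U (t, x)" shows "Fis (\<rho> t) = Dm t"
 unfolding Dm_def using assms by (intro fisher_cong) (simp add: u_def)

end

section \<open>The dissipation potential through densities\<close>

lemma (in densities) dissipation_formula:
 assumes \<nu>: "sigma_finite_measure \<nu>" "sets \<nu> = sets borel" and w: "w \<in> Bor borel"
  and j: "j = signed_density \<nu> w" and ref: "\<nu> = flux_ref \<pi> \<kappa> \<alpha> \<rho>"
 shows "dissipation \<pi> \<kappa> \<psi>s \<alpha> \<rho> j = (\<integral>\<^sup>+ p. ennreal (\<psi> (2 * w p)) \<partial>\<nu>) / 2"
proof -
 have wn[measurable]: "w \<in> Bor \<nu>" using w \<nu>(2) by (simp cong: measurable_cong_sets)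
 have ac: "absolutely_continuous \<nu> (total_var j)"
  unfolding j by (simp add: total_var_signed_density absolutely_continuousI_density)
 have "signed_scale 2 j = signed_density \<nu> (%p. 2 * w p)" unfolding j by (rule signed_scale_signed_density) simp_all
 then have "AE p in \<nu>. signed_deriv \<nu> (signed_scale 2 j) p = 2 * w p"
  using signed_deriv_signed_density[OF \<nu>, of "%p. 2 * w p"] w by simp
 then have "(\<integral>\<^sup>+ p. ennreal (\<psi> (signed_deriv \<nu> (signed_scale 2 j) p)) \<partial>\<nu>) = (\<integral>\<^sup>+ p. ennreal (\<psi> (2 * w p)) \<partial>\<nu>)"
  by (intro nn_integral_cong_AE) (auto elim!: eventually_mono)
 then show ?thesis unfolding dissipation_def Let_def ref[symmetric] using ac by simp
qed

text \<open>Since division by 0 gives 0, the quotient \<open>a / g\<close> is the right density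
  exactly when \<open>a\<close> vanishes wherever \<open>g\<close> does, up to a null set; this is
  also what absolute continuity means here.\<close>

lemma signed_density_change:
 assumes M: "sigma_finite_measure M" and [measurable]: "a \<in> Bor M" "g \<in> Bor M"
  and g: "!!p. 0 <= g p"
 shows "absolutely_continuous (density M (%p. ennreal (g p))) (total_var (signed_density M a)) \<longleftrightarrow>
   (AE p in M. g p = 0 --> a p = 0)"
  and "(AE p in M. g p = 0 --> a p = 0) ==>
   signed_density M a = signed_density (density M (%p. ennreal (g p))) (%p. a p / g p)"
proof -
 let ?N = "density M (%p. ennreal (g p))"
 have tv: "total_var (signed_density M a) = density M (%x. ennreal \<bar>a x\<bar>)"
  by (rule total_var_signed_density) simp
 have eq: "signed_density M a = signed_density ?N (%p. a p / g p)" if ae: "AE p in M. g p = 0 --> a p = 0"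
 proof -
  have "density M (%p. ennreal (s * a p)) = density ?N (%p. ennreal (s * (a p / g p)))" for s
  proof -
   have "density M (%p. ennreal (s * a p)) = density M (%p. ennreal (g p) * ennreal (s * (a p / g p)))"
    using ae by (intro density_cong) (auto elim!: eventually_mono simp: g ennreal_mult'[symmetric])
   then show ?thesis by (simp add: density_density_eq)
  qed
  from this[of 1] this[of "- 1"] show ?thesis by (simp add: signed_density_def)
 qed
 show "absolutely_continuous ?N (total_var (signed_density M a)) \<longleftrightarrow> (AE p in M. g p = 0 --> a p = 0)"
 proof
  assume ac: "absolutely_continuous ?N (total_var (signed_density M a))"
  let ?Z = "{p\<in>space M. g p = 0}"
  have "?Z \<in> null_sets ?N" by (subst null_sets_density_iff) auto
  with ac have "?Z \<in> null_sets (density M (%x. ennreal \<bar>a x\<bar>))" unfolding tv absolutely_continuous_def by auto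
  then have "AE x in M. x \<in> ?Z --> ennreal \<bar>a x\<bar> = 0" by (subst (asm) null_sets_density_iff) auto
  with AE_space show "AE p in M. g p = 0 --> a p = 0" by eventually_elim auto
 next
  assume "AE p in M. g p = 0 --> a p = 0"
  from eq[OF this] show "absolutely_continuous ?N (total_var (signed_density M a))"
   by (simp add: total_var_signed_density absolutely_continuousI_density)
 qed
 show "(AE p in M. g p = 0 --> a p = 0) ==> signed_density M a = signed_density ?N (%p. a p / g p)" by (rule eq)
qed

text \<open>\<open>a\<close> and \<open>b\<close> are found independently of each other. That they
  are the two parts of one real density follows from the mutual singularity of the parts of
  \<open>j\<close>.\<close>

lemma signed_density_of_parts:
 assumes M: "sigma_finite_measure M" "sets M = sets borel" and j: "j \<in> sigma_signed"
  and a: "a \<in> Bor borel" "b \<in> Bor borel" "!!p. 0 <= a p" "!!p. 0 <= b p"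
  and parts: "fst j = density M (%p. ennreal (a p))" "snd j = density M (%p. ennreal (b p))"
 shows "j = signed_density M (%p. a p - b p)"
proof -
 have [measurable]: "a \<in> Bor M" "b \<in> Bor M"
  using a M(2) by (simp_all cong: measurable_cong_sets)
 have "total_var j = density M (%p. ennreal (a p) + ennreal (b p))"
  unfolding total_var_def parts by (rule add_measure_density) simp_all
 then have "absolutely_continuous M (total_var j)" by (simp add: absolutely_continuousI_density)
 from signed_density_signed_deriv[OF M j this] have "j = signed_density M (signed_deriv M j)" .
 also have "... = signed_density M (%p. a p - b p)"
 proof (rule signed_density_cong)
  show "AE p in M. signed_deriv M j p = a p - b p"
   using pos_deriv_of_density[OF M(1), of a] pos_deriv_of_density[OF M(1), of b] a(3,4)
   unfolding signed_deriv_def parts by (auto elim: eventually_elim2)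
 qed simp_all
 finally show ?thesis .
qed

section \<open>Joint densities of the flux\<close>

context curve
begin

lemma weighted: "weighted_space TT borel (jump_weight :: 'v \<times> 'v => real)"
 by (intro weighted_space.intro finite_TT complete_TT jump_weight_measurable jump_weight_pos)

text \<open>Off the diagonal the squared distance, capped at 1, is below the distance capped at 1.
  On the diagonal the weight is 1 instead, but the flux does not charge it.\<close>

lemma tv_weight_le:
 assumes t: "t \<in> {0..T}"
 shows "(\<integral>\<^sup>+ p. ennreal (jump_weight p) \<partial>total_var (j t)) <= mass t"
 unfolding mass_def
proof (rule nn_integral_mono_AE)
 have "- offdiag \<in> null_sets (total_var (j t))"
  using j_diag[OF t] tv_sets[OF t] by (simp add: null_sets_def)
 then have "AE p in total_var (j t). p \<notin> - offdiag" by (rule AE_not_in)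
 then show "AE p in total_var (j t). ennreal (jump_weight p) <= ennreal (min 1 (dist (fst p) (snd p)))"
 proof eventually_elim
  case (elim p)
  then have ne: "fst p ~= snd p" by auto
  have "min 1 ((dist (fst p) (snd p))\<^sup>2) <= min 1 (dist (fst p) (snd p))"
  proof (cases "dist (fst p) (snd p) <= 1")
   case True then have "(dist (fst p) (snd p))\<^sup>2 <= dist (fst p) (snd p)"
    using mult_right_mono[OF True zero_le_dist[of "fst p" "snd p"]] by (simp add: power2_eq_square)
   then show ?thesis by simp
  qed simp
  with ne show ?case by (auto simp: jump_weight_def intro!: ennreal_leI)
 qed
qed

lemma wk_tv: "weighted_kernel TT borel jump_weight (%t. total_var (j t))"
 unfolding weighted_kernel_def
proof (intro conjI ballI)
 show "AE t in TT. (\<integral>\<^sup>+ p. ennreal (jump_weight p) \<partial>total_var (j t)) < \<infinity>"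
  using AE_mass AE_space by eventually_elim (use tv_weight_le in \<open>auto intro: le_less_trans\<close>)
qed (auto simp: tv_sets tv_emeasure_meas)

lemma fst_snd_le_tv:
 assumes t: "t \<in> {0..T}" and h: "h \<in> Bor borel"
 shows "(\<integral>\<^sup>+ p. h p \<partial>fst (j t)) <= (\<integral>\<^sup>+ p. h p \<partial>total_var (j t))"
  "(\<integral>\<^sup>+ p. h p \<partial>snd (j t)) <= (\<integral>\<^sup>+ p. h p \<partial>total_var (j t))"
proof -
 note S = sigma_signedD(1,2)[OF j_sigma[OF t]]
 have "(\<integral>\<^sup>+ p. h p \<partial>total_var (j t)) = (\<integral>\<^sup>+ p. h p \<partial>fst (j t)) + (\<integral>\<^sup>+ p. h p \<partial>snd (j t))"
  unfolding total_var_def using S h by (intro nn_integral_add_measure) (simp_all cong: measurable_cong_sets)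
 then show "(\<integral>\<^sup>+ p. h p \<partial>fst (j t)) <= (\<integral>\<^sup>+ p. h p \<partial>total_var (j t))"
  "(\<integral>\<^sup>+ p. h p \<partial>snd (j t)) <= (\<integral>\<^sup>+ p. h p \<partial>total_var (j t))" by simp_all
qed

lemma wk_parts:
 "weighted_kernel TT borel jump_weight (%t. fst (j t))" "weighted_kernel TT borel jump_weight (%t. snd (j t))"
 unfolding weighted_kernel_def
proof (safe)
 have m: "(%p::'v \<times> 'v. ennreal (jump_weight p)) \<in> Bor borel" by measurable
 show "AE t in TT. (\<integral>\<^sup>+ p. ennreal (jump_weight p) \<partial>fst (j t)) < \<infinity>"
  "AE t in TT. (\<integral>\<^sup>+ p. ennreal (jump_weight p) \<partial>snd (j t)) < \<infinity>"
  using wk_tv[unfolded weighted_kernel_def, THEN conjunct2, THEN conjunct2] AE_space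
  by (eventually_elim, use fst_snd_le_tv[OF _ m] in \<open>auto intro: le_less_trans\<close>)+
qed (use sigma_signedD(1,2)[OF j_sigma] in \<open>auto simp: j_emeasure_meas\<close>)

lemma nu_weight_finite:
 assumes "AE x in \<pi>. u t x = U (t, x)"
 shows "(\<integral>\<^sup>+ p. ennreal (jump_weight p) \<partial>\<nu> t) < \<infinity>"
proof -
 obtain K where K: "0 <= K" "!!t p. A t p <= K" using A_bounded by metis
 have "(\<integral>\<^sup>+ p. ennreal (jump_weight p) \<partial>\<nu> t) = (\<integral>\<^sup>+ p. ennreal (A t p) * ennreal (jump_weight p) \<partial>\<theta>)"
  unfolding nu_eq_A[OF assms] by (intro nn_integral_density) (simp_all add: measurable_edge_borel)
 also have "... <= (\<integral>\<^sup>+ p. ennreal K * ennreal (jump_weight p) \<partial>\<theta>)"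
  using K by (intro nn_integral_mono mult_right_mono ennreal_leI) auto
 also have "... = ennreal K * (\<integral>\<^sup>+ p. ennreal (jump_weight p) \<partial>\<theta>)"
  by (intro nn_integral_cmult) (simp add: measurable_edge_borel)
 also have "... < \<infinity>" using edge_weight_finite by (simp add: ennreal_mult_less_top)
 finally show ?thesis .
qed

lemma wk_nu: "weighted_kernel TT borel jump_weight \<nu>"
 unfolding weighted_kernel_def
proof (intro conjI ballI)
 show "AE t in TT. (\<integral>\<^sup>+ p. ennreal (jump_weight p) \<partial>\<nu> t) < \<infinity>"
  using u_eq_U by eventually_elim (rule nu_weight_finite)
next
 fix B :: "('v \<times> 'v) set" assume B[measurable]: "B \<in> sets borel"
 have "(%t. \<integral>\<^sup>+ p. ennreal (A t p) * ind B p \<partial>\<theta>) \<in> Bor borel"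
  using joint_nn_integral_meas[of "%q. ennreal (A (fst q) (snd q)) * ind B (snd q)"] A_joint_meas by simp
 then have "(%t. \<integral>\<^sup>+ p. ennreal (A t p) * ind B p \<partial>\<theta>) \<in> Bor TT" by (rule borel_to_TT)
 then show "(%t. em (\<nu> t) B) \<in> Bor TT"
 proof (rule TTc.measurable_AE_cong)
  show "AE t in TT. (\<integral>\<^sup>+ p. ennreal (A t p) * ind B p \<partial>\<theta>) = em (\<nu> t) B"
   using u_eq_U
  proof eventually_elim
   case (elim t)
   show ?case unfolding nu_eq_A[OF elim] by (subst emeasure_density) (simp_all add: measurable_edge_borel)
  qed
 qed simp
qed simp

text \<open>Dominates the flux and its reference measure together, so the flux has a density even at
  times when it is not absolutely continuous with respect to \<open>\<nu> t\<close>; such times have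
  to be recognised measurably.\<close>

definition Mref :: "real => ('v \<times> 'v) measure" where "Mref t = add_measure (total_var (j t)) (\<nu> t)"

lemma wk_Mref: "weighted_kernel TT borel jump_weight Mref"
 unfolding weighted_kernel_def
proof (intro conjI ballI)
 have m: "(%p::'v \<times> 'v. ennreal (jump_weight p)) \<in> Bor borel" by measurable
 show "AE t in TT. (\<integral>\<^sup>+ p. ennreal (jump_weight p) \<partial>Mref t) < \<infinity>"
  using wk_tv[unfolded weighted_kernel_def, THEN conjunct2, THEN conjunct2]
   wk_nu[unfolded weighted_kernel_def, THEN conjunct2, THEN conjunct2] AE_space
 proof eventually_elim
  case (elim t)
  have "(\<integral>\<^sup>+ p. ennreal (jump_weight p) \<partial>Mref t) =
   (\<integral>\<^sup>+ p. ennreal (jump_weight p) \<partial>total_var (j t)) + (\<integral>\<^sup>+ p. ennreal (jump_weight p) \<partial>\<nu> t)"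
   unfolding Mref_def using elim(3) m tv_sets[of t] by (intro nn_integral_add_measure) (simp_all cong: measurable_cong_sets)
  with elim show ?case by simp
 qed
next
 fix B :: "('v \<times> 'v) set" assume B: "B \<in> sets borel"
 have e: "em (Mref t) B = em (total_var (j t)) B + em (\<nu> t) B" if "t \<in> space TT" for t
  unfolding Mref_def using that B tv_sets[of t] by (subst emeasure_add_measure) simp_all
 show "(%t. em (Mref t) B) \<in> Bor TT"
 proof (subst measurable_cong[OF e])
  show "(%t. em (total_var (j t)) B + em (\<nu> t) B) \<in> Bor TT"
   using wk_nu B by (intro borel_measurable_add tv_emeasure_meas) (auto simp: weighted_kernel_def)
 qed
qed (simp add: Mref_def tv_sets)

lemma Mref_facts:
 assumes t: "t \<in> {0..T}"
 shows "sets (Mref t) = sets borel" "sigma_finite_measure (Mref t)"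
  "absolutely_continuous (Mref t) (fst (j t))" "absolutely_continuous (Mref t) (snd (j t))"
  "absolutely_continuous (Mref t) (\<nu> t)"
proof -
 note S = sigma_signedD[OF j_sigma[OF t]]
 show "sets (Mref t) = sets borel" using S by (simp add: Mref_def)
 show "sigma_finite_measure (Mref t)"
  unfolding Mref_def using S nu_sigma_finite by (intro sigma_finite_add_measure) simp_all
 have a: "absolutely_continuous (Mref t) (total_var (j t))" "absolutely_continuous (Mref t) (\<nu> t)"
  unfolding Mref_def using S by (simp_all add: absolutely_continuous_add_measure)
 have b: "absolutely_continuous (total_var (j t)) (fst (j t))" "absolutely_continuous (total_var (j t)) (snd (j t))"
  unfolding total_var_def using S by (simp_all add: absolutely_continuous_add_measure)
 show "absolutely_continuous (Mref t) (\<nu> t)" by (rule a(2))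
 show "absolutely_continuous (Mref t) (fst (j t))" "absolutely_continuous (Mref t) (snd (j t))"
  using absolutely_continuous_trans[OF a(1) b(1)] absolutely_continuous_trans[OF a(1) b(2)] by auto
qed

text \<open>Measurability in time of the dissipation potential: with respect to \<open>Mref t\<close> both the flux
  and the reference measure have jointly measurable densities \<open>a\<close> and \<open>g\<close>, and absolute continuity
  of the flux means that \<open>a\<close> vanishes where \<open>g\<close> does.\<close>

lemma flux_structure_ex:
 "\<exists>w. w \<in> Bor (TT \<Otimes>\<^sub>M borel) & (%t. Dis (\<rho> t) (j t)) \<in> Bor TT &
  (AE t in TT. Dis (\<rho> t) (j t) < \<infinity> --> j t = signed_density (\<nu> t) (%p. w (t, p)))"
proof -
 have acs: "AE t in TT. absolutely_continuous (Mref t) (fst (j t))"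
  "AE t in TT. absolutely_continuous (Mref t) (snd (j t))" "AE t in TT. absolutely_continuous (Mref t) (\<nu> t)"
  by (rule AE_I2, rule Mref_facts, simp)+
 obtain a where a: "a \<in> Bor (TT \<Otimes>\<^sub>M borel)" "\<forall>p. 0 <= a p"
  "AE t in TT. fst (j t) = density (Mref t) (%y. ennreal (a (t, y)))"
  by (rule weighted_kernel_density[OF weighted wk_parts(1) wk_Mref acs(1)])
 obtain b where b: "b \<in> Bor (TT \<Otimes>\<^sub>M borel)" "\<forall>p. 0 <= b p"
  "AE t in TT. snd (j t) = density (Mref t) (%y. ennreal (b (t, y)))"
  by (rule weighted_kernel_density[OF weighted wk_parts(2) wk_Mref acs(2)])
 obtain g where g: "g \<in> Bor (TT \<Otimes>\<^sub>M borel)" "\<forall>p. 0 <= g p"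
  "AE t in TT. \<nu> t = density (Mref t) (%y. ennreal (g (t, y)))"
  by (rule weighted_kernel_density[OF weighted wk_nu wk_Mref acs(3)])
 note nn = a(2)[rule_format] b(2)[rule_format] g(2)[rule_format]
 note [measurable] = a(1) b(1) g(1)
 define w where "w p = (a p - b p) / g p" for p
 have w[measurable]: "w \<in> Bor (TT \<Otimes>\<^sub>M borel)" unfolding w_def[abs_def] by measurable
 \<comment> \<open>The mass of the set where the flux has a nonzero density but the reference
   measure has none. Its vanishing is absolute continuity, expressed as a measurable condition on
   \<open>t\<close>.\<close>
 let ?I = "%t. \<integral>\<^sup>+ p. (if g (t, p) = 0 & a (t, p) - b (t, p) ~= 0 then 1 else 0) \<partial>Mref t"
 let ?R = "%t. (\<integral>\<^sup>+ p. ennreal (g (t, p)) * ennreal (\<psi> (2 * w (t, p))) \<partial>Mref t) / 2"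
 have I[measurable]: "?I \<in> Bor TT"
  using weighted_space.weighted_kernel_nn_integral_measurable[OF weighted wk_Mref,
    of "%q. if g q = 0 & a q - b q ~= 0 then 1 else 0"] by simp
 have "(%t. \<integral>\<^sup>+ p. ennreal (g (t, p)) * ennreal (\<psi> (2 * w (t, p))) \<partial>Mref t) \<in> Bor TT"
  using weighted_space.weighted_kernel_nn_integral_measurable[OF weighted wk_Mref,
    of "%q. ennreal (g q) * ennreal (\<psi> (2 * w q))"] by simp
 then have R[measurable]: "?R \<in> Bor TT" by simp
 have all: "AE t in TT. Dis (\<rho> t) (j t) = (if ?I t = 0 then ?R t else \<infinity>) &
   (?I t = 0 --> j t = signed_density (\<nu> t) (%p. w (t, p)))"
  using a(3) b(3) g(3) AE_space
 proof eventually_elim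
  case (elim t)
  then have t: "t \<in> {0..T}" by simp
  note MF = Mref_facts[OF t]
  have sec: "(%p. a (t, p)) \<in> Bor borel" "(%p. b (t, p)) \<in> Bor borel"
   "(%p. g (t, p)) \<in> Bor borel" "(%p. w (t, p)) \<in> Bor borel"
   using elim(4) by measurable
  have secM[measurable]: "(%p. a (t, p)) \<in> Bor (Mref t)" "(%p. b (t, p)) \<in> Bor (Mref t)"
   "(%p. g (t, p)) \<in> Bor (Mref t)" "(%p. w (t, p)) \<in> Bor (Mref t)"
   using sec MF(1) by (simp_all cong: measurable_cong_sets)
  have jM: "j t = signed_density (Mref t) (%p. a (t, p) - b (t, p))"
   by (rule signed_density_of_parts[OF MF(2,1) j_sigma[OF t] sec(1,2) nn(1,2) elim(1,2)])
  have am: "(%p. a (t, p) - b (t, p)) \<in> Bor (Mref t)" by simp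
  note ch = signed_density_change[OF MF(2) am secM(3) nn(3), folded elim(3) jM]
  have Ieq: "?I t = 0 \<longleftrightarrow> (AE p in Mref t. g (t, p) = 0 --> a (t, p) - b (t, p) = 0)"
  proof -
   have "?I t = 0 \<longleftrightarrow> (AE p in Mref t. (if g (t, p) = 0 & a (t, p) - b (t, p) ~= 0 then 1 else 0) = (0::ennreal))"
    by (intro nn_integral_0_iff_AE) measurable
   also have "... \<longleftrightarrow> (AE p in Mref t. g (t, p) = 0 --> a (t, p) - b (t, p) = 0)"
    by (intro AE_cong) auto
   finally show ?thesis .
  qed
  have jw: "j t = signed_density (\<nu> t) (%p. w (t, p))" if "?I t = 0"
   using ch(2) that Ieq by (simp add: w_def)
  show ?case
  proof (cases "?I t = 0")
   case True
   have "Dis (\<rho> t) (j t) = (\<integral>\<^sup>+ p. ennreal (\<psi> (2 * w (t, p))) \<partial>\<nu> t) / 2"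
    by (rule dissipation_formula[OF nu_sigma_finite sets_nu sec(4) jw[OF True] \<nu>_def])
   also have "(\<integral>\<^sup>+ p. ennreal (\<psi> (2 * w (t, p))) \<partial>\<nu> t) =
     (\<integral>\<^sup>+ p. ennreal (g (t, p)) * ennreal (\<psi> (2 * w (t, p))) \<partial>Mref t)"
    unfolding elim(3) by (intro nn_integral_density) measurable
   finally show ?thesis using True jw by simp
  next
   case False
   then have "~ absolutely_continuous (\<nu> t) (total_var (j t))" using ch(1) Ieq by blast
   then have "Dis (\<rho> t) (j t) = \<infinity>" unfolding dissipation_def Let_def \<nu>_def[symmetric] by simp
   then show ?thesis using False by simp
  qed
 qed
 have "(%t. if ?I t = 0 then ?R t else \<infinity>) \<in> Bor TT" by measurable
 then have "(%t. Dis (\<rho> t) (j t)) \<in> Bor TT"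
 proof (rule TTc.measurable_AE_cong)
  show "AE t in TT. (if ?I t = 0 then ?R t else \<infinity>) = Dis (\<rho> t) (j t)"
   using all by eventually_elim simp
 qed simp
 moreover have "AE t in TT. Dis (\<rho> t) (j t) < \<infinity> --> j t = signed_density (\<nu> t) (%p. w (t, p))"
  using all by eventually_elim (auto split: if_splits)
 ultimately show ?thesis using w by blast
qed

definition w :: "real \<times> ('v \<times> 'v) => real" where
 "w = (SOME w. w \<in> Bor (TT \<Otimes>\<^sub>M borel) & (%t. Dis (\<rho> t) (j t)) \<in> Bor TT &
  (AE t in TT. Dis (\<rho> t) (j t) < \<infinity> --> j t = signed_density (\<nu> t) (%p. w (t, p))))"

lemma w_meas[measurable]: "w \<in> Bor (TT \<Otimes>\<^sub>M borel)"
 and Dis_meas[measurable]: "(%t. Dis (\<rho> t) (j t)) \<in> Bor TT"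
 and j_w: "AE t in TT. Dis (\<rho> t) (j t) < \<infinity> --> j t = signed_density (\<nu> t) (%p. w (t, p))"
 using someI_ex[OF flux_structure_ex] unfolding w_def[symmetric] by blast+

lemma Fis_meas[measurable]: "(%t. Fis (\<rho> t)) \<in> Bor TT"
 by (rule TTc.measurable_AE_cong[OF borel_to_TT[OF Dm_meas]])
  (use u_eq_U in \<open>auto elim!: eventually_mono simp: Fis_eq_Dm\<close>)

text \<open>Gathers what is known only at a.e. time in one predicate, so that later arguments can
  speak of individual times.\<close>

definition good :: "real => bool" where
 "good t \<longleftrightarrow> t \<in> {0..T} & (AE x in \<pi>. u t x = U (t, x)) & j t = signed_density (\<nu> t) (%p. w (t, p)) &
  Dis (\<rho> t) (j t) < \<infinity> & Fis (\<rho> t) < \<infinity>"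

lemma AE_good: "AE t in TT. good t"
proof -
 have "AE t in TT. Dis (\<rho> t) (j t) + Fis (\<rho> t) ~= \<infinity>"
  using dis_fin by (intro nn_integral_PInf_AE) auto
 with u_eq_U j_w AE_space show ?thesis
  by eventually_elim (auto simp: good_def top.not_eq_extremum)
qed

lemma AE_good_time: "AE t in lebesgue. t \<in> {0..T} --> good t"
 using AE_good by (simp add: AE_lebesgue_on)

definition Rr :: "real => real" where "Rr t = enn2real (Dis (\<rho> t) (j t))"
definition Dr :: "real => real" where "Dr t = enn2real (Fis (\<rho> t))"

lemma Rr_Dr_nonneg[simp]: "0 <= Rr t" "0 <= Dr t" by (simp_all add: Rr_def Dr_def)

lemma Rr_Dr_integrable: "integrable TT Rr" "integrable TT Dr"
proof -
 have "(\<integral>\<^sup>+ t. ennreal (norm (Rr t)) \<partial>TT) <= (\<integral>\<^sup>+ t. (Dis (\<rho> t) (j t) + Fis (\<rho> t)) \<partial>TT)"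
  by (intro nn_integral_mono) (simp add: Rr_def ennreal_enn2real_if add_increasing2)
 then show "integrable TT Rr" using dis_fin by (intro integrableI_bounded) (auto simp: Rr_def[abs_def] intro: le_less_trans)
 have "(\<integral>\<^sup>+ t. ennreal (norm (Dr t)) \<partial>TT) <= (\<integral>\<^sup>+ t. (Dis (\<rho> t) (j t) + Fis (\<rho> t)) \<partial>TT)"
  by (intro nn_integral_mono) (simp add: Dr_def ennreal_enn2real_if add_increasing)
 then show "integrable TT Dr" using dis_fin by (intro integrableI_bounded) (auto simp: Dr_def[abs_def] intro: le_less_trans)
qed

lemma w_section: assumes "t \<in> {0..T}" shows "(%p. w (t, p)) \<in> Bor borel"
proof -
 have "t \<in> space TT" using assms by simp
 then show ?thesis by measurable
qed

lemma goodD: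
 assumes "good t"
 shows "t \<in> {0..T}" "AE x in \<pi>. u t x = U (t, x)" "\<nu> t = density \<theta> (%p. ennreal (A t p))"
  "j t = signed_density \<theta> (%p. w (t, p) * A t p)"
  "ennreal (2 * Rr t) = (\<integral>\<^sup>+ p. ennreal (\<psi> (2 * w (t, p)) * A t p) \<partial>\<theta>)"
  "ennreal (2 * Dr t) = (\<integral>\<^sup>+ p. D (U (t, fst p), U (t, snd p)) \<partial>\<theta>)"
  "Dis (\<rho> t) (j t) = ennreal (Rr t)" "Fis (\<rho> t) = ennreal (Dr t)"
proof -
 show t: "t \<in> {0..T}" and ae: "AE x in \<pi>. u t x = U (t, x)" using assms by (auto simp: good_def)
 show nu: "\<nu> t = density \<theta> (%p. ennreal (A t p))" by (rule nu_eq_A[OF ae])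
 have jn: "j t = signed_density (\<nu> t) (%p. w (t, p))" using assms by (simp add: good_def)
 note [measurable] = w_section[OF t]
 have dd: "density (\<nu> t) (%p. ennreal (s * w (t, p))) = density \<theta> (%p. ennreal (s * (w (t, p) * A t p)))" for s
 proof -
  have "ennreal (A t p) * ennreal (s * w (t, p)) = ennreal (s * (w (t, p) * A t p))" for p
   by (simp add: ennreal_mult'[symmetric] ac_simps)
  then show ?thesis unfolding nu by (subst density_density_eq) (simp_all add: measurable_edge_borel)
 qed
 show "j t = signed_density \<theta> (%p. w (t, p) * A t p)"
  unfolding jn using dd[of 1] dd[of "- 1"] by (simp add: signed_density_def)
 have "Dis (\<rho> t) (j t) = (\<integral>\<^sup>+ p. ennreal (\<psi> (2 * w (t, p))) \<partial>\<nu> t) / 2"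
  by (rule dissipation_formula[OF nu_sigma_finite sets_nu w_section[OF t] jn \<nu>_def])
 also have "(\<integral>\<^sup>+ p. ennreal (\<psi> (2 * w (t, p))) \<partial>\<nu> t) = (\<integral>\<^sup>+ p. ennreal (\<psi> (2 * w (t, p)) * A t p) \<partial>\<theta>)"
  unfolding nu by (subst nn_integral_density) (simp_all add: measurable_edge_borel ennreal_mult mult.commute)
 finally have e: "Dis (\<rho> t) (j t) = (\<integral>\<^sup>+ p. ennreal (\<psi> (2 * w (t, p)) * A t p) \<partial>\<theta>) / 2" .
 have two: "2 * (x / 2) = x" for x :: ennreal
  by (simp add: ennreal_times_divide mult.commute mult_divide_eq_ennreal)
 show R: "Dis (\<rho> t) (j t) = ennreal (Rr t)" and F: "Fis (\<rho> t) = ennreal (Dr t)"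
  using assms by (auto simp: good_def Rr_def Dr_def)
 show "ennreal (2 * Rr t) = (\<integral>\<^sup>+ p. ennreal (\<psi> (2 * w (t, p)) * A t p) \<partial>\<theta>)"
 proof -
  have "ennreal (2 * Rr t) = 2 * Dis (\<rho> t) (j t)" unfolding R by (simp add: ennreal_mult)
  also have "... = (\<integral>\<^sup>+ p. ennreal (\<psi> (2 * w (t, p)) * A t p) \<partial>\<theta>)" unfolding e by (rule two)
  finally show ?thesis .
 qed
 show "ennreal (2 * Dr t) = (\<integral>\<^sup>+ p. D (U (t, fst p), U (t, snd p)) \<partial>\<theta>)"
 proof -
  have "ennreal (2 * Dr t) = 2 * Fis (\<rho> t)" unfolding F by (simp add: ennreal_mult)
  also have "... = (\<integral>\<^sup>+ p. D (U (t, fst p), U (t, snd p)) \<partial>\<theta>)"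
   unfolding Fis_eq_Dm[OF ae] Dm_def by (rule two)
  finally show ?thesis .
 qed
qed

end

section \<open>Convex combinations of reflecting curves\<close>

lemma mix_signed_facts:
 assumes \<mu>: "\<mu> \<in> sigma_signed" and \<nu>: "\<nu> \<in> sigma_signed" and s: "0 <= s" "s <= 1"
 shows "mix_signed s \<mu> \<nu> \<in> sigma_signed"
  and "h \<in> Bor borel ==> (\<integral>\<^sup>+ x. h x \<partial>total_var (mix_signed s \<mu> \<nu>)) <=
   ennreal (1 - s) * (\<integral>\<^sup>+ x. h x \<partial>total_var \<mu>) + ennreal s * (\<integral>\<^sup>+ x. h x \<partial>total_var \<nu>)"
  and "k \<in> Bor borel ==> S \<in> sets borel ==> integrable (total_var \<mu>) k ==>
   integrable (total_var \<nu>) k ==>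
   signed_integral (mix_signed s \<mu> \<nu>) S k = (1 - s) * signed_integral \<mu> S k + s * signed_integral \<nu> S k"
proof -
 note D = sigma_signedD[OF \<mu>] sigma_signedD[OF \<nu>]
 \<comment> \<open>With respect to this common dominating measure, mixing is the pointwise
   combination of densities. Total variation is only subadditive, since the two densities may
   cancel.\<close>
 define Y where "Y = add_measure (total_var \<mu>) (total_var \<nu>)"
 have Y: "sigma_finite_measure Y" "sets Y = sets borel"
  unfolding Y_def using D by (simp_all add: sigma_finite_add_measure)
 have ac: "absolutely_continuous Y (total_var \<mu>)" "absolutely_continuous Y (total_var \<nu>)"
  unfolding Y_def using D by (simp_all add: absolutely_continuous_add_measure)
 define f where "f = signed_deriv Y \<mu>"
 define g where "g = signed_deriv Y \<nu>"
 have rep: "\<mu> = signed_density Y f" "\<nu> = signed_density Y g"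
  unfolding f_def g_def by (rule signed_density_signed_deriv[OF Y \<mu> ac(1)], rule signed_density_signed_deriv[OF Y \<nu> ac(2)])
 have fg[measurable]: "f \<in> Bor Y" "g \<in> Bor Y" by (simp_all add: f_def g_def)
 have bm: "Bor Y = Bor borel" using Y(2) by (intro measurable_cong_sets) simp_all
 have fgb: "f \<in> Bor borel" "g \<in> Bor borel" using fg unfolding bm .
 have mix: "mix_signed s \<mu> \<nu> = signed_density Y (%x. (1 - s) * f x + s * g x)"
  unfolding rep by (rule mix_signed_signed_density[OF Y fgb s])
 have mm: "(%x. (1 - s) * f x + s * g x) \<in> Bor Y" by measurable
 show "mix_signed s \<mu> \<nu> \<in> sigma_signed"
  unfolding mix using mm unfolding bm by (rule signed_density_in_sigma_signed[OF Y])
 show "(\<integral>\<^sup>+ x. h x \<partial>total_var (mix_signed s \<mu> \<nu>)) <=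
   ennreal (1 - s) * (\<integral>\<^sup>+ x. h x \<partial>total_var \<mu>) + ennreal s * (\<integral>\<^sup>+ x. h x \<partial>total_var \<nu>)"
  if h: "h \<in> Bor borel"
 proof -
  have [measurable]: "h \<in> Bor Y" using h unfolding bm .
  have i: "(\<integral>\<^sup>+ x. h x \<partial>total_var (signed_density Y k)) = (\<integral>\<^sup>+ x. ennreal \<bar>k x\<bar> * h x \<partial>Y)"
   if [measurable]: "k \<in> Bor Y" for k
   by (simp add: total_var_signed_density nn_integral_density)
  have "(\<integral>\<^sup>+ x. ennreal \<bar>(1 - s) * f x + s * g x\<bar> * h x \<partial>Y) <=
    (\<integral>\<^sup>+ x. ennreal (1 - s) * (ennreal \<bar>f x\<bar> * h x) + ennreal s * (ennreal \<bar>g x\<bar> * h x) \<partial>Y)"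
  proof (rule nn_integral_mono)
   fix x
   have "\<bar>(1 - s) * f x + s * g x\<bar> <= (1 - s) * \<bar>f x\<bar> + s * \<bar>g x\<bar>"
    using s abs_triangle_ineq[of "(1 - s) * f x" "s * g x"] by (simp add: abs_mult)
   then have "ennreal \<bar>(1 - s) * f x + s * g x\<bar> <= ennreal ((1 - s) * \<bar>f x\<bar> + s * \<bar>g x\<bar>)" by (rule ennreal_leI)
   also have "... = ennreal (1 - s) * ennreal \<bar>f x\<bar> + ennreal s * ennreal \<bar>g x\<bar>" using s by (simp add: ennreal_mult)
   finally have "ennreal \<bar>(1 - s) * f x + s * g x\<bar> * h x <= (ennreal (1 - s) * ennreal \<bar>f x\<bar> + ennreal s * ennreal \<bar>g x\<bar>) * h x"
    by (rule mult_right_mono) simp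
   then show "ennreal \<bar>(1 - s) * f x + s * g x\<bar> * h x <=
     ennreal (1 - s) * (ennreal \<bar>f x\<bar> * h x) + ennreal s * (ennreal \<bar>g x\<bar> * h x)"
    by (simp only: distrib_right mult.assoc)
  qed
  also have "... = ennreal (1 - s) * (\<integral>\<^sup>+ x. ennreal \<bar>f x\<bar> * h x \<partial>Y) + ennreal s * (\<integral>\<^sup>+ x. ennreal \<bar>g x\<bar> * h x \<partial>Y)"
   by (simp add: nn_integral_add nn_integral_cmult)
  finally show ?thesis unfolding mix unfolding rep i[OF mm] i[OF fg(1)] i[OF fg(2)] .
 qed
 show "signed_integral (mix_signed s \<mu> \<nu>) S k = (1 - s) * signed_integral \<mu> S k + s * signed_integral \<nu> S k"
  if k: "k \<in> Bor borel" and S: "S \<in> sets borel" and int: "integrable (total_var \<mu>) k" "integrable (total_var \<nu>) k"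
 proof -
  have km[measurable]: "k \<in> Bor Y" using k unfolding bm .
  have Sm[measurable]: "S \<in> sets Y" using S Y(2) by simp
  have fk: "integrable Y (%x. f x * k x)" "integrable Y (%x. g x * k x)"
   using int unfolding rep by (simp_all add: integrable_total_var_signed_density)
  have fkS: "integrable Y (%x. f x * (ind S x * k x))" "integrable Y (%x. g x * (ind S x * k x))"
   using integrable_mult_indicator[OF Sm fk(1)] integrable_mult_indicator[OF Sm fk(2)] by (simp_all add: ac_simps)
  have "integrable Y (%x. (1 - s) * (f x * (ind S x * k x)) + s * (g x * (ind S x * k x)))"
   using fkS by simp
  then have mk: "integrable Y (%x. ((1 - s) * f x + s * g x) * (ind S x * k x))"
   by (simp only: distrib_right mult.assoc)
  have "(\<integral>x. ((1 - s) * f x + s * g x) * (ind S x * k x) \<partial>Y) =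
   (\<integral>x. (1 - s) * (f x * (ind S x * k x)) + s * (g x * (ind S x * k x)) \<partial>Y)"
   by (simp only: distrib_right mult.assoc)
  also have "... = (1 - s) * (\<integral>x. f x * (ind S x * k x) \<partial>Y) + s * (\<integral>x. g x * (ind S x * k x) \<partial>Y)"
   using fkS by simp
  finally show ?thesis
   unfolding mix signed_integral_signed_density[OF mm km Sm mk]
   unfolding rep signed_integral_signed_density[OF fg(1) km Sm fkS(1)] signed_integral_signed_density[OF fg(2) km Sm fkS(2)] .
 qed
qed

context densities
begin

text \<open>Fenchel's inequality with weights; a deficit in the weights is harmless because
  \<open>\<psi>s\<close> is nonnegative.\<close>

lemma psi_subconvex:
 assumes "0 <= p" "0 <= q" "p + q <= 1"
 shows "\<psi> (p * x + q * y) <= p * \<psi> x + q * \<psi> y"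
proof (rule psi_leI)
 fix \<xi>
 have "p * (x * \<xi>) <= p * (\<psi> x + \<psi>s \<xi>)" "q * (y * \<xi>) <= q * (\<psi> y + \<psi>s \<xi>)"
  using assms fenchel by (auto intro!: mult_left_mono)
 moreover have "(p + q) * \<psi>s \<xi> <= 1 * \<psi>s \<xi>" using assms by (intro mult_right_mono) auto
 ultimately show "(p * x + q * y) * \<xi> - \<psi>s \<xi> <= p * \<psi> x + q * \<psi> y"
  by (simp add: algebra_simps)
qed

text \<open>Joint convexity of the perspective of \<psi> together with its monotonicity in the
  mobility: by concavity the mobility \<open>a\<close> of a mixture may exceed the mixture of the
  mobilities. If \<open>a\<close> is 0, the left side is 0.\<close>

lemma perspective_le:
 assumes s: "0 <= s" "s <= 1" and ab: "0 <= a0" "0 <= a1" and a: "(1 - s) * a0 + s * a1 <= a"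
 shows "\<psi> (2 * (((1 - s) * (w0 * a0) + s * (w1 * a1)) / a)) * a <= (1 - s) * (\<psi> (2 * w0) * a0) + s * (\<psi> (2 * w1) * a1)"
proof (cases "a = 0")
 case True then show ?thesis using s ab by simp
next
 case False
 have "0 <= (1 - s) * a0 + s * a1" using s ab by simp
 with False a have apos: "0 < a" by linarith
 let ?p = "(1 - s) * a0 / a" and ?q = "s * a1 / a"
 have pq: "0 <= ?p" "0 <= ?q" "?p + ?q <= 1"
  using s ab a apos by (auto simp: pos_divide_le_eq add_divide_distrib[symmetric])
 have e: "2 * (((1 - s) * (w0 * a0) + s * (w1 * a1)) / a) = ?p * (2 * w0) + ?q * (2 * w1)"
  using apos by (simp add: field_simps)
 have "\<psi> (2 * (((1 - s) * (w0 * a0) + s * (w1 * a1)) / a)) * a <= (?p * \<psi> (2 * w0) + ?q * \<psi> (2 * w1)) * a"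
  unfolding e using apos by (intro mult_right_mono psi_subconvex pq) auto
 also have "... = (1 - s) * (\<psi> (2 * w0) * a0) + s * (\<psi> (2 * w1) * a1)"
  using apos by (simp add: field_simps)
 finally show ?thesis .
qed

end

section \<open>Test functions against the flux\<close>

context curve
begin

lemma total_var_good:
 assumes g: "good t" and h: "h \<in> Bor borel"
 shows "(\<integral>\<^sup>+ p. h p \<partial>total_var (j t)) = (\<integral>\<^sup>+ p. ennreal (\<bar>w (t, p)\<bar> * A t p) * h p \<partial>\<theta>)"
proof -
 note [measurable] = w_section[OF goodD(1)[OF g]]
 have m: "(%p. w (t, p) * A t p) \<in> Bor \<theta>"
  unfolding measurable_edge_borel by measurable
 show ?thesis
  unfolding goodD(4)[OF g] total_var_signed_density[OF m]
  using h by (subst nn_integral_density) (simp_all add: measurable_edge_borel abs_mult)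
qed

text \<open>Fenchel's inequality for \<open>2 * w\<close> and \<open>N * h\<close>, divided by
  \<open>2 * N\<close>. For bounded \<open>h\<close> the term \<open>\<psi>s (N * h)\<close> is at
  most quadratic in \<open>h\<close>. The free parameter \<open>N\<close> is what later makes the
  contribution of the dissipation small.\<close>

lemma fenchel_flux:
 assumes N: "0 < N"
 obtains c where "0 <= c" "!!t h. good t ==> h \<in> Bor borel ==> (AE p in \<theta>. \<bar>h p\<bar> <= B) ==>
  (\<integral>\<^sup>+ p. ennreal \<bar>h p\<bar> \<partial>total_var (j t)) <= ennreal (Rr t / N) + ennreal c * (\<integral>\<^sup>+ p. ennreal ((h p)\<^sup>2) \<partial>\<theta>)"
proof -
 obtain K where K: "0 <= K" "!!t p. A t p <= K" using A_bounded by metis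
 obtain c' where c': "0 <= c'" "!!\<xi>. \<bar>\<xi>\<bar> <= N * B ==> \<psi>s \<xi> <= c' * \<xi>\<^sup>2" using psis_upper by metis
 \<comment> \<open>\<open>c'\<close> and \<open>N\<^sup>2\<close> come from the quadratic bound on
   \<open>\<psi>s\<close>, and \<open>K\<close> bounds the mobility.\<close>
 define c where "c = (1 / (2 * N)) * (c' * N\<^sup>2 * K)"
 have c: "0 <= c" using N K(1) c'(1) by (simp add: c_def)
 have "(\<integral>\<^sup>+ p. ennreal \<bar>h p\<bar> \<partial>total_var (j t)) <= ennreal (Rr t / N) + ennreal c * (\<integral>\<^sup>+ p. ennreal ((h p)\<^sup>2) \<partial>\<theta>)"
  if g: "good t" and h: "h \<in> Bor borel" and b: "AE p in \<theta>. \<bar>h p\<bar> <= B" for t h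
 proof -
  note [measurable] = w_section[OF goodD(1)[OF g]] h
  have hm: "(%p. ennreal \<bar>h p\<bar>) \<in> Bor borel" by measurable
  have "(\<integral>\<^sup>+ p. ennreal \<bar>h p\<bar> \<partial>total_var (j t)) = (\<integral>\<^sup>+ p. ennreal (\<bar>w (t, p)\<bar> * A t p) * ennreal \<bar>h p\<bar> \<partial>\<theta>)"
   by (rule total_var_good[OF g hm])
  also have "... <= (\<integral>\<^sup>+ p. ennreal (1 / (2 * N)) * ennreal (\<psi> (2 * w (t, p)) * A t p) + ennreal c * ennreal ((h p)\<^sup>2) \<partial>\<theta>)"
   using b
  proof (intro nn_integral_mono_AE, eventually_elim)
   case (elim p)
   have "\<bar>2 * w (t, p)\<bar> * \<bar>N * h p\<bar> <= \<psi> (2 * w (t, p)) + \<psi>s (N * h p)" by (rule fenchel_abs)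
   also have "\<psi>s (N * h p) <= c' * (N * h p)\<^sup>2" using elim N by (intro c'(2)) (simp add: abs_mult)
   finally have "\<bar>2 * w (t, p)\<bar> * \<bar>N * h p\<bar> * A t p <= (\<psi> (2 * w (t, p)) + c' * (N * h p)\<^sup>2) * A t p"
    by (intro mult_right_mono) auto
   also have "... <= \<psi> (2 * w (t, p)) * A t p + c' * (N * h p)\<^sup>2 * K"
    unfolding distrib_right using K c'(1) by (intro add_left_mono mult_left_mono) auto
   finally have "(1 / (2 * N)) * (\<bar>2 * w (t, p)\<bar> * \<bar>N * h p\<bar> * A t p) <=
     (1 / (2 * N)) * (\<psi> (2 * w (t, p)) * A t p + c' * (N * h p)\<^sup>2 * K)"
    using N by (intro mult_left_mono) auto
   moreover have "(1 / (2 * N)) * (\<bar>2 * w (t, p)\<bar> * \<bar>N * h p\<bar> * A t p) = \<bar>w (t, p)\<bar> * A t p * \<bar>h p\<bar>"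
    using N by (simp add: abs_mult field_simps)
   moreover have "(1 / (2 * N)) * (\<psi> (2 * w (t, p)) * A t p + c' * (N * h p)\<^sup>2 * K) =
     (1 / (2 * N)) * (\<psi> (2 * w (t, p)) * A t p) + c * (h p)\<^sup>2"
    unfolding c_def by (simp add: distrib_left power_mult_distrib)
   ultimately have "\<bar>w (t, p)\<bar> * A t p * \<bar>h p\<bar> <= (1 / (2 * N)) * (\<psi> (2 * w (t, p)) * A t p) + c * (h p)\<^sup>2" by linarith
   then have "ennreal (\<bar>w (t, p)\<bar> * A t p * \<bar>h p\<bar>) <= ennreal ((1 / (2 * N)) * (\<psi> (2 * w (t, p)) * A t p) + c * (h p)\<^sup>2)"
    by (rule ennreal_leI)
   also have "... = ennreal (1 / (2 * N)) * ennreal (\<psi> (2 * w (t, p)) * A t p) + ennreal c * ennreal ((h p)\<^sup>2)"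
    using N c by (simp add: ennreal_mult[symmetric] ennreal_plus[symmetric] del: ennreal_plus)
   finally show ?case by (simp add: ennreal_mult)
  qed
  also have "... = ennreal (1 / (2 * N)) * ennreal (2 * Rr t) + ennreal c * (\<integral>\<^sup>+ p. ennreal ((h p)\<^sup>2) \<partial>\<theta>)"
   unfolding goodD(5)[OF g]
   by (subst nn_integral_add, simp add: measurable_edge_borel, simp add: measurable_edge_borel,
     subst (1 2) nn_integral_cmult) (simp_all add: measurable_edge_borel)
  also have "ennreal (1 / (2 * N)) * ennreal (2 * Rr t) = ennreal (Rr t / N)"
   using N by (subst ennreal_mult[symmetric]) simp_all
  finally show ?thesis .
 qed
 with c that show ?thesis by blast
qed

lemma flux_integrable:
 assumes h: "h \<in> Bor borel" and fin: "(\<integral>\<^sup>+ t. (\<integral>\<^sup>+ p. ennreal \<bar>h p\<bar> \<partial>total_var (j t)) \<partial>TT) < \<infinity>"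
 shows "AE t in TT. integrable (total_var (j t)) h"
  and "integrable TT (%t. signed_integral (j t) offdiag h)"
proof -
 have hm: "(%p. ennreal \<bar>h p\<bar>) \<in> Bor borel" using h by measurable
 have ae: "AE t in TT. (\<integral>\<^sup>+ p. ennreal \<bar>h p\<bar> \<partial>total_var (j t)) ~= \<infinity>"
  using fin by (intro nn_integral_PInf_AE tv_nn_integral_meas[OF hm]) auto
 show aei: "AE t in TT. integrable (total_var (j t)) h"
  using ae AE_space
 proof eventually_elim
  case (elim t)
  have "h \<in> Bor (total_var (j t))" using h tv_sets[of t] elim(2) by (simp cong: measurable_cong_sets)
  with elim(1) show ?case by (simp add: integrable_iff_bounded top.not_eq_extremum)
 qed
 let ?k = "%p. ind offdiag p * h p"
 have k: "?k \<in> Bor borel" using h offdiag_borel by measurable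
 \<comment> \<open>The Bochner integral written with nonnegative integrals, for which measurability
   in time is known at once. The two agree at a.e. time, namely where \<open>h\<close> is
   integrable.\<close>
 let ?L = "%M. enn2real (\<integral>\<^sup>+ p. ennreal (?k p) \<partial>M) - enn2real (\<integral>\<^sup>+ p. ennreal (- ?k p) \<partial>M)"
 have part: "(%t. ?L (m t)) \<in> Bor TT"
  if m: "!!t. t \<in> space TT ==> sets (m t) = sets borel" "!!B. B \<in> sets borel ==> (%t. em (m t) B) \<in> Bor TT" for m
 proof -
  have [measurable]: "(%t. \<integral>\<^sup>+ p. ennreal (?k p) \<partial>m t) \<in> Bor TT" "(%t. \<integral>\<^sup>+ p. ennreal (- ?k p) \<partial>m t) \<in> Bor TT"
   by (rule nn_integral_measurable_of_emeasure[OF m(1) m(2) measurable_compose[OF k measurable_ennreal]],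
     assumption+,
     rule nn_integral_measurable_of_emeasure[OF m(1) m(2)
      measurable_compose[OF borel_measurable_uminus[OF k] measurable_ennreal]])
  show ?thesis by measurable
 qed
 have s1: "sets (fst (j t)) = sets borel" "sets (snd (j t)) = sets borel" if "t \<in> space TT" for t
  using sigma_signedD(1,2)[OF j_sigma] that by simp_all
 have "(%t. ?L (fst (j t)) - ?L (snd (j t))) \<in> Bor TT"
  by (intro borel_measurable_diff part s1 j_emeasure_meas)
 then have meas: "(%t. signed_integral (j t) offdiag h) \<in> Bor TT"
 proof (rule TTc.measurable_AE_cong)
  show "AE t in TT. ?L (fst (j t)) - ?L (snd (j t)) = signed_integral (j t) offdiag h"
   using ae AE_space
  proof eventually_elim
   case (elim t)
   then have t: "t \<in> {0..T}" by simp
   have L: "(LINT p:offdiag|M. h p) = ?L M"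
    if sM: "sets M = sets borel" and le: "(\<integral>\<^sup>+ p. ennreal \<bar>h p\<bar> \<partial>M) <= (\<integral>\<^sup>+ p. ennreal \<bar>h p\<bar> \<partial>total_var (j t))" for M
   proof -
    have km: "?k \<in> Bor M" using k sM by (simp cong: measurable_cong_sets)
    have "(\<integral>\<^sup>+ p. ennreal (norm (?k p)) \<partial>M) <= (\<integral>\<^sup>+ p. ennreal \<bar>h p\<bar> \<partial>M)"
     by (intro nn_integral_mono) (auto simp: indicator_def)
    also note le
    finally have "(\<integral>\<^sup>+ p. ennreal (norm (?k p)) \<partial>M) < \<infinity>" using elim(1) by (simp add: top.not_eq_extremum le_less_trans)
    then have "integrable M ?k" using km by (simp add: integrable_iff_bounded)
    then show ?thesis unfolding set_lebesgue_integral_def real_scaleR_def by (rule real_lebesgue_integral_def)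
   qed
   show ?case
    unfolding signed_integral_def using L[OF s1(1) fst_snd_le_tv(1)[OF t hm]] L[OF s1(2) fst_snd_le_tv(2)[OF t hm]] t
    by simp
  qed
 qed simp
 show "integrable TT (%t. signed_integral (j t) offdiag h)"
 proof (rule integrableI_bounded[OF meas])
  have "(\<integral>\<^sup>+ t. ennreal (norm (signed_integral (j t) offdiag h)) \<partial>TT) <= (\<integral>\<^sup>+ t. (\<integral>\<^sup>+ p. ennreal \<bar>h p\<bar> \<partial>total_var (j t)) \<partial>TT)"
   using h by (intro nn_integral_mono) (simp add: si_bound)
  with fin show "(\<integral>\<^sup>+ t. ennreal (norm (signed_integral (j t) offdiag h)) \<partial>TT) < \<infinity>" by (rule le_less_trans[rotated])
 qed
qed

lemma Lip_flux_finite: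
 assumes f: "f \<in> Lip_b"
 shows "(\<integral>\<^sup>+ t. (\<integral>\<^sup>+ p. ennreal \<bar>ograd f p\<bar> \<partial>total_var (j t)) \<partial>TT) < \<infinity>"
proof -
 obtain K where K: "0 <= K" "!!p :: 'v \<times> 'v. \<bar>ograd f p\<bar> <= K * min 1 (dist (fst p) (snd p))"
  using Lip_ograd_bound[OF f] by metis
 have "(\<integral>\<^sup>+ t. (\<integral>\<^sup>+ p. ennreal \<bar>ograd f p\<bar> \<partial>total_var (j t)) \<partial>TT) <= (\<integral>\<^sup>+ t. ennreal K * mass t \<partial>TT)"
 proof (rule nn_integral_mono)
  fix t assume "t \<in> space TT"
  then have t: "t \<in> {0..T}" by simp
  have "(\<integral>\<^sup>+ p. ennreal \<bar>ograd f p\<bar> \<partial>total_var (j t)) <= (\<integral>\<^sup>+ p. ennreal K * ennreal (min 1 (dist (fst p) (snd p))) \<partial>total_var (j t))"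
   using K by (intro nn_integral_mono) (auto simp: ennreal_mult[symmetric] intro!: ennreal_leI)
  also have "... = ennreal K * mass t"
   unfolding mass_def using tv_sets[OF t] by (intro nn_integral_cmult) (simp cong: measurable_cong_sets)
  finally show "(\<integral>\<^sup>+ p. ennreal \<bar>ograd f p\<bar> \<partial>total_var (j t)) <= ennreal K * mass t" .
 qed
 also have "... = ennreal K * (\<integral>\<^sup>+ t. mass t \<partial>TT)" by (rule nn_integral_cmult) simp
 also have "... < \<infinity>" using mass_fin by (simp add: ennreal_mult_less_top)
 finally show ?thesis .
qed

lemma X2_facts:
 assumes "f \<in> X2 \<pi> \<kappa>"
 obtains B where "f \<in> Bor borel" "AE x in \<pi>. \<bar>f x\<bar> <= B" "AE p in \<theta>. \<bar>ograd f p\<bar> <= 2 * B"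
  "(\<integral>\<^sup>+ p. ennreal ((ograd f p)\<^sup>2) \<partial>\<theta>) < \<infinity>"
proof -
 obtain B where f: "f \<in> Bor borel" "AE x in \<pi>. \<bar>f x\<bar> <= B"
  "(\<integral>\<^sup>+p\<in>offdiag. ennreal (\<bar>ograd f p\<bar>\<^sup>2) \<partial>\<theta>) < \<infinity>"
  using assms unfolding X2_def by blast
 have "AE p in \<theta>. \<bar>ograd f p\<bar> <= 2 * B"
  using AE_edge[OF f(2)] by eventually_elim (auto simp: ograd_def split_def)
 moreover have "(\<integral>\<^sup>+p\<in>offdiag. ennreal (\<bar>ograd f p\<bar>\<^sup>2) \<partial>\<theta>) = (\<integral>\<^sup>+ p. ennreal ((ograd f p)\<^sup>2) \<partial>\<theta>)"
  using AE_edge_offdiag by (intro nn_integral_cong_AE) (auto elim!: eventually_mono simp: indicator_def)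
 ultimately show ?thesis using f that by simp
qed

lemma X2_flux_finite:
 assumes f: "f \<in> X2 \<pi> \<kappa>"
 shows "(\<integral>\<^sup>+ t. (\<integral>\<^sup>+ p. ennreal \<bar>ograd f p\<bar> \<partial>total_var (j t)) \<partial>TT) < \<infinity>"
proof -
 obtain B where B: "f \<in> Bor borel" "AE p in \<theta>. \<bar>ograd f p\<bar> <= 2 * B"
  "(\<integral>\<^sup>+ p. ennreal ((ograd f p)\<^sup>2) \<partial>\<theta>) < \<infinity>"
  using X2_facts[OF f] by metis
 obtain c where c: "0 <= c" "!!t h. good t ==> h \<in> Bor borel ==> (AE p in \<theta>. \<bar>h p\<bar> <= 2 * B) ==>
  (\<integral>\<^sup>+ p. ennreal \<bar>h p\<bar> \<partial>total_var (j t)) <= ennreal (Rr t / 1) + ennreal c * (\<integral>\<^sup>+ p. ennreal ((h p)\<^sup>2) \<partial>\<theta>)"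
  using fenchel_flux[of 1 "2 * B"] by (metis zero_less_one)
 let ?I = "ennreal c * (\<integral>\<^sup>+ p. ennreal ((ograd f p)\<^sup>2) \<partial>\<theta>)"
 have I: "?I < \<infinity>" using B(3) by (simp add: ennreal_mult_less_top)
 have "(\<integral>\<^sup>+ t. (\<integral>\<^sup>+ p. ennreal \<bar>ograd f p\<bar> \<partial>total_var (j t)) \<partial>TT) <= (\<integral>\<^sup>+ t. ennreal (Rr t) + ?I \<partial>TT)"
 proof (rule nn_integral_mono_AE)
  show "AE t in TT. (\<integral>\<^sup>+ p. ennreal \<bar>ograd f p\<bar> \<partial>total_var (j t)) <= ennreal (Rr t) + ?I"
   using AE_good by eventually_elim (use c(2)[OF _ ograd_measurable[OF B(1)] B(2)] in simp)
 qed
 also have "... = (\<integral>\<^sup>+ t. ennreal (Rr t) \<partial>TT) + ?I * em TT (space TT)"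
  using Rr_Dr_integrable(1) by (subst nn_integral_add) (simp_all del: space_TT)
 also have "... < \<infinity>"
 proof -
  have "(\<integral>\<^sup>+ t. ennreal (norm (Rr t)) \<partial>TT) < \<infinity>"
   using Rr_Dr_integrable(1) by (simp only: integrable_iff_bounded)
  moreover have "em TT (space TT) < top" by (metis TT.emeasure_finite less_top)
  ultimately show ?thesis using I by (simp add: ennreal_mult_less_top del: space_TT)
 qed
 finally show ?thesis .
qed

lemma X2_rho_integrable:
 assumes f: "f \<in> X2 \<pi> \<kappa>" and t: "t \<in> {0..T}" shows "integrable (\<rho> t) f"
proof -
 obtain B where B: "f \<in> Bor borel" "AE x in \<pi>. \<bar>f x\<bar> <= B" using X2_facts[OF f] by metis
 have "integrable \<pi> f"
  using B by (intro pi.integrable_const_bound[of _ B]) (auto simp: measurable_pi_borel)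
 then show ?thesis using u_mult_integrable[OF t] integral_rho(2)[OF t B(1)] by simp
qed

end

context entropy_space
begin

text \<open>In terms of densities, mixing is pointwise for the measures and for the fluxes.
  Concavity of the mobility makes the reference measure of the mixture dominate the mixture of the
  reference measures, so the perspective inequality bounds the dissipation.\<close>

lemma RCE_mix:
 assumes T: "0 < T" and r0: "(\<rho>0, j0) \<in> RCE \<pi> \<kappa> \<phi> \<psi>s \<alpha> T" and r1: "(\<rho>1, j1) \<in> RCE \<pi> \<kappa> \<phi> \<psi>s \<alpha> T"
  and s: "0 < s" "s < 1"
 shows "(%t. mix_measure s (\<rho>0 t) (\<rho>1 t), %t. mix_signed s (j0 t) (j1 t)) \<in> RCE \<pi> \<kappa> \<phi> \<psi>s \<alpha> T"
proof -
 interpret c0: curve \<pi> \<kappa> \<phi> \<psi>s \<alpha> T \<rho>0 j0 by unfold_locales (rule T, rule r0)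
 interpret c1: curve \<pi> \<kappa> \<phi> \<psi>s \<alpha> T \<rho>1 j1 by unfold_locales (rule T, rule r1)
 let ?r = "%t. mix_measure s (\<rho>0 t) (\<rho>1 t)" and ?j = "%t. mix_signed s (j0 t) (j1 t)"
 let ?TT = "lebesgue_on {0..T}"
 have s': "0 <= s" "s <= 1" using s by simp_all
 define um where "um t x = (1 - s) * c0.u t x + s * c1.u t x" for t x
 have umm[measurable]: "um t \<in> Bor borel" for t unfolding um_def[abs_def] by measurable
 have umn: "0 <= um t x" for t x unfolding um_def using s by simp
 have rd: "?r t = dens (um t)" if t: "t \<in> {0..T}" for t
  unfolding c0.rho_dens[OF t] c1.rho_dens[OF t] um_def[abs_def] dens_def
  by (rule mix_measure_density) (simp_all add: s' measurable_pi_borel)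
 have umi: "integrable \<pi> (um t)" if t: "t \<in> {0..T}" for t
  unfolding um_def[abs_def] using c0.u_integrable[OF t] c1.u_integrable[OF t] by simp
 have rf: "?r t \<in> finite_borel_measures" if t: "t \<in> {0..T}" for t
 proof -
  have "em (dens (um t)) (space (dens (um t))) = (\<integral>\<^sup>+ x. ennreal (um t x) \<partial>\<pi>)"
   using nn_integral_density[of "%x. ennreal (um t x)" \<pi> "%_. 1"] by (simp add: dens_def measurable_pi_borel)
  also have "... < \<infinity>"
  proof -
   have "(\<integral>\<^sup>+ x. ennreal (norm (um t x)) \<partial>\<pi>) < \<infinity>" using umi[OF t] by (simp only: integrable_iff_bounded)
   then show ?thesis by (simp add: umn)
  qed
  finally have "finite_measure (dens (um t))" by (intro finite_measureI) simp
  then show ?thesis unfolding rd[OF t] by (simp add: finite_borel_measures_def dens_def)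
 qed
 note MF = mix_signed_facts[OF c0.j_sigma c1.j_sigma s']
 have js: "?j t \<in> sigma_signed" if "t \<in> {0..T}" for t by (rule MF(1)[OF that that])
 have jd: "em (total_var (?j t)) (- offdiag) = 0" if t: "t \<in> {0..T}" for t
 proof -
  have ob: "- offdiag \<in> sets (borel :: ('v \<times> 'v) measure)" using offdiag_borel by (rule borel_comp)
  have "(\<integral>\<^sup>+ p. ind (- offdiag) p \<partial>total_var (?j t)) <=
    ennreal (1 - s) * (\<integral>\<^sup>+ p. ind (- offdiag) p \<partial>total_var (j0 t)) + ennreal s * (\<integral>\<^sup>+ p. ind (- offdiag) p \<partial>total_var (j1 t))"
   using ob by (intro MF(2)[OF t t]) simp
  then show ?thesis
   using ob sigma_signedD(3)[OF js[OF t]] c0.tv_sets[OF t] c1.tv_sets[OF t] c0.j_diag[OF t] c1.j_diag[OF t] by simp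
 qed
 \<comment> \<open>Because of cancellation, the parts of the mixed flux are not mixtures of the
   parts. They are the positive and negative parts of a jointly measurable density \<open>F\<close>
   with respect to a common kernel, which represents the mixed flux at a.e. time.\<close>
 have flux: "measurable_flux T ?j"
 proof -
  define Y where "Y t = add_measure (total_var (j0 t)) (total_var (j1 t))" for t
  have Ys: "sets (Y t) = sets borel" "sigma_finite_measure (Y t)"
   "absolutely_continuous (Y t) (total_var (j0 t))" "absolutely_continuous (Y t) (total_var (j1 t))" if t: "t \<in> {0..T}" for t
   unfolding Y_def using sigma_signedD[OF c0.j_sigma[OF t]] sigma_signedD[OF c1.j_sigma[OF t]]
   by (simp_all add: sigma_finite_add_measure absolutely_continuous_add_measure)
  have wk: "weighted_kernel ?TT borel jump_weight Y"
   unfolding weighted_kernel_def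
  proof (intro conjI ballI)
   have m: "(%p::'v \<times> 'v. ennreal (jump_weight p)) \<in> Bor borel" by measurable
   show "AE t in ?TT. (\<integral>\<^sup>+ p. ennreal (jump_weight p) \<partial>Y t) < \<infinity>"
    using c0.wk_tv[unfolded weighted_kernel_def, THEN conjunct2, THEN conjunct2]
     c1.wk_tv[unfolded weighted_kernel_def, THEN conjunct2, THEN conjunct2] AE_space
   proof eventually_elim
    case (elim t)
    then have t: "t \<in> {0..T}" by simp
    have "(\<integral>\<^sup>+ p. ennreal (jump_weight p) \<partial>Y t) =
     (\<integral>\<^sup>+ p. ennreal (jump_weight p) \<partial>total_var (j0 t)) + (\<integral>\<^sup>+ p. ennreal (jump_weight p) \<partial>total_var (j1 t))"
     unfolding Y_def using m c0.tv_sets[OF t] c1.tv_sets[OF t]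
     by (intro nn_integral_add_measure) (simp_all cong: measurable_cong_sets)
    with elim show ?case by simp
   qed
  next
   fix B :: "('v \<times> 'v) set" assume B: "B \<in> sets borel"
   have e: "em (Y t) B = em (total_var (j0 t)) B + em (total_var (j1 t)) B" if "t \<in> space ?TT" for t
    unfolding Y_def using that B c0.tv_sets[of t] c1.tv_sets[of t] by (subst emeasure_add_measure) simp_all
   show "(%t. em (Y t) B) \<in> Bor ?TT"
    by (subst measurable_cong[OF e], assumption) (intro borel_measurable_add c0.tv_emeasure_meas c1.tv_emeasure_meas B)
  qed (use Ys(1) in simp)
  have acp: "absolutely_continuous (Y t) (fst (j0 t))" "absolutely_continuous (Y t) (snd (j0 t))"
   "absolutely_continuous (Y t) (fst (j1 t))" "absolutely_continuous (Y t) (snd (j1 t))" if t: "t \<in> {0..T}" for t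
  proof -
   have p: "absolutely_continuous (total_var \<mu>) (fst \<mu>)" "absolutely_continuous (total_var \<mu>) (snd \<mu>)"
    if "\<mu> \<in> sigma_signed" for \<mu> :: "('v \<times> 'v) signed"
    unfolding total_var_def using sigma_signedD(1,2)[OF that] by (simp_all add: absolutely_continuous_add_measure)
   show "absolutely_continuous (Y t) (fst (j0 t))" "absolutely_continuous (Y t) (snd (j0 t))"
    "absolutely_continuous (Y t) (fst (j1 t))" "absolutely_continuous (Y t) (snd (j1 t))"
    by (rule absolutely_continuous_trans[OF Ys(3)[OF t] p(1)[OF c0.j_sigma[OF t]]],
      rule absolutely_continuous_trans[OF Ys(3)[OF t] p(2)[OF c0.j_sigma[OF t]]],
      rule absolutely_continuous_trans[OF Ys(4)[OF t] p(1)[OF c1.j_sigma[OF t]]],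
      rule absolutely_continuous_trans[OF Ys(4)[OF t] p(2)[OF c1.j_sigma[OF t]]])
  qed
  have acs: "AE t in ?TT. absolutely_continuous (Y t) (fst (j0 t))" "AE t in ?TT. absolutely_continuous (Y t) (snd (j0 t))"
   "AE t in ?TT. absolutely_continuous (Y t) (fst (j1 t))" "AE t in ?TT. absolutely_continuous (Y t) (snd (j1 t))"
   by (rule AE_I2, rule acp, simp)+
  obtain a0 where a0: "a0 \<in> Bor (?TT \<Otimes>\<^sub>M borel)" "\<forall>p. 0 <= a0 p"
   "AE t in ?TT. fst (j0 t) = density (Y t) (%y. ennreal (a0 (t, y)))"
   by (rule weighted_kernel_density[OF c0.weighted c0.wk_parts(1) wk acs(1)])
  obtain b0 where b0: "b0 \<in> Bor (?TT \<Otimes>\<^sub>M borel)" "\<forall>p. 0 <= b0 p"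
   "AE t in ?TT. snd (j0 t) = density (Y t) (%y. ennreal (b0 (t, y)))"
   by (rule weighted_kernel_density[OF c0.weighted c0.wk_parts(2) wk acs(2)])
  obtain a1 where a1: "a1 \<in> Bor (?TT \<Otimes>\<^sub>M borel)" "\<forall>p. 0 <= a1 p"
   "AE t in ?TT. fst (j1 t) = density (Y t) (%y. ennreal (a1 (t, y)))"
   by (rule weighted_kernel_density[OF c0.weighted c1.wk_parts(1) wk acs(3)])
  obtain b1 where b1: "b1 \<in> Bor (?TT \<Otimes>\<^sub>M borel)" "\<forall>p. 0 <= b1 p"
   "AE t in ?TT. snd (j1 t) = density (Y t) (%y. ennreal (b1 (t, y)))"
   by (rule weighted_kernel_density[OF c0.weighted c1.wk_parts(2) wk acs(4)])
  note [measurable] = a0(1) b0(1) a1(1) b1(1)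
  define F where "F q = (1 - s) * (a0 q - b0 q) + s * (a1 q - b1 q)" for q
  have F[measurable]: "F \<in> Bor (?TT \<Otimes>\<^sub>M borel)" unfolding F_def[abs_def] by measurable
  have rep: "AE t in ?TT. ?j t = signed_density (Y t) (%p. F (t, p)) & (%p. F (t, p)) \<in> Bor borel"
   using a0(3) b0(3) a1(3) b1(3) AE_space
  proof eventually_elim
   case (elim t)
   then have t: "t \<in> {0..T}" by simp
   have sec: "(%p. a0 (t, p)) \<in> Bor borel" "(%p. b0 (t, p)) \<in> Bor borel"
    "(%p. a1 (t, p)) \<in> Bor borel" "(%p. b1 (t, p)) \<in> Bor borel"
    "(%p. F (t, p)) \<in> Bor borel"
    using elim(5) by measurable
   have d0: "(%p. a0 (t, p) - b0 (t, p)) \<in> Bor borel" and d1: "(%p. a1 (t, p) - b1 (t, p)) \<in> Bor borel"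
    using sec by measurable
   note G = Ys(2,1)[OF t]
   have e0: "j0 t = signed_density (Y t) (%p. a0 (t, p) - b0 (t, p))"
    by (rule signed_density_of_parts[OF G c0.j_sigma[OF t] sec(1,2) a0(2)[rule_format] b0(2)[rule_format] elim(1,2)])
   have e1: "j1 t = signed_density (Y t) (%p. a1 (t, p) - b1 (t, p))"
    by (rule signed_density_of_parts[OF G c1.j_sigma[OF t] sec(3,4) a1(2)[rule_format] b1(2)[rule_format] elim(3,4)])
   have "?j t = signed_density (Y t) (%p. F (t, p))"
    unfolding e0 e1 F_def by (rule mix_signed_signed_density[OF G d0 d1 s'])
   with sec(5) show ?case by blast
  qed
  show ?thesis
   unfolding measurable_flux_def
  proof (intro ballI conjI)
   fix B :: "('v \<times> 'v) set" assume B[measurable]: "B \<in> sets borel"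
   have meas: "(%t. \<integral>\<^sup>+ p. ennreal (k * F (t, p)) * ind B p \<partial>Y t) \<in> Bor ?TT" for k
    using weighted_space.weighted_kernel_nn_integral_measurable[OF c0.weighted wk,
     of "%q. ennreal (k * F q) * ind B (snd q)"] by simp
   have eq: "em (density (Y t) (%p. ennreal (k * F (t, p)))) B = (\<integral>\<^sup>+ p. ennreal (k * F (t, p)) * ind B p \<partial>Y t)"
    if "t \<in> {0..T}" "(%p. F (t, p)) \<in> Bor borel" for t k
   proof -
    have "(%p. F (t, p)) \<in> Bor (Y t)" using that Ys(1)[OF that(1)] by (simp cong: measurable_cong_sets)
    then have "(%p. ennreal (k * F (t, p))) \<in> Bor (Y t)" by measurable
    then show ?thesis using Ys(1)[OF that(1)] B by (intro emeasure_density) simp_all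
   qed
   show "(%t. em (fst (?j t)) B) \<in> Bor ?TT"
   proof (rule c0.TTc.measurable_AE_cong[OF meas[of 1]])
    show "AE t in ?TT. (\<integral>\<^sup>+ p. ennreal (1 * F (t, p)) * ind B p \<partial>Y t) = em (fst (?j t)) B"
     using rep AE_space by eventually_elim (use eq[of _ 1] in \<open>simp add: signed_density_def\<close>)
   qed simp
   show "(%t. em (snd (?j t)) B) \<in> Bor ?TT"
   proof (rule c0.TTc.measurable_AE_cong[OF meas[of "- 1"]])
    show "AE t in ?TT. (\<integral>\<^sup>+ p. ennreal (- 1 * F (t, p)) * ind B p \<partial>Y t) = em (snd (?j t)) B"
     using rep AE_space by eventually_elim (use eq[of _ "- 1"] in \<open>simp add: signed_density_def\<close>)
   qed simp
  qed
 qed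
 have Sl: "{0..T} \<in> sets lebesgue" by simp
 have mass: "(\<integral>\<^sup>+t\<in>{0..T}. (\<integral>\<^sup>+ (x, y). ennreal (min 1 (dist x y)) \<partial>total_var (?j t)) \<partial>lebesgue) < \<infinity>"
 proof -
  have "(\<integral>\<^sup>+ t. (\<integral>\<^sup>+ p. ennreal (min 1 (dist (fst p) (snd p))) \<partial>total_var (?j t)) \<partial>?TT) <=
    (\<integral>\<^sup>+ t. ennreal (1 - s) * c0.mass t + ennreal s * c1.mass t \<partial>?TT)"
   unfolding c0.mass_def c1.mass_def by (intro nn_integral_mono MF(2)) auto
  also have "... = ennreal (1 - s) * (\<integral>\<^sup>+ t. c0.mass t \<partial>?TT) + ennreal s * (\<integral>\<^sup>+ t. c1.mass t \<partial>?TT)"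
   by (simp add: nn_integral_add nn_integral_cmult)
  also have "... < \<infinity>" using c0.mass_fin c1.mass_fin by (simp add: ennreal_mult_less_top)
  finally show ?thesis unfolding nn_integral_lebesgue_on[OF Sl] by (simp add: split_def)
 qed
 have ce: "satisfies_ce T X ?r ?j"
  if X: "satisfies_ce T X \<rho>0 j0" "satisfies_ce T X \<rho>1 j1"
   and Xm: "!!f. f \<in> X ==> f \<in> Bor borel"
   and Xr: "!!f t. f \<in> X ==> t \<in> {0..T} ==> integrable (\<rho>0 t) f" "!!f t. f \<in> X ==> t \<in> {0..T} ==> integrable (\<rho>1 t) f"
   and Xj: "!!f. f \<in> X ==> (\<integral>\<^sup>+ t. (\<integral>\<^sup>+ p. ennreal \<bar>ograd f p\<bar> \<partial>total_var (j0 t)) \<partial>?TT) < \<infinity>"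
    "!!f. f \<in> X ==> (\<integral>\<^sup>+ t. (\<integral>\<^sup>+ p. ennreal \<bar>ograd f p\<bar> \<partial>total_var (j1 t)) \<partial>?TT) < \<infinity>" for X
  unfolding satisfies_ce_def
 proof (intro ballI allI impI)
  fix f a b assume f: "f \<in> X" and ab: "0 <= a & a <= b & b <= T"
  note fm = Xm[OF f]
  have om: "ograd f \<in> Bor borel" by (rule c0.ograd_measurable[OF fm])
  have lin: "(LINT x|?r t. f x) = (1 - s) * (LINT x|\<rho>0 t. f x) + s * (LINT x|\<rho>1 t. f x)" if t: "t \<in> {0..T}" for t
  proof -
   have i: "integrable \<pi> (%x. c0.u t x * f x)" "integrable \<pi> (%x. c1.u t x * f x)"
    using Xr[OF f t] c0.integral_rho(2)[OF t fm] c1.integral_rho(2)[OF t fm] by simp_all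
   have "(LINT x|?r t. f x) = (\<integral>x. um t x * f x \<partial>\<pi>)"
    unfolding rd[OF t] dens_def using fm umn by (intro integral_real_density) (simp_all add: measurable_pi_borel)
   also have "... = (\<integral>x. (1 - s) * (c0.u t x * f x) + s * (c1.u t x * f x) \<partial>\<pi>)"
    unfolding um_def by (simp only: distrib_right mult.assoc)
   also have "... = (1 - s) * (\<integral>x. c0.u t x * f x \<partial>\<pi>) + s * (\<integral>x. c1.u t x * f x \<partial>\<pi>)" using i by simp
   finally show ?thesis using c0.integral_rho(1)[OF t fm] c1.integral_rho(1)[OF t fm] by simp
  qed
  note F0 = c0.flux_integrable[OF om Xj(1)[OF f]] and F1 = c1.flux_integrable[OF om Xj(2)[OF f]]
  let ?s0 = "%r. signed_integral (j0 r) offdiag (ograd f)" and ?s1 = "%r. signed_integral (j1 r) offdiag (ograd f)"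
  have ab': "0 <= a" "a <= b" "b <= T" using ab by auto
  have si: "set_integrable lebesgue {a..b} ?s0" "set_integrable lebesgue {a..b} ?s1"
   by (rule c0.indefinite_integral_continuous_TT(2)[OF F0(2) ab'], rule c1.indefinite_integral_continuous_TT(2)[OF F1(2) ab'])
  have ae: "AE r in lebesgue. r \<in> {0..T} --> signed_integral (?j r) offdiag (ograd f) = (1 - s) * ?s0 r + s * ?s1 r"
  proof -
   have "AE r in ?TT. signed_integral (?j r) offdiag (ograd f) = (1 - s) * ?s0 r + s * ?s1 r"
    using F0(1) F1(1) AE_space
    by eventually_elim (use MF(3)[OF _ _ om offdiag_borel] in simp)
   then show ?thesis by (simp add: AE_lebesgue_on)
  qed
  have sl: "(%r. ind {a..b} r *\<^sub>R ((1 - s) * ?s0 r + s * ?s1 r)) \<in> Bor lebesgue"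
  proof -
   have "set_integrable lebesgue {a..b} (%r. (1 - s) * ?s0 r + s * ?s1 r)"
    using si by (intro set_integral_add set_integrable_mult_right) auto
   then show ?thesis unfolding set_integrable_def by (rule borel_measurable_integrable)
  qed
  have ae': "AE r in lebesgue. ind {a..b} r *\<^sub>R ((1 - s) * ?s0 r + s * ?s1 r) =
    ind {a..b} r *\<^sub>R signed_integral (?j r) offdiag (ograd f)"
   using ae by eventually_elim (use ab' in \<open>simp add: indicator_def\<close>)
  have sl': "(%r. ind {a..b} r *\<^sub>R signed_integral (?j r) offdiag (ograd f)) \<in> Bor lebesgue"
   by (rule borel_measurable_AE[OF sl ae'])
  have "(LINT r:{a..b}|lebesgue. signed_integral (?j r) offdiag (ograd f)) = (LINT r:{a..b}|lebesgue. (1 - s) * ?s0 r + s * ?s1 r)"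
   unfolding set_lebesgue_integral_def using ae'
   by (intro integral_cong_AE sl sl') (auto elim!: eventually_mono)
  also have "... = (1 - s) * (LINT r:{a..b}|lebesgue. ?s0 r) + s * (LINT r:{a..b}|lebesgue. ?s1 r)"
   using si by (subst set_integral_add) (auto intro!: set_integrable_mult_right)
  finally have R: "(LINT r:{a..b}|lebesgue. signed_integral (?j r) offdiag (ograd f)) =
   (1 - s) * (LINT r:{a..b}|lebesgue. ?s0 r) + s * (LINT r:{a..b}|lebesgue. ?s1 r)" .
  have E0: "(LINT x|\<rho>0 b. f x) - (LINT x|\<rho>0 a. f x) = (LINT r:{a..b}|lebesgue. ?s0 r)"
   and E1: "(LINT x|\<rho>1 b. f x) - (LINT x|\<rho>1 a. f x) = (LINT r:{a..b}|lebesgue. ?s1 r)"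
   using X f ab unfolding satisfies_ce_def by blast+
  show "(LINT x|?r b. f x) - (LINT x|?r a. f x) = (LINT r:{a..b}|lebesgue. signed_integral (?j r) offdiag (ograd f))"
   unfolding R E0[symmetric] E1[symmetric] using lin[of a] lin[of b] ab by (simp add: algebra_simps)
 qed
 have ceL: "satisfies_ce T Lip_b ?r ?j"
  by (intro ce c0.ce_lip c1.ce_lip Lip_b_borel c0.Lip_flux_finite c1.Lip_flux_finite
   Lip_b_integrable c0.rho_finite c1.rho_finite c0.rho_sets c1.rho_sets)
 have X2m: "f \<in> Bor borel" if "f \<in> X2 \<pi> \<kappa>" for f using that by (simp add: X2_def)
 have ceX: "satisfies_ce T (X2 \<pi> \<kappa>) ?r ?j"
  by (intro ce c0.ce_X2 c1.ce_X2 c0.X2_flux_finite c1.X2_flux_finite c0.X2_rho_integrable c1.X2_rho_integrable)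
   (simp add: X2_def)
 have ent: "Ent (?r t) <= Ent (\<rho>0 t) + Ent (\<rho>1 t)" if t: "t \<in> {0..T}" for t
 proof -
  have conv: "\<phi> (um t x) <= \<phi> (c0.u t x) + \<phi> (c1.u t x)" for x
  proof -
   have "\<phi> (um t x) <= (1 - s) * \<phi> (c0.u t x) + s * \<phi> (c1.u t x)"
    using convex_onD[OF phi_convex, of s "c0.u t x" "c1.u t x"] s' by (simp add: um_def)
   also have "... <= 1 * \<phi> (c0.u t x) + 1 * \<phi> (c1.u t x)"
    using s' phi_nonneg[of "c0.u t x"] phi_nonneg[of "c1.u t x"] by (intro add_mono mult_right_mono) simp_all
   finally show ?thesis by simp
  qed
  have pm: "(%x. ennreal (\<phi> (v x))) \<in> Bor \<pi>" if "v \<in> Bor borel" "!!x. 0 <= v x" for v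
   using phi_measurable[of v \<pi>] that by (simp add: measurable_pi_borel)
  have "Ent (?r t) = (\<integral>\<^sup>+ x. ennreal (\<phi> (um t x)) \<partial>\<pi>)" unfolding rd[OF t] by (rule entropy_dens[OF umm umn])
  also have "... <= (\<integral>\<^sup>+ x. ennreal (\<phi> (c0.u t x)) + ennreal (\<phi> (c1.u t x)) \<partial>\<pi>)"
  proof (rule nn_integral_mono)
   fix x
   have "ennreal (\<phi> (um t x)) <= ennreal (\<phi> (c0.u t x) + \<phi> (c1.u t x))" using conv by (rule ennreal_leI)
   then show "ennreal (\<phi> (um t x)) <= ennreal (\<phi> (c0.u t x)) + ennreal (\<phi> (c1.u t x))"
    by (simp add: phi_nonneg)
  qed
  also have "... = (\<integral>\<^sup>+ x. ennreal (\<phi> (c0.u t x)) \<partial>\<pi>) + (\<integral>\<^sup>+ x. ennreal (\<phi> (c1.u t x)) \<partial>\<pi>)"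
   by (intro nn_integral_add pm) simp_all
  also have "... = Ent (\<rho>0 t) + Ent (\<rho>1 t)"
   unfolding c0.rho_dens[OF t] c1.rho_dens[OF t] by (simp add: entropy_dens)
  finally show ?thesis .
 qed
 have entS: "(SUP t\<in>{0..T}. Ent (?r t)) < \<infinity>"
 proof -
  have "(SUP t\<in>{0..T}. Ent (?r t)) <= (SUP t\<in>{0..T}. Ent (\<rho>0 t)) + (SUP t\<in>{0..T}. Ent (\<rho>1 t))"
  proof (rule SUP_least)
   fix t assume t: "t \<in> {0..T}"
   show "Ent (?r t) <= (SUP t\<in>{0..T}. Ent (\<rho>0 t)) + (SUP t\<in>{0..T}. Ent (\<rho>1 t))"
    by (rule order_trans[OF ent[OF t]]) (intro add_mono SUP_upper t)
  qed
  also have "... < \<infinity>" using c0.ent_sup c1.ent_sup by simp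
  finally show ?thesis .
 qed
 have dis: "AE t in ?TT. Dis (?r t) (?j t) + Fis (?r t) <=
   ennreal ((1 - s) * (c0.Rr t + c0.Dr t) + s * (c1.Rr t + c1.Dr t))"
  using c0.AE_good c1.AE_good
 proof eventually_elim
  case (elim t)
  note g0 = c0.goodD[OF elim(1)] and g1 = c1.goodD[OF elim(2)]
  have t: "t \<in> {0..T}" by (rule g0(1))
  let ?w0 = "%p. c0.w (t, p)" and ?w1 = "%p. c1.w (t, p)"
  note [measurable] = c0.w_section[OF t] c1.w_section[OF t]
  define F where "F p = (1 - s) * (?w0 p * c0.A t p) + s * (?w1 p * c1.A t p)" for p
  have Fm[measurable]: "F \<in> Bor borel" unfolding F_def[abs_def] by measurable
  have jF: "?j t = signed_density \<theta> F"
   unfolding g0(4) g1(4) F_def[abs_def]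
   by (rule mix_signed_signed_density[OF edge.sigma_finite_measure_axioms sets_edge _ _ s']) measurable
  define am where "am p = \<alpha> (um t (fst p), um t (snd p))" for p
  have amm[measurable]: "am \<in> Bor borel"
   unfolding am_def[abs_def]
   by (intro alpha_measurable measurable_compose[OF borel_measurable_fst_snd(1) umm]
    measurable_compose[OF borel_measurable_fst_snd(2) umm]) (simp_all add: umn)
  have amn: "0 <= am p" for p by (simp add: am_def alpha_nonneg umn)
  have ref: "flux_ref \<pi> \<kappa> \<alpha> (?r t) = density \<theta> (%p. ennreal (am p))"
  proof -
   have pd: "AE x in \<pi>. pos_deriv \<pi> (?r t) x = um t x"
    unfolding rd[OF t] by (rule pos_deriv_dens[OF umm umn])
   have m1: "(%p. \<alpha> (pos_deriv \<pi> (?r t) (fst p), pos_deriv \<pi> (?r t) (snd p))) \<in> Bor borel"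
    by (intro alpha_measurable measurable_compose[OF borel_measurable_fst_snd(1) pos_deriv_pi_measurable]
     measurable_compose[OF borel_measurable_fst_snd(2) pos_deriv_pi_measurable]) simp_all
   show ?thesis unfolding flux_ref_def split_def
   proof (rule density_cong)
    show "AE p in \<theta>. ennreal (\<alpha> (pos_deriv \<pi> (?r t) (fst p), pos_deriv \<pi> (?r t) (snd p))) = ennreal (am p)"
     using AE_edge[OF pd] by eventually_elim (simp add: am_def)
    show "(%p. ennreal (\<alpha> (pos_deriv \<pi> (?r t) (fst p), pos_deriv \<pi> (?r t) (snd p)))) \<in> Bor \<theta>"
     unfolding c0.measurable_edge_borel by (rule measurable_compose[OF m1 measurable_ennreal])
   qed (simp add: c0.measurable_edge_borel)
  qed
  have ge: "AE p in \<theta>. (1 - s) * c0.A t p + s * c1.A t p <= am p"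
   using AE_edge[OF g0(2)] AE_edge[OF g1(2)]
  proof eventually_elim
   case (elim p)
   show ?case
    unfolding c0.A_def c1.A_def am_def um_def using elim s' by (simp add: alpha_concave)
  qed
  \<comment> \<open>Where the mobility of the mixture vanishes, both mobilities vanish, since both
    weights are positive. This is absolute continuity of the mixed flux.\<close>
  have z: "AE p in \<theta>. am p = 0 --> F p = 0"
   using ge
  proof eventually_elim
   case (elim p)
   show ?case
   proof
    assume "am p = 0"
    moreover have "0 <= (1 - s) * c0.A t p" "0 <= s * c1.A t p" using s' by simp_all
    ultimately have "(1 - s) * c0.A t p = 0" "s * c1.A t p = 0" using elim by linarith+
    then show "F p = 0" using s by (simp add: F_def)
   qed
  qed
  have Fe: "F \<in> Bor \<theta>" "am \<in> Bor \<theta>" by (simp_all add: c0.measurable_edge_borel)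
  have jn: "?j t = signed_density (flux_ref \<pi> \<kappa> \<alpha> (?r t)) (%p. F p / am p)"
   unfolding jF ref by (rule signed_density_change(2)[OF edge.sigma_finite_measure_axioms Fe amn z])
  have sfr: "sigma_finite_measure (flux_ref \<pi> \<kappa> \<alpha> (?r t))"
   unfolding ref by (rule sigma_finite_density_real[OF edge.sigma_finite_measure_axioms Fe(2)])
  have sr: "sets (flux_ref \<pi> \<kappa> \<alpha> (?r t)) = sets borel" unfolding ref by simp
  have Fam: "(%p. F p / am p) \<in> Bor borel" by measurable
  have dF: "Dis (?r t) (?j t) = (\<integral>\<^sup>+ p. ennreal (\<psi> (2 * (F p / am p))) \<partial>flux_ref \<pi> \<kappa> \<alpha> (?r t)) / 2"
   by (rule dissipation_formula[OF sfr sr Fam jn refl])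
  have "(\<integral>\<^sup>+ p. ennreal (\<psi> (2 * (F p / am p))) \<partial>flux_ref \<pi> \<kappa> \<alpha> (?r t)) =
    (\<integral>\<^sup>+ p. ennreal (\<psi> (2 * (F p / am p)) * am p) \<partial>\<theta>)"
   unfolding ref by (subst nn_integral_density) (simp_all add: c0.measurable_edge_borel ennreal_mult amn mult.commute)
  also have "... <= (\<integral>\<^sup>+ p. ennreal (1 - s) * ennreal (\<psi> (2 * ?w0 p) * c0.A t p) + ennreal s * ennreal (\<psi> (2 * ?w1 p) * c1.A t p) \<partial>\<theta>)"
   using ge
  proof (intro nn_integral_mono_AE, eventually_elim)
   case (elim p)
   have "ennreal (\<psi> (2 * (F p / am p)) * am p) <= ennreal ((1 - s) * (\<psi> (2 * ?w0 p) * c0.A t p) + s * (\<psi> (2 * ?w1 p) * c1.A t p))"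
    unfolding F_def by (intro ennreal_leI perspective_le s' elim) simp_all
   also have "... = ennreal (1 - s) * ennreal (\<psi> (2 * ?w0 p) * c0.A t p) + ennreal s * ennreal (\<psi> (2 * ?w1 p) * c1.A t p)"
    using s' by (simp add: ennreal_mult'[symmetric] ennreal_plus[symmetric] del: ennreal_plus)
   finally show ?case .
  qed
  also have "... = ennreal (1 - s) * ennreal (2 * c0.Rr t) + ennreal s * ennreal (2 * c1.Rr t)"
  proof -
   have m: "(%p. ennreal (\<psi> (2 * ?w0 p) * c0.A t p)) \<in> Bor \<theta>"
    "(%p. ennreal (\<psi> (2 * ?w1 p) * c1.A t p)) \<in> Bor \<theta>"
    unfolding c0.measurable_edge_borel by measurable
   have m': "(%p. ennreal (1 - s) * ennreal (\<psi> (2 * ?w0 p) * c0.A t p)) \<in> Bor \<theta>"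
    "(%p. ennreal s * ennreal (\<psi> (2 * ?w1 p) * c1.A t p)) \<in> Bor \<theta>"
    using m by (intro borel_measurable_times_ennreal; simp)+
   show ?thesis
    unfolding g0(5) g1(5) nn_integral_add[OF m'] nn_integral_cmult[OF m(1)] nn_integral_cmult[OF m(2)] ..
  qed
  also have "... = ennreal (2 * ((1 - s) * c0.Rr t + s * c1.Rr t))"
   using s' by (simp add: ennreal_mult'[symmetric] ennreal_plus[symmetric] distrib_left del: ennreal_plus)
  finally have "Dis (?r t) (?j t) <= ennreal (2 * ((1 - s) * c0.Rr t + s * c1.Rr t)) / 2"
   unfolding dF by (rule divide_right_mono_ennreal)
  also have "... = ennreal ((1 - s) * c0.Rr t + s * c1.Rr t)"
  proof -
   have "ennreal (2 * x) / 2 = ennreal x" if "0 <= x" for x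
    using divide_ennreal[of "2 * x" 2] that by simp
   moreover have "0 <= (1 - s) * c0.Rr t + s * c1.Rr t" using s' by simp
   ultimately show ?thesis by blast
  qed
  finally have D1: "Dis (?r t) (?j t) <= ennreal ((1 - s) * c0.Rr t + s * c1.Rr t)" .
  have "Fis (?r t) <= ennreal (1 - s) * Fis (\<rho>0 t) + ennreal s * Fis (\<rho>1 t)"
   using fconv c0.rho_fbm[OF t] c1.rho_fbm[OF t] c0.ent_fin[OF t] c1.ent_fin[OF t] s unfolding fisher_convex_def by blast
  also have "... = ennreal ((1 - s) * c0.Dr t + s * c1.Dr t)"
   unfolding g0(8) g1(8) using s' by (simp add: ennreal_mult'[symmetric] ennreal_plus[symmetric] del: ennreal_plus)
  finally have D2: "Fis (?r t) <= ennreal ((1 - s) * c0.Dr t + s * c1.Dr t)" .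
  have "Dis (?r t) (?j t) + Fis (?r t) <= ennreal ((1 - s) * c0.Rr t + s * c1.Rr t) + ennreal ((1 - s) * c0.Dr t + s * c1.Dr t)"
   by (rule add_mono[OF D1 D2])
  also have "... = ennreal ((1 - s) * (c0.Rr t + c0.Dr t) + s * (c1.Rr t + c1.Dr t))"
  proof -
   have n: "0 <= (1 - s) * c0.Rr t + s * c1.Rr t" "0 <= (1 - s) * c0.Dr t + s * c1.Dr t" using s' by simp_all
   show ?thesis unfolding ennreal_plus[OF n, symmetric] by (simp add: algebra_simps)
  qed
  finally show ?case .
 qed
 have disI: "(\<integral>\<^sup>+t\<in>{0..T}. (Dis (?r t) (?j t) + Fis (?r t)) \<partial>lebesgue) < \<infinity>"
 proof -
  let ?g = "%t. (1 - s) * (c0.Rr t + c0.Dr t) + s * (c1.Rr t + c1.Dr t)"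
  have gi: "integrable ?TT ?g" using c0.Rr_Dr_integrable c1.Rr_Dr_integrable by simp
  have gn: "0 <= ?g t" for t using s' by simp
  have "(\<integral>\<^sup>+ t. (Dis (?r t) (?j t) + Fis (?r t)) \<partial>?TT) <= (\<integral>\<^sup>+ t. ennreal (?g t) \<partial>?TT)"
   using dis by (rule nn_integral_mono_AE)
  also have "... = (\<integral>\<^sup>+ t. ennreal (norm (?g t)) \<partial>?TT)" using gn by (intro nn_integral_cong) simp
  also have "... < \<infinity>" using gi by (simp only: integrable_iff_bounded)
  finally show ?thesis unfolding nn_integral_lebesgue_on[OF Sl] .
 qed
 have bnd: "AE t\<in>{0<..<T} in lebesgue. AE x in \<pi>. pos_deriv \<pi> (?r t) x <= c0.C + c1.C"
 proof (rule AE_I2, rule impI)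
  fix t assume "t \<in> {0<..<T}"
  then have t: "t \<in> {0..T}" by simp
  have pd: "AE x in \<pi>. pos_deriv \<pi> (?r t) x = um t x"
   unfolding rd[OF t] by (rule pos_deriv_dens[OF umm umn])
  show "AE x in \<pi>. pos_deriv \<pi> (?r t) x <= c0.C + c1.C"
   using pd c0.u_le_C[OF t] c1.u_le_C[OF t]
  proof eventually_elim
   case (elim x)
   have "um t x <= 1 * c0.C + 1 * c1.C"
    unfolding um_def using s' elim by (intro add_mono mult_mono) simp_all
   then show ?case using elim by simp
  qed
 qed
 have ce': "(?r, ?j) \<in> CE T"
  unfolding CE_def mem_Collect_eq prod.case
  by (rule conjI, rule ballI, erule rf, rule conjI, rule ballI, rule conjI, erule js, erule jd,
    rule conjI, rule flux, rule conjI, rule mass, rule ceL)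
 have ace: "(?r, ?j) \<in> ACE \<pi> \<kappa> \<phi> \<psi>s \<alpha> T"
  unfolding ACE_def mem_Collect_eq prod.case by (rule conjI, rule ce', rule conjI, rule entS, rule disI)
 show ?thesis
  unfolding RCE_def mem_Collect_eq prod.case
  by (rule conjI, rule ace, rule conjI, rule exI, rule bnd, rule ceX)
qed

end

section \<open>Real analysis: Lebesgue points, absolute continuity, continuity of translations\<close>

text \<open>One-sided averages to the right come from the differentiation theorem; those to the left
  follow by applying it to the reflected function.\<close>

lemma lebesgue_points:
 fixes g :: "real => real"
 assumes g: "!!a b. g integrable_on {a..b}"
 shows "\<exists>N. negligible N & (\<forall>t. t \<notin> N -->
  ((%h. integral {t..t + h} g / h) \<longlongrightarrow> g t) (at_right 0) &
  ((%h. integral {t - h..t} g / h) \<longlongrightarrow> g t) (at_right 0))"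
proof -
 have R: "\<exists>N. negligible N & (\<forall>t. t \<notin> N --> ((%h. integral {t..t + h} g / h) \<longlongrightarrow> g t) (at_right 0))"
  if g: "!!a b. g integrable_on {a..b}" for g :: "real => real"
 proof -
  have g': "g integrable_on cbox a b" for a b using g by simp
  obtain N where N: "negligible N" "!!x e. [|x \<notin> N; 0 < e|] ==> \<exists>d>0. \<forall>h. 0 < h & h < d -->
   norm (integral (cbox x (x + h *\<^sub>R One)) g /\<^sub>R h ^ DIM(real) - g x) < e"
   using integrable_ccontinuous_explicit[OF g'] by blast
  have "((%h. integral {t..t + h} g / h) \<longlongrightarrow> g t) (at_right 0)" if "t \<notin> N" for t
  proof (rule tendstoI)
   fix e :: real assume "0 < e"
   from N(2)[OF that this] obtain d where d: "0 < d" "!!h. 0 < h ==> h < d ==>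
    norm (integral (cbox t (t + h *\<^sub>R One)) g /\<^sub>R h ^ DIM(real) - g t) < e" by blast
   show "\<forall>\<^sub>F h in at_right 0. dist (integral {t..t + h} g / h) (g t) < e"
   proof (rule eventually_at_rightI[OF _ d(1)])
    fix h assume "h \<in> {0<..<d}"
    then show "dist (integral {t..t + h} g / h) (g t) < e"
     using d(2)[of h] by (simp add: dist_real_def divide_inverse mult.commute)
   qed
  qed
  with N(1) show ?thesis by blast
 qed
 obtain N1 where N1: "negligible N1" "!!t. t \<notin> N1 ==> ((%h. integral {t..t + h} g / h) \<longlongrightarrow> g t) (at_right 0)"
  using R[OF g] by blast
 have gr: "(%x. g (- x)) integrable_on {a..b}" for a b
  using g[of "- b" "- a"] Henstock_Kurzweil_Integration.integrable_reflect_real[where f=g and a="- b" and b="- a"] by simp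
 obtain N2 where N2: "negligible N2"
  "!!t. t \<notin> N2 ==> ((%h. integral {t..t + h} (%x. g (- x)) / h) \<longlongrightarrow> g (- t)) (at_right 0)"
  using R[OF gr] by blast
 have "negligible (uminus ` N2)"
  by (rule negligible_differentiable_image_negligible[OF _ N2(1)])
   (simp_all add: linear_imp_differentiable_on linear_iff)
 then have neg: "negligible (N1 \<union> uminus ` N2)" using N1(1) by (rule negligible_Un[rotated])
 have left: "((%h. integral {t - h..t} g / h) \<longlongrightarrow> g t) (at_right 0)" if t: "t \<notin> uminus ` N2" for t
 proof -
  have "- t \<notin> N2" using t by force
  from N2(2)[OF this] have l: "((%h. integral {- t..- t + h} (%x. g (- x)) / h) \<longlongrightarrow> g t) (at_right 0)" by simp
  have "integral {- t..- t + h} (%x. g (- x)) = integral {t - h..t} g" for h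
   using Henstock_Kurzweil_Integration.integral_reflect_real[where f=g and a="t - h" and b=t] by (simp add: algebra_simps)
  with l show ?thesis by simp
 qed
 show ?thesis
  by (intro exI[of _ "N1 \<union> uminus ` N2"] conjI neg allI impI N1(2) left) simp_all
qed

text \<open>The extension by 0 provides integrability on every bounded interval, which the theorem
  on Lebesgue points asks for.\<close>

lemma set_integrable_time:
 fixes G :: "real => real"
 assumes G: "integrable (lebesgue_on {0..T}) G" and T: "0 <= T"
 shows "set_integrable lebesgue {0..T} G"
  and "!!s t. 0 <= s ==> t <= T ==> (LINT r:{s..t}|lebesgue. G r) = integral {s..t} (%r. if r \<in> {0..T} then G r else 0)"
  and "!!a b. (%r. if r \<in> {0..T} then G r else 0) integrable_on {a..b}"
proof -
 show si: "set_integrable lebesgue {0..T} G"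
  using G by (simp add: set_integrable_def integrable_restrict_space)
 let ?g = "%r. if r \<in> {0..T} then G r else 0"
 have gi: "integrable lebesgue ?g"
 proof -
  have "(%r. ind {0..T} r *\<^sub>R G r) = ?g" by (auto simp: indicator_def)
  then show ?thesis using si unfolding set_integrable_def by simp
 qed
 have sg: "set_integrable lebesgue {a..b} ?g" for a b
  unfolding set_integrable_def using gi by (intro integrable_mult_indicator) simp_all
 show "?g integrable_on {a..b}" for a b
  by (rule set_lebesgue_integral_eq_integral(1)[OF sg])
 show "(LINT r:{s..t}|lebesgue. G r) = integral {s..t} ?g" if "0 <= s" "t <= T" for s t
 proof -
  have "(LINT r:{s..t}|lebesgue. G r) = (LINT r:{s..t}|lebesgue. ?g r)"
   unfolding set_lebesgue_integral_def using that by (intro Bochner_Integration.integral_cong) (auto simp: indicator_def)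
  also have "... = integral {s..t} ?g" by (rule set_lebesgue_integral_eq_integral(2)[OF sg])
  finally show ?thesis .
 qed
qed

lemma primitive_derivative:
 fixes G E :: "real => real"
 assumes G: "integrable (lebesgue_on {0..T}) G" and T: "0 < T"
  and E: "!!s t. 0 <= s ==> s <= t ==> t <= T ==> E t - E s = (LINT r:{s..t}|lebesgue. G r)"
 shows "AE t\<in>{0<..<T} in lebesgue. (E has_real_derivative G t) (at t)"
proof -
 let ?g = "%r. if r \<in> {0..T} then G r else 0"
 note S = set_integrable_time[OF G less_imp_le[OF T]]
 obtain N where N: "negligible N"
  "!!t. t \<notin> N ==> ((%h. integral {t..t + h} ?g / h) \<longlongrightarrow> ?g t) (at_right 0)"
  "!!t. t \<notin> N ==> ((%h. integral {t - h..t} ?g / h) \<longlongrightarrow> ?g t) (at_right 0)"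
  using lebesgue_points[OF S(3)] by blast
 have "(E has_real_derivative G t) (at t)" if t: "t \<in> {0<..<T}" "t \<notin> N" for t
 proof -
  have gt: "?g t = G t" using t(1) by simp
  have "((%h. (E (t + h) - E t) / h) \<longlongrightarrow> G t) (at_right 0)"
  proof (rule Lim_transform_eventually)
   show "((%h. integral {t..t + h} ?g / h) \<longlongrightarrow> G t) (at_right 0)" using N(2)[OF t(2)] unfolding gt .
   show "\<forall>\<^sub>F h in at_right 0. integral {t..t + h} ?g / h = (E (t + h) - E t) / h"
   proof (rule eventually_at_rightI[of 0 "T - t"])
    fix h assume "h \<in> {0<..<T - t}"
    then show "integral {t..t + h} ?g / h = (E (t + h) - E t) / h"
     using E[of t "t + h"] S(2)[of t "t + h"] t(1) by simp
   qed (use t in simp)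
  qed
  moreover have "((%h. (E (t + h) - E t) / h) \<longlongrightarrow> G t) (at_left 0)"
  proof -
   have "((%h. (E (t + - h) - E t) / - h) \<longlongrightarrow> G t) (at_right 0)"
   proof (rule Lim_transform_eventually)
    show "((%h. integral {t - h..t} ?g / h) \<longlongrightarrow> G t) (at_right 0)" using N(3)[OF t(2)] unfolding gt .
    show "\<forall>\<^sub>F h in at_right 0. integral {t - h..t} ?g / h = (E (t + - h) - E t) / - h"
    proof (rule eventually_at_rightI[of 0 t])
     fix h assume h: "h \<in> {0<..<t}"
     then have "E t - E (t - h) = integral {t - h..t} ?g"
      using E[of "t - h" t] S(2)[of "t - h" t] t(1) by simp
     then show "integral {t - h..t} ?g / h = (E (t + - h) - E t) / - h"
      using h by (simp add: divide_simps)
    qed (use t in simp)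
   qed
   then show ?thesis unfolding filterlim_at_left_to_right[of _ _ "0::real"] by simp
  qed
  ultimately show ?thesis unfolding DERIV_def filterlim_at_split by blast
 qed
 moreover have "AE t in lebesgue. t \<notin> N"
  using N(1) by (intro AE_not_in) (simp add: negligible_iff_null_sets)
 ultimately show ?thesis by (auto elim!: eventually_mono)
qed

text \<open>Absolute continuity of the integral. By dominated convergence the part of |G| above some
  height \<open>n\<close> has small integral; the rest contributes at most \<open>n\<close> times
  the total length of the intervals.\<close>

lemma primitive_abs_cont:
 fixes G E :: "real => real"
 assumes G: "integrable (lebesgue_on {0..T}) G" and T: "0 <= T"
  and E: "!!s t. 0 <= s ==> s <= t ==> t <= T ==> E t - E s = (LINT r:{s..t}|lebesgue. G r)"
 shows "abs_cont_on 0 T E"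
 unfolding abs_cont_on_def
proof (intro allI impI)
 fix e :: real assume e: "0 < e"
 let ?g = "%r. ind {0..T} r * \<bar>G r\<bar>"
 note S = set_integrable_time(1)[OF G T]
 have gi: "integrable lebesgue ?g"
  using integrable_abs[OF S[unfolded set_integrable_def]] by (simp add: abs_mult)
 then have gm[measurable]: "?g \<in> Bor lebesgue" by simp
 have gn: "0 <= ?g r" for r by simp
 have "(%n. \<integral>r. ?g r * ind {r. real n < ?g r} r \<partial>lebesgue) \<longlonglongrightarrow> (\<integral>r. 0 \<partial>(lebesgue :: real measure))"
 proof (rule integral_dominated_convergence[where w="?g"])
  show "AE r in lebesgue. (%n. ?g r * ind {r. real n < ?g r} r) \<longlonglongrightarrow> 0"
  proof (rule AE_I2)
   fix r
   have "eventually (%n. ?g r <= real n) sequentially"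
    by (rule filterlim_real_sequentially[unfolded filterlim_at_top, rule_format])
   then have "eventually (%n. ?g r * ind {r. real n < ?g r} r = 0) sequentially"
    by eventually_elim simp
   then show "(%n. ?g r * ind {r. real n < ?g r} r) \<longlonglongrightarrow> 0" by (rule tendsto_eventually)
  qed
  show "AE r in lebesgue. norm (?g r * ind {r. real n < ?g r} r) <= ?g r" for n
   by (rule AE_I2) (simp add: indicator_def)
  show "(%r. ?g r * ind {r. real n < ?g r} r) \<in> Bor lebesgue" for n
  proof -
   have [measurable]: "{r. real n < ?g r} \<in> sets lebesgue" using borel_measurable_less[OF borel_measurable_const gm, of "real n"] by simp
   show ?thesis by measurable
  qed
 qed (use gi in simp_all)
 then have "eventually (%n. (\<integral>r. ?g r * ind {r. real n < ?g r} r \<partial>lebesgue) < e / 2) sequentially"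
  using order_tendstoD(2)[of _ 0 sequentially "e / 2"] e by simp
 then obtain n where n: "(\<integral>r. ?g r * ind {r. real n < ?g r} r \<partial>lebesgue) < e / 2"
  using eventually_happens'[OF sequentially_bot] by blast
 let ?G = "{r. real n < ?g r}"
 have Gs[measurable]: "?G \<in> sets lebesgue" using borel_measurable_less[OF borel_measurable_const gm, of "real n"] by simp
 have bi: "integrable lebesgue (%r. ?g r * ind ?G r)"
  using integrable_mult_indicator[OF Gs gi] by (simp add: mult.commute)
 \<comment> \<open>Gives the bounded part less than half of \<open>e\<close>; the other half is the
   integral above height \<open>n\<close>. The summand 1 covers \<open>n = 0\<close>.\<close>
 define d where "d = e / (2 * (real n + 1))"
 have d: "0 < d" "real n * d < e / 2" using e by (auto simp: d_def field_simps)
 show "\<exists>\<delta>>0. \<forall>(k::nat) l r. (\<forall>i<k. 0 <= l i & l i <= r i & r i <= T) &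
   disjoint_family_on (%i. {l i<..<r i}) {..<k} & (\<Sum>i<k. r i - l i) < \<delta> --> (\<Sum>i<k. \<bar>E (r i) - E (l i)\<bar>) < e"
 proof (intro exI[of _ d] conjI allI impI d(1))
  fix k :: nat and l r :: "nat => real"
  assume A: "(\<forall>i<k. 0 <= l i & l i <= r i & r i <= T) &
   disjoint_family_on (%i. {l i<..<r i}) {..<k} & (\<Sum>i<k. r i - l i) < d"
  then have lr: "0 <= l i" "l i <= r i" "r i <= T" if "i < k" for i using that by auto
  let ?I = "%i. {l i<..<r i}"
  have Ei: "\<bar>E (r i) - E (l i)\<bar> <= (\<integral>x. ind (?I i) x * (real n + ?g x * ind ?G x) \<partial>lebesgue)" if i: "i < k" for i
  proof -
   note b = lr[OF i]
   have ii: "integrable lebesgue (%x. ind (?I i) x * (real n + ?g x * ind ?G x))"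
   proof -
    have "integrable lebesgue (%x. real n * ind (?I i) x)"
     by (intro integrable_mult_right integrable_real_indicator) (use b in simp_all)
    moreover have "integrable lebesgue (%x. ind (?I i) x *\<^sub>R (?g x * ind ?G x))"
     by (rule integrable_mult_indicator[OF _ bi]) simp
    ultimately have "integrable lebesgue (%x. real n * ind (?I i) x + ind (?I i) x *\<^sub>R (?g x * ind ?G x))" by (rule Bochner_Integration.integrable_add)
    then show ?thesis by (simp add: distrib_left mult.commute)
   qed
   have "AE x in lebesgue. x \<notin> {l i, r i}"
    by (intro AE_not_in null_sets_completionI countable_imp_null_set_lborel) simp
   then have ae: "AE x in lebesgue. \<bar>ind {l i..r i} x * G x\<bar> <= ind (?I i) x * (real n + ?g x * ind ?G x)"
    by eventually_elim (use b in \<open>auto simp: indicator_def\<close>)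
   have gs: "integrable lebesgue (%x. ind {l i..r i} x * G x)"
    using set_integrable_subset[OF S, of "{l i..r i}"] b by (simp add: set_integrable_def)
   have "\<bar>E (r i) - E (l i)\<bar> = \<bar>\<integral>x. ind {l i..r i} x * G x \<partial>lebesgue\<bar>"
    using E[OF b] by (simp add: set_lebesgue_integral_def)
   also have "... <= (\<integral>x. \<bar>ind {l i..r i} x * G x\<bar> \<partial>lebesgue)" by (rule integral_abs_bound)
   also have "... <= (\<integral>x. ind (?I i) x * (real n + ?g x * ind ?G x) \<partial>lebesgue)"
    by (rule integral_mono_AE[OF integrable_abs[OF gs] ii ae])
   finally show ?thesis .
  qed
  have s1: "(\<integral>x. ind (?I i) x * (real n + ?g x * ind ?G x) \<partial>lebesgue) =
    real n * (r i - l i) + (\<integral>x. ind (?I i) x * (?g x * ind ?G x) \<partial>lebesgue)" if i: "i < k" for i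
  proof -
   have a: "integrable lebesgue (%x. real n * ind (?I i) x)"
    by (intro integrable_mult_right integrable_real_indicator) (use lr[OF i] in simp_all)
   have b: "integrable lebesgue (%x. ind (?I i) x * (?g x * ind ?G x))"
    using integrable_mult_indicator[OF _ bi, of "?I i"] by simp
   have "(\<integral>x. ind (?I i) x * (real n + ?g x * ind ?G x) \<partial>lebesgue) =
    (\<integral>x. real n * ind (?I i) x + ind (?I i) x * (?g x * ind ?G x) \<partial>lebesgue)"
    by (simp only: distrib_left mult.commute)
   also have "... = (\<integral>x. real n * ind (?I i) x \<partial>lebesgue) + (\<integral>x. ind (?I i) x * (?g x * ind ?G x) \<partial>lebesgue)"
    by (rule Bochner_Integration.integral_add[OF a b])
   also have "(\<integral>x. real n * ind (?I i) x \<partial>lebesgue) = real n * (r i - l i)" using lr[OF i] by simp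
   finally show ?thesis .
  qed
  have "(\<Sum>i<k. \<integral>x. ind (?I i) x * (?g x * ind ?G x) \<partial>lebesgue) =
    (\<integral>x. (\<Sum>i<k. ind (?I i) x * (?g x * ind ?G x)) \<partial>lebesgue)"
   using integrable_mult_indicator[OF _ bi] by (intro Bochner_Integration.integral_sum[symmetric]) simp
  also have "... <= (\<integral>x. ?g x * ind ?G x \<partial>lebesgue)"
  proof (rule integral_mono[OF _ bi])
   show "integrable lebesgue (%x. \<Sum>i<k. ind (?I i) x * (?g x * ind ?G x))"
    using integrable_mult_indicator[OF _ bi] by (intro Bochner_Integration.integrable_sum) simp
   fix x
   have "(\<Sum>i<k. ind (?I i) x :: real) = ind (\<Union>i<k. ?I i) x"
    using A by (intro indicator_UN_disjoint[symmetric]) auto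
   then have "(\<Sum>i<k. ind (?I i) x :: real) <= 1" by (simp add: indicator_def)
   then have "(\<Sum>i<k. ind (?I i) x) * (?g x * ind ?G x) <= 1 * (?g x * ind ?G x)"
    by (rule mult_right_mono) simp
   then show "(\<Sum>i<k. ind (?I i) x * (?g x * ind ?G x)) <= ?g x * ind ?G x"
    by (simp add: sum_distrib_right)
  qed
  finally have s2: "(\<Sum>i<k. \<integral>x. ind (?I i) x * (?g x * ind ?G x) \<partial>lebesgue) < e / 2" using n by linarith
  have "(\<Sum>i<k. \<bar>E (r i) - E (l i)\<bar>) <=
    (\<Sum>i<k. real n * (r i - l i) + (\<integral>x. ind (?I i) x * (?g x * ind ?G x) \<partial>lebesgue))"
  proof (rule sum_mono)
   fix i assume "i \<in> {..<k}"
   then have i: "i < k" by simp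
   show "\<bar>E (r i) - E (l i)\<bar> <= real n * (r i - l i) + (\<integral>x. ind (?I i) x * (?g x * ind ?G x) \<partial>lebesgue)"
    using Ei[OF i] unfolding s1[OF i] .
  qed
  also have "... = real n * (\<Sum>i<k. r i - l i) + (\<Sum>i<k. \<integral>x. ind (?I i) x * (?g x * ind ?G x) \<partial>lebesgue)"
   by (simp add: sum.distrib sum_distrib_left)
  also have "... <= real n * d + (\<Sum>i<k. \<integral>x. ind (?I i) x * (?g x * ind ?G x) \<partial>lebesgue)"
   using A by (intro add_right_mono mult_left_mono) auto
  finally show "(\<Sum>i<k. \<bar>E (r i) - E (l i)\<bar>) < e" using s2 d(2) by linarith
 qed
qed

lemma nn_integral_shift:
 fixes a :: real
 assumes "f \<in> Bor borel"
 shows "(\<integral>\<^sup>+ s. f (s + a) \<partial>lborel) = (\<integral>\<^sup>+ s. f s \<partial>lborel)"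
 using nn_integral_real_affine[OF assms, of 1 a] by (simp add: add.commute)

text \<open>In L1 by approximation with a Lipschitz function on a bounded window; the bound on
  \<open>g\<close> turns L1 smallness into smallness of the squares.\<close>

lemma translation_continuous:
 fixes g :: "real => real"
 assumes gm: "g \<in> Bor borel" and B: "!!s. \<bar>g s\<bar> <= B" and T: "0 <= T"
  and supp: "!!s. s \<notin> {0..T} ==> g s = 0" and \<tau>: "\<tau> \<longlonglongrightarrow> (0::real)"
 shows "(%n. \<integral>\<^sup>+ s. ennreal ((g (s + \<tau> n) - g s)\<^sup>2) \<partial>lborel) \<longlonglongrightarrow> 0"
proof -
 have B0: "0 <= B" using B[of 0] by linarith
 \<comment> \<open>Shifts are shorter than 1, so the shifted difference lives on
   \<open>[-1, T + 1]\<close>, and the shifted points stay in the window. Its length is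
   \<open>T + 4\<close>.\<close>
 let ?W = "{-2..T + 2} :: real set"
 define M where "M = density lborel (ind ?W :: real => ennreal)"
 have Ms: "sets M = sets borel" by (simp add: M_def)
 have Mf: "finite_measure M"
 proof (rule finite_measureI)
  have "em M (space M) = em lborel ?W" by (simp add: M_def emeasure_density)
  also have "... = ennreal (T + 4)" using T by simp
  finally show "em M (space M) ~= \<infinity>" by simp
 qed
 interpret Mf: finite_measure M by (rule Mf)
 have gM: "integrable M g"
  using gm Ms B by (intro Mf.integrable_const_bound[of _ B]) (simp_all cong: measurable_cong_sets)
 have small: "\<exists>\<delta>>0. \<forall>t. \<bar>t\<bar> < \<delta> --> (\<integral>\<^sup>+ s. ennreal \<bar>g (s + t) - g s\<bar> \<partial>lborel) <= ennreal e" if e: "0 < e" for e :: real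
 proof -
  obtain f where f: "f \<in> Lip_b" "(\<integral>x. \<bar>g x - f x\<bar> \<partial>M) < e / 3"
   using Lip_b_dense[OF Mf Ms gM, of "e / 3"] e by (metis divide_pos_pos zero_less_numeral)
  obtain L where L: "L-lipschitz_on UNIV f" using f(1) by (auto simp: Lip_b_def)
  have L0: "0 <= L" by (rule lipschitz_on_nonneg[OF L])
  note fm[measurable] = Lip_b_borel[OF f(1)] and gm[measurable]
  have fMi: "integrable M f" by (rule Lip_b_integrable[OF Mf Ms f(1)])
  have gf: "(\<integral>\<^sup>+ s. ennreal \<bar>g s - f s\<bar> * ind ?W s \<partial>lborel) <= ennreal (e / 3)"
  proof -
   have "(\<integral>\<^sup>+ s. ennreal \<bar>g s - f s\<bar> * ind ?W s \<partial>lborel) = (\<integral>\<^sup>+ s. ennreal \<bar>g s - f s\<bar> \<partial>M)"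
    unfolding M_def by (subst nn_integral_density) (simp_all add: mult.commute)
   also have "... = ennreal (\<integral>s. \<bar>g s - f s\<bar> \<partial>M)"
    using gM fMi by (intro nn_integral_eq_integral) simp_all
   also have "... <= ennreal (e / 3)" using f(2) by (intro ennreal_leI) simp
   finally show ?thesis .
  qed
  define \<delta> where "\<delta> = min 1 (e / (3 * (L * (T + 4) + 1)))"
  have LT: "0 <= L * (T + 4)" using L0 T by simp
  have \<delta>: "0 < \<delta>" "\<delta> <= 1" "\<delta> <= e / (3 * (L * (T + 4) + 1))"
   using e LT by (auto simp: \<delta>_def intro!: divide_pos_pos)
  have Ld: "L * \<delta> * (T + 4) <= e / 3"
  proof -
   have "\<delta> * (3 * (L * (T + 4) + 1)) <= e" using \<delta>(3) LT by (simp add: pos_le_divide_eq)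
   then have "\<delta> * (L * (T + 4)) * 3 + 3 * \<delta> <= e" by (simp add: algebra_simps)
   then show ?thesis using \<delta>(1) by (simp add: algebra_simps)
  qed
  have "(\<integral>\<^sup>+ s. ennreal \<bar>g (s + t) - g s\<bar> \<partial>lborel) <= ennreal e" if t: "\<bar>t\<bar> < \<delta>" for t
  proof -
   have t1: "\<bar>t\<bar> < 1" using t \<delta>(2) by linarith
   let ?h = "%s. ennreal \<bar>g s - f s\<bar> * ind ?W s"
   have pt: "ennreal \<bar>g (s + t) - g s\<bar> <= ?h (s + t) + ennreal (L * \<delta>) * ind ?W s + ?h s" for s
   proof (cases "s \<in> {-1..T + 1}")
    case True
    then have in2: "s \<in> ?W" "s + t \<in> ?W" using t1 by auto
    have "\<bar>f (s + t) - f s\<bar> <= L * \<bar>t\<bar>" using lipschitz_onD[OF L, of "s + t" s] by (simp add: dist_real_def)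
    also have "... <= L * \<delta>" using t L0 by (intro mult_left_mono) auto
    finally have "\<bar>g (s + t) - g s\<bar> <= \<bar>g (s + t) - f (s + t)\<bar> + L * \<delta> + \<bar>g s - f s\<bar>" by linarith
    then have "ennreal \<bar>g (s + t) - g s\<bar> <= ennreal (\<bar>g (s + t) - f (s + t)\<bar> + L * \<delta> + \<bar>g s - f s\<bar>)" by (rule ennreal_leI)
    also have "... = ennreal \<bar>g (s + t) - f (s + t)\<bar> + ennreal (L * \<delta>) + ennreal \<bar>g s - f s\<bar>"
     using L0 \<delta>(1) by simp
    finally show ?thesis using in2 by simp
   next
    case False
    then have "g s = 0" "g (s + t) = 0" using t1 by (auto intro!: supp)
    then show ?thesis by simp
   qed
   have hm: "?h \<in> Bor borel" by measurable
   have "(\<integral>\<^sup>+ s. ennreal \<bar>g (s + t) - g s\<bar> \<partial>lborel) <= (\<integral>\<^sup>+ s. ?h (s + t) + ennreal (L * \<delta>) * ind ?W s + ?h s \<partial>lborel)"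
    by (rule nn_integral_mono) (rule pt)
   also have "... = (\<integral>\<^sup>+ s. ?h (s + t) \<partial>lborel) + ennreal (L * \<delta>) * em lborel ?W + (\<integral>\<^sup>+ s. ?h s \<partial>lborel)"
    by (simp add: nn_integral_add nn_integral_cmult_indicator)
   also have "(\<integral>\<^sup>+ s. ?h (s + t) \<partial>lborel) = (\<integral>\<^sup>+ s. ?h s \<partial>lborel)" by (rule nn_integral_shift[OF hm])
   also have "ennreal (L * \<delta>) * em lborel ?W = ennreal (L * \<delta> * (T + 4))"
   proof -
    have "em lborel ?W = ennreal (T + 4)" using T by simp
    then show ?thesis using T L0 \<delta>(1) ennreal_mult[of "L * \<delta>" "T + 4"] by (simp del: ennreal_plus add: add.commute)
   qed
   also have "(\<integral>\<^sup>+ s. ?h s \<partial>lborel) + ennreal (L * \<delta> * (T + 4)) + (\<integral>\<^sup>+ s. ?h s \<partial>lborel) <= ennreal (e / 3) + ennreal (e / 3) + ennreal (e / 3)"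
    by (intro add_mono gf ennreal_leI Ld)
   also have "... = ennreal e" using e by (simp add: ennreal_plus[symmetric] del: ennreal_plus)
   finally show ?thesis .
  qed
  with \<delta>(1) show ?thesis by blast
 qed
 have sq: "(\<integral>\<^sup>+ s. ennreal ((g (s + t) - g s)\<^sup>2) \<partial>lborel) <= ennreal (2 * B) * (\<integral>\<^sup>+ s. ennreal \<bar>g (s + t) - g s\<bar> \<partial>lborel)" for t
 proof -
  have "(\<integral>\<^sup>+ s. ennreal ((g (s + t) - g s)\<^sup>2) \<partial>lborel) <= (\<integral>\<^sup>+ s. ennreal (2 * B) * ennreal \<bar>g (s + t) - g s\<bar> \<partial>lborel)"
  proof (rule nn_integral_mono)
   fix s
   have "\<bar>g (s + t) - g s\<bar> <= 2 * B" using B[of s] B[of "s + t"] by linarith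
   then have "\<bar>g (s + t) - g s\<bar> * \<bar>g (s + t) - g s\<bar> <= 2 * B * \<bar>g (s + t) - g s\<bar>" by (rule mult_right_mono) simp
   then have "(g (s + t) - g s)\<^sup>2 <= 2 * B * \<bar>g (s + t) - g s\<bar>" by (simp add: power2_eq_square)
   then have "ennreal ((g (s + t) - g s)\<^sup>2) <= ennreal (2 * B * \<bar>g (s + t) - g s\<bar>)" by (rule ennreal_leI)
   then show "ennreal ((g (s + t) - g s)\<^sup>2) <= ennreal (2 * B) * ennreal \<bar>g (s + t) - g s\<bar>"
    using B0 by (simp add: ennreal_mult)
  qed
  also have "... = ennreal (2 * B) * (\<integral>\<^sup>+ s. ennreal \<bar>g (s + t) - g s\<bar> \<partial>lborel)"
   using gm by (intro nn_integral_cmult) simp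
  finally show ?thesis .
 qed
 show ?thesis
 proof (rule order_tendstoI)
  fix a :: ennreal assume a: "0 < a"
  obtain b where b: "0 < b" "b < a" using dense[OF a] by blast
  then obtain e where e: "0 < e" "ennreal e < a" by (cases b) auto
  define e' where "e' = e / (2 * B + 1)"
  have e': "0 < e'" "2 * B * e' <= e" using e B0 by (auto simp: e'_def field_simps)
  obtain \<delta> where \<delta>: "0 < \<delta>" "!!t. \<bar>t\<bar> < \<delta> ==> (\<integral>\<^sup>+ s. ennreal \<bar>g (s + t) - g s\<bar> \<partial>lborel) <= ennreal e'"
   using small[OF e'(1)] by blast
  have "eventually (%n. \<bar>\<tau> n\<bar> < \<delta>) sequentially"
   using tendstoD[OF \<tau> \<delta>(1)] by (simp add: dist_real_def)
  then show "eventually (%n. (\<integral>\<^sup>+ s. ennreal ((g (s + \<tau> n) - g s)\<^sup>2) \<partial>lborel) < a) sequentially"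
  proof eventually_elim
   case (elim n)
   have "(\<integral>\<^sup>+ s. ennreal ((g (s + \<tau> n) - g s)\<^sup>2) \<partial>lborel) <= ennreal (2 * B) * ennreal e'"
    by (rule order_trans[OF sq]) (intro mult_left_mono \<delta>(2) elim, simp)
   also have "... = ennreal (2 * B * e')" using B0 e'(1) by (simp add: ennreal_mult)
   also have "... <= ennreal e" using e'(2) by (rule ennreal_leI)
   finally show ?case using e(2) by (rule le_less_trans)
  qed
 qed simp
qed

text \<open>The increment over a step \<open>h\<close> is integrated over starting times in
  \<open>[a,b]\<close>. The left side telescopes to the integral of \<open>G\<close> over the step
  after \<open>b\<close> minus that after \<open>a\<close>. On the right the order of integration is
  exchanged, with the lag between the two times as variable; small lags contribute little, so the
  right side is small compared with \<open>h\<close>. Dividing by \<open>h\<close> and letting it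
  tend to 0 compares the values at Lebesgue points.\<close>

lemma nonincreasing_of_increments:
 fixes G :: "real => real" and Q :: "real => real => ennreal"
 assumes G: "integrable (lebesgue_on {0..T}) G" and T: "0 < T"
  and Q: "(%q. Q (fst q) (snd q)) \<in> Bor (borel \<Otimes>\<^sub>M borel)"
  and q: "!!\<tau>. \<tau> \<longlonglongrightarrow> (0::real) ==> (%n. \<integral>\<^sup>+ s. Q s (s + \<tau> n) \<partial>lborel) \<longlonglongrightarrow> 0"
  and N0: "negligible N0" and c: "0 <= c"
  and inc: "!!s t. s \<notin> N0 ==> t \<notin> N0 ==> 0 <= s ==> s <= t ==> t <= T ==>
   ennreal (G t - G s) <= ennreal c * (\<integral>\<^sup>+ r. (Q s r + Q t r) * ind {s..t} r \<partial>lborel)"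
 shows "\<exists>N. negligible N & (\<forall>a b. 0 < a & a <= b & b < T & a \<notin> N & b \<notin> N --> G b <= G a)"
proof -
 let ?g = "%r. if r \<in> {0..T} then G r else 0"
 let ?q = "%\<tau>. \<integral>\<^sup>+ s. Q s (s + \<tau>) \<partial>lborel"
 note S = set_integrable_time[OF G less_imp_le[OF T]]
 obtain N where N: "negligible N"
  "!!t. t \<notin> N ==> ((%h. integral {t..t + h} ?g / h) \<longlongrightarrow> ?g t) (at_right 0)"
  using lebesgue_points[OF S(3)] by blast
 have qm: "?q \<in> Bor borel"
 proof -
  have p: "(%q::real \<times> real. (snd q, snd q + fst q)) \<in> borel \<Otimes>\<^sub>M lborel \<rightarrow>\<^sub>M borel \<Otimes>\<^sub>M borel" by measurable
  have "(%q. Q (snd q) (snd q + fst q)) \<in> Bor (borel \<Otimes>\<^sub>M lborel)"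
   using measurable_compose[OF p Q] by simp
  then show ?thesis by (intro lborel.borel_measurable_nn_integral) (simp add: split_def)
 qed
 have small: "\<exists>\<delta>>0. \<forall>\<tau>. \<bar>\<tau>\<bar> < \<delta> --> ?q \<tau> <= ennreal \<epsilon>" if e: "0 < \<epsilon>" for \<epsilon>
 proof (rule ccontr)
  assume "~ ?thesis"
  then have "\<exists>\<tau>. \<bar>\<tau>\<bar> < 1 / real (Suc n) & ~ ?q \<tau> <= ennreal \<epsilon>" for n
   by (metis of_nat_0_less_iff zero_less_Suc zero_less_divide_1_iff)
  then obtain \<tau> where \<tau>: "!!n. \<bar>\<tau> n\<bar> < 1 / real (Suc n)" "!!n. ~ ?q (\<tau> n) <= ennreal \<epsilon>" by metis
  have "\<tau> \<longlonglongrightarrow> 0"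
   by (rule tendsto_rabs_zero_cancel, rule real_tendsto_sandwich[OF _ _ tendsto_const LIMSEQ_inverse_real_of_nat])
    (use \<tau>(1) in \<open>auto intro!: always_eventually less_imp_le simp: inverse_eq_divide\<close>)
  from order_tendstoD(2)[OF q[OF this], of "ennreal \<epsilon>"] e have "\<forall>\<^sub>F n in sequentially. ?q (\<tau> n) < ennreal \<epsilon>" by simp
  with \<tau>(2) show False using eventually_happens'[of sequentially] by (metis (no_types, lifting) less_imp_le sequentially_bot)
 qed
 \<comment> \<open>With the integration time written as frozen time plus lag, the initial end point
   produces lags in \<open>[0,h]\<close> and the final one lags in \<open>[-h,0]\<close>.\<close>
 have shifted: "(%s. \<integral>\<^sup>+ r. (Q s r + Q (s + h) r) * ind {s..s + h} r \<partial>lborel) \<in> Bor lborel"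
  "(\<integral>\<^sup>+ s. (\<integral>\<^sup>+ r. (Q s r + Q (s + h) r) * ind {s..s + h} r \<partial>lborel) \<partial>lborel)
   = (\<integral>\<^sup>+ \<tau>. ?q \<tau> * ind {0..h} \<tau> \<partial>lborel) + (\<integral>\<^sup>+ \<tau>. ?q \<tau> * ind {-h..0} \<tau> \<partial>lborel)" for h
 proof -
  have p: "(%q::real \<times> real. (fst q, fst q + snd q)) \<in> lborel \<Otimes>\<^sub>M lborel \<rightarrow>\<^sub>M borel \<Otimes>\<^sub>M borel"
   "(%q::real \<times> real. (fst q + h, snd q)) \<in> borel \<Otimes>\<^sub>M borel \<rightarrow>\<^sub>M borel \<Otimes>\<^sub>M borel"
   "(%q::real \<times> real. (fst q + h, fst q + snd q)) \<in> lborel \<Otimes>\<^sub>M lborel \<rightarrow>\<^sub>M borel \<Otimes>\<^sub>M borel"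
   by measurable
  note M1 = measurable_compose[OF p(1) Q, simplified] and M2 = measurable_compose[OF p(2) Q, simplified]
  have sec: "(%r. Q s r) \<in> Bor borel" for s
   using measurable_compose[OF measurable_Pair1'[of s borel borel] Q] by simp
  have q1: "(\<integral>\<^sup>+ s. (\<integral>\<^sup>+ r. Q s (s + r) * ind {a..b} r \<partial>lborel) \<partial>lborel) = (\<integral>\<^sup>+ \<tau>. ?q \<tau> * ind {a..b} \<tau> \<partial>lborel)" for a b
  proof -
   have m: "(%(s, r). Q s (s + r) * ind {a..b} r) \<in> Bor (lborel \<Otimes>\<^sub>M lborel)"
    using M1 unfolding split_def by measurable
   have "(\<integral>\<^sup>+ s. (\<integral>\<^sup>+ r. Q s (s + r) * ind {a..b} r \<partial>lborel) \<partial>lborel) =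
     (\<integral>\<^sup>+ r. (\<integral>\<^sup>+ s. Q s (s + r) * ind {a..b} r \<partial>lborel) \<partial>lborel)"
    by (rule lborel_pair.Fubini'[OF m, symmetric])
   also have "... = (\<integral>\<^sup>+ \<tau>. ?q \<tau> * ind {a..b} \<tau> \<partial>lborel)"
   proof (rule nn_integral_cong)
    fix \<tau>
    show "(\<integral>\<^sup>+ s. Q s (s + \<tau>) * ind {a..b} \<tau> \<partial>lborel) = ?q \<tau> * ind {a..b} \<tau>"
     by (cases "\<tau> \<in> {a..b}") simp_all
   qed
   finally show ?thesis .
  qed
  have in1: "(\<integral>\<^sup>+ r. Q s r * ind {s + a..s + b} r \<partial>lborel) = (\<integral>\<^sup>+ r. Q s (s + r) * ind {a..b} r \<partial>lborel)" for s a b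
  proof -
   have "(%r. Q s r * ind {s + a..s + b} r) \<in> Bor borel" using sec by measurable
   from nn_integral_shift[OF this, of s, symmetric]
   show ?thesis by (simp add: add.commute indicator_def)
  qed
  have m1: "(%s. \<integral>\<^sup>+ r. Q s r * ind {s..s + h} r \<partial>lborel) \<in> Bor lborel"
  proof -
   have "(%(s, r). Q s (s + r) * ind {0..h} r) \<in> Bor (lborel \<Otimes>\<^sub>M lborel)"
    using M1 unfolding split_def by measurable
   from lborel.borel_measurable_nn_integral[OF this] show ?thesis using in1[of _ 0 h] by simp
  qed
  have m2: "(%s. \<integral>\<^sup>+ r. Q s r * ind {s - h..s} r \<partial>lborel) \<in> Bor borel"
  proof -
   have "(%(s, r). Q s (s + r) * ind {-h..0} r) \<in> Bor (lborel \<Otimes>\<^sub>M lborel)"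
    using M1 unfolding split_def by measurable
   from lborel.borel_measurable_nn_integral[OF this] show ?thesis using in1[of _ "-h" 0] by simp
  qed
  have m3: "(%s. \<integral>\<^sup>+ r. Q (s + h) r * ind {s..s + h} r \<partial>lborel) \<in> Bor lborel"
   using measurable_compose[of "%s. s + h" borel borel, OF _ m2] by simp
  have split: "(\<integral>\<^sup>+ r. (Q s r + Q (s + h) r) * ind {s..s + h} r \<partial>lborel) =
    (\<integral>\<^sup>+ r. Q s r * ind {s..s + h} r \<partial>lborel) + (\<integral>\<^sup>+ r. Q (s + h) r * ind {s..s + h} r \<partial>lborel)" for s
  proof -
   have "(%r. Q s r * ind {s..s + h} r) \<in> Bor lborel"
    "(%r. Q (s + h) r * ind {s..s + h} r) \<in> Bor lborel"
    using sec[of s] sec[of "s + h"] by measurable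
   from nn_integral_add[OF this] show ?thesis by (simp only: distrib_right)
  qed
  show "(%s. \<integral>\<^sup>+ r. (Q s r + Q (s + h) r) * ind {s..s + h} r \<partial>lborel) \<in> Bor lborel"
   unfolding split by (rule borel_measurable_add[OF m1 m3])
  have "(\<integral>\<^sup>+ s. (\<integral>\<^sup>+ r. (Q s r + Q (s + h) r) * ind {s..s + h} r \<partial>lborel) \<partial>lborel) =
    (\<integral>\<^sup>+ s. (\<integral>\<^sup>+ r. Q s r * ind {s..s + h} r \<partial>lborel) + (\<integral>\<^sup>+ r. Q (s + h) r * ind {s..s + h} r \<partial>lborel) \<partial>lborel)"
   unfolding split ..
  also have "... = (\<integral>\<^sup>+ s. (\<integral>\<^sup>+ r. Q s r * ind {s..s + h} r \<partial>lborel) \<partial>lborel) +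
    (\<integral>\<^sup>+ s. (\<integral>\<^sup>+ r. Q (s + h) r * ind {s..s + h} r \<partial>lborel) \<partial>lborel)"
   by (rule nn_integral_add[OF m1 m3])
  also have "(\<integral>\<^sup>+ s. (\<integral>\<^sup>+ r. Q (s + h) r * ind {s..s + h} r \<partial>lborel) \<partial>lborel) =
    (\<integral>\<^sup>+ s. (\<integral>\<^sup>+ r. Q s r * ind {s - h..s} r \<partial>lborel) \<partial>lborel)"
   using nn_integral_shift[OF m2, of h] by simp
  finally show "(\<integral>\<^sup>+ s. (\<integral>\<^sup>+ r. (Q s r + Q (s + h) r) * ind {s..s + h} r \<partial>lborel) \<partial>lborel)
   = (\<integral>\<^sup>+ \<tau>. ?q \<tau> * ind {0..h} \<tau> \<partial>lborel) + (\<integral>\<^sup>+ \<tau>. ?q \<tau> * ind {-h..0} \<tau> \<partial>lborel)"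
   using in1[of _ 0 h] in1[of _ "-h" 0] q1[of 0 h] q1[of "-h" 0] by simp
 qed
 have main: "G b <= G a" if ab: "0 < a" "a <= b" "b < T" "a \<notin> N" "b \<notin> N" for a b
 proof (rule field_le_epsilon)
  fix e :: real assume e: "0 < e"
  \<comment> \<open>The factor 2 accounts for the two lag integrals; the summand 1 covers
    \<open>c = 0\<close>.\<close>
  define \<epsilon> where "\<epsilon> = e / (2 * c + 1)"
  have \<epsilon>: "0 < \<epsilon>" "c * (2 * \<epsilon>) <= e" using e c by (auto simp: \<epsilon>_def field_simps)
  obtain \<delta> where \<delta>: "0 < \<delta>" "!!\<tau>. \<bar>\<tau>\<bar> < \<delta> ==> ?q \<tau> <= ennreal \<epsilon>" using small[OF \<epsilon>(1)] by blast
  have "(integral {b..b + h} ?g - integral {a..a + h} ?g) / h <= e" if h: "0 < h" "h < min \<delta> (T - b)" for h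
  proof -
   have gi: "?g integrable_on {x..y}" for x y by (rule S(3))
   have shift: "F \<circ> (+) h = (%s. F (s + h))" for F :: "real => real" by (auto simp: add.commute)
   have gs: "(%s. ?g (s + h)) integrable_on {a..b}" "integral {a..b} (%s. ?g (s + h)) = integral {a + h..b + h} ?g"
    using integrable_on_shift_Icc_real[of ?g h a b] integral_shift_Icc_real[of a b ?g h] gi[of "a + h" "b + h"]
    unfolding shift by simp_all
   have "integral {a..a + h} ?g + integral {a + h..b + h} ?g = integral {a..b} ?g + integral {b..b + h} ?g"
    using Henstock_Kurzweil_Integration.integral_combine[of a "a + h" "b + h" ?g]
     Henstock_Kurzweil_Integration.integral_combine[of a b "b + h" ?g] gi ab h by simp
   then have eq: "integral {b..b + h} ?g - integral {a..a + h} ?g = integral {a..b} (%s. ?g (s + h) - ?g s)"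
    using Henstock_Kurzweil_Integration.integral_diff[OF gs(1) gi] gs(2) by simp
   let ?X = "%s. \<integral>\<^sup>+ r. (Q s r + Q (s + h) r) * ind {s..s + h} r \<partial>lborel"
   let ?d = "%s. ?g (s + h) - ?g s"
   \<comment> \<open>The shift rule is used for the gauge integral. Shifting the absolute value as
     well makes the shifted function absolutely integrable.\<close>
   have ag: "(%r. \<bar>?g r\<bar>) integrable_on {x..y}" for x y
   proof -
    have "integrable (lebesgue_on {0..T}) (%r. \<bar>G r\<bar>)" using G by simp
    from set_integrable_time(3)[OF this less_imp_le[OF T], of x y] show ?thesis
     by (rule Henstock_Kurzweil_Integration.integrable_eq) auto
   qed
   have sd: "set_integrable lebesgue {a..b} ?d"
   proof (rule set_integral_diff(1))
    show "set_integrable lebesgue {a..b} (%s. ?g (s + h))"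
     unfolding absolutely_integrable_on_def
     using gs(1) integrable_on_shift_Icc_real[of "%r. \<bar>?g r\<bar>" h a b] ag[of "a + h" "b + h"]
     unfolding shift by simp
    show "set_integrable lebesgue {a..b} ?g"
     unfolding absolutely_integrable_on_def using gi ag by simp
   qed
   have "ennreal (integral {a..b} ?d) <= (\<integral>\<^sup>+ s. ennreal (ind {a..b} s * ?d s) \<partial>lebesgue)"
   proof -
    have "integral {a..b} ?d = (\<integral>s. ind {a..b} s * ?d s \<partial>lebesgue)"
     using set_lebesgue_integral_eq_integral(2)[OF sd] by (simp add: set_lebesgue_integral_def)
    also have "... <= enn2real (\<integral>\<^sup>+ s. ennreal (ind {a..b} s * ?d s) \<partial>lebesgue)"
     using sd unfolding set_integrable_def by (subst real_lebesgue_integral_def) simp_all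
    finally show ?thesis
     by (rule order_trans[OF ennreal_leI]) (simp add: ennreal_enn2real_if)
   qed
   also have "... <= (\<integral>\<^sup>+ s. ennreal c * ?X s \<partial>lebesgue)"
   proof (rule nn_integral_mono_AE)
    \<comment> \<open>Both ends of the increment, \<open>s\<close> and \<open>s + h\<close>, have to
      avoid the exceptional set.\<close>
    have "negligible ((+) (- h) ` N0)" using N0 by (rule negligible_translation)
    then have "AE s in lebesgue. s \<notin> (+) (- h) ` N0" by (intro AE_not_in) (simp add: negligible_iff_null_sets)
    moreover have "AE s in lebesgue. s \<notin> N0" using N0 by (intro AE_not_in) (simp add: negligible_iff_null_sets)
    ultimately show "AE s in lebesgue. ennreal (ind {a..b} s * ?d s) <= ennreal c * ?X s"
    proof eventually_elim
     case (elim s)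
     show ?case
     proof (cases "s \<in> {a..b}")
      case True
      have "s + h \<notin> N0" using elim(1) by (metis (no_types) add.commute add_diff_cancel_left' image_eqI uminus_add_conv_diff)
      from inc[OF elim(2) this] True ab h show ?thesis by simp
     qed simp
    qed
   qed
   also have "... = ennreal c * ((\<integral>\<^sup>+ \<tau>. ?q \<tau> * ind {0..h} \<tau> \<partial>lborel) + (\<integral>\<^sup>+ \<tau>. ?q \<tau> * ind {-h..0} \<tau> \<partial>lborel))"
    unfolding nn_integral_completion nn_integral_cmult[OF shifted(1)] shifted(2) ..
   also have "... <= ennreal c * ((\<integral>\<^sup>+ \<tau>. ennreal \<epsilon> * ind {0..h} \<tau> \<partial>lborel) + (\<integral>\<^sup>+ \<tau>. ennreal \<epsilon> * ind {-h..0} \<tau> \<partial>lborel))"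
    by (intro mult_left_mono add_mono nn_integral_mono)
     (use \<delta>(2) h in \<open>auto simp: indicator_def\<close>)
   also have "... = ennreal (c * (2 * \<epsilon>) * h)"
   proof -
    have "ennreal (c * (2 * \<epsilon>) * h) = ennreal c * ennreal (\<epsilon> * h + \<epsilon> * h)"
     using c \<epsilon> h by (simp add: ennreal_mult[symmetric] algebra_simps del: ennreal_plus)
    also have "... = ennreal c * (ennreal \<epsilon> * ennreal h + ennreal \<epsilon> * ennreal h)"
     using \<epsilon>(1) h(1) by (simp only: ennreal_plus ennreal_mult mult_nonneg_nonneg less_imp_le)
    finally show ?thesis using h by (simp add: nn_integral_cmult_indicator)
   qed
   finally have "integral {a..b} ?d <= c * (2 * \<epsilon>) * h" using c \<epsilon> h by (simp add: ennreal_le_iff)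
   then have "integral {a..b} ?d / h <= c * (2 * \<epsilon>)" using h by (simp add: pos_divide_le_eq)
   then show ?thesis unfolding eq using \<epsilon>(2) by linarith
  qed
  then have ev: "\<forall>\<^sub>F h in at_right 0. integral {b..b + h} ?g / h - integral {a..a + h} ?g / h <= e"
   by (intro eventually_at_rightI[of 0 "min \<delta> (T - b)"]) (use \<delta>(1) ab in \<open>simp_all add: diff_divide_distrib\<close>)
  have "?g b - ?g a <= e"
   by (rule tendsto_upperbound[OF tendsto_diff[OF N(2)[OF ab(5)] N(2)[OF ab(4)]] ev]) simp
  then show "G b <= G a + e" using ab by simp
 qed
 show ?thesis by (intro exI[of _ N] conjI N(1)) (use main in blast)
qed

section \<open>The chain rule for the truncated entropy\<close>

context curve
begin

lemma joint_TT_meas: "g \<in> Bor (borel \<Otimes>\<^sub>M borel) ==> g \<in> Bor (TT \<Otimes>\<^sub>M borel)"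
proof -
 assume g: "g \<in> Bor (borel \<Otimes>\<^sub>M borel)"
 have "(%q. (fst q, snd q)) \<in> TT \<Otimes>\<^sub>M borel \<rightarrow>\<^sub>M borel \<Otimes>\<^sub>M borel"
 proof (rule measurable_Pair)
  have "(%t. t) \<in> TT \<rightarrow>\<^sub>M borel" by (rule borel_to_TT) simp
  then show "fst \<in> TT \<Otimes>\<^sub>M borel \<rightarrow>\<^sub>M borel" using measurable_compose[OF measurable_fst] by fastforce
 qed (rule measurable_snd)
 from measurable_compose[OF this g] show ?thesis by simp
qed

lemma total_var_integrable:
 assumes "r \<in> {0..T}" "h \<in> Bor borel" "(\<integral>\<^sup>+ p. ennreal \<bar>h p\<bar> \<partial>total_var (j r)) < \<infinity>"
 shows "integrable (total_var (j r)) h"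
proof -
 have "h \<in> Bor (total_var (j r))" using assms(1,2) tv_sets by (simp cong: measurable_cong_sets)
 with assms(3) show ?thesis by (simp add: integrable_iff_bounded)
qed

text \<open>\<open>S\<close> is \<open>offdiag\<close> in the chain rule and \<open>UNIV\<close> in
  the energy balance; the difference is not charged.\<close>

lemma signed_integral_good:
 assumes g: "good r" and h: "h \<in> Bor borel" "(\<integral>\<^sup>+ p. ennreal \<bar>h p\<bar> \<partial>total_var (j r)) < \<infinity>"
  and S: "offdiag \<subseteq> S" "S \<in> sets borel"
 shows "integrable \<theta> (%p. w (r, p) * A r p * h p)"
  "signed_integral (j r) S h = (\<integral>p. w (r, p) * A r p * h p \<partial>\<theta>)"
proof -
 have m: "(%p. w (r, p) * A r p) \<in> Bor \<theta>" "h \<in> Bor \<theta>" "S \<in> sets \<theta>"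
  unfolding measurable_edge_borel
  by (rule borel_measurable_times[OF w_section[OF goodD(1)[OF g]] A_meas]) (simp_all add: h(1) S(2))
 have "integrable (total_var (j r)) h" by (rule total_var_integrable[OF goodD(1)[OF g] h])
 then show i: "integrable \<theta> (%p. w (r, p) * A r p * h p)"
  unfolding goodD(4)[OF g] integrable_total_var_signed_density[OF m(1,2)] .
 have ae: "AE p in \<theta>. w (r, p) * A r p * (ind S p * h p) = w (r, p) * A r p * h p"
  using AE_edge_offdiag
 proof eventually_elim
  case (elim p)
  then have "p \<in> offdiag" by (simp add: split_def)
  then have "p \<in> S" by (rule subsetD[OF S(1)])
  then show ?case by simp
 qed
 have mi: "(%p. w (r, p) * A r p * (ind S p * h p)) \<in> Bor \<theta>"
  using m by measurable
 have i2: "integrable \<theta> (%p. w (r, p) * A r p * (ind S p * h p))"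
  by (rule integrable_cong_AE_imp[OF i mi]) (use ae in eventually_elim, simp)
 have "signed_integral (j r) S h = (\<integral>p. w (r, p) * A r p * (ind S p * h p) \<partial>\<theta>)"
  unfolding goodD(4)[OF g] by (rule signed_integral_signed_density[OF m i2])
 also have "... = (\<integral>p. w (r, p) * A r p * h p \<partial>\<theta>)"
  by (rule integral_cong_AE[OF mi _ ae]) (use i in simp)
 finally show "signed_integral (j r) S h = (\<integral>p. w (r, p) * A r p * h p \<partial>\<theta>)" .
qed

end

locale truncated_curve = curve +
 fixes e :: real
 assumes e: "0 < e"
begin

text \<open>Built from the jointly measurable version \<open>U\<close>, and 0 outside
  \<open>[0,T]\<close>, because continuity of translations is applied to functions of time with
  bounded support.\<close>

definition f :: "real => 'a => real" where
 "f t x = (if t \<in> {0..T} then tr_deriv e (U (t, x)) else 0)"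

definition B :: real where "B = \<bar>deriv \<phi> e\<bar> + \<bar>deriv \<phi> (max C e)\<bar>"

lemma B_nonneg: "0 <= B" by (simp add: B_def)

lemma f_bound: "\<bar>f t x\<bar> <= B"
 using tr_deriv_bound[OF e U_nonneg U_le] by (simp add: f_def B_def)

lemma f_meas[measurable]: "f t \<in> Bor borel"
 unfolding f_def[abs_def] using measurable_compose[OF U_fixed_meas tr_deriv_measurable[OF e]] by simp

definition \<zeta> :: "real => 'a \<times> 'a => real" where "\<zeta> t p = f t (snd p) - f t (fst p)"

lemma zeta_ograd: "\<zeta> t = ograd (f t)" by (auto simp: \<zeta>_def ograd_def)

lemma zeta_bound: "\<bar>\<zeta> t p\<bar> <= 2 * B"
 using f_bound[of t "snd p"] f_bound[of t "fst p"] by (simp add: \<zeta>_def)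

lemma zeta_meas[measurable]: "\<zeta> t \<in> Bor borel"
 unfolding zeta_ograd by (rule ograd_measurable) simp

lemma zeta_joint_meas: "(%q. \<zeta> (fst q) (snd q)) \<in> Bor (borel \<Otimes>\<^sub>M borel)"
proof -
 note [measurable] = measurable_compose[OF U_section_meas(1) tr_deriv_measurable[OF e]]
  measurable_compose[OF U_section_meas(2) tr_deriv_measurable[OF e]]
 show ?thesis unfolding \<zeta>_def f_def by measurable
qed

lemma zeta_bound_fisher:
 obtains K where "0 <= K" "!!t. good t ==> (\<integral>\<^sup>+ p. ennreal ((\<zeta> t p)\<^sup>2) \<partial>\<theta>) <= ennreal (K * Dr t)"
proof (rule truncated_gradient_bound[OF e, of C])
 fix K assume K: "0 <= K" "!!u. u \<in> Bor borel ==> (!!x. 0 <= u x) ==> (!!x. u x <= C) ==>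
  (\<integral>\<^sup>+ p. ennreal ((tr_deriv e (u (snd p)) - tr_deriv e (u (fst p)))\<^sup>2) \<partial>\<theta>)
   <= ennreal K * (\<integral>\<^sup>+ p. D (u (fst p), u (snd p)) \<partial>\<theta>)"
 have "(\<integral>\<^sup>+ p. ennreal ((\<zeta> t p)\<^sup>2) \<partial>\<theta>) <= ennreal (2 * K * Dr t)" if g: "good t" for t
 proof -
  have "(\<integral>\<^sup>+ p. ennreal ((\<zeta> t p)\<^sup>2) \<partial>\<theta>) <= ennreal K * (\<integral>\<^sup>+ p. D (U (t, fst p), U (t, snd p)) \<partial>\<theta>)"
   using K(2)[OF U_fixed_meas[of t] U_nonneg U_le] goodD(1)[OF g] by (simp add: \<zeta>_def f_def)
  also have "... = ennreal (2 * K * Dr t)"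
   unfolding goodD(6)[OF g, symmetric] using K(1) by (simp add: ennreal_mult[symmetric] mult.commute mult.left_commute)
  finally show ?thesis .
 qed
 then show thesis using that[of "2 * K"] K(1) by simp
qed

lemma f_X2: assumes "good t" shows "f t \<in> X2 \<pi> \<kappa>"
proof -
 obtain K where K: "0 <= K" "!!t. good t ==> (\<integral>\<^sup>+ p. ennreal ((\<zeta> t p)\<^sup>2) \<partial>\<theta>) <= ennreal (K * Dr t)"
  using zeta_bound_fisher by metis
 have "(\<integral>\<^sup>+p\<in>offdiag. ennreal (\<bar>ograd (f t) p\<bar>\<^sup>2) \<partial>\<theta>) <= (\<integral>\<^sup>+ p. ennreal ((\<zeta> t p)\<^sup>2) \<partial>\<theta>)"
  unfolding zeta_ograd by (intro nn_integral_mono) (auto simp: indicator_def)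
 also have "... <= ennreal (K * Dr t)" by (rule K(2)[OF assms])
 also have "... < \<infinity>" by simp
 finally have 1: "(\<integral>\<^sup>+p\<in>offdiag. ennreal (\<bar>ograd (f t) p\<bar>\<^sup>2) \<partial>\<theta>) < \<infinity>" .
 have "AE x in \<pi>. \<bar>f t x\<bar> <= B" using f_bound by simp
 with 1 show ?thesis unfolding X2_def by auto
qed

definition E :: "real => real" where "E t = (\<integral>x. tr_phi e (u t x) \<partial>\<pi>)"

lemma tr_phi_bound_ex: "\<exists>K\<ge>0. \<forall>r. 0 <= r --> r <= C --> \<bar>tr_phi e r\<bar> <= K"
proof -
 obtain K where K: "0 <= K" "!!u. 0 <= u ==> u <= C ==> \<phi> u <= K" using phi_bounded_on[of C] by metis
 have "\<bar>tr_phi e r\<bar> <= K + \<bar>\<phi> e\<bar> + \<bar>deriv \<phi> e\<bar> * e" if r: "0 <= r" "r <= C" for r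
 proof (cases "e <= r")
  case True
  have "0 <= \<bar>deriv \<phi> e\<bar> * e" using e by simp
  with True show ?thesis using K(2)[OF r] phi_nonneg[OF r(1)] by (simp add: tr_phi_def)
 next
  case False
  have "\<bar>deriv \<phi> e * (r - e)\<bar> <= \<bar>deriv \<phi> e\<bar> * e"
   using False r unfolding abs_mult by (intro mult_left_mono) auto
  then have "\<bar>\<phi> e + deriv \<phi> e * (r - e)\<bar> <= \<bar>\<phi> e\<bar> + \<bar>deriv \<phi> e\<bar> * e" by linarith
  with False K(1) show ?thesis by (simp add: tr_phi_def)
 qed
 moreover have "0 <= K + \<bar>\<phi> e\<bar> + \<bar>deriv \<phi> e\<bar> * e" using K(1) e by simp
 ultimately show ?thesis by blast
qed

lemma tr_phi_integrable: assumes t: "t \<in> {0..T}" shows "integrable \<pi> (%x. tr_phi e (u t x))"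
proof -
 obtain K where K: "!!r. 0 <= r ==> r <= C ==> \<bar>tr_phi e r\<bar> <= K" using tr_phi_bound_ex by blast
 have m: "(%x. tr_phi e (u t x)) \<in> Bor \<pi>"
  unfolding measurable_pi_borel by (rule tr_phi_measurable[OF u_meas e])
 show ?thesis
 proof (rule pi.integrable_const_bound[OF _ m, of K])
  show "AE x in \<pi>. norm (tr_phi e (u t x)) <= K" using u_le_C[OF t] by eventually_elim (simp add: K)
 qed
qed

text \<open>The integrated tangent inequality of the truncated entropy at time \<open>s\<close>. The
  test function is allowed to be any bounded Borel version of the truncated slope, so that it can be
  taken from \<open>U\<close> at good times and from a cut-off of \<open>u s\<close>
  otherwise.\<close>

lemma convexity_inequality:
 assumes s: "s \<in> {0..T}" and t: "t \<in> {0..T}" and h: "h \<in> Bor borel" "!!x. \<bar>h x\<bar> <= K"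
  and ae: "AE x in \<pi>. h x = tr_deriv e (u s x)"
 shows "(\<integral>x. h x \<partial>\<rho> t) - (\<integral>x. h x \<partial>\<rho> s) <= E t - E s"
proof -
 note hi = bounded_pi_integrable[OF h]
 have i: "integrable \<pi> (%x. u t x * h x)" "integrable \<pi> (%x. u s x * h x)"
  using u_mult_integrable[OF t hi] u_mult_integrable[OF s hi] by auto
 have "(\<integral>x. h x \<partial>\<rho> t) - (\<integral>x. h x \<partial>\<rho> s) = (\<integral>x. u t x * h x - u s x * h x \<partial>\<pi>)"
  unfolding integral_rho(1)[OF t h(1)] integral_rho(1)[OF s h(1)] using i by simp
 also have "... <= (\<integral>x. tr_phi e (u t x) - tr_phi e (u s x) \<partial>\<pi>)"
 proof (rule integral_mono_AE)
  show "integrable \<pi> (%x. u t x * h x - u s x * h x)" using i by simp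
  show "integrable \<pi> (%x. tr_phi e (u t x) - tr_phi e (u s x))" using tr_phi_integrable[OF t] tr_phi_integrable[OF s] by simp
  show "AE x in \<pi>. u t x * h x - u s x * h x <= tr_phi e (u t x) - tr_phi e (u s x)"
   using ae
  proof eventually_elim
   case (elim x)
   then show ?case using tr_phi_tangent[OF e u_nonneg[of s x] u_nonneg[of t x]] by (simp add: algebra_simps)
  qed
 qed
 also have "... = E t - E s" unfolding E_def using tr_phi_integrable[OF t] tr_phi_integrable[OF s] by simp
 finally show ?thesis .
qed

text \<open>The slope is frozen at time \<open>s\<close>, the flux is taken at time
  \<open>r\<close>; the diagonal values are the expected rate of the truncated entropy.\<close>

definition \<Phi> :: "real => real => real" where "\<Phi> s r = signed_integral (j r) offdiag (\<zeta> s)"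

lemma good_f: "good t ==> AE x in \<pi>. f t x = tr_deriv e (u t x)"
 using goodD(1,2)[of t] by (auto elim!: eventually_mono simp: f_def)

lemma forward_inequality:
 assumes "good s" "s <= t" "t <= T"
 shows "(LINT r:{s..t}|lebesgue. \<Phi> s r) <= E t - E s"
proof -
 have st: "s \<in> {0..T}" "t \<in> {0..T}" using goodD(1)[OF assms(1)] assms by auto
 have "(LINT r:{s..t}|lebesgue. \<Phi> s r) = (\<integral>x. f s x \<partial>\<rho> t) - (\<integral>x. f s x \<partial>\<rho> s)"
  using ce_X2 f_X2[OF assms(1)] st assms unfolding satisfies_ce_def \<Phi>_def zeta_ograd by simp
 also have "... <= E t - E s" by (rule convexity_inequality[OF st f_meas f_bound good_f[OF assms(1)]])
 finally show ?thesis .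
qed

lemma backward_inequality:
 assumes "good t" "0 <= s" "s <= t"
 shows "E t - E s <= (LINT r:{s..t}|lebesgue. \<Phi> t r)"
proof -
 have st: "s \<in> {0..T}" "t \<in> {0..T}" using goodD(1)[OF assms(1)] assms by auto
 have "(LINT r:{s..t}|lebesgue. \<Phi> t r) = (\<integral>x. f t x \<partial>\<rho> t) - (\<integral>x. f t x \<partial>\<rho> s)"
  using ce_X2 f_X2[OF assms(1)] st assms unfolding satisfies_ce_def \<Phi>_def zeta_ograd by simp
 moreover have "(\<integral>x. f t x \<partial>\<rho> s) - (\<integral>x. f t x \<partial>\<rho> t) <= E s - E t"
  by (rule convexity_inequality[OF st(2,1) f_meas f_bound good_f[OF assms(1)]])
 ultimately show ?thesis by simp
qed

definition Q :: "real => real => ennreal" where "Q s r = (\<integral>\<^sup>+ p. ennreal ((\<zeta> s p - \<zeta> r p)\<^sup>2) \<partial>\<theta>)"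

text \<open>Both come from Fenchel's inequality against the flux at time \<open>r\<close>: once for
  the gradient frozen at \<open>s\<close>, whose L2 norm is controlled by \<open>Dr s\<close>, and
  once for the difference of two gradients. The first provides integrability and bounds over short
  intervals; the second is the error of replacing \<open>s\<close> by \<open>r\<close>.\<close>

lemma Phi_bounds:
 assumes N: "0 < N"
 obtains c where "0 <= c" "!!s r. good s ==> good r ==> \<bar>\<Phi> s r\<bar> <= Rr r / N + c * Dr s"
  "!!s r. good s ==> good r ==> ennreal \<bar>\<Phi> s r - \<Phi> r r\<bar> <= ennreal (Rr r / N) + ennreal c * Q s r"
proof -
 obtain K where K: "0 <= K" "!!t. good t ==> (\<integral>\<^sup>+ p. ennreal ((\<zeta> t p)\<^sup>2) \<partial>\<theta>) <= ennreal (K * Dr t)"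
  using zeta_bound_fisher by metis
 \<comment> \<open>The bound \<open>4 * B\<close> fits a difference of two gradients, each at most
   \<open>2 * B\<close>.\<close>
 obtain c where c: "0 <= c" "!!t h. good t ==> h \<in> Bor borel ==> (AE p in \<theta>. \<bar>h p\<bar> <= 4 * B) ==>
  (\<integral>\<^sup>+ p. ennreal \<bar>h p\<bar> \<partial>total_var (j t)) <= ennreal (Rr t / N) + ennreal c * (\<integral>\<^sup>+ p. ennreal ((h p)\<^sup>2) \<partial>\<theta>)"
  using fenchel_flux[OF N, of "4 * B"] by metis
 have zb: "AE p in \<theta>. \<bar>\<zeta> s p\<bar> <= 4 * B" for s
 proof (rule AE_I2)
  fix p show "\<bar>\<zeta> s p\<bar> <= 4 * B" using zeta_bound[of s p] B_nonneg by linarith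
 qed
 have tv: "(\<integral>\<^sup>+ p. ennreal \<bar>\<zeta> s p\<bar> \<partial>total_var (j r)) <= ennreal (Rr r / N + (c * K) * Dr s)" if g: "good s" "good r" for s r
 proof -
  have "(\<integral>\<^sup>+ p. ennreal \<bar>\<zeta> s p\<bar> \<partial>total_var (j r)) <= ennreal (Rr r / N) + ennreal c * (\<integral>\<^sup>+ p. ennreal ((\<zeta> s p)\<^sup>2) \<partial>\<theta>)"
   by (rule c(2)[OF g(2) zeta_meas zb])
  also have "... <= ennreal (Rr r / N) + ennreal c * ennreal (K * Dr s)"
   by (intro add_left_mono mult_left_mono K(2) g) simp
  also have "... = ennreal (Rr r / N + (c * K) * Dr s)"
  proof -
   have "0 <= Rr r / N" "0 <= c * (K * Dr s)" using N c(1) K(1) by simp_all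
   then show ?thesis using c(1) K(1) by (simp add: ennreal_mult[symmetric] ennreal_plus[symmetric] mult.assoc del: ennreal_plus)
  qed
  finally show ?thesis .
 qed
 have fin: "(\<integral>\<^sup>+ p. ennreal \<bar>\<zeta> s p\<bar> \<partial>total_var (j r)) < \<infinity>" if g: "good s" "good r" for s r
  using tv[OF g] by (rule le_less_trans) simp
 have 1: "\<bar>\<Phi> s r\<bar> <= Rr r / N + (c * K) * Dr s" if g: "good s" "good r" for s r
 proof -
  have "ennreal \<bar>\<Phi> s r\<bar> <= ennreal (Rr r / N + (c * K) * Dr s)"
   unfolding \<Phi>_def by (rule order_trans[OF si_bound[OF goodD(1)[OF g(2)] zeta_meas] tv[OF g]])
  moreover have "0 <= Rr r / N + (c * K) * Dr s" using N c(1) K(1) by simp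
  ultimately show ?thesis by (simp add: ennreal_le_iff)
 qed
 have 2: "ennreal \<bar>\<Phi> s r - \<Phi> r r\<bar> <= ennreal (Rr r / N) + ennreal (c + c * K) * Q s r" if g: "good s" "good r" for s r
 proof -
  have dm: "(%p. \<zeta> s p - \<zeta> r p) \<in> Bor borel" by measurable
  have db: "AE p in \<theta>. \<bar>\<zeta> s p - \<zeta> r p\<bar> <= 4 * B"
  proof (rule AE_I2)
   fix p show "\<bar>\<zeta> s p - \<zeta> r p\<bar> <= 4 * B" using zeta_bound[of s p] zeta_bound[of r p] by linarith
  qed
  note Z1 = signed_integral_good[OF g(2) zeta_meas fin[OF g] order_refl offdiag_borel] and Z2 = signed_integral_good[OF g(2) zeta_meas fin[OF g(2) g(2)] order_refl offdiag_borel]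
  have "\<Phi> s r - \<Phi> r r = (\<integral>p. w (r, p) * A r p * (\<zeta> s p - \<zeta> r p) \<partial>\<theta>)"
   unfolding \<Phi>_def Z1(2) Z2(2) using Z1(1) Z2(1) by (simp add: right_diff_distrib)
  then have "ennreal \<bar>\<Phi> s r - \<Phi> r r\<bar> <= (\<integral>\<^sup>+ p. ennreal \<bar>w (r, p) * A r p * (\<zeta> s p - \<zeta> r p)\<bar> \<partial>\<theta>)"
   using norm_integral_le_nn[of \<theta> "%p. w (r, p) * A r p * (\<zeta> s p - \<zeta> r p)"] by simp
  also have "... = (\<integral>\<^sup>+ p. ennreal (\<bar>w (r, p)\<bar> * A r p) * ennreal \<bar>\<zeta> s p - \<zeta> r p\<bar> \<partial>\<theta>)"
   by (intro nn_integral_cong) (simp add: abs_mult ennreal_mult)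
  also have "... = (\<integral>\<^sup>+ p. ennreal \<bar>\<zeta> s p - \<zeta> r p\<bar> \<partial>total_var (j r))"
   using dm by (intro total_var_good[OF g(2), symmetric]) measurable
  also have "... <= ennreal (Rr r / N) + ennreal c * Q s r"
   unfolding Q_def by (rule c(2)[OF g(2) dm db])
  also have "... <= ennreal (Rr r / N) + ennreal (c + c * K) * Q s r"
   using c(1) K(1) by (intro add_left_mono mult_right_mono ennreal_leI) simp_all
  finally show ?thesis .
 qed
 have 3: "\<bar>\<Phi> s r\<bar> <= Rr r / N + (c + c * K) * Dr s" if g: "good s" "good r" for s r
 proof -
  have "(c * K) * Dr s <= (c + c * K) * Dr s" using c(1) by (intro mult_right_mono) simp_all
  with 1[OF g] show ?thesis by linarith
 qed
 have "0 <= c + c * K" using c(1) K(1) by simp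
 from that[OF this 3 2] show ?thesis .
qed

lemma Phi_integrable: assumes "good s" shows "integrable TT (\<Phi> s)"
 unfolding \<Phi>_def[abs_def] zeta_ograd
 using flux_integrable(2)[OF ograd_measurable[OF f_meas] X2_flux_finite[OF f_X2[OF assms]]] .

text \<open>The diagonal of \<Phi> at good times, written as an integral over \<theta> so that
  measurability in time follows from that of the joint densities.\<close>

definition F :: "real => real" where "F r = (\<integral>p. w (r, p) * A r p * \<zeta> r p \<partial>\<theta>)"

lemma F_eq: assumes "good r" shows "F r = \<Phi> r r"
proof -
 have "(\<integral>\<^sup>+ p. ennreal \<bar>\<zeta> r p\<bar> \<partial>total_var (j r)) < \<infinity>"
 proof -
  obtain K where K: "0 <= K" "!!t. good t ==> (\<integral>\<^sup>+ p. ennreal ((\<zeta> t p)\<^sup>2) \<partial>\<theta>) <= ennreal (K * Dr t)"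
   using zeta_bound_fisher by metis
  obtain c where c: "0 <= c" "!!t h. good t ==> h \<in> Bor borel ==> (AE p in \<theta>. \<bar>h p\<bar> <= 2 * B) ==>
   (\<integral>\<^sup>+ p. ennreal \<bar>h p\<bar> \<partial>total_var (j t)) <= ennreal (Rr t / 1) + ennreal c * (\<integral>\<^sup>+ p. ennreal ((h p)\<^sup>2) \<partial>\<theta>)"
   using fenchel_flux[of 1 "2 * B"] by (metis zero_less_one)
  have "(\<integral>\<^sup>+ p. ennreal \<bar>\<zeta> r p\<bar> \<partial>total_var (j r)) <= ennreal (Rr r / 1) + ennreal c * (\<integral>\<^sup>+ p. ennreal ((\<zeta> r p)\<^sup>2) \<partial>\<theta>)"
   using zeta_bound by (intro c(2)[OF assms zeta_meas] AE_I2)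
  also have "... <= ennreal (Rr r / 1) + ennreal c * ennreal (K * Dr r)"
   by (intro add_left_mono mult_left_mono K(2) assms) simp
  also have "... < \<infinity>" by (simp add: ennreal_mult_less_top)
  finally show ?thesis .
 qed
 from signed_integral_good(2)[OF assms zeta_meas this order_refl offdiag_borel] show ?thesis by (simp add: F_def \<Phi>_def)
qed

lemma F_meas: "F \<in> Bor TT"
proof -
 have "(%q. w q * A (fst q) (snd q) * \<zeta> (fst q) (snd q)) \<in> Bor (TT \<Otimes>\<^sub>M borel)"
  by (intro borel_measurable_times w_meas joint_TT_meas A_joint_meas zeta_joint_meas)
 then have "(%(r, p). w (r, p) * A r p * \<zeta> r p) \<in> Bor (TT \<Otimes>\<^sub>M \<theta>)"
  by (simp add: split_def measurable_cong_sets[OF sets_pair_measure_cong[OF refl sets_edge] refl])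
 then show ?thesis unfolding F_def[abs_def] by (rule edge.borel_measurable_lebesgue_integral)
qed

lemma F_integrable: "integrable TT F"
proof -
 obtain c where c: "0 <= c" "!!s r. good s ==> good r ==> \<bar>\<Phi> s r\<bar> <= Rr r / 1 + c * Dr s"
  using Phi_bounds[of 1] by (metis zero_less_one)
 show ?thesis
 proof (rule Bochner_Integration.integrable_bound)
  show "integrable TT (%r. Rr r + c * Dr r)" using Rr_Dr_integrable by simp
  show "AE r in TT. norm (F r) <= norm (Rr r + c * Dr r)"
   using AE_good
  proof eventually_elim
   case (elim r)
   have "0 <= Rr r + c * Dr r" using c(1) by simp
   then show ?case using c(2)[OF elim elim] unfolding F_eq[OF elim] by simp
  qed
 qed (rule F_meas)
qed

definition prim :: "(real => real) => real => real" where "prim g t = (LINT r:{0..t}|lebesgue. g r)"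

definition H :: "real => real" where "H t = E t - prim F t"

lemma prim_diff:
 assumes "integrable TT g" "0 <= s" "s <= t" "t <= T"
 shows "(LINT r:{s..t}|lebesgue. g r) = prim g t - prim g s"
 using indefinite_integral_continuous_TT(3)[OF assms] by (simp add: prim_def)

lemma prim_cont: "integrable TT g ==> continuous_on {0..T} (prim g)"
 unfolding prim_def[abs_def] by (rule indefinite_integral_continuous_TT(1))

lemma Q_meas: "(%q. Q (fst q) (snd q)) \<in> Bor (borel \<Otimes>\<^sub>M borel)"
proof -
 have p: "(%q::(real \<times> real) \<times> 'a \<times> 'a. (fst (fst q), snd q)) \<in> (borel \<Otimes>\<^sub>M borel) \<Otimes>\<^sub>M \<theta> \<rightarrow>\<^sub>M borel \<Otimes>\<^sub>M borel"
  "(%q::(real \<times> real) \<times> 'a \<times> 'a. (snd (fst q), snd q)) \<in> (borel \<Otimes>\<^sub>M borel) \<Otimes>\<^sub>M \<theta> \<rightarrow>\<^sub>M borel \<Otimes>\<^sub>M borel"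
  unfolding measurable_cong_sets[OF sets_pair_measure_cong[OF refl sets_edge] refl] by measurable
 note [measurable] = measurable_compose[OF p(1) zeta_joint_meas, simplified] measurable_compose[OF p(2) zeta_joint_meas, simplified]
 have "(%q::(real \<times> real) \<times> 'a \<times> 'a. ennreal ((\<zeta> (fst (fst q)) (snd q) - \<zeta> (snd (fst q)) (snd q))\<^sup>2))
   \<in> Bor ((borel \<Otimes>\<^sub>M borel) \<Otimes>\<^sub>M \<theta>)" by measurable
 then show ?thesis
  unfolding Q_def by (intro edge.borel_measurable_nn_integral) (simp add: split_def)
qed

lemma Q_meas2: "(%r. Q s r) \<in> Bor borel"
 using measurable_compose[OF measurable_Pair1'[of s borel borel] Q_meas] by simp

text \<open>A drop of \<open>H\<close> is estimated with the slope at the initial time, a rise with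
  the slope at the final time; hence the sum of the two squared distances on the right.\<close>

lemma H_increment:
 assumes N: "0 < N"
 obtains c where "0 <= c" "!!s t. good s ==> good t ==> s <= t ==>
  ennreal \<bar>H t - H s\<bar> <= ennreal ((prim Rr t - prim Rr s) / N) +
   ennreal c * (\<integral>\<^sup>+ r. (Q s r + Q t r) * ind {s..t} r \<partial>lborel)"
proof -
 obtain c where c: "0 <= c" "!!s r. good s ==> good r ==> ennreal \<bar>\<Phi> s r - \<Phi> r r\<bar> <= ennreal (Rr r / N) + ennreal c * Q s r"
  using Phi_bounds[OF N] by metis
 have "ennreal \<bar>H t - H s\<bar> <= ennreal ((prim Rr t - prim Rr s) / N) +
   ennreal c * (\<integral>\<^sup>+ r. (Q s r + Q t r) * ind {s..t} r \<partial>lborel)"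
  if g: "good s" "good t" and st: "s <= t" for s t
 proof -
  have st': "0 <= s" "s <= t" "t <= T" using goodD(1)[OF g(1)] goodD(1)[OF g(2)] st by auto
  let ?R = "ennreal ((prim Rr t - prim Rr s) / N) + ennreal c * (\<integral>\<^sup>+ r. (Q s r + Q t r) * ind {s..t} r \<partial>lborel)"
  have key: "ennreal \<bar>LINT r:{s..t}|lebesgue. \<Phi> a r - F r\<bar> <= ?R" if a: "good a" "a = s \<or> a = t" for a
  proof -
   have "ennreal \<bar>LINT r:{s..t}|lebesgue. \<Phi> a r - F r\<bar> <= (\<integral>\<^sup>+ r. ennreal \<bar>ind {s..t} r * (\<Phi> a r - F r)\<bar> \<partial>lebesgue)"
    unfolding set_lebesgue_integral_def real_scaleR_def by (rule norm_integral_le_nn)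
   also have "... <= (\<integral>\<^sup>+ r. ennreal (ind {s..t} r * (Rr r / N)) + ennreal c * ((Q s r + Q t r) * ind {s..t} r) \<partial>lebesgue)"
   proof (rule nn_integral_mono_AE)
    note AE_good_time
    then show "AE r in lebesgue. ennreal \<bar>ind {s..t} r * (\<Phi> a r - F r)\<bar> <=
     ennreal (ind {s..t} r * (Rr r / N)) + ennreal c * ((Q s r + Q t r) * ind {s..t} r)"
    proof eventually_elim
     case (elim r)
     show ?case
     proof (cases "r \<in> {s..t}")
      case True
      then have gr: "good r" using elim st' by auto
      have "ennreal \<bar>\<Phi> a r - F r\<bar> <= ennreal (Rr r / N) + ennreal c * Q a r"
       unfolding F_eq[OF gr] by (rule c(2)[OF a(1) gr])
      also have "... <= ennreal (Rr r / N) + ennreal c * (Q s r + Q t r)"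
       using a(2) by (intro add_left_mono mult_left_mono) auto
      finally show ?thesis using True by simp
     qed simp
    qed
   qed
   also have "... = (\<integral>\<^sup>+ r. ennreal (ind {s..t} r * (Rr r / N)) \<partial>lebesgue) +
     (\<integral>\<^sup>+ r. ennreal c * ((Q s r + Q t r) * ind {s..t} r) \<partial>lebesgue)"
   proof (rule nn_integral_add)
    have "set_integrable lebesgue {s..t} Rr" by (rule indefinite_integral_continuous_TT(2)[OF Rr_Dr_integrable(1) st'])
    then have "(%r. ind {s..t} r * Rr r) \<in> Bor lebesgue"
     unfolding set_integrable_def real_scaleR_def by (rule borel_measurable_integrable)
    then have "(%r. ennreal ((ind {s..t} r * Rr r) / N)) \<in> Bor lebesgue" by measurable
    then show "(%r. ennreal (ind {s..t} r * (Rr r / N))) \<in> Bor lebesgue" by simp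
    have "(%r. ennreal c * ((Q s r + Q t r) * ind {s..t} r)) \<in> Bor borel"
     using Q_meas2[of s] Q_meas2[of t] by measurable
    then show "(%r. ennreal c * ((Q s r + Q t r) * ind {s..t} r)) \<in> Bor lebesgue"
     by (intro measurable_completion) simp
   qed
   also have "(\<integral>\<^sup>+ r. ennreal (ind {s..t} r * (Rr r / N)) \<partial>lebesgue) = ennreal ((prim Rr t - prim Rr s) / N)"
   proof -
    have si: "integrable lebesgue (%r. ind {s..t} r * (Rr r / N))"
     using indefinite_integral_continuous_TT(2)[OF Rr_Dr_integrable(1) st'] unfolding set_integrable_def by simp
    have "(\<integral>\<^sup>+ r. ennreal (ind {s..t} r * (Rr r / N)) \<partial>lebesgue) = ennreal (\<integral>r. ind {s..t} r * (Rr r / N) \<partial>lebesgue)"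
     using si N by (intro nn_integral_eq_integral) simp_all
    also have "(\<integral>r. ind {s..t} r * (Rr r / N) \<partial>lebesgue) = (prim Rr t - prim Rr s) / N"
     unfolding prim_diff[OF Rr_Dr_integrable(1) st', symmetric] set_lebesgue_integral_def by simp
    finally show ?thesis .
   qed
   also have "(\<integral>\<^sup>+ r. ennreal c * ((Q s r + Q t r) * ind {s..t} r) \<partial>lebesgue) =
     ennreal c * (\<integral>\<^sup>+ r. (Q s r + Q t r) * ind {s..t} r \<partial>lborel)"
   proof -
    have m: "(%r. (Q s r + Q t r) * ind {s..t} r) \<in> Bor lborel"
     using Q_meas2[of s] Q_meas2[of t] by measurable
    show ?thesis unfolding nn_integral_completion by (rule nn_integral_cmult[OF m])
   qed
   finally show ?thesis .
  qed
  have diff: "(LINT r:{s..t}|lebesgue. \<Phi> a r - F r) = (LINT r:{s..t}|lebesgue. \<Phi> a r) - (prim F t - prim F s)" if a: "good a" for a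
   unfolding prim_diff[OF F_integrable st', symmetric]
   by (rule set_integral_diff(2)) (rule indefinite_integral_continuous_TT(2)[OF _ st'], rule Phi_integrable[OF a],
     rule indefinite_integral_continuous_TT(2)[OF F_integrable st'])
  have lo: "(LINT r:{s..t}|lebesgue. \<Phi> s r - F r) <= H t - H s"
   using forward_inequality[OF g(1) st st'(3)] diff[OF g(1)] by (simp add: H_def)
  have up: "H t - H s <= (LINT r:{s..t}|lebesgue. \<Phi> t r - F r)"
   using backward_inequality[OF g(2) st'(1,2)] diff[OF g(2)] by (simp add: H_def)
  show ?thesis
  proof (cases "0 <= H t - H s")
   case True
   then have "ennreal \<bar>H t - H s\<bar> <= ennreal \<bar>LINT r:{s..t}|lebesgue. \<Phi> t r - F r\<bar>" using up by (intro ennreal_leI) linarith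
   also have "... <= ?R" by (rule key[OF g(2)]) simp
   finally show ?thesis .
  next
   case False
   then have "ennreal \<bar>H t - H s\<bar> <= ennreal \<bar>LINT r:{s..t}|lebesgue. \<Phi> s r - F r\<bar>" using lo by (intro ennreal_leI) linarith
   also have "... <= ?R" by (rule key[OF g(1)]) simp
   finally show ?thesis .
  qed
 qed
 with c(1) that show ?thesis by blast
qed

text \<open>Continuity of translations in \<open>L\<^sup>2\<close>, reduced to scalar functions by integrating over the edges
  last.\<close>

definition q :: "real => ennreal" where "q \<tau> = (\<integral>\<^sup>+ s. Q s (s + \<tau>) \<partial>lborel)"

lemma q_fubini: "q \<tau> = (\<integral>\<^sup>+ p. (\<integral>\<^sup>+ s. ennreal ((\<zeta> (s + \<tau>) p - \<zeta> s p)\<^sup>2) \<partial>lborel) \<partial>\<theta>)"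
proof -
 interpret P: pair_sigma_finite lborel \<theta> by unfold_locales
 have p: "(%q::real \<times> 'a \<times> 'a. (fst q + \<tau>, snd q)) \<in> borel \<Otimes>\<^sub>M borel \<rightarrow>\<^sub>M borel \<Otimes>\<^sub>M borel" by measurable
 note [measurable] = measurable_compose[OF p zeta_joint_meas, simplified] zeta_joint_meas
 have m: "(%q. ennreal ((\<zeta> (fst q + \<tau>) (snd q) - \<zeta> (fst q) (snd q))\<^sup>2)) \<in> Bor (borel \<Otimes>\<^sub>M borel)" by measurable
 have "sets (lborel \<Otimes>\<^sub>M \<theta>) = sets (borel \<Otimes>\<^sub>M borel)" by (intro sets_pair_measure_cong) simp_all
 then have m': "(%(s, p). ennreal ((\<zeta> (s + \<tau>) p - \<zeta> s p)\<^sup>2)) \<in> Bor (lborel \<Otimes>\<^sub>M \<theta>)"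
  using m by (simp add: split_def cong: measurable_cong_sets)
 show ?thesis
  unfolding q_def Q_def using P.Fubini'[OF m'] by (simp add: power2_commute)
qed

text \<open>For a single edge this is continuity of translations of one bounded function of time.
  Over the edges the limit is dominated, because the squared gradients are integrable in time and
  edge through the Fisher information.\<close>

lemma q_tendsto:
 assumes \<tau>: "\<tau> \<longlonglongrightarrow> (0::real)"
 shows "(%n. q (\<tau> n)) \<longlonglongrightarrow> 0"
proof -
 interpret P: pair_sigma_finite lborel \<theta> by unfold_locales
 obtain K where K: "0 <= K" "!!t. good t ==> (\<integral>\<^sup>+ p. ennreal ((\<zeta> t p)\<^sup>2) \<partial>\<theta>) <= ennreal (K * Dr t)"
  using zeta_bound_fisher by metis
 have zs: "(%s. \<zeta> s p) \<in> Bor borel" for p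
  using measurable_compose[OF measurable_Pair2'[of p borel borel] zeta_joint_meas] by simp
 let ?J = "%p. \<integral>\<^sup>+ s. ennreal ((\<zeta> s p)\<^sup>2) \<partial>lborel"
 have sj: "sets (lborel \<Otimes>\<^sub>M \<theta>) = sets (borel \<Otimes>\<^sub>M borel)" by (intro sets_pair_measure_cong) simp_all
 have zm: "(%(s, p). ennreal ((\<zeta> s p)\<^sup>2)) \<in> Bor (lborel \<Otimes>\<^sub>M \<theta>)"
  using zeta_joint_meas by (simp add: split_def cong: measurable_cong_sets[OF sj refl])
 have Jm: "?J \<in> Bor \<theta>"
  using lborel.borel_measurable_nn_integral[of "%p s. ennreal ((\<zeta> s p)\<^sup>2)" \<theta>] measurable_pair_swap[OF zm]
  by (simp add: split_def)
 have Jfin: "(\<integral>\<^sup>+ p. ?J p \<partial>\<theta>) < \<infinity>"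
 proof -
  have "(\<integral>\<^sup>+ p. ?J p \<partial>\<theta>) = (\<integral>\<^sup>+ s. (\<integral>\<^sup>+ p. ennreal ((\<zeta> s p)\<^sup>2) \<partial>\<theta>) \<partial>lborel)"
   by (rule P.Fubini'[OF zm])
  also have "... = (\<integral>\<^sup>+ s. (\<integral>\<^sup>+ p. ennreal ((\<zeta> s p)\<^sup>2) \<partial>\<theta>) \<partial>lebesgue)" by (simp add: nn_integral_completion)
  also have "... <= (\<integral>\<^sup>+ s. ennreal (K * Dr s) * ind {0..T} s \<partial>lebesgue)"
  proof (rule nn_integral_mono_AE)
   note AE_good_time
   then show "AE s in lebesgue. (\<integral>\<^sup>+ p. ennreal ((\<zeta> s p)\<^sup>2) \<partial>\<theta>) <= ennreal (K * Dr s) * ind {0..T} s"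
   proof eventually_elim
    case (elim s)
    show ?case
    proof (cases "s \<in> {0..T}")
     case True with elim K(2) show ?thesis by simp
    next
     case False
     have "\<zeta> s p = 0" for p using False by (auto simp: \<zeta>_def f_def)
     then show ?thesis by simp
    qed
   qed
  qed
  also have "... = (\<integral>\<^sup>+ s. ennreal (norm (K * Dr s)) \<partial>TT)"
   using K(1) by (subst nn_integral_lebesgue_on) simp_all
  also have "... < \<infinity>"
  proof -
   have "integrable TT (%s. K * Dr s)" using Rr_Dr_integrable(2) by simp
   then show ?thesis by (simp only: integrable_iff_bounded)
  qed
  finally show ?thesis .
 qed
 have "(%n. \<integral>\<^sup>+ p. (\<integral>\<^sup>+ s. ennreal ((\<zeta> (s + \<tau> n) p - \<zeta> s p)\<^sup>2) \<partial>lborel) \<partial>\<theta>) \<longlonglongrightarrow> (\<integral>\<^sup>+ p. 0 \<partial>\<theta>)"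
 \<comment> \<open>The factor 4 is 2 + 2: the square of a difference is at most twice the sum of the
   squares, and both have the same time integral by invariance under shifts.\<close>
 proof (rule nn_integral_dominated_convergence[where w="%p. 4 * ?J p"])
  show "(%p. \<integral>\<^sup>+ s. ennreal ((\<zeta> (s + \<tau> n) p - \<zeta> s p)\<^sup>2) \<partial>lborel) \<in> Bor \<theta>" for n
  proof -
   have pr: "(%q::('a \<times> 'a) \<times> real. (snd q + \<tau> n, fst q)) \<in> \<theta> \<Otimes>\<^sub>M lborel \<rightarrow>\<^sub>M borel \<Otimes>\<^sub>M borel"
    "(%q::('a \<times> 'a) \<times> real. (snd q, fst q)) \<in> \<theta> \<Otimes>\<^sub>M lborel \<rightarrow>\<^sub>M borel \<Otimes>\<^sub>M borel"
    unfolding measurable_cong_sets[OF sets_pair_measure_cong[OF sets_edge sets_lborel] refl] by measurable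
   note [measurable] = measurable_compose[OF pr(1) zeta_joint_meas, simplified] measurable_compose[OF pr(2) zeta_joint_meas, simplified]
   have "(%q. ennreal ((\<zeta> (snd q + \<tau> n) (fst q) - \<zeta> (snd q) (fst q))\<^sup>2)) \<in> Bor (\<theta> \<Otimes>\<^sub>M lborel)" by measurable
   then show ?thesis by (intro lborel.borel_measurable_nn_integral) (simp add: split_def)
  qed
  show "AE p in \<theta>. (\<integral>\<^sup>+ s. ennreal ((\<zeta> (s + \<tau> n) p - \<zeta> s p)\<^sup>2) \<partial>lborel) <= 4 * ?J p" for n
  proof (rule AE_I2)
   fix p
   have m2: "(%s. ennreal ((\<zeta> s p)\<^sup>2)) \<in> Bor borel" using zs by measurable
   then have m1: "(%s. ennreal ((\<zeta> (s + \<tau> n) p)\<^sup>2)) \<in> Bor borel"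
    by (rule measurable_compose[rotated]) measurable
   have "(\<integral>\<^sup>+ s. ennreal ((\<zeta> (s + \<tau> n) p - \<zeta> s p)\<^sup>2) \<partial>lborel) <=
     (\<integral>\<^sup>+ s. 2 * ennreal ((\<zeta> (s + \<tau> n) p)\<^sup>2) + 2 * ennreal ((\<zeta> s p)\<^sup>2) \<partial>lborel)"
   proof (rule nn_integral_mono)
    fix s
    let ?a = "\<zeta> (s + \<tau> n) p" and ?b = "\<zeta> s p"
    have "(?a - ?b)\<^sup>2 <= 2 * ?a\<^sup>2 + 2 * ?b\<^sup>2"
     using sum_squares_bound[of "?a" "- ?b"] by (simp add: power2_eq_square algebra_simps)
    then have "ennreal ((?a - ?b)\<^sup>2) <= ennreal (2 * ?a\<^sup>2 + 2 * ?b\<^sup>2)" by (rule ennreal_leI)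
    then show "ennreal ((?a - ?b)\<^sup>2) <= 2 * ennreal (?a\<^sup>2) + 2 * ennreal (?b\<^sup>2)" by (simp add: ennreal_mult)
   qed
   also have "... = 2 * (\<integral>\<^sup>+ s. ennreal ((\<zeta> (s + \<tau> n) p)\<^sup>2) \<partial>lborel) + 2 * ?J p"
    using m1 m2 by (simp add: nn_integral_add nn_integral_cmult)
   also have "(\<integral>\<^sup>+ s. ennreal ((\<zeta> (s + \<tau> n) p)\<^sup>2) \<partial>lborel) = ?J p" by (rule nn_integral_shift[OF m2])
   also have "2 * ?J p + 2 * ?J p = 4 * ?J p" by (simp add: distrib_right[symmetric])
   finally show "(\<integral>\<^sup>+ s. ennreal ((\<zeta> (s + \<tau> n) p - \<zeta> s p)\<^sup>2) \<partial>lborel) <= 4 * ?J p" .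
  qed
  show "AE p in \<theta>. (%n. \<integral>\<^sup>+ s. ennreal ((\<zeta> (s + \<tau> n) p - \<zeta> s p)\<^sup>2) \<partial>lborel) \<longlonglongrightarrow> 0"
   by (intro AE_I2 translation_continuous[OF zs zeta_bound less_imp_le[OF T] _ \<tau>]) (auto simp: \<zeta>_def f_def)
  show "(%p. 4 * ?J p) \<in> Bor \<theta>" using Jm by measurable
  show "(\<integral>\<^sup>+ p. 4 * ?J p \<partial>\<theta>) < \<infinity>" using Jfin Jm by (simp add: nn_integral_cmult ennreal_mult_less_top)
 qed simp
 then show ?thesis unfolding q_fubini by simp
qed

end

section \<open>Constancy of the truncated entropy minus the primitive of its rate\<close>

context truncated_curve
begin

lemma E_bounded: "\<exists>K. \<forall>t\<in>{0..T}. \<bar>E t\<bar> <= K"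
proof -
 obtain K where K: "!!r. 0 <= r ==> r <= C ==> \<bar>tr_phi e r\<bar> <= K" using tr_phi_bound_ex by blast
 have "\<bar>E t\<bar> <= (\<integral>x. K \<partial>\<pi>)" if t: "t \<in> {0..T}" for t
 proof -
  have "\<bar>E t\<bar> <= (\<integral>x. \<bar>tr_phi e (u t x)\<bar> \<partial>\<pi>)" unfolding E_def by (rule integral_abs_bound)
  also have "... <= (\<integral>x. K \<partial>\<pi>)"
  proof (rule integral_mono_AE)
   show "AE x in \<pi>. \<bar>tr_phi e (u t x)\<bar> <= K" using u_le_C[OF t] by eventually_elim (simp add: K)
  qed (use tr_phi_integrable[OF t] in simp_all)
  finally show ?thesis .
 qed
 then show ?thesis by blast
qed

lemma E_meas: "E \<in> Bor TT"
proof (rule TTc.measurable_AE_cong)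
 have "sets (borel \<Otimes>\<^sub>M \<pi>) = sets (borel :: (real \<times> 'a) measure)"
  unfolding borel_prod[symmetric] by (intro sets_pair_measure_cong) simp_all
 then have "(%(t, x). tr_phi e (U (t, x))) \<in> Bor (borel \<Otimes>\<^sub>M \<pi>)"
  using tr_phi_measurable[OF U_meas e] by (simp cong: measurable_cong_sets)
 then show "(%t. \<integral>x. tr_phi e (U (t, x)) \<partial>\<pi>) \<in> Bor TT"
  by (intro borel_to_TT pi.borel_measurable_lebesgue_integral)
 show "AE t in TT. (\<integral>x. tr_phi e (U (t, x)) \<partial>\<pi>) = E t"
  using AE_good
 proof eventually_elim
  case (elim t)
  show ?case unfolding E_def
  proof (rule integral_cong_AE)
   show "(%x. tr_phi e (U (t, x))) \<in> Bor \<pi>" "(%x. tr_phi e (u t x)) \<in> Bor \<pi>"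
    unfolding measurable_pi_borel by (intro tr_phi_measurable e U_fixed_meas u_meas)+
   show "AE x in \<pi>. tr_phi e (U (t, x)) = tr_phi e (u t x)"
    using goodD(2)[OF elim] by eventually_elim simp
  qed
 qed
qed simp

lemma prim_integrable: assumes "integrable TT g" shows "integrable TT (prim g)"
proof -
 note c = prim_cont[OF assms]
 have "bounded (prim g ` {0..T})" by (intro compact_imp_bounded compact_continuous_image c) simp
 then obtain K where K: "!!x. x \<in> prim g ` {0..T} ==> norm x <= K" unfolding bounded_iff by blast
 show ?thesis
 proof (rule TT.integrable_const_bound)
  show "AE x in TT. norm (prim g x) <= K" using K by (intro AE_I2) simp
  show "prim g \<in> Bor TT" by (rule continuous_imp_measurable_on_sets_lebesgue[OF c]) simp
 qed
qed

lemma H_integrable: "integrable TT H"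
proof -
 obtain K where K: "!!t. t \<in> {0..T} ==> \<bar>E t\<bar> <= K" using E_bounded by blast
 have "integrable TT E"
 proof (rule TT.integrable_const_bound[OF _ E_meas])
  show "AE x in TT. norm (E x) <= K" using K by (intro AE_I2) simp
 qed
 then show ?thesis unfolding H_def[abs_def] using prim_integrable[OF F_integrable] by simp
qed

lemma prim_mono:
 assumes g: "integrable TT g" "!!x. 0 <= g x" and st: "0 <= s" "s <= t" "t <= T"
 shows "prim g s <= prim g t"
proof -
 have "0 <= (LINT r:{s..t}|lebesgue. g r)"
  unfolding set_lebesgue_integral_def using g(2) by (intro Bochner_Integration.integral_nonneg) simp
 then show ?thesis unfolding prim_diff[OF g(1) st] by simp
qed

text \<open>Subtracting \<open>prim Rr / N\<close> absorbs the first term of the increment bound.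
  What remains is a translation error, for which \<open>nonincreasing_of_increments\<close> is made;
  the two signs treat rises and drops.\<close>

lemma H_almost_monotone:
 assumes N: "0 < N" and \<sigma>: "\<sigma> = 1 \<or> \<sigma> = -1"
 shows "\<exists>M. negligible M & (\<forall>a b. 0 < a & a <= b & b < T & a \<notin> M & b \<notin> M -->
  \<sigma> * H b - prim Rr b / N <= \<sigma> * H a - prim Rr a / N)"
proof (rule H_increment[OF N])
 fix c assume c: "0 <= c" "!!s t. good s ==> good t ==> s <= t ==>
  ennreal \<bar>H t - H s\<bar> <= ennreal ((prim Rr t - prim Rr s) / N) +
   ennreal c * (\<integral>\<^sup>+ r. (Q s r + Q t r) * ind {s..t} r \<partial>lborel)"
 note AE_good_time
 then obtain N0 where N0: "N0 \<in> null_sets lebesgue" "{t \<in> space lebesgue. ~ (t \<in> {0..T} --> good t)} \<subseteq> N0"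
  unfolding eventually_ae_filter by blast
 have q: "(%n. \<integral>\<^sup>+ s. Q s (s + \<tau> n) \<partial>lborel) \<longlonglongrightarrow> 0" if "\<tau> \<longlonglongrightarrow> 0" for \<tau>
  using q_tendsto[OF that] by (simp add: q_def)
 have neg: "negligible N0" using N0(1) by (simp add: negligible_iff_null_sets)
 have int: "integrable TT (%t. \<sigma> * H t - prim Rr t / N)"
  using H_integrable prim_integrable[OF Rr_Dr_integrable(1)] by simp
 have inc: "ennreal ((\<sigma> * H t - prim Rr t / N) - (\<sigma> * H s - prim Rr s / N)) <=
   ennreal c * (\<integral>\<^sup>+ r. (Q s r + Q t r) * ind {s..t} r \<partial>lborel)" (is "_ <= ?X")
  if a: "s \<notin> N0" "t \<notin> N0" "0 <= s" "s <= t" "t <= T" for s t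
 proof -
  have gd: "good x" if x: "x \<notin> N0" "0 <= x" "x <= T" for x
  proof (rule ccontr)
   assume "~ good x"
   then have "x \<in> {t \<in> space lebesgue. ~ (t \<in> {0..T} --> good t)}" using x by simp
   with N0(2) x(1) show False by blast
  qed
  have g: "good s" "good t" using gd[of s] gd[of t] a by simp_all
  let ?p = "(prim Rr t - prim Rr s) / N"
  have p: "0 <= ?p" using prim_mono[OF Rr_Dr_integrable(1) _ a(3-5)] N by simp
  have "(\<sigma> * H t - prim Rr t / N) - (\<sigma> * H s - prim Rr s / N) <= \<bar>H t - H s\<bar> - ?p"
   using \<sigma> by (auto simp: diff_divide_distrib)
  then have "ennreal ((\<sigma> * H t - prim Rr t / N) - (\<sigma> * H s - prim Rr s / N)) <= ennreal (\<bar>H t - H s\<bar> - ?p)"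
   by (rule ennreal_leI)
  also have "... = ennreal \<bar>H t - H s\<bar> - ennreal ?p" by (rule ennreal_minus[symmetric, OF p])
  also have "... <= ?X" using c(2)[OF g a(4)] by (simp add: ennreal_minus_le_iff)
  finally show ?thesis .
 qed
 show ?thesis by (rule nonincreasing_of_increments[OF int T Q_meas q neg c(1) inc])
qed

text \<open>The exceptional sets for the countably many values of \<open>N\<close> and both signs
  are united. Outside their union \<open>N\<close> tends to infinity for fixed times, and the two
  monotonicities leave a constant.\<close>

lemma H_constant: obtains c where "AE t in TT. H t = c"
proof -
 let ?P = "%\<sigma> n M. negligible M & (\<forall>a b. 0 < a & a <= b & b < T & a \<notin> M & b \<notin> M -->
  \<sigma> * H b - prim Rr b / real (Suc n) <= \<sigma> * H a - prim Rr a / real (Suc n))"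
 have ex: "\<forall>n. \<exists>M. ?P \<sigma> n M" if "\<sigma> = 1 \<or> \<sigma> = -1" for \<sigma>
  by (intro allI H_almost_monotone that) simp
 obtain M1 where M1: "\<forall>n. ?P 1 n (M1 n)" using choice[OF ex[of 1]] by auto
 obtain M2 where M2: "\<forall>n. ?P (-1) n (M2 n)" using choice[OF ex[of "-1"]] by auto
 let ?M = "(\<Union>n. M1 n) \<union> (\<Union>n. M2 n)"
 have "negligible (\<Union>n. M1 n)" "negligible (\<Union>n. M2 n)"
  by (rule negligible_countable_Union; use M1 M2 in blast)+
 then have neg: "negligible ?M" by simp
 have le: "\<sigma> * (H b - H a) <= 0"
  if inc: "!!n. \<sigma> * H b - prim Rr b / real (Suc n) <= \<sigma> * H a - prim Rr a / real (Suc n)" for \<sigma> a b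
 proof -
  have "\<sigma> * (H b - H a) <= (prim Rr b - prim Rr a) * recip n" for n
   using inc[of n] by (simp add: right_diff_distrib left_diff_distrib divide_inverse)
  moreover have "(%n. (prim Rr b - prim Rr a) * recip n) \<longlonglongrightarrow> (prim Rr b - prim Rr a) * 0"
   by (intro tendsto_intros LIMSEQ_inverse_real_of_nat)
  ultimately show ?thesis by (intro LIMSEQ_le_const[of _ 0]) auto
 qed
 have eq: "H a = H b" if ab: "0 < a" "a <= b" "b < T" "a \<notin> ?M" "b \<notin> ?M" for a b
 proof -
  have "1 * (H b - H a) <= 0"
   by (rule le, rule spec[OF M1, THEN conjunct2, THEN spec, THEN spec, THEN mp]) (use ab in simp)
  moreover have "-1 * (H b - H a) <= 0"
   by (rule le, rule spec[OF M2, THEN conjunct2, THEN spec, THEN spec, THEN mp]) (use ab in simp)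
  ultimately show ?thesis by simp
 qed
 have "AE t in lebesgue. t \<notin> ?M & t \<notin> {0, T}"
 proof (rule AE_conjI)
  show "AE t in lebesgue. t \<notin> ?M" using neg by (intro AE_not_in) (simp add: negligible_iff_null_sets)
  show "AE t in lebesgue. t \<notin> {0, T}" by (intro AE_not_in null_sets_completionI countable_imp_null_set_lborel) simp
 qed
 then have "AE t in lebesgue. t \<in> {0..T} --> t \<notin> ?M & 0 < t & t < T"
  by eventually_elim force
 then have ae: "AE t in TT. t \<notin> ?M & 0 < t & t < T"
  by (subst AE_lebesgue_on) simp_all
 obtain t0 where t0: "0 < t0" "t0 < T" "t0 \<notin> ?M" using AE_TT_ex[OF ae order_refl T order_refl] by (elim exE conjE) rule
 have "AE t in TT. H t = H t0"
  using ae
 proof eventually_elim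
  case (elim t)
  note m = conjunct1[OF elim] conjunct1[OF conjunct2[OF elim]] conjunct2[OF conjunct2[OF elim]]
  show ?case
  proof (cases "t <= t0")
   case True show ?thesis by (rule eq[OF m(2) True t0(2) m(1) t0(3)])
  next
   case False
   then have "t0 <= t" by simp
   then show ?thesis by (rule eq[OF t0(1) _ m(3) t0(3) m(1), symmetric])
  qed
 qed
 then show ?thesis by (rule that)
qed

lemma small_dissipation_time:
 assumes P: "AE t in TT. P t" and st: "0 <= s" "s < t" "t <= T"
 shows "\<exists>r. s < r & r < t & P r & Dr r * (t - s) <= prim Dr t - prim Dr s + (t - s)"
proof (rule ccontr)
 assume n: "~ ?thesis"
 let ?v = "(prim Dr t - prim Dr s + (t - s)) / (t - s)"
 have si: "set_integrable lebesgue {s..t} Dr"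
  by (rule indefinite_integral_continuous_TT(2)[OF Rr_Dr_integrable(2)]) (use st in simp_all)
 have "prim Dr t - prim Dr s + (t - s) = (\<integral>r. ind {s..t} r * ?v \<partial>lebesgue)" using st by simp
 also have "... <= (\<integral>r. ind {s..t} r * Dr r \<partial>lebesgue)"
 proof (rule integral_mono_AE)
  have "AE t in lebesgue. t \<in> {0..T} --> P t" using P by (simp add: AE_lebesgue_on)
  moreover have "AE r in lebesgue. r \<notin> {s, t}" by (intro AE_not_in null_sets_completionI countable_imp_null_set_lborel) simp
  ultimately show "AE r in lebesgue. ind {s..t} r * ?v <= ind {s..t} r * Dr r"
  proof eventually_elim
   case (elim r)
   show ?case
   proof (cases "r \<in> {s..t}")
    case True
    then have "s < r" "r < t" "P r" using elim st by auto
    with n have "prim Dr t - prim Dr s + (t - s) <= Dr r * (t - s)" by (metis linorder_le_cases)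
    then show ?thesis using True st by (simp add: pos_divide_le_eq)
   qed simp
  qed
  show "integrable lebesgue (%r. ind {s..t} r * Dr r)" using si by (simp add: set_integrable_def)
  show "integrable lebesgue (%r. ind {s..t} r * ?v)"
   by (intro integrable_mult_left integrable_real_indicator) (use st in simp_all)
 qed
 also have "... = prim Dr t - prim Dr s"
  using prim_diff[OF Rr_Dr_integrable(2), of s t] st by (simp add: set_lebesgue_integral_def)
 finally show False using st by simp
qed

lemma Phi_time_bound:
 obtains c where "0 <= c" "!!r s t. good r ==> 0 <= s ==> s <= t ==> t <= T ==>
  \<bar>LINT x:{s..t}|lebesgue. \<Phi> r x\<bar> <= prim Rr t - prim Rr s + c * (Dr r * (t - s))"
proof -
 obtain c where c: "0 <= c" "!!s r. good s ==> good r ==> \<bar>\<Phi> s r\<bar> <= Rr r / 1 + c * Dr s"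
  using Phi_bounds[of 1] by (metis zero_less_one)
 have "\<bar>LINT x:{s..t}|lebesgue. \<Phi> r x\<bar> <= prim Rr t - prim Rr s + c * (Dr r * (t - s))"
  if g: "good r" and st: "0 <= s" "s <= t" "t <= T" for r s t
 proof -
  have i1: "integrable lebesgue (%x. ind {s..t} x * \<Phi> r x)"
   using indefinite_integral_continuous_TT(2)[OF Phi_integrable[OF g] st] by (simp add: set_integrable_def)
  have i2: "integrable lebesgue (%x. ind {s..t} x * Rr x)"
   using indefinite_integral_continuous_TT(2)[OF Rr_Dr_integrable(1) st] by (simp add: set_integrable_def)
  have i3: "integrable lebesgue (%x. ind {s..t} x * (c * Dr r))"
   by (intro integrable_mult_left integrable_real_indicator) (use st in simp_all)
  have "\<bar>LINT x:{s..t}|lebesgue. \<Phi> r x\<bar> <= (\<integral>x. \<bar>ind {s..t} x * \<Phi> r x\<bar> \<partial>lebesgue)"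
   unfolding set_lebesgue_integral_def real_scaleR_def by (rule integral_abs_bound)
  also have "... <= (\<integral>x. ind {s..t} x * Rr x + ind {s..t} x * (c * Dr r) \<partial>lebesgue)"
  proof (rule integral_mono_AE)
   note AE_good_time
   then show "AE x in lebesgue. \<bar>ind {s..t} x * \<Phi> r x\<bar> <= ind {s..t} x * Rr x + ind {s..t} x * (c * Dr r)"
   proof eventually_elim
    case (elim x)
    show ?case
    proof (cases "x \<in> {s..t}")
     case True
     then have "good x" using elim st by auto
     from c(2)[OF g this] True show ?thesis by simp
    qed simp
   qed
  qed (use i1 i2 i3 in simp_all)
  also have "... = (LINT x:{s..t}|lebesgue. Rr x) + c * Dr r * (t - s)"
   using i2 i3 st by (simp add: set_lebesgue_integral_def)
  finally show ?thesis unfolding prim_diff[OF Rr_Dr_integrable(1) st] by (simp add: mult.assoc)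
 qed
 with c(1) that show ?thesis by blast
qed

text \<open>The identity is known at a.e. time. The upper bound at \<open>b\<close> is lower
  semicontinuity of \<open>E\<close>: the convexity inequality is used with the slope at
  \<open>b\<close> itself. The lower bound uses slopes at good times tending to \<open>b\<close>,
  chosen so that their contribution vanishes in the limit.\<close>

lemma E_eq:
 assumes c: "AE t in TT. H t = c" and b: "b \<in> {0..T}"
 shows "E b = c + prim F b"
proof -
 \<comment> \<open>The intervals from \<open>s n\<close> to \<open>t n\<close> shrink to
   \<open>b\<close> from the left, and from the right when \<open>b = 0\<close>.\<close>
 define s where "s = (%n. if b = 0 then 0 else b * (1 - recip n))"
 define t where "t = (%n. if b = 0 then T * recip n else b)"
 have st: "0 <= s n" "s n < t n" "t n <= T" "b = t n \<or> b = 0 & s n = 0" for n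
 proof -
  have k: "0 < recip n" "recip n <= 1" by (simp_all add: inverse_le_1_iff)
  show "0 <= s n" "b = t n \<or> b = 0 & s n = 0" using b k by (auto simp: s_def t_def)
  show "t n <= T" using b k T mult_left_mono[OF k(2), of T] by (auto simp: t_def)
  show "s n < t n"
  proof (cases "b = 0")
   case True then show ?thesis using T k by (simp add: s_def t_def)
  next
   case False
   then have "0 < b * recip n" using b k(1) by (intro mult_pos_pos) auto
   then show ?thesis using False by (simp add: s_def t_def right_diff_distrib)
  qed
 qed
 have z: "(%n. K * recip n) \<longlonglongrightarrow> 0" for K
  using tendsto_mult[OF tendsto_const LIMSEQ_inverse_real_of_nat, of K] by simp
 have sl: "s \<longlonglongrightarrow> b"
 proof (cases "b = 0")
  case False
  then have "s = (%n. b - b * recip n)" by (simp add: s_def right_diff_distrib)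
  then show ?thesis using tendsto_diff[OF tendsto_const z, of b b] by simp
 qed (simp add: s_def)
 have tl: "t \<longlonglongrightarrow> b"
 proof (cases "b = 0")
  case True
  then have "t = (%n. T * recip n)" by (simp add: t_def)
  with z True show ?thesis by simp
 qed (simp add: t_def)
 have P: "AE t in TT. good t & H t = c" using AE_good c by eventually_elim simp
 have "\<exists>r. s n < r & r < t n & (good r & H r = c) &
   Dr r * (t n - s n) <= prim Dr (t n) - prim Dr (s n) + (t n - s n)" for n
  by (rule small_dissipation_time[OF P st(1-3)])
 then obtain r where r: "!!n. s n < r n" "!!n. r n < t n" "!!n. good (r n)" "!!n. H (r n) = c"
   "!!n. Dr (r n) * (t n - s n) <= prim Dr (t n) - prim Dr (s n) + (t n - s n)" by metis
 have rl: "r \<longlonglongrightarrow> b"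
  by (rule real_tendsto_sandwich[OF _ _ sl tl]) (use r(1,2) in \<open>auto intro!: always_eventually less_imp_le\<close>)
 have rT: "r n \<in> {0..T}" "s n \<in> {0..T}" "t n \<in> {0..T}" for n using goodD(1)[OF r(3)] st[of n] by auto
 have lim: "(%n. g (x n)) \<longlonglongrightarrow> g b" if "continuous_on {0..T} g" "x \<longlonglongrightarrow> b" "!!n. x n \<in> {0..T}" for g :: "real => real" and x
  by (rule continuous_on_tendsto_compose[OF that(1,2) b], rule always_eventually, rule allI, rule that(3))
 have Er: "E (r n) = c + prim F (r n)" for n using r(4)[of n] by (simp add: H_def)
 have El: "(%n. E (r n)) \<longlonglongrightarrow> c + prim F b"
  unfolding Er by (rule tendsto_add[OF tendsto_const lim[OF prim_cont[OF F_integrable] rl rT(1)]])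
 have "E b <= c + prim F b"
 proof -
  \<comment> \<open>The time \<open>b\<close> need not be good, so this slope need not belong to
    \<open>X2\<close>. A bounded Borel version is enough: it is tested only through the continuity
    of \<rho> against such functions.\<close>
  define h where "h = (%x. tr_deriv e (min C (u b x)))"
  have hm: "h \<in> Bor borel"
  proof -
   have "(%x. min C (u b x)) \<in> Bor borel" using u_meas[of b] by measurable
   from measurable_compose[OF this tr_deriv_measurable[OF e]] show ?thesis unfolding h_def .
  qed
  have hb: "\<bar>h x\<bar> <= B" for x
   unfolding h_def B_def by (rule tr_deriv_bound[OF e]) (use C_nonneg u_nonneg in auto)
  have ae: "AE x in \<pi>. h x = tr_deriv e (u b x)"
   using u_le_C[OF b] by eventually_elim (simp add: h_def min_def)
  have "(%n. (\<integral>x. h x \<partial>\<rho> (r n)) - (\<integral>x. h x \<partial>\<rho> b)) \<longlonglongrightarrow> (\<integral>x. h x \<partial>\<rho> b) - (\<integral>x. h x \<partial>\<rho> b)"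
   by (rule tendsto_diff[OF lim[OF rho_continuous[OF hm hb] rl rT(1)] tendsto_const])
  moreover have "(%n. E (r n) - E b) \<longlonglongrightarrow> c + prim F b - E b" by (rule tendsto_diff[OF El tendsto_const])
  moreover have "(\<integral>x. h x \<partial>\<rho> (r n)) - (\<integral>x. h x \<partial>\<rho> b) <= E (r n) - E b" for n
   by (rule convexity_inequality[OF b rT(1) hm hb ae])
  ultimately have "(\<integral>x. h x \<partial>\<rho> b) - (\<integral>x. h x \<partial>\<rho> b) <= c + prim F b - E b" by (intro LIMSEQ_le) auto
  then show ?thesis by simp
 qed
 moreover have "c + prim F b <= E b"
 proof -
  obtain k where k: "0 <= k" "!!r s t. good r ==> 0 <= s ==> s <= t ==> t <= T ==>
   \<bar>LINT x:{s..t}|lebesgue. \<Phi> r x\<bar> <= prim Rr t - prim Rr s + k * (Dr r * (t - s))"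
   using Phi_time_bound by metis
  let ?R = "%n. prim Rr (t n) - prim Rr (s n) + k * (prim Dr (t n) - prim Dr (s n) + (t n - s n))"
  have key: "\<bar>LINT x:{a..a'}|lebesgue. \<Phi> (r n) x\<bar> <= ?R n" if a: "s n <= a" "a <= a'" "a' <= t n" for n a a'
  proof -
   have a': "0 <= a" "a' <= T" using a st[of n] by auto
   have "prim Rr a' <= prim Rr (t n)" "prim Rr (s n) <= prim Rr a"
    by (rule prim_mono[OF Rr_Dr_integrable(1)]; use a a' st[of n] in simp)+
   moreover have "k * (Dr (r n) * (a' - a)) <= k * (prim Dr (t n) - prim Dr (s n) + (t n - s n))"
   proof (rule mult_left_mono[OF _ k(1)])
    have "Dr (r n) * (a' - a) <= Dr (r n) * (t n - s n)" using a by (intro mult_left_mono) auto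
    with r(5)[of n] show "Dr (r n) * (a' - a) <= prim Dr (t n) - prim Dr (s n) + (t n - s n)" by linarith
   qed
   ultimately show ?thesis using k(2)[OF r(3)[of n] a'(1) a(2) a'(2)] by linarith
  qed
  have "E (r n) - ?R n <= E b" for n
   using st(4)[of n]
  proof
   assume bt: "b = t n"
   have "r n <= b" "s n <= r n" using r(1,2)[of n] bt by auto
   from forward_inequality[OF r(3) this(1)] key[OF this(2,1)] bt b show ?thesis by fastforce
  next
   assume b0: "b = 0 & s n = 0"
   have rr: "0 <= r n" "r n <= t n" using r(2)[of n] rT(1)[of n] by auto
   have "s n <= 0" using b0 by simp
   from backward_inequality[OF r(3) order_refl rr(1)] key[OF this rr] b0 show ?thesis by fastforce
  qed
  moreover have "(%n. E (r n) - ?R n) \<longlonglongrightarrow> c + prim F b - (prim Rr b - prim Rr b + k * (prim Dr b - prim Dr b + (b - b)))"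
   by (rule tendsto_diff[OF El tendsto_add[OF
      tendsto_diff[OF lim[OF prim_cont[OF Rr_Dr_integrable(1)] tl rT(3)] lim[OF prim_cont[OF Rr_Dr_integrable(1)] sl rT(2)]]
      tendsto_mult[OF tendsto_const tendsto_add[OF
       tendsto_diff[OF lim[OF prim_cont[OF Rr_Dr_integrable(2)] tl rT(3)] lim[OF prim_cont[OF Rr_Dr_integrable(2)] sl rT(2)]]
       tendsto_diff[OF tl sl]]]]])
  ultimately have "c + prim F b - (prim Rr b - prim Rr b + k * (prim Dr b - prim Dr b + (b - b))) <= E b"
   by (intro LIMSEQ_le_const2) auto
  then show ?thesis by simp
 qed
 ultimately show ?thesis by simp
qed

end

text \<open>Stated through \<open>u\<close> and \<open>U\<close> alone, so that \<open>e\<close> can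
  vary in the limit to come; the measurability of the rate is exported with it.\<close>

lemma (in curve) truncated_chain_rule:
 assumes e: "0 < e" and st: "0 <= s" "s <= t" "t <= T"
 shows "(\<integral>x. tr_phi e (u t x) \<partial>\<pi>) - (\<integral>x. tr_phi e (u s x) \<partial>\<pi>) =
  (LINT r:{s..t}|lebesgue. (\<integral>p. w (r, p) * A r p * (tr_deriv e (U (r, snd p)) - tr_deriv e (U (r, fst p))) \<partial>\<theta>))"
  "(%r. \<integral>p. w (r, p) * A r p * (tr_deriv e (U (r, snd p)) - tr_deriv e (U (r, fst p))) \<partial>\<theta>) \<in> Bor TT"
proof -
 interpret truncated_curve \<pi> \<kappa> \<phi> \<psi>s \<alpha> T \<rho> j e by unfold_locales (rule e)
 obtain c where c: "AE t in TT. H t = c" using H_constant by blast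
 let ?F = "%r. \<integral>p. w (r, p) * A r p * (tr_deriv e (U (r, snd p)) - tr_deriv e (U (r, fst p))) \<partial>\<theta>"
 have F: "F r = ?F r" if "r \<in> {0..T}" for r using that by (simp add: F_def \<zeta>_def f_def)
 have "E t - E s = (LINT r:{s..t}|lebesgue. F r)"
  using E_eq[OF c, of s] E_eq[OF c, of t] prim_diff[OF F_integrable st] st by simp
 also have "... = (LINT r:{s..t}|lebesgue. ?F r)"
  unfolding set_lebesgue_integral_def
 proof (rule Bochner_Integration.integral_cong[OF refl])
  fix r show "ind {s..t} r *\<^sub>R F r = ind {s..t} r *\<^sub>R ?F r"
   using F[of r] st by (cases "r \<in> {s..t}") auto
 qed
 finally show "(\<integral>x. tr_phi e (u t x) \<partial>\<pi>) - (\<integral>x. tr_phi e (u s x) \<partial>\<pi>) = (LINT r:{s..t}|lebesgue. ?F r)"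
  by (simp add: E_def)
 have "(F \<in> Bor TT) = (?F \<in> Bor TT)" by (rule measurable_cong) (simp add: F)
 then show "?F \<in> Bor TT" using F_meas by blast
qed

section \<open>Removing the truncation\<close>

context densities
begin

lemma slope_measurable: "entropy_slope \<phi> \<in> Bor borel"
proof -
 have "(%r. ind {0<..} r *\<^sub>R d\<phi> r) \<in> Bor borel"
  by (rule borel_measurable_continuous_on_indicator[OF _ dphi_cont]) simp
 then have "(%r. if 0 < r then ereal (ind {0<..} r *\<^sub>R d\<phi> r) else entropy_slope \<phi> 0) \<in> Bor borel"
  by measurable
 also have "(%r. if 0 < r then ereal (ind {0<..} r *\<^sub>R d\<phi> r) else entropy_slope \<phi> 0) = entropy_slope \<phi>"
  by (auto simp: entropy_slope_def fun_eq_iff)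
 finally show ?thesis .
qed

lemma slope_diff_measurable:
 assumes [measurable]: "u \<in> Bor M" "v \<in> Bor M"
 shows "(%x. slope_diff \<phi> (u x, v x)) \<in> Bor M"
proof -
 note [measurable] = measurable_compose[OF assms(1) slope_measurable] measurable_compose[OF assms(2) slope_measurable]
 show ?thesis unfolding slope_diff_def split_conv by measurable
qed

text \<open>The bound is uniform in \<open>e\<close>, as needed for dominated convergence. From
  above, the tangent line lies below \<phi>; from below, only a positive slope at \<open>e\<close>
  can produce negative values, and it is at most the slope at 1.\<close>

lemma tr_phi_bound:
 assumes e: "0 < e" "e <= 1" and K: "!!r. 0 <= r ==> r <= C ==> \<phi> r <= K" and r: "0 <= r" "r <= C"
 shows "\<bar>tr_phi e r\<bar> <= K + \<bar>d\<phi> 1\<bar>"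
proof -
 have up: "tr_phi e r <= K" using tr_phi_le[OF e(1) r(1)] K[OF r] by linarith
 have K0: "0 <= K" using phi_nonneg[OF r(1)] K[OF r] by linarith
 have "- \<bar>d\<phi> 1\<bar> <= tr_phi e r"
 proof (cases "e <= r")
  case True
  then show ?thesis using phi_nonneg[OF r(1)] by (simp add: tr_phi_def)
 next
  case False
  have p: "0 <= \<phi> e" using e by (intro phi_nonneg) simp
  have "d\<phi> e * (e - r) <= \<bar>d\<phi> 1\<bar>"
  proof (cases "0 <= d\<phi> e")
   case True
   have "d\<phi> e * (e - r) <= d\<phi> e * 1" using True e r by (intro mult_left_mono) auto
   also have "... <= \<bar>d\<phi> 1\<bar>" using dphi_mono[OF e] by simp
   finally show ?thesis .
  next
   case dn: False
   have "d\<phi> e * (e - r) <= 0" using dn \<open>~ e <= r\<close> by (intro mult_nonpos_nonneg) auto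
   then show ?thesis by simp
  qed
  then show ?thesis using False p by (simp add: tr_phi_def right_diff_distrib)
 qed
 with up K0 show ?thesis by linarith
qed

end

section \<open>The limit of vanishing truncation\<close>

context curve
begin

text \<open>Infinite slope differences become 0 under \<open>real_of_ereal\<close>. At good times
  they occur only where \<open>A\<close> vanishes, up to a null set, so the integrand of
  \<open>J\<close> is not affected.\<close>

definition S :: "real => 'v \<times> 'v => real" where
 "S t p = real_of_ereal (slope_diff \<phi> (U (t, fst p), U (t, snd p)))"

definition J :: "real => real" where "J t = (\<integral>p. w (t, p) * A t p * S t p \<partial>\<theta>)"

definition J\<^sub>t\<^sub>r :: "real => real => real" where
 "J\<^sub>t\<^sub>r e t = (\<integral>p. w (t, p) * A t p * (tr_deriv e (U (t, snd p)) - tr_deriv e (U (t, fst p))) \<partial>\<theta>)"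

text \<open>The integrand of dissipation plus Fisher information. By Fenchel's inequality it
  dominates the flux tested with the truncated slopes, uniformly in \<open>e\<close>.\<close>

definition M :: "real => 'v \<times> 'v => real" where
 "M t p = \<psi> (2 * w (t, p)) * A t p / 2 + enn2real (D (U (t, fst p), U (t, snd p))) / 2"

lemma U_edge_meas: "(%p. U (t, fst p)) \<in> Bor borel" "(%p. U (t, snd p)) \<in> Bor borel"
 by (intro measurable_compose[OF borel_measurable_fst_snd(1) U_fixed_meas] measurable_compose[OF borel_measurable_fst_snd(2) U_fixed_meas])+

lemma S_meas: "S t \<in> Bor borel"
 unfolding S_def[abs_def] by (intro borel_measurable_real_of_ereal slope_diff_measurable U_edge_meas)

lemma wA_meas: assumes "t \<in> {0..T}" shows "(%p. w (t, p) * A t p) \<in> Bor borel"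
 by (rule borel_measurable_times[OF w_section[OF assms] A_meas])

lemma M_integral:
 assumes g: "good t"
 shows "integrable \<theta> (M t)" "(\<integral>p. M t p \<partial>\<theta>) = Rr t + Dr t" "!!p. 0 <= M t p"
  "AE p in \<theta>. D (U (t, fst p), U (t, snd p)) < \<infinity>"
proof -
 have Dm: "(%p. D (U (t, fst p), U (t, snd p))) \<in> Bor \<theta>"
  unfolding measurable_edge_borel by (intro fisher_measurable U_edge_meas) simp_all
 have "AE p in \<theta>. D (U (t, fst p), U (t, snd p)) ~= \<infinity>"
  by (rule nn_integral_PInf_AE[OF Dm]) (simp add: goodD(6)[OF g, symmetric])
 then show fin: "AE p in \<theta>. D (U (t, fst p), U (t, snd p)) < \<infinity>" by eventually_elim (simp add: less_top)
 have pm: "(%p. \<psi> (2 * w (t, p)) * A t p) \<in> Bor \<theta>"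
  unfolding measurable_edge_borel
 proof (rule borel_measurable_times[OF measurable_compose[OF _ psi_measurable] A_meas])
  show "(%p. 2 * w (t, p)) \<in> Bor borel" using w_section[OF goodD(1)[OF g]] by (intro borel_measurable_times borel_measurable_const)
 qed
 have i1: "integrable \<theta> (%p. \<psi> (2 * w (t, p)) * A t p)"
  by (rule integrableI_nn_integral_finite[OF pm _ goodD(5)[OF g, symmetric]]) simp
 have v1: "(\<integral>p. \<psi> (2 * w (t, p)) * A t p \<partial>\<theta>) = 2 * Rr t"
  by (subst integral_eq_nn_integral[OF pm]) (simp_all add: goodD(5)[OF g, symmetric])
 have eD: "(\<integral>\<^sup>+ p. ennreal (enn2real (D (U (t, fst p), U (t, snd p)))) \<partial>\<theta>) = ennreal (2 * Dr t)"
  unfolding goodD(6)[OF g] by (rule nn_integral_cong_AE) (use fin in eventually_elim, simp)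
 have em: "(%p. enn2real (D (U (t, fst p), U (t, snd p)))) \<in> Bor \<theta>" using Dm by (rule borel_measurable_enn2real)
 have i2: "integrable \<theta> (%p. enn2real (D (U (t, fst p), U (t, snd p))))"
  by (rule integrableI_nn_integral_finite[OF em _ eD]) simp
 have v2: "(\<integral>p. enn2real (D (U (t, fst p), U (t, snd p))) \<partial>\<theta>) = 2 * Dr t"
  by (subst integral_eq_nn_integral[OF em]) (simp_all add: eD)
 show "integrable \<theta> (M t)" unfolding M_def[abs_def] using i1 i2 by simp
 show "(\<integral>p. M t p \<partial>\<theta>) = Rr t + Dr t" unfolding M_def using i1 i2 v1 v2 by simp
 show "0 <= M t p" for p by (simp add: M_def)
qed

lemma flux_le_M:
 assumes "\<psi>s \<xi> * A t p <= enn2real (D (U (t, fst p), U (t, snd p)))"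
 shows "\<bar>w (t, p) * A t p * \<xi>\<bar> <= M t p"
proof -
 have "(\<bar>2 * w (t, p)\<bar> * \<bar>\<xi>\<bar>) * A t p <= (\<psi> (2 * w (t, p)) + \<psi>s \<xi>) * A t p"
  by (rule mult_right_mono[OF fenchel_abs]) simp
 then show ?thesis using assms by (simp add: M_def abs_mult algebra_simps)
qed

lemma ennreal_le_enn2real: "ennreal x <= y ==> y < \<infinity> ==> x <= enn2real y" for x and y :: ennreal
 by (cases y) (auto simp: ennreal_le_iff2)

lemma flux_bounds:
 assumes g: "good t"
 shows "0 < e ==> AE p in \<theta>. \<bar>w (t, p) * A t p * (tr_deriv e (U (t, snd p)) - tr_deriv e (U (t, fst p)))\<bar> <= M t p"
  and "AE p in \<theta>. \<bar>w (t, p) * A t p * S t p\<bar> <= M t p"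
  and "AE p in \<theta>. 0 < A t p --> \<bar>slope_diff \<phi> (U (t, fst p), U (t, snd p))\<bar> ~= \<infinity>"
proof -
 note fin = M_integral(4)[OF g]
 show "AE p in \<theta>. \<bar>w (t, p) * A t p * (tr_deriv e (U (t, snd p)) - tr_deriv e (U (t, fst p)))\<bar> <= M t p" if e: "0 < e"
  using fin
 proof eventually_elim
  case (elim p)
  show ?case
   by (rule flux_le_M, rule ennreal_le_enn2real[OF _ elim])
    (simp only: A_def, rule fisher_ge_truncated[OF e U_nonneg U_nonneg])
 qed
 show "AE p in \<theta>. \<bar>w (t, p) * A t p * S t p\<bar> <= M t p"
  using fin
 proof eventually_elim
  case (elim p)
  show ?case
  proof (cases "0 < A t p")
   case True
   then have a: "0 < \<alpha> (U (t, fst p), U (t, snd p))" by (simp add: A_def)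
   show ?thesis
    by (rule flux_le_M, rule ennreal_le_enn2real[OF _ elim])
     (simp only: A_def S_def, rule fisher_ge_slope(2)[OF U_nonneg U_nonneg elim a])
  next
   case False
   then have "A t p = 0" using A_nonneg[of t p] by linarith
   then show ?thesis using M_integral(3)[OF g, of p] by simp
  qed
 qed
 show "AE p in \<theta>. 0 < A t p --> \<bar>slope_diff \<phi> (U (t, fst p), U (t, snd p))\<bar> ~= \<infinity>"
  using fin
 proof eventually_elim
  case (elim p)
  show ?case unfolding A_def by (intro impI fisher_ge_slope(1)[OF U_nonneg U_nonneg elim])
 qed
qed

text \<open>If the integral does not exist, it is 0 by convention and the bound is trivial.\<close>

lemma integral_le_M:
 assumes g: "good t" and "AE p in \<theta>. \<bar>h p\<bar> <= M t p"
 shows "\<bar>\<integral>p. h p \<partial>\<theta>\<bar> <= Rr t + Dr t"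
proof (cases "integrable \<theta> h")
 case True
 have "\<bar>\<integral>p. h p \<partial>\<theta>\<bar> <= (\<integral>p. \<bar>h p\<bar> \<partial>\<theta>)" by (rule integral_abs_bound)
 also have "... <= (\<integral>p. M t p \<partial>\<theta>)"
  by (rule integral_mono_AE[OF _ M_integral(1)[OF g] assms(2)]) (use True in simp)
 finally show ?thesis unfolding M_integral(2)[OF g] .
qed (simp add: not_integrable_integral_eq)

lemma J_bound: "good t ==> \<bar>J t\<bar> <= Rr t + Dr t"
 unfolding J_def by (intro integral_le_M flux_bounds(2))

lemma J_tr_bound: "good t ==> 0 < e ==> \<bar>J\<^sub>t\<^sub>r e t\<bar> <= Rr t + Dr t"
 unfolding J\<^sub>t\<^sub>r_def by (intro integral_le_M flux_bounds(1))

lemma RD_integrable_of_bound: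
 assumes "h \<in> Bor TT" "!!t. good t ==> \<bar>h t\<bar> <= Rr t + Dr t"
 shows "integrable TT h"
proof (rule Bochner_Integration.integrable_bound)
 show "integrable TT (%t. Rr t + Dr t)" using Rr_Dr_integrable by simp
 show "AE t in TT. norm (h t) <= norm (Rr t + Dr t)"
  using AE_good
 proof eventually_elim
  case (elim t)
  have "0 <= Rr t + Dr t" by simp
  then show ?case using assms(2)[OF elim] by simp
 qed
qed (rule assms(1))

lemma J_integrable: "integrable TT J"
proof (rule RD_integrable_of_bound[OF _ J_bound])
 have "(%q. S (fst q) (snd q)) \<in> Bor (borel \<Otimes>\<^sub>M borel)"
  unfolding S_def by (intro borel_measurable_real_of_ereal slope_diff_measurable U_section_meas)
 then have "(%q. w q * A (fst q) (snd q) * S (fst q) (snd q)) \<in> Bor (TT \<Otimes>\<^sub>M borel)"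
  by (intro borel_measurable_times w_meas joint_TT_meas A_joint_meas)
 then have "(%(r, p). w (r, p) * A r p * S r p) \<in> Bor (TT \<Otimes>\<^sub>M \<theta>)"
  by (simp add: split_def measurable_cong_sets[OF sets_pair_measure_cong[OF refl sets_edge] refl])
 then show "J \<in> Bor TT" unfolding J_def[abs_def] by (rule edge.borel_measurable_lebesgue_integral)
qed

lemma J_tr_integrable: "0 < e ==> integrable TT (J\<^sub>t\<^sub>r e)"
 by (rule RD_integrable_of_bound[OF _ J_tr_bound])
  (use truncated_chain_rule(2)[of e 0 0] T in \<open>simp_all add: J\<^sub>t\<^sub>r_def[abs_def]\<close>)

lemma e_seq: "filterlim (%n. recip n) (at_right 0) sequentially"
 unfolding filterlim_at using LIMSEQ_inverse_real_of_nat by (auto intro!: always_eventually)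

lemma J_tr_tendsto:
 assumes g: "good t"
 shows "(%n. J\<^sub>t\<^sub>r (recip n) t) \<longlonglongrightarrow> J t"
 unfolding J\<^sub>t\<^sub>r_def J_def
proof (rule integral_dominated_convergence)
 have wA: "(%p. w (t, p) * A t p) \<in> Bor borel" by (rule wA_meas[OF goodD(1)[OF g]])
 show "(%p. w (t, p) * A t p * S t p) \<in> Bor \<theta>"
  unfolding measurable_edge_borel by (rule borel_measurable_times[OF wA S_meas])
 show "(%p. w (t, p) * A t p * (tr_deriv (recip n) (U (t, snd p)) - tr_deriv (recip n) (U (t, fst p))))
   \<in> Bor \<theta>" for n
  unfolding measurable_edge_borel
  by (rule borel_measurable_times[OF wA borel_measurable_diff[OF
    measurable_compose[OF U_edge_meas(2) tr_deriv_measurable] measurable_compose[OF U_edge_meas(1) tr_deriv_measurable]]]) simp_all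
 show "integrable \<theta> (M t)" by (rule M_integral(1)[OF g])
 show "AE p in \<theta>. norm (w (t, p) * A t p * (tr_deriv (recip n) (U (t, snd p)) - tr_deriv (recip n) (U (t, fst p)))) <= M t p" for n
  unfolding real_norm_def by (rule flux_bounds(1)[OF g]) simp
 show "AE p in \<theta>. (%n. w (t, p) * A t p * (tr_deriv (recip n) (U (t, snd p)) - tr_deriv (recip n) (U (t, fst p))))
   \<longlonglongrightarrow> w (t, p) * A t p * S t p"
  using flux_bounds(3)[OF g]
 proof eventually_elim
  case (elim p)
  show ?case
  proof (cases "0 < A t p")
   case True
   with elim have "\<bar>slope_diff \<phi> (U (t, fst p), U (t, snd p))\<bar> ~= \<infinity>" by simp
   from filterlim_compose[OF tr_deriv_diff_tendsto[OF U_nonneg U_nonneg this] e_seq]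
   show ?thesis unfolding S_def by (rule tendsto_mult[OF tendsto_const])
  next
   case False
   then have "A t p = 0" using A_nonneg[of t p] by linarith
   then show ?thesis by simp
  qed
 qed
qed

definition Er :: "real => real" where "Er t = (\<integral>x. \<phi> (u t x) \<partial>\<pi>)"

lemma Ent_eq: assumes t: "t \<in> {0..T}" shows "Ent (\<rho> t) = ennreal (Er t)" "0 <= Er t"
proof -
 have e: "Ent (\<rho> t) = (\<integral>\<^sup>+ x. ennreal (\<phi> (u t x)) \<partial>\<pi>)" using rho_ac[OF t] by (simp add: entropy_def u_def)
 have m: "(%x. \<phi> (u t x)) \<in> Bor \<pi>" unfolding measurable_pi_borel by (rule phi_measurable[OF u_meas u_nonneg])
 have nn: "0 <= \<phi> (u t x)" for x by (rule phi_nonneg) simp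
 have "integrable \<pi> (%x. \<phi> (u t x))"
  using ent_fin[OF t] m nn unfolding e by (simp add: integrable_iff_bounded)
 then show "Ent (\<rho> t) = ennreal (Er t)" unfolding e Er_def using nn by (intro nn_integral_eq_integral) simp_all
 show "0 <= Er t" unfolding Er_def using nn by simp
qed

lemma tr_entropy_tendsto:
 assumes t: "t \<in> {0..T}"
 shows "(%n. \<integral>x. tr_phi (recip n) (u t x) \<partial>\<pi>) \<longlonglongrightarrow> Er t"
 unfolding Er_def
proof -
 obtain K where K: "0 <= K" "!!r. 0 <= r ==> r <= C ==> \<phi> r <= K" using phi_bounded_on[of C] by metis
 show "(%n. \<integral>x. tr_phi (recip n) (u t x) \<partial>\<pi>) \<longlonglongrightarrow> (\<integral>x. \<phi> (u t x) \<partial>\<pi>)"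
 proof (rule integral_dominated_convergence)
  show "(%x. \<phi> (u t x)) \<in> Bor \<pi>" unfolding measurable_pi_borel by (rule phi_measurable[OF u_meas u_nonneg])
  show "(%x. tr_phi (recip n) (u t x)) \<in> Bor \<pi>" for n
   unfolding measurable_pi_borel by (rule tr_phi_measurable[OF u_meas]) simp
  show "integrable \<pi> (%x. K + \<bar>d\<phi> 1\<bar>)" by simp
  show "AE x in \<pi>. norm (tr_phi (recip n) (u t x)) <= K + \<bar>d\<phi> 1\<bar>" for n
   using u_le_C[OF t]
  proof eventually_elim
   case (elim x)
   have "recip n <= 1" by (simp add: inverse_le_1_iff)
   then show ?case unfolding real_norm_def by (intro tr_phi_bound[OF _ _ K(2)]) (use elim in simp_all)
  qed
  show "AE x in \<pi>. (%n. tr_phi (recip n) (u t x)) \<longlonglongrightarrow> \<phi> (u t x)"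
   by (intro AE_I2 filterlim_compose[OF tr_phi_tendsto e_seq]) simp
 qed
qed

lemma entropy_increment:
 assumes st: "0 <= s" "s <= t" "t <= T"
 shows "Er t - Er s = (LINT r:{s..t}|lebesgue. J r)"
proof (rule LIMSEQ_unique)
 have sT: "s \<in> {0..T}" "t \<in> {0..T}" using st by auto
 have eq: "(\<integral>x. tr_phi (recip n) (u t x) \<partial>\<pi>) - (\<integral>x. tr_phi (recip n) (u s x) \<partial>\<pi>) =
  (LINT r:{s..t}|lebesgue. J\<^sub>t\<^sub>r (recip n) r)" for n
  unfolding J\<^sub>t\<^sub>r_def by (rule truncated_chain_rule(1)[OF _ st]) simp
 show "(%n. LINT r:{s..t}|lebesgue. J\<^sub>t\<^sub>r (recip n) r) \<longlonglongrightarrow> Er t - Er s"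
  using tendsto_diff[OF tr_entropy_tendsto[OF sT(2)] tr_entropy_tendsto[OF sT(1)]] unfolding eq .
 have si: "integrable lebesgue (%r. ind {s..t} r *\<^sub>R h r)" if "integrable TT h" for h :: "real => real"
  using indefinite_integral_continuous_TT(2)[OF that st] by (simp only: set_integrable_def)
 have ae: "AE r in lebesgue. r \<in> {0..T} --> good r" using AE_good by (simp add: AE_lebesgue_on)
 show "(%n. LINT r:{s..t}|lebesgue. J\<^sub>t\<^sub>r (recip n) r) \<longlonglongrightarrow> (LINT r:{s..t}|lebesgue. J r)"
  unfolding set_lebesgue_integral_def
 proof (rule integral_dominated_convergence)
  show "(%r. ind {s..t} r *\<^sub>R J r) \<in> Bor lebesgue"
   by (rule borel_measurable_integrable[OF si[OF J_integrable]])
  show "(%r. ind {s..t} r *\<^sub>R J\<^sub>t\<^sub>r (recip n) r) \<in> Bor lebesgue" for n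
   by (rule borel_measurable_integrable[OF si[OF J_tr_integrable]]) simp
  show "integrable lebesgue (%r. ind {s..t} r *\<^sub>R (Rr r + Dr r))"
   by (rule si) (use Rr_Dr_integrable in simp)
  show "AE r in lebesgue. norm (ind {s..t} r *\<^sub>R J\<^sub>t\<^sub>r (recip n) r) <= ind {s..t} r *\<^sub>R (Rr r + Dr r)" for n
   using ae
  proof eventually_elim
   case (elim r)
   show ?case
   proof (cases "r \<in> {s..t}")
    case True
    then have "good r" using elim st by auto
    from J_tr_bound[OF this, of "recip n"] True show ?thesis by simp
   qed simp
  qed
  show "AE r in lebesgue. (%n. ind {s..t} r *\<^sub>R J\<^sub>t\<^sub>r (recip n) r) \<longlonglongrightarrow> ind {s..t} r *\<^sub>R J r"
   using ae
  proof eventually_elim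
   case (elim r)
   show ?case
   proof (cases "r \<in> {s..t}")
    case True
    then have "good r" using elim st by auto
    from J_tr_tendsto[OF this] True show ?thesis by simp
   qed simp
  qed
 qed
qed

section \<open>Chain rule and energy balance\<close>

text \<open>The gradient is defined with the derivative of \<open>\<rho> t\<close> itself, which
  agrees with \<open>U\<close> along a.e. edge at good times. The flux does not see infinite slopes,
  because its density contains the factor \<open>A\<close>.\<close>

lemma entropy_gradient_flux:
 assumes g: "good t" and B: "offdiag \<subseteq> B" "B \<in> sets borel"
 shows "ext_integrable (j t) B (neg_entropy_grad \<pi> \<phi> (\<rho> t))"
  "ext_integral (j t) B (neg_entropy_grad \<pi> \<phi> (\<rho> t)) = - J t"
proof -
 let ?s = "%p. slope_diff \<phi> (u t (fst p), u t (snd p))"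
 let ?h = "%p. real_of_ereal (neg_entropy_grad \<pi> \<phi> (\<rho> t) p)"
 have n: "neg_entropy_grad \<pi> \<phi> (\<rho> t) p = - ?s p" for p by (simp add: neg_entropy_grad_def u_def split_def)
 have ue: "(%p. u t (fst p)) \<in> Bor borel" "(%p. u t (snd p)) \<in> Bor borel"
  by (intro measurable_compose[OF borel_measurable_fst_snd(1) u_meas] measurable_compose[OF borel_measurable_fst_snd(2) u_meas])+
 have hm: "?h \<in> Bor borel"
  unfolding n by (intro borel_measurable_real_of_ereal borel_measurable_uminus_ereal slope_diff_measurable ue)
 have aeU: "AE p in \<theta>. u t (fst p) = U (t, fst p) & u t (snd p) = U (t, snd p)" by (rule AE_edge[OF goodD(2)[OF g]])
 have hS: "AE p in \<theta>. ?h p = - S t p" using aeU by eventually_elim (simp add: n S_def)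
 have hb: "AE p in \<theta>. ennreal (\<bar>w (t, p)\<bar> * A t p) * ennreal \<bar>?h p\<bar> <= ennreal (M t p)"
  using hS flux_bounds(2)[OF g]
 proof eventually_elim
  case (elim p)
  have "ennreal (\<bar>w (t, p)\<bar> * A t p) * ennreal \<bar>?h p\<bar> = ennreal \<bar>w (t, p) * A t p * S t p\<bar>"
   unfolding elim(1) by (simp add: abs_mult ennreal_mult[symmetric])
  also have "... <= ennreal (M t p)" by (rule ennreal_leI[OF elim(2)])
  finally show ?case .
 qed
 have "(\<integral>\<^sup>+ p. ennreal \<bar>?h p\<bar> \<partial>total_var (j t)) = (\<integral>\<^sup>+ p. ennreal (\<bar>w (t, p)\<bar> * A t p) * ennreal \<bar>?h p\<bar> \<partial>\<theta>)"
  by (rule total_var_good[OF g]) (use hm in measurable)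
 also have "... <= (\<integral>\<^sup>+ p. ennreal (M t p) \<partial>\<theta>)" by (rule nn_integral_mono_AE[OF hb])
 also have "... = ennreal (Rr t + Dr t)"
  unfolding M_integral(2)[OF g, symmetric] by (rule nn_integral_eq_integral[OF M_integral(1)[OF g]]) (simp add: M_integral(3)[OF g])
 also have "... < \<infinity>" by simp
 finally have fin: "(\<integral>\<^sup>+ p. ennreal \<bar>?h p\<bar> \<partial>total_var (j t)) < \<infinity>" .
 have wm: "(%p. w (t, p) * A t p) \<in> Bor \<theta>"
  unfolding measurable_edge_borel by (rule wA_meas[OF goodD(1)[OF g]])
 have tv: "total_var (j t) = density \<theta> (%p. ennreal \<bar>w (t, p) * A t p\<bar>)"
  unfolding goodD(4)[OF g] by (rule total_var_signed_density[OF wm])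
 show "ext_integrable (j t) B (neg_entropy_grad \<pi> \<phi> (\<rho> t))"
  unfolding ext_integrable_def
 proof
  have "AE p in total_var (j t). \<bar>neg_entropy_grad \<pi> \<phi> (\<rho> t) p\<bar> ~= \<infinity>"
  proof -
   have "AE p in \<theta>. 0 < ennreal \<bar>w (t, p) * A t p\<bar> --> \<bar>neg_entropy_grad \<pi> \<phi> (\<rho> t) p\<bar> ~= \<infinity>"
    using aeU flux_bounds(3)[OF g]
   proof eventually_elim
    case (elim p)
    show ?case
    proof
     assume "0 < ennreal \<bar>w (t, p) * A t p\<bar>"
     then have "A t p ~= 0" by auto
     then have "0 < A t p" using A_nonneg[of t p] by linarith
     then show "\<bar>neg_entropy_grad \<pi> \<phi> (\<rho> t) p\<bar> ~= \<infinity>" using elim by (simp add: n)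
    qed
   qed
   moreover have "(%p. ennreal \<bar>w (t, p) * A t p\<bar>) \<in> Bor \<theta>" using wm by measurable
   ultimately show ?thesis unfolding tv by (subst AE_density) simp_all
  qed
  then show "AE p\<in>B in total_var (j t). \<bar>neg_entropy_grad \<pi> \<phi> (\<rho> t) p\<bar> ~= \<infinity>" by eventually_elim simp
  have "integrable (total_var (j t)) ?h" by (rule total_var_integrable[OF goodD(1)[OF g] hm fin])
  then show "set_integrable (total_var (j t)) B ?h"
   unfolding set_integrable_def by (rule integrable_mult_indicator[rotated]) (simp add: tv B(2))
 qed
 have "ext_integral (j t) B (neg_entropy_grad \<pi> \<phi> (\<rho> t)) = (\<integral>p. w (t, p) * A t p * ?h p \<partial>\<theta>)"
  unfolding ext_integral_def by (rule signed_integral_good(2)[OF g hm fin B])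
 also have "... = (\<integral>p. - (w (t, p) * A t p * S t p) \<partial>\<theta>)"
 proof (rule integral_cong_AE)
  show "(%p. w (t, p) * A t p * ?h p) \<in> Bor \<theta>"
   by (rule borel_measurable_times[OF wm]) (simp only: measurable_edge_borel hm)
  show "(%p. - (w (t, p) * A t p * S t p)) \<in> Bor \<theta>"
   by (rule borel_measurable_uminus, rule borel_measurable_times[OF wm]) (simp only: measurable_edge_borel S_meas)
  show "AE p in \<theta>. w (t, p) * A t p * ?h p = - (w (t, p) * A t p * S t p)"
   using hS by eventually_elim simp
 qed
 also have "... = - J t" by (simp add: J_def)
 finally show "ext_integral (j t) B (neg_entropy_grad \<pi> \<phi> (\<rho> t)) = - J t" .
qed

lemma AE_good_interior: "AE t in lebesgue. t \<in> {0<..<T} --> good t"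
proof -
 note AE_good_time
 then show ?thesis by eventually_elim simp
qed

lemma entropy_derivative:
 "AE t\<in>{0<..<T} in lebesgue. ((%r. enn2real (Ent (\<rho> r))) has_real_derivative J t) (at t)"
 by (rule primitive_derivative[OF J_integrable T])
  (use Ent_eq entropy_increment in simp)

lemma chain_rule: "chain_rule \<pi> \<phi> T \<rho> j"
 unfolding chain_rule_def
proof (intro conjI ballI)
 show "Ent (\<rho> t) < \<infinity>" if "t \<in> {0..T}" for t by (rule ent_fin[OF that])
 show "abs_cont_on 0 T (%t. enn2real (Ent (\<rho> t)))"
  by (rule primitive_abs_cont[OF J_integrable less_imp_le[OF T]]) (use Ent_eq entropy_increment in simp)
 show "AE t\<in>{0<..<T} in lebesgue.
    ext_integrable (j t) offdiag (neg_entropy_grad \<pi> \<phi> (\<rho> t)) &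
    ((%r. enn2real (Ent (\<rho> r))) has_real_derivative - ext_integral (j t) offdiag (neg_entropy_grad \<pi> \<phi> (\<rho> t))) (at t)"
  using AE_good_interior entropy_derivative
 proof eventually_elim
  case (elim t)
  show ?case
  proof
   assume t: "t \<in> {0<..<T}"
   with elim have g: "good t" and d: "((%r. enn2real (Ent (\<rho> r))) has_real_derivative J t) (at t)" by blast+
   show "ext_integrable (j t) offdiag (neg_entropy_grad \<pi> \<phi> (\<rho> t)) &
    ((%r. enn2real (Ent (\<rho> r))) has_real_derivative - ext_integral (j t) offdiag (neg_entropy_grad \<pi> \<phi> (\<rho> t))) (at t)"
    using entropy_gradient_flux(1)[OF g order_refl offdiag_borel] d
    unfolding entropy_gradient_flux(2)[OF g order_refl offdiag_borel] by simp
  qed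
 qed
qed

lemma dissipation_time_integral:
 assumes st: "0 <= s" "s <= t" "t <= T"
 shows "(\<integral>\<^sup>+r\<in>{s..t}. (Dis (\<rho> r) (j r) + Fis (\<rho> r)) \<partial>lebesgue) = ennreal (LINT r:{s..t}|lebesgue. Rr r + Dr r)"
  "0 <= (LINT r:{s..t}|lebesgue. Rr r + Dr r)"
proof -
 have i: "integrable lebesgue (%r. ind {s..t} r *\<^sub>R (Rr r + Dr r))"
  using indefinite_integral_continuous_TT(2)[OF _ st, of "%r. Rr r + Dr r"] Rr_Dr_integrable by (simp add: set_integrable_def)
 have ae: "AE r in lebesgue. r \<in> {0..T} --> good r" using AE_good by (simp add: AE_lebesgue_on)
 have "(\<integral>\<^sup>+r\<in>{s..t}. (Dis (\<rho> r) (j r) + Fis (\<rho> r)) \<partial>lebesgue) = (\<integral>\<^sup>+r. ennreal (ind {s..t} r *\<^sub>R (Rr r + Dr r)) \<partial>lebesgue)"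
 proof (rule nn_integral_cong_AE)
  show "AE r in lebesgue. (Dis (\<rho> r) (j r) + Fis (\<rho> r)) * ind {s..t} r = ennreal (ind {s..t} r *\<^sub>R (Rr r + Dr r))"
   using ae
  proof eventually_elim
   case (elim r)
   show ?case
   proof (cases "r \<in> {s..t}")
    case True
    then have "good r" using elim st by auto
    then show ?thesis using True by (simp add: goodD(7,8))
   qed simp
  qed
 qed
 also have "... = ennreal (LINT r:{s..t}|lebesgue. Rr r + Dr r)"
  unfolding set_lebesgue_integral_def by (rule nn_integral_eq_integral[OF i]) simp
 finally show "(\<integral>\<^sup>+r\<in>{s..t}. (Dis (\<rho> r) (j r) + Fis (\<rho> r)) \<partial>lebesgue) = ennreal (LINT r:{s..t}|lebesgue. Rr r + Dr r)" .
 show "0 <= (LINT r:{s..t}|lebesgue. Rr r + Dr r)" unfolding set_lebesgue_integral_def by (rule Bochner_Integration.integral_nonneg) simp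
qed

text \<open>At good times the sum of \<open>Rr\<close>, \<open>Dr\<close> and \<open>J\<close> is
  nonnegative by Fenchel's inequality. The dissipation inequality up to time \<open>T\<close>, with
  the entropy increment written as the integral of \<open>J\<close>, makes its integral nonpositive;
  hence it vanishes at a.e. time.\<close>

lemma dissipative_rate:
 assumes ds: "dissipative_solution \<pi> \<kappa> \<phi> \<psi>s \<alpha> T \<rho> j"
 shows "AE r in lebesgue. r \<in> {0..T} --> J r = - (Rr r + Dr r)"
proof -
 have T0: "0 \<in> {0..T}" "T \<in> {0..T}" using T by auto
 have i: "integrable TT (%r. Rr r + Dr r)" using Rr_Dr_integrable by simp
 have si: "set_integrable lebesgue {0..T} (%r. Rr r + Dr r)" "set_integrable lebesgue {0..T} J"
  by (rule indefinite_integral_continuous_TT(2); use i J_integrable T in simp)+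
 have "(\<integral>\<^sup>+r\<in>{0..T}. (Dis (\<rho> r) (j r) + Fis (\<rho> r)) \<partial>lebesgue) + Ent (\<rho> T) <= Ent (\<rho> 0)"
  using ds T0(2) unfolding dissipative_solution_def by blast
 then have "ennreal ((LINT r:{0..T}|lebesgue. Rr r + Dr r) + Er T) <= ennreal (Er 0)"
  using dissipation_time_integral[of 0 T] Ent_eq[OF T0(1)] Ent_eq[OF T0(2)] T by (simp add: ennreal_plus)
 then have "(LINT r:{0..T}|lebesgue. Rr r + Dr r) + Er T <= Er 0"
  using Ent_eq(2)[OF T0(1)] by (simp add: ennreal_le_iff)
 then have le: "(LINT r:{0..T}|lebesgue. Rr r + Dr r) + (LINT r:{0..T}|lebesgue. J r) <= 0"
  using entropy_increment[of 0 T] T by simp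
 let ?f = "%r. ind {0..T} r *\<^sub>R ((Rr r + Dr r) + J r)"
 have fi: "integrable lebesgue ?f" using set_integral_add(1)[OF si] by (simp only: set_integrable_def)
 have pos: "AE r in lebesgue. 0 <= ?f r"
 proof -
  note AE_good_time
  then show ?thesis
  proof eventually_elim
   case (elim r)
   show ?case
   proof (cases "r \<in> {0..T}")
    case True
    with elim J_bound[of r] show ?thesis by simp
   qed simp
  qed
 qed
 have "(\<integral>r. ?f r \<partial>lebesgue) <= 0"
  using le set_integral_add(2)[OF si] by (simp only: set_lebesgue_integral_def)
 moreover have "0 <= (\<integral>r. ?f r \<partial>lebesgue)" by (rule integral_nonneg_AE[OF pos])
 ultimately have "AE r in lebesgue. ?f r = 0" using integral_nonneg_eq_0_iff_AE[OF fi pos] by linarith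
 then show ?thesis
 proof eventually_elim
  case (elim r)
  then show ?case by (cases "r \<in> {0..T}") auto
 qed
qed

lemma reflecting_solution:
 assumes ds: "dissipative_solution \<pi> \<kappa> \<phi> \<psi>s \<alpha> T \<rho> j"
 shows "reflecting_solution \<pi> \<kappa> \<phi> \<psi>s \<alpha> T \<rho> j"
proof -
 have "(\<integral>\<^sup>+r\<in>{s..t}. (Dis (\<rho> r) (j r) + Fis (\<rho> r)) \<partial>lebesgue) + Ent (\<rho> t) = Ent (\<rho> s)"
  if st: "0 <= s" "s <= t" "t <= T" for s t
 proof -
  have sT: "s \<in> {0..T}" "t \<in> {0..T}" using st by auto
  have "(LINT r:{s..t}|lebesgue. J r) = (LINT r:{s..t}|lebesgue. - (Rr r + Dr r))"
   unfolding set_lebesgue_integral_def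
  proof (rule integral_cong_AE)
   have i: "integrable TT (%r. - (Rr r + Dr r))" using Rr_Dr_integrable by (intro integrable_minus) simp
   show "(%r. ind {s..t} r *\<^sub>R J r) \<in> Bor lebesgue"
    using indefinite_integral_continuous_TT(2)[OF J_integrable st] unfolding set_integrable_def by (rule borel_measurable_integrable)
   show "(%r. ind {s..t} r *\<^sub>R - (Rr r + Dr r)) \<in> Bor lebesgue"
    using indefinite_integral_continuous_TT(2)[OF i st] unfolding set_integrable_def by (rule borel_measurable_integrable)
   show "AE r in lebesgue. ind {s..t} r *\<^sub>R J r = ind {s..t} r *\<^sub>R - (Rr r + Dr r)"
    using dissipative_rate[OF ds]
   proof eventually_elim
    case (elim r)
    then show ?case using st by (cases "r \<in> {s..t}") auto
   qed
  qed
  also have "... = - (LINT r:{s..t}|lebesgue. Rr r + Dr r)"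
   unfolding set_lebesgue_integral_def by (simp only: scaleR_minus_right Bochner_Integration.integral_minus)
  finally have eq: "(LINT r:{s..t}|lebesgue. Rr r + Dr r) + Er t = Er s" using entropy_increment[OF st] by simp
  have "ennreal ((LINT r:{s..t}|lebesgue. Rr r + Dr r) + Er t) =
    ennreal (LINT r:{s..t}|lebesgue. Rr r + Dr r) + ennreal (Er t)"
   by (rule ennreal_plus[OF dissipation_time_integral(2)[OF st] Ent_eq(2)[OF sT(2)]])
  then show ?thesis unfolding dissipation_time_integral(1)[OF st] Ent_eq(1)[OF sT(1)] Ent_eq(1)[OF sT(2)] eq by simp
 qed
 moreover have "Ent (\<rho> 0) < \<infinity>" using T by (intro ent_fin) simp
 ultimately show ?thesis using rce unfolding reflecting_solution_def by blast
qed

lemma pointwise_energy_balance: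
 assumes ds: "dissipative_solution \<pi> \<kappa> \<phi> \<psi>s \<alpha> T \<rho> j"
 shows "pointwise_energy_balance \<pi> \<kappa> \<phi> \<psi>s \<alpha> T \<rho> j"
 unfolding pointwise_energy_balance_def
 using AE_good_interior entropy_derivative dissipative_rate[OF ds]
proof eventually_elim
 case (elim t)
 show ?case
 proof
  assume t: "t \<in> {0<..<T}"
  then have tT: "t \<in> {0..T}" by simp
  from t elim have g: "good t" and d: "((%r. enn2real (Ent (\<rho> r))) has_real_derivative J t) (at t)" by blast+
  from tT elim(3) have r: "J t = - (Rr t + Dr t)" by blast
  note G = entropy_gradient_flux[OF g subset_UNIV, simplified]
  show "\<exists>e\<ge>0. Dis (\<rho> t) (j t) + Fis (\<rho> t) = ennreal e &
    ((%r. enn2real (Ent (\<rho> r))) has_real_derivative - e) (at t) &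
    ext_integrable (j t) UNIV (neg_entropy_grad \<pi> \<phi> (\<rho> t)) &
    e = ext_integral (j t) UNIV (neg_entropy_grad \<pi> \<phi> (\<rho> t))"
  proof (intro exI[of _ "Rr t + Dr t"] conjI)
   show "0 <= Rr t + Dr t" by simp
   show "Dis (\<rho> t) (j t) + Fis (\<rho> t) = ennreal (Rr t + Dr t)" by (simp add: goodD(7,8)[OF g])
   show "((%r. enn2real (Ent (\<rho> r))) has_real_derivative - (Rr t + Dr t)) (at t)" using d unfolding r .
   show "ext_integrable (j t) UNIV (neg_entropy_grad \<pi> \<phi> (\<rho> t))" by (rule G(1))
   show "Rr t + Dr t = ext_integral (j t) UNIV (neg_entropy_grad \<pi> \<phi> (\<rho> t))" unfolding G(2) r by simp
  qed
 qed
qed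

end

theorem theorem4p9:
  fixes \<pi> :: "'v::{metric_space, second_countable_topology} measure"
    and \<kappa> :: "'v \<Rightarrow> 'v measure"
    and \<phi> \<psi>s :: "real \<Rightarrow> real"
    and \<alpha> :: "real \<times> real \<Rightarrow> real"
    and T :: real
  assumes "0 < T"
    and "\<pi> \<in> finite_borel_measures"
    and "jump_kernel \<kappa>"
    and "detailed_balance \<pi> \<kappa>"
    and "entropy_density \<phi>"
    and "dual_dissipation_density \<psi>s"
    and "mobility_density \<alpha>"
    and "fisher_lsc \<pi> \<kappa> \<phi> \<psi>s \<alpha>"
    and "fisher_convex \<pi> \<kappa> \<phi> \<psi>s \<alpha>"
  shows "(\<forall>\<rho>0 j0 \<rho>1 j1 \<theta>.
            (\<rho>0, j0) \<in> RCE \<pi> \<kappa> \<phi> \<psi>s \<alpha> T \<and> (\<rho>1, j1) \<in> RCE \<pi> \<kappa> \<phi> \<psi>s \<alpha> T \<and> 0 < \<theta> \<and> \<theta> < 1 \<longrightarrow>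
            (\<lambda>t. mix_measure \<theta> (\<rho>0 t) (\<rho>1 t), \<lambda>t. mix_signed \<theta> (j0 t) (j1 t))
              \<in> RCE \<pi> \<kappa> \<phi> \<psi>s \<alpha> T) \<and>
         (\<forall>\<rho> j. (\<rho>, j) \<in> RCE \<pi> \<kappa> \<phi> \<psi>s \<alpha> T \<longrightarrow> chain_rule \<pi> \<phi> T \<rho> j) \<and>
         (\<forall>\<rho> j. (\<rho>, j) \<in> RCE \<pi> \<kappa> \<phi> \<psi>s \<alpha> T \<and> dissipative_solution \<pi> \<kappa> \<phi> \<psi>s \<alpha> T \<rho> j \<longrightarrow>
            reflecting_solution \<pi> \<kappa> \<phi> \<psi>s \<alpha> T \<rho> j \<and>
            pointwise_energy_balance \<pi> \<kappa> \<phi> \<psi>s \<alpha> T \<rho> j)"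
proof -
  have E: "entropy_space \<pi> \<kappa> \<phi> \<psi>s \<alpha>"
    using assms by (intro entropy_space.intro jump_space.intro densities.intro entropy_space_axioms.intro)
  have cv: "curve \<pi> \<kappa> \<phi> \<psi>s \<alpha> T \<rho> j" if "(\<rho>, j) \<in> RCE \<pi> \<kappa> \<phi> \<psi>s \<alpha> T" for \<rho> j
    by (rule curve.intro[OF E], rule curve_axioms.intro[OF assms(1) that])
  show ?thesis
  proof (intro conjI allI impI; (elim conjE)?)
    fix \<rho>0 \<rho>1 j0 j1 and \<theta> :: real
    assume "(\<rho>0, j0) \<in> RCE \<pi> \<kappa> \<phi> \<psi>s \<alpha> T" "(\<rho>1, j1) \<in> RCE \<pi> \<kappa> \<phi> \<psi>s \<alpha> T" "0 < \<theta>" "\<theta> < 1"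
    then show "(\<lambda>t. mix_measure \<theta> (\<rho>0 t) (\<rho>1 t), \<lambda>t. mix_signed \<theta> (j0 t) (j1 t)) \<in> RCE \<pi> \<kappa> \<phi> \<psi>s \<alpha> T"
      by (rule entropy_space.RCE_mix[OF E assms(1)])
  next
    fix \<rho> j assume "(\<rho>, j) \<in> RCE \<pi> \<kappa> \<phi> \<psi>s \<alpha> T"
    then show "chain_rule \<pi> \<phi> T \<rho> j" by (rule curve.chain_rule[OF cv])
  next
    fix \<rho> j assume r: "(\<rho>, j) \<in> RCE \<pi> \<kappa> \<phi> \<psi>s \<alpha> T" and d: "dissipative_solution \<pi> \<kappa> \<phi> \<psi>s \<alpha> T \<rho> j"
    show "reflecting_solution \<pi> \<kappa> \<phi> \<psi>s \<alpha> T \<rho> j" by (rule curve.reflecting_solution[OF cv[OF r] d])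
    show "pointwise_energy_balance \<pi> \<kappa> \<phi> \<psi>s \<alpha> T \<rho> j" by (rule curve.pointwise_energy_balance[OF cv[OF r] d])
  qed
qed

end
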